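(* Let $P,Q$ be polynomials as in the context, and let $g\not\equiv0$ be an entire solution of $$g''-\frac{P'}{P}g'+\frac QPg=0$$ having no common zeros with $P$. Then the following are equivalent: (i) there exists a representation $$\frac{P(z)}{g^2(z)}=\sum_{n=1}^{\infty}\frac{c_n}{(z-t_n)^2},\qquad |t_n|\to\infty,\quad \sum_{n=1}^\infty\frac{|c_n|}{|t_n|^2}<\infty;$$ (ii) $g(z)\to\infty$ in every Stokes sector as $z\to\infty$; (iii) $g$ has infinitely many zeros near every Stokes ray.
   Context: Setting. $P(z)=z^p+az^{p-1}+O(z^{p-2})$ and $Q(z)=bz^q+cz^{q-1}+O(z^{q-2})$ are polynomials, $b\ne0$, $q\ge p\ge0$, $N=q-p$. With $p_1,\dots,p_p$ the zeros of $P$ counted with multiplicity, $\frac QP=S+\sum_{j=1}^p\frac{D_j}{z-p_j}$ with a polynomial $S$ of degree $N$ (at most simple poles). Put $d=\frac{ab-c}{bN}$ if $N\ge1$, $d=0$ if $N=0$, and $\theta_k=\frac{2\pi k-\arg b}{N+2}$ for $k\in\mathbb Z$ (modulo $N+2$). There are $N+2$ Stokes rays $\Gamma_k=\{\arg(z-d)=\theta_k\}$ and $N+2$ Stokes sectors $S_k=\{\arg(z-d)\in(\theta_k,\theta_{k+1})\}$. "$g(z)\to\infty$ in $S_k$" means: for every sufficiently small $\delta>0$, $g(z)\to\infty$ as $z\to\infty$ with $\arg(z-d)\in(\theta_k+\delta,\theta_{k+1}-\delta)$. Zeros near a ray: let $\Lambda_k(C)=\{|z-d|>r_0,\ |\arg(z-d)-\theta_k|<C\varepsilon(|z-d|)\}$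 for some fixed large $r_0$, where $\varepsilon(r)=r^{-2}$ if $N\ge3$, $(\log r)r^{-2}$ if $N=2$, $r^{-3/2}$ if $N=1$, $(1+|D|\log r)r^{-1}$ if $N=0$ with $D=b^{-1/2}\sum_jD_j$. The function $g$ has infinitely many zeros near $\Gamma_k$ if $\Lambda_k(C)$ contains infinitely many zeros of $g$ for some $C>0$. In the summability condition a possible term with $t_n=0$ is omitted. *)

theory Defs
  imports "HOL-Complex_Analysis.Complex_Analysis"
begin

text \<open>
  Throughout, \<open>N\<close> is the degree of \<open>Q/P\<close> at infinity, \<open>b\<close> the leading coefficient of \<open>Q\<close>,
  \<open>d\<close> the common vertex of the Stokes rays, and the index \<open>k\<close> ranges over all integers; rays
  and sectors depend on \<open>k\<close> only modulo \<open>N + 2\<close>, because all statements about arguments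
  below go through \<^const>\<open>is_Arg\<close>, which allows any real value of the argument. Hence the
  choice of the principal value of \<open>arg b\<close> only shifts the numbering of the rays.
\<close>

definition stokes_angle :: "nat \<Rightarrow> complex \<Rightarrow> int \<Rightarrow> real" where
  "stokes_angle N b k = (2 * pi * of_int k - Arg b) / (of_nat N + 2)"

definition stokes_subsector :: "nat \<Rightarrow> complex \<Rightarrow> complex \<Rightarrow> int \<Rightarrow> real \<Rightarrow> complex set" where
  "stokes_subsector N b d k \<delta> =
     {z. z \<noteq> d \<and> (\<exists>t. is_Arg (z - d) t \<and>
            stokes_angle N b k + \<delta> < t \<and> t < stokes_angle N b (k + 1) - \<delta>)}"

definition infinity_in_stokes_sector ::
  "nat \<Rightarrow> complex \<Rightarrow> complex \<Rightarrow> int \<Rightarrow> (complex \<Rightarrow> complex) \<Rightarrow> bool" where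
  "infinity_in_stokes_sector N b d k g \<longleftrightarrow>
     (\<forall>\<^sub>F \<delta> in at_right 0.
        filterlim g at_infinity (inf at_infinity (principal (stokes_subsector N b d k \<delta>))))"

definition stokes_width :: "nat \<Rightarrow> complex \<Rightarrow> real \<Rightarrow> real" where
  "stokes_width N D r =
     (if N \<ge> 3 then r powr (-2)
      else if N = 2 then ln r * r powr (-2)
      else if N = 1 then r powr (-3/2)
      else (1 + cmod D * ln r) * r powr (-1))"

definition stokes_neighbourhood ::
  "nat \<Rightarrow> complex \<Rightarrow> complex \<Rightarrow> complex \<Rightarrow> real \<Rightarrow> int \<Rightarrow> real \<Rightarrow> complex set" where
  "stokes_neighbourhood N b d D r0 k C =
     {z. cmod (z - d) > r0 \<and>
         (\<exists>t. is_Arg (z - d) t \<and>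
              \<bar>t - stokes_angle N b k\<bar> < C * stokes_width N D (cmod (z - d)))}"

definition infinitely_many_zeros_near_ray ::
  "nat \<Rightarrow> complex \<Rightarrow> complex \<Rightarrow> complex \<Rightarrow> real \<Rightarrow> int \<Rightarrow> (complex \<Rightarrow> complex) \<Rightarrow> bool" where
  "infinitely_many_zeros_near_ray N b d D r0 k g \<longleftrightarrow>
     (\<exists>C>0. infinite {z \<in> stokes_neighbourhood N b d D r0 k C. g z = 0})"

text \<open>
  The expansion of \<open>P/g\<^sup>2\<close> into double poles is an identity of
  meromorphic functions; it is required at all points where neither side has a pole.
\<close>

definition has_double_pole_expansion :: "complex poly \<Rightarrow> (complex \<Rightarrow> complex) \<Rightarrow> bool" where
  "has_double_pole_expansion P g \<longleftrightarrow>
     (\<exists>c t :: nat \<Rightarrow> complex.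
        filterlim (\<lambda>n. cmod (t n)) at_top sequentially \<and>
        summable (\<lambda>n. if t n = 0 then 0 else cmod (c n) / (cmod (t n))\<^sup>2) \<and>
        (\<forall>z. g z \<noteq> 0 \<and> z \<notin> range t \<longrightarrow>
             (\<lambda>n. c n / (z - t n)\<^sup>2) sums (poly P z / (g z)\<^sup>2)))"

end

theory Submission
  imports Defs
begin

text \<open>
  In the logarithmic coordinate \<open>z = d + exp (\<i> \<theta>\<^sub>k + s)\<close> the Liouville--Green transformation \<open>g = A u\<close>,
  \<open>u' = H V\<close>, \<open>V' = - (H + \<sigma>) u\<close> turns the equation into a system on a right half-plane with
  \<open>H \<sim> \<surd>|b| exp (\<mu> s)\<close>, \<open>\<mu> = N/2 + 1\<close>, and exponentially small \<open>\<sigma>\<close>; moreover \<open>P / g\<^sup>2 = exp (- s) H / u\<^sup>2\<close>.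
  With \<open>\<Phi>' = H\<close> one gets \<open>u \<approx> L exp (\<i> \<Phi>) + R exp (- \<i> \<Phi>)\<close>, where the first term dominates in the adjacent
  sector with \<open>Im s < 0\<close> and the second one in the sector with \<open>Im s > 0\<close>.

  Hence \<open>g \<rightarrow> \<infinity>\<close> in both adjacent sectors iff \<open>L \<noteq> 0 \<noteq> R\<close>, in which case \<open>u\<close> is close to a
  multiple of \<open>cos (\<Phi> + c\<^sub>0)\<close> and has infinitely many zeros near the ray, while for \<open>L = 0\<close> it has
  none. For the double pole expansion one compares mean values over circles: the mean of \<open>1 / (w - t)\<^sup>2\<close>
  over a circle about \<open>z\<close> is \<open>1 / (z - t)\<^sup>2\<close> if \<open>t\<close> lies outside and \<open>0\<close> if it lies inside. So an
  expansion forces \<open>P / g\<^sup>2\<close> to be bounded on zero-free discs of radius proportional to \<open>|z|\<close>, which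
  rules out recessive sectors. Conversely, if all sectors are dominant, the zeros near each ray are
  as sparse as those of the cosine, the series converges, and its difference from \<open>P / g\<^sup>2\<close> is an entire
  function of polynomial growth which tends to \<open>0\<close> along the middle of a sector.
\<close>

text \<open>No basis of solutions is constructed. The coefficients \<open>al\<close> and
  \<open>be\<close> of the given solution with respect to exp(\<i> \<Phi>) and exp(- \<i> \<Phi>)
  are functions of the point; they would be constant if \<sigma> were 0. Their equations contain
  exp(2 \<i> \<Phi>) and its inverse, one of which is huge off the ray, so errors can only be
  controlled along paths on which Im \<Phi> is monotone. This dictates two kinds of paths:
  horizontal ones inside a sector, which produce the limits L and R, and vertical ones close to the
  ray, where Re H > 0. They are joined at points with Im \<Phi> = 0, where both exponentials have
  modulus 1. Changing the signs of H, V, \<sigma> and \<Phi> swaps \<open>al\<close> and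
  \<open>be\<close>, so each estimate is proved once. The width \<epsilon>(r) measures the drift of
  Im \<Phi> on the ray itself: for N \<ge> 1 the vertex d makes b (z - d)^N agree with Q/P to two
  orders, and integrating H times the remaining relative error gives the listed power or logarithm.
  In the mean value argument a circle is chosen for each centre separately, which avoids a global
  family of contours between the poles.\<close>

section \<open>Coupled integral inequalities\<close>

text \<open>Gronwall's inequality is replaced by a maximum: the weighted sum \<open>f\<close>
  attains its maximum \<open>Z\<close>, both increments are at most \<open>Z\<close> times the
  increment of \<open>k\<close>, and as the latter is at most 1/4, \<open>Z \<le> M + Z / 2\<close>
  can be solved for \<open>Z\<close>. Monotonicity of \<open>y\<close> allows the weight of
  \<open>\<beta>\<close> to be moved from an interior point to the end point.\<close>

lemma coupled_bound:
  fixes \<alpha> \<beta> \<alpha>' \<beta>' :: "real \<Rightarrow> complex" and y k k' :: "real \<Rightarrow> real"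
  assumes ab: "a \<le> b"
    and da: "\<And>t. t \<in> {a..b} \<Longrightarrow> (\<alpha> has_vector_derivative \<alpha>' t) (at t)"
    and db: "\<And>t. t \<in> {a..b} \<Longrightarrow> (\<beta> has_vector_derivative \<beta>' t) (at t)"
    and dk: "\<And>t. t \<in> {a..b} \<Longrightarrow> (k has_real_derivative k' t) (at t)"
    and ba: "\<And>t. t \<in> {a..b} \<Longrightarrow> norm (\<alpha>' t) \<le> k' t * (norm (\<alpha> t) + norm (\<beta> t) * exp (2 * y t))"
    and bb: "\<And>t. t \<in> {a..b} \<Longrightarrow> norm (\<beta>' t) \<le> k' t * (norm (\<alpha> t) * exp (- 2 * y t) + norm (\<beta> t))"
    and k'pos: "\<And>t. t \<in> {a..b} \<Longrightarrow> 0 \<le> k' t"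
    and ycont: "continuous_on {a..b} y"
    and ymono: "\<And>s t. a \<le> s \<Longrightarrow> s \<le> t \<Longrightarrow> t \<le> b \<Longrightarrow> y t \<le> y s"
    and small: "k b - k a \<le> 1/4"
    and t: "t \<in> {a..b}"
  shows "norm (\<alpha> t - \<alpha> a) \<le> 2 * (k t - k a) * (norm (\<alpha> a) + norm (\<beta> a) * exp (2 * y a))"
    and "norm (\<beta> t - \<beta> a) \<le> 2 * (k t - k a) * (norm (\<alpha> a) + norm (\<beta> a) * exp (2 * y a)) * exp (- 2 * y t)"
proof -
  define M where "M = norm (\<alpha> a) + norm (\<beta> a) * exp (2 * y a)"
  define f where "f = (\<lambda>t. norm (\<alpha> t) + norm (\<beta> t) * exp (2 * y t))"
  have ca: "continuous_on {a..b} \<alpha>" and cb: "continuous_on {a..b} \<beta>"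
    using da db by (meson continuous_at_imp_continuous_on has_vector_derivative_continuous)+
  have cf: "continuous_on {a..b} f"
    unfolding f_def by (intro continuous_intros ca cb ycont)
  obtain t0 where t0: "t0 \<in> {a..b}" and t0max: "\<And>x. x \<in> {a..b} \<Longrightarrow> f x \<le> f t0"
    using continuous_attains_sup[of "{a..b}" f] cf ab by auto
  define Z where "Z = f t0"
  have Z0: "Z \<ge> 0" by (simp add: Z_def f_def)
  have fb: "f x \<le> Z" if "x \<in> {a..b}" for x using t0max that Z_def by auto
  have kc: "continuous_on {a..b} k"
    using dk by (meson DERIV_isCont continuous_at_imp_continuous_on)
  have A: "norm (\<alpha> x - \<alpha> a) \<le> Z * (k x - k a)" if x: "x \<in> {a..b}" for x
  proof (cases "x = a")
    case False
    then have ax: "a < x" using x by auto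
    have "norm (\<alpha> x - \<alpha> a) \<le> Z * k x - Z * k a"
    proof (rule differentiable_bound_general[where f = \<alpha> and \<phi> = "\<lambda>x. Z * k x" and f' = \<alpha>' and \<phi>' = "\<lambda>x. Z * k' x", OF ax])
      show "continuous_on {a..x} \<alpha>" using ca continuous_on_subset x by fastforce
      show "continuous_on {a..x} (\<lambda>x. Z * k x)"
        by (intro continuous_intros continuous_on_subset[OF kc]) (use x in auto)
      fix s assume s: "a < s" "s < x"
      then have s': "s \<in> {a..b}" using x by auto
      show "(\<alpha> has_vector_derivative \<alpha>' s) (at s)" using da s' by auto
      show "((\<lambda>x. Z * k x) has_vector_derivative Z * k' s) (at s)"
        using dk[OF s'] by (auto intro!: derivative_eq_intros simp: has_real_derivative_iff_has_vector_derivative[symmetric])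
      have "norm (\<alpha>' s) \<le> k' s * f s" using ba[OF s'] by (simp add: f_def)
      also have "\<dots> \<le> k' s * Z" using fb[OF s'] k'pos[OF s'] by (rule mult_left_mono)
      finally show "norm (\<alpha>' s) \<le> Z * k' s" by (simp add: mult.commute)
    qed
    then show ?thesis by (simp add: algebra_simps)
  qed auto
  have B: "norm (\<beta> x - \<beta> a) \<le> Z * (k x - k a) * exp (- 2 * y x)" if x: "x \<in> {a..b}" for x
  proof (cases "x = a")
    case False
    then have ax: "a < x" using x by auto
    have "norm (\<beta> x - \<beta> a) \<le> Z * exp (- 2 * y x) * k x - Z * exp (- 2 * y x) * k a"
    proof (rule differentiable_bound_general[where f = \<beta> and \<phi> = "\<lambda>r. Z * exp (- 2 * y x) * k r" and f' = \<beta>' and \<phi>' = "\<lambda>r. Z * exp (- 2 * y x) * k' r", OF ax])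
      show "continuous_on {a..x} \<beta>" using cb continuous_on_subset x by fastforce
      show "continuous_on {a..x} (\<lambda>r. Z * exp (- 2 * y x) * k r)"
        by (intro continuous_intros continuous_on_subset[OF kc]) (use x in auto)
      fix s assume s: "a < s" "s < x"
      then have s': "s \<in> {a..b}" using x by auto
      show "(\<beta> has_vector_derivative \<beta>' s) (at s)" using db s' by auto
      show "((\<lambda>r. Z * exp (- 2 * y x) * k r) has_vector_derivative Z * exp (- 2 * y x) * k' s) (at s)"
        using dk[OF s'] by (auto intro!: derivative_eq_intros simp: has_real_derivative_iff_has_vector_derivative[symmetric])
      have e: "exp (- 2 * y s) * exp (2 * y s) = 1" by (simp add: exp_add[symmetric])
      have "f s * exp (- 2 * y s) = norm (\<alpha> s) * exp (- 2 * y s) + norm (\<beta> s) * (exp (- 2 * y s) * exp (2 * y s))"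
        by (simp add: f_def algebra_simps del: mult_minus_left)
      then have "norm (\<beta>' s) \<le> k' s * (f s * exp (- 2 * y s))"
        using bb[OF s'] unfolding e by simp
      also have "\<dots> \<le> k' s * (Z * exp (- 2 * y x))"
        using fb[OF s'] k'pos[OF s'] ymono[of s x] s x Z0 by (intro mult_left_mono mult_mono) auto
      finally show "norm (\<beta>' s) \<le> Z * exp (- 2 * y x) * k' s" by (simp add: algebra_simps)
    qed
    then show ?thesis by (simp add: algebra_simps)
  qed auto
  have kmono: "k s \<le> k x" if "a \<le> s" "s \<le> x" "x \<le> b" for s x
  proof (rule DERIV_nonneg_imp_nondecreasing[OF that(2)])
    fix r assume "s \<le> r" "r \<le> x"
    then have "r \<in> {a..b}" using that by auto
    then show "\<exists>d. (k has_real_derivative d) (at r) \<and> 0 \<le> d" using dk k'pos by blast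
  qed
  have "f t0 \<le> M + 2 * (Z * (k t0 - k a))"
  proof -
    have 1: "norm (\<alpha> t0) \<le> norm (\<alpha> a) + Z * (k t0 - k a)"
      using A[OF t0] norm_triangle_ineq2[of "\<alpha> t0" "\<alpha> a"] by linarith
    have "norm (\<beta> t0) \<le> norm (\<beta> a) + Z * (k t0 - k a) * exp (- 2 * y t0)"
      using B[OF t0] norm_triangle_ineq2[of "\<beta> t0" "\<beta> a"] by linarith
    then have "norm (\<beta> t0) * exp (2 * y t0) \<le> (norm (\<beta> a) + Z * (k t0 - k a) * exp (- 2 * y t0)) * exp (2 * y t0)"
      by (rule mult_right_mono) auto
    also have "\<dots> = norm (\<beta> a) * exp (2 * y t0) + Z * (k t0 - k a)"
      by (simp add: algebra_simps exp_add[symmetric])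
    also have "\<dots> \<le> norm (\<beta> a) * exp (2 * y a) + Z * (k t0 - k a)"
      using ymono[of a t0] t0 by (intro add_mono mult_left_mono order_refl) auto
    finally show ?thesis using 1 by (simp add: f_def M_def)
  qed
  moreover have "Z * (k t0 - k a) \<le> Z * (1/4)"
    using kmono[of t0 b] t0 small Z0 by (intro mult_left_mono) auto
  ultimately have ZM: "Z \<le> 2 * M" by (simp add: Z_def)
  have kk: "k t - k a \<ge> 0" using kmono[of a t] t by auto
  have Zk: "Z * (k t - k a) \<le> 2 * (k t - k a) * M"
    using mult_right_mono[OF ZM kk] by (simp add: algebra_simps)
  show "norm (\<alpha> t - \<alpha> a) \<le> 2 * (k t - k a) * M" using A[OF t] Zk by linarith
  show "norm (\<beta> t - \<beta> a) \<le> 2 * (k t - k a) * M * exp (- 2 * y t)"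
    by (rule order_trans[OF B[OF t] mult_right_mono[OF Zk]]) simp
qed

section \<open>The first-order system and its slowly varying coefficients\<close>

locale wkb_system =
  fixes u V H Sg \<Phi> :: "complex \<Rightarrow> complex" and \<rho>0 \<mu> C :: real
  assumes mu: "\<mu> \<ge> 1" and C: "C > 0" and rho0: "\<rho>0 \<ge> 0"
    and du: "\<And>s. Re s > \<rho>0 \<Longrightarrow> (u has_field_derivative H s * V s) (at s)"
    and dV: "\<And>s. Re s > \<rho>0 \<Longrightarrow> (V has_field_derivative - (H s + Sg s) * u s) (at s)"
    and dPhi: "\<And>s. Re s > \<rho>0 \<Longrightarrow> (\<Phi> has_field_derivative H s) (at s)"
    and Sg: "\<And>s. Re s > \<rho>0 \<Longrightarrow> norm (Sg s) \<le> C * exp (- \<mu> * Re s)"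
begin

text \<open>Variation of constants: the coefficients of exp(\<i> \<Phi>) and exp(- \<i> \<Phi>),
  determined by matching both \<open>u\<close> and \<open>V\<close>. The quantity \<open>amp\<close>
  is exp(Im \<Phi>) times the resulting bound for the norm of \<open>u\<close>, the natural size
  when exp(\<i> \<Phi>) dominates.\<close>

definition "al s = exp (- (\<i> * \<Phi> s)) / 2 * (u s - \<i> * V s)"
definition "be s = exp (\<i> * \<Phi> s) / 2 * (u s + \<i> * V s)"
definition "amp s = norm (al s) + norm (be s) * exp (2 * Im (\<Phi> s))"

lemma exp_pm: "exp (- (\<i> * w)) * exp (\<i> * w) = 1" "exp (\<i> * w) * exp (- (\<i> * w)) = 1"
  by (simp_all add: exp_add[symmetric])

lemma u_eq: "u s = al s * exp (\<i> * \<Phi> s) + be s * exp (- (\<i> * \<Phi> s))"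
proof -
  have "al s * exp (\<i> * \<Phi> s) = (exp (- (\<i> * \<Phi> s)) * exp (\<i> * \<Phi> s)) * (u s - \<i> * V s) / 2"
    by (simp add: al_def)
  moreover have "be s * exp (- (\<i> * \<Phi> s)) = (exp (\<i> * \<Phi> s) * exp (- (\<i> * \<Phi> s))) * (u s + \<i> * V s) / 2"
    by (simp add: be_def)
  ultimately have A: "al s * exp (\<i> * \<Phi> s) = (u s - \<i> * V s) / 2"
    and B: "be s * exp (- (\<i> * \<Phi> s)) = (u s + \<i> * V s) / 2" unfolding exp_pm by simp_all
  show ?thesis by (simp only: A B) (simp add: field_simps)
qed

lemma V_eq: "V s = \<i> * (al s * exp (\<i> * \<Phi> s) - be s * exp (- (\<i> * \<Phi> s)))"
proof -
  have "al s * exp (\<i> * \<Phi> s) = (exp (- (\<i> * \<Phi> s)) * exp (\<i> * \<Phi> s)) * (u s - \<i> * V s) / 2"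
    by (simp add: al_def)
  moreover have "be s * exp (- (\<i> * \<Phi> s)) = (exp (\<i> * \<Phi> s) * exp (- (\<i> * \<Phi> s))) * (u s + \<i> * V s) / 2"
    by (simp add: be_def)
  ultimately have A: "al s * exp (\<i> * \<Phi> s) = (u s - \<i> * V s) / 2"
    and B: "be s * exp (- (\<i> * \<Phi> s)) = (u s + \<i> * V s) / 2" unfolding exp_pm by simp_all
  show ?thesis by (simp only: A B) (simp add: field_simps)
qed

lemma d_al: "Re s > \<rho>0 \<Longrightarrow> (al has_field_derivative \<i> * Sg s / 2 * exp (- (\<i> * \<Phi> s)) * u s) (at s)"
  unfolding al_def[abs_def]
  by (auto intro!: derivative_eq_intros du dV dPhi simp: field_simps)

lemma d_be: "Re s > \<rho>0 \<Longrightarrow> (be has_field_derivative - (\<i> * Sg s / 2 * exp (\<i> * \<Phi> s) * u s)) (at s)"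
  unfolding be_def[abs_def]
  by (auto intro!: derivative_eq_intros du dV dPhi simp: field_simps)

lemma u_bound: "norm (u s) \<le> norm (al s) * exp (- Im (\<Phi> s)) + norm (be s) * exp (Im (\<Phi> s))"
  by (subst u_eq, rule order_trans[OF norm_triangle_ineq]) (simp add: norm_mult)

text \<open>\<open>coupled_bound\<close> along a straight path of unit speed. The sign of Im (v * H)
  says that Im \<Phi> does not increase along it, so that exp(\<i> \<Phi>) is the growing
  exponential and \<open>al\<close> the coefficient that is controlled without a weight.\<close>

lemma path_bound:
  fixes k k' :: "real \<Rightarrow> real"
  assumes T: "T \<ge> 0" and v: "norm v = 1"
    and dom: "\<And>t. 0 \<le> t \<Longrightarrow> t \<le> T \<Longrightarrow> Re (s0 + of_real t * v) > \<rho>0"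
    and mono: "\<And>t. 0 \<le> t \<Longrightarrow> t \<le> T \<Longrightarrow> Im (v * H (s0 + of_real t * v)) \<le> 0"
    and dk: "\<And>t. 0 \<le> t \<Longrightarrow> t \<le> T \<Longrightarrow> (k has_real_derivative k' t) (at t)"
    and k': "\<And>t. 0 \<le> t \<Longrightarrow> t \<le> T \<Longrightarrow> norm (Sg (s0 + of_real t * v)) / 2 \<le> k' t"
    and small: "k T - k 0 \<le> 1/4"
  shows "norm (al (s0 + of_real T * v) - al s0) \<le> 2 * (k T - k 0) * amp s0"
    and "norm (be (s0 + of_real T * v) - be s0) \<le> 2 * (k T - k 0) * amp s0 * exp (- 2 * Im (\<Phi> (s0 + of_real T * v)))"
proof -
  define p where "p = (\<lambda>t::real. s0 + of_real t * v)"
  have dp: "(p has_vector_derivative v) (at t)" for t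
    unfolding p_def by (auto intro!: derivative_eq_intros)
  define y where "y = (\<lambda>t. Im (\<Phi> (p t)))"
  have pd: "Re (p t) > \<rho>0" if "t \<in> {0..T}" for t using dom that by (auto simp: p_def)
  have dy: "(y has_real_derivative Im (v * H (p t))) (at t)" if "t \<in> {0..T}" for t
    using bounded_linear.has_vector_derivative[OF bounded_linear_Im field_vector_diff_chain_at[OF dp dPhi[OF pd[OF that]]]]
    unfolding y_def o_def has_real_derivative_iff_has_vector_derivative .
  have ab: "norm (al (p t) - al (p 0)) \<le> 2 * (k t - k 0) * (norm (al (p 0)) + norm (be (p 0)) * exp (2 * y 0))
     \<and> norm (be (p t) - be (p 0)) \<le> 2 * (k t - k 0) * (norm (al (p 0)) + norm (be (p 0)) * exp (2 * y 0)) * exp (- 2 * y t)"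
    if t: "t \<in> {0..T}" for t
  proof -
    have A: "((\<lambda>t. al (p t)) has_vector_derivative v * (\<i> * Sg (p t) / 2 * exp (- (\<i> * \<Phi> (p t))) * u (p t))) (at t)"
      if "t \<in> {0..T}" for t
      using field_vector_diff_chain_at[OF dp d_al[OF pd[OF that]]] by (simp add: o_def)
    have B: "((\<lambda>t. be (p t)) has_vector_derivative v * (- (\<i> * Sg (p t) / 2 * exp (\<i> * \<Phi> (p t)) * u (p t)))) (at t)"
      if "t \<in> {0..T}" for t
      using field_vector_diff_chain_at[OF dp d_be[OF pd[OF that]]] by (simp add: o_def)
    have kp: "norm (Sg (p t)) / 2 \<le> k' t" if "t \<in> {0..T}" for t using k' that by (auto simp: p_def)
    have k0: "0 \<le> k' t" if "t \<in> {0..T}" for t by (rule order_trans[OF _ kp[OF that]]) simp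
    have ee: "exp (- y t) * exp (y t) = 1" "exp (y t) * exp (- y t) = 1" for t by (simp_all add: exp_add[symmetric])
    have e2: "exp (2 * y t) = exp (y t) * exp (y t)" "exp (- 2 * y t) = exp (- y t) * exp (- y t)" for t
      by (simp_all add: exp_add[symmetric])
    have bA: "norm (v * (\<i> * Sg (p t) / 2 * exp (- (\<i> * \<Phi> (p t))) * u (p t)))
       \<le> k' t * (norm (al (p t)) + norm (be (p t)) * exp (2 * y t))" if "t \<in> {0..T}" for t
    proof -
      have "norm (v * (\<i> * Sg (p t) / 2 * exp (- (\<i> * \<Phi> (p t))) * u (p t))) = norm (Sg (p t)) / 2 * (exp (y t) * norm (u (p t)))"
        by (simp add: norm_mult v y_def)
      also have "\<dots> \<le> k' t * (exp (y t) * (norm (al (p t)) * exp (- y t) + norm (be (p t)) * exp (y t)))"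
        using kp[OF that] u_bound[of "p t"] k0[OF that] unfolding y_def[symmetric]
        by (intro mult_mono) (auto simp: y_def)
      also have "exp (y t) * (norm (al (p t)) * exp (- y t) + norm (be (p t)) * exp (y t))
        = norm (al (p t)) * (exp (- y t) * exp (y t)) + norm (be (p t)) * (exp (y t) * exp (y t))"
        by (simp only: ring_distribs mult_ac)
      finally show ?thesis unfolding ee e2 by simp
    qed
    have bB: "norm (v * (- (\<i> * Sg (p t) / 2 * exp (\<i> * \<Phi> (p t)) * u (p t))))
       \<le> k' t * (norm (al (p t)) * exp (- 2 * y t) + norm (be (p t)))" if "t \<in> {0..T}" for t
    proof -
      have "norm (v * (- (\<i> * Sg (p t) / 2 * exp (\<i> * \<Phi> (p t)) * u (p t)))) = norm (Sg (p t)) / 2 * (exp (- y t) * norm (u (p t)))"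
        by (simp add: norm_mult v y_def)
      also have "\<dots> \<le> k' t * (exp (- y t) * (norm (al (p t)) * exp (- y t) + norm (be (p t)) * exp (y t)))"
        using kp[OF that] u_bound[of "p t"] k0[OF that] unfolding y_def[symmetric]
        by (intro mult_mono) (auto simp: y_def)
      also have "exp (- y t) * (norm (al (p t)) * exp (- y t) + norm (be (p t)) * exp (y t))
        = norm (al (p t)) * (exp (- y t) * exp (- y t)) + norm (be (p t)) * (exp (- y t) * exp (y t))"
        by (simp only: ring_distribs mult_ac)
      finally show ?thesis unfolding ee e2 by simp
    qed
    have yc: "continuous_on {0..T} y"
      using dy by (meson DERIV_isCont continuous_at_imp_continuous_on)
    have ym: "y t \<le> y s" if "0 \<le> s" "s \<le> t" "t \<le> T" for s t
    proof (rule DERIV_nonpos_imp_nonincreasing[OF that(2)])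
      fix r assume "s \<le> r" "r \<le> t"
      then have r: "r \<in> {0..T}" using that by auto
      then have "Im (v * H (p r)) \<le> 0" using mono by (auto simp: p_def)
      then show "\<exists>d. (y has_real_derivative d) (at r) \<and> d \<le> 0" using dy[OF r] by blast
    qed
    show ?thesis
      using coupled_bound[OF T A B _ bA bB k0 yc ym small t] dk by auto
  qed
  show "norm (al (s0 + of_real T * v) - al s0) \<le> 2 * (k T - k 0) * amp s0"
    and "norm (be (s0 + of_real T * v) - be s0) \<le> 2 * (k T - k 0) * amp s0 * exp (- 2 * Im (\<Phi> (s0 + of_real T * v)))"
    using ab[of T] T by (auto simp: p_def y_def amp_def)
qed

abbreviation "eps \<rho> \<equiv> C * exp (- \<mu> * \<rho>)"

text \<open>The bound on \<open>Sg\<close> is integrable over a horizontal half-line, with integral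
  of the size of its initial value. Hence the estimate does not depend on the length
  \<open>T\<close>, and \<open>T\<close> may tend to infinity.\<close>

lemma horizontal_bound:
  assumes "Re s0 > \<rho>0" "T \<ge> 0" "\<And>t. 0 \<le> t \<Longrightarrow> t \<le> T \<Longrightarrow> Im (H (s0 + of_real t)) \<le> 0"
    and "eps (Re s0) \<le> 1/2"
  shows "norm (al (s0 + of_real T) - al s0) \<le> eps (Re s0) * amp s0"
    and "norm (be (s0 + of_real T) - be s0) \<le> eps (Re s0) * amp s0 * exp (- 2 * Im (\<Phi> (s0 + of_real T)))"
proof -
  define k where "k = (\<lambda>t. - (C / (2 * \<mu>)) * exp (- \<mu> * (Re s0 + t)))"
  have kT: "k T - k 0 \<le> eps (Re s0) / 2"
  proof -
    have "k T - k 0 \<le> C / (2 * \<mu>) * exp (- \<mu> * Re s0)"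
      using C mu by (simp add: k_def)
    also have "\<dots> \<le> C / 2 * exp (- \<mu> * Re s0)"
      using C mu by (intro mult_right_mono divide_left_mono) auto
    finally show ?thesis by simp
  qed
  have dk: "(k has_real_derivative C / 2 * exp (- \<mu> * (Re s0 + t))) (at t)" for t
    unfolding k_def using mu by (auto intro!: derivative_eq_intros)
  have "k T - k 0 \<le> 1/4" using kT assms by simp
  have a0: "amp s0 \<ge> 0" by (simp add: amp_def)
  have Sg': "norm (Sg (s0 + of_real t * 1)) / 2 \<le> C / 2 * exp (- \<mu> * (Re s0 + t))" if "0 \<le> t" for t
    using Sg[of "s0 + of_real t"] that assms(1) by simp
  have 1: "norm (al (s0 + of_real T * 1) - al s0) \<le> 2 * (k T - k 0) * amp s0"
    and 2: "norm (be (s0 + of_real T * 1) - be s0) \<le> 2 * (k T - k 0) * amp s0 * exp (- 2 * Im (\<Phi> (s0 + of_real T * 1)))"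
    using assms(1,3) by (intro path_bound[where k' = "\<lambda>t. C / 2 * exp (- \<mu> * (Re s0 + t))"] assms(2) dk Sg' \<open>k T - k 0 \<le> 1/4\<close>; simp)+
  have 3: "2 * (k T - k 0) * amp s0 \<le> eps (Re s0) * amp s0"
    using kT a0 by (intro mult_right_mono) auto
  show "norm (al (s0 + of_real T) - al s0) \<le> eps (Re s0) * amp s0" using 1 3 by simp
  show "norm (be (s0 + of_real T) - be s0) \<le> eps (Re s0) * amp s0 * exp (- 2 * Im (\<Phi> (s0 + of_real T)))"
    using order_trans[OF 2 mult_right_mono[OF 3]] by simp
qed

text \<open>Vertically the bound on \<open>Sg\<close> is constant, so the length \<open>T\<close>
  enters. The number \<open>\<sigma>\<close> is the direction, up or down, and the sign of Re H
  again expresses that Im \<Phi> does not increase.\<close>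

lemma vertical_bound:
  assumes "Re s0 > \<rho>0" "T \<ge> 0" "\<sigma> = 1 \<or> \<sigma> = -1"
    and "\<And>t. 0 \<le> t \<Longrightarrow> t \<le> T \<Longrightarrow> \<sigma> * Re (H (s0 + \<i> * of_real (\<sigma> * t))) \<le> 0"
    and "eps (Re s0) * T \<le> 1/2"
  shows "norm (al (s0 + \<i> * of_real (\<sigma> * T)) - al s0) \<le> eps (Re s0) * T * amp s0"
    and "norm (be (s0 + \<i> * of_real (\<sigma> * T)) - be s0) \<le> eps (Re s0) * T * amp s0 * exp (- 2 * Im (\<Phi> (s0 + \<i> * of_real (\<sigma> * T))))"
proof -
  define k where "k = (\<lambda>t. eps (Re s0) / 2 * t)"
  have kT: "k T - k 0 = eps (Re s0) * T / 2" by (simp add: k_def)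
  have dk: "(k has_real_derivative eps (Re s0) / 2) (at t)" for t
    unfolding k_def by (auto intro!: derivative_eq_intros)
  have sm: "k T - k 0 \<le> 1/4" using kT assms by simp
  have Sg': "norm (Sg (s0 + of_real t * (\<i> * of_real \<sigma>))) / 2 \<le> eps (Re s0) / 2" for t
    using Sg[of "s0 + of_real t * (\<i> * of_real \<sigma>)"] assms(1) by simp
  have e: "s0 + \<i> * of_real (\<sigma> * t) = s0 + of_real t * (\<i> * of_real \<sigma>)" for t by (simp add: mult_ac)
  have n: "norm (\<i> * of_real \<sigma>) = 1" using assms(3) by (auto simp: norm_mult)
  note * = path_bound[where k' = "\<lambda>t. eps (Re s0) / 2" and k = k, OF assms(2) n _ _ dk Sg' sm]
  show "norm (al (s0 + \<i> * of_real (\<sigma> * T)) - al s0) \<le> eps (Re s0) * T * amp s0"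
    and "norm (be (s0 + \<i> * of_real (\<sigma> * T)) - be s0) \<le> eps (Re s0) * T * amp s0 * exp (- 2 * Im (\<Phi> (s0 + \<i> * of_real (\<sigma> * T))))"
    unfolding e using * assms(1,4) unfolding kT e by (auto simp: mult_ac)
qed

text \<open>The symmetry that exchanges the two exponentials, hence \<open>al\<close> with
  \<open>be\<close> and the sector below the ray with the one above it.\<close>

lemma negated: "wkb_system u (\<lambda>s. - V s) (\<lambda>s. - H s) (\<lambda>s. - Sg s) (\<lambda>s. - \<Phi> s) \<rho>0 \<mu> C"
proof unfold_locales
  fix s assume s: "Re s > \<rho>0"
  show "(u has_field_derivative - H s * - V s) (at s)" using du[OF s] by simp
  show "((\<lambda>s. - V s) has_field_derivative - (- H s + - Sg s) * u s) (at s)"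
    using DERIV_minus[OF dV[OF s]] by (simp add: algebra_simps)
  show "((\<lambda>s. - \<Phi> s) has_field_derivative - H s) (at s)" using DERIV_minus[OF dPhi[OF s]] by simp
  show "norm (- Sg s) \<le> C * exp (- \<mu> * Re s)" using Sg[OF s] by simp
qed (use mu C rho0 in auto)

lemma negated_al_be:
  "wkb_system.al u (\<lambda>s. - V s) (\<lambda>s. - \<Phi> s) = be" "wkb_system.be u (\<lambda>s. - V s) (\<lambda>s. - \<Phi> s) = al"
  by (auto simp: fun_eq_iff be_def al_def wkb_system.al_def[OF negated] wkb_system.be_def[OF negated])

lemma eps_small: assumes "e > 0" shows "\<forall>\<^sub>F \<rho> in at_top. eps \<rho> < e"
proof -
  have "((\<lambda>\<rho>. eps \<rho>) \<longlongrightarrow> 0) at_top" using mu by real_asymp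
  then show ?thesis using assms order_tendstoD(2) by blast
qed

end

section \<open>Asymptotics in strips\<close>

context wkb_system
begin

text \<open>A horizontal half-strip in which exp(\<i> \<Phi>) grows doubly exponentially to the
  right. A subsector well inside a Stokes sector becomes such a strip, for the system itself or for
  its negative.\<close>

definition "growth_strip t1 t2 c \<rho>1 \<longleftrightarrow> t1 \<le> t2 \<and> 0 < c \<and> \<rho>0 < \<rho>1 \<and>
  (\<forall>s. \<rho>1 \<le> Re s \<longrightarrow> t1 \<le> Im s \<longrightarrow> Im s \<le> t2 \<longrightarrow> Im (H s) \<le> - (c * exp (\<mu> * Re s)))"

lemma growth_stripD:
  assumes "growth_strip t1 t2 c \<rho>1"
  shows "t1 \<le> t2" "0 < c" "\<rho>0 < \<rho>1"
    "\<And>s. \<rho>1 \<le> Re s \<Longrightarrow> t1 \<le> Im s \<Longrightarrow> Im s \<le> t2 \<Longrightarrow> Im (H s) \<le> - (c * exp (\<mu> * Re s))"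
  using assms unfolding growth_strip_def by auto

lemma eps_antimono: "\<rho> \<le> \<rho>' \<Longrightarrow> eps \<rho>' \<le> eps \<rho>"
  using mu C by simp

lemma eps_pos: "eps \<rho> > 0" using C by simp

lemma amp_nonneg: "amp s \<ge> 0" by (simp add: amp_def)

lemma continuous_on_al: "S \<subseteq> {s. Re s > \<rho>0} \<Longrightarrow> continuous_on S al"
  by (intro continuous_at_imp_continuous_on ballI DERIV_isCont[OF d_al]) auto

lemma continuous_on_be: "S \<subseteq> {s. Re s > \<rho>0} \<Longrightarrow> continuous_on S be"
  by (intro continuous_at_imp_continuous_on ballI DERIV_isCont[OF d_be]) auto

lemma continuous_on_Phi: "S \<subseteq> {s. Re s > \<rho>0} \<Longrightarrow> continuous_on S \<Phi>"
  by (intro continuous_at_imp_continuous_on ballI DERIV_isCont[OF dPhi]) auto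

lemma continuous_on_amp: "S \<subseteq> {s. Re s > \<rho>0} \<Longrightarrow> continuous_on S amp"
  unfolding amp_def[abs_def]
  by (intro continuous_intros continuous_on_al continuous_on_be continuous_on_Phi)

lemma norm_d_al: "Re s > \<rho>0 \<Longrightarrow> norm (\<i> * Sg s / 2 * exp (- (\<i> * \<Phi> s)) * u s) \<le> eps (Re s) * amp s"
proof -
  assume s: "Re s > \<rho>0"
  have "exp (Im (\<Phi> s)) * norm (u s) \<le> exp (Im (\<Phi> s)) * (norm (al s) * exp (- Im (\<Phi> s)) + norm (be s) * exp (Im (\<Phi> s)))"
    using u_bound by simp
  also have "\<dots> = norm (al s) * (exp (Im (\<Phi> s)) * exp (- Im (\<Phi> s))) + norm (be s) * (exp (Im (\<Phi> s)) * exp (Im (\<Phi> s)))"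
    by (simp only: ring_distribs mult_ac)
  also have "\<dots> = amp s" by (simp add: amp_def exp_add[symmetric])
  finally have "norm (Sg s) / 2 * (exp (Im (\<Phi> s)) * norm (u s)) \<le> eps (Re s) * amp s"
    using Sg[OF s] eps_pos[of "Re s"] by (intro mult_mono) auto
  then show ?thesis by (simp add: norm_mult)
qed

lemma Im_Phi_decay:
  assumes G: "growth_strip t1 t2 c \<rho>1" and s: "\<rho>1 \<le> Re s" "t1 \<le> Im s" "Im s \<le> t2" and T: "T \<ge> 0"
  shows "Im (\<Phi> (s + of_real T)) \<le> Im (\<Phi> s) - c * exp (\<mu> * Re s) * T"
proof -
  note g = growth_stripD[OF G]
  define y where "y = (\<lambda>t. Im (\<Phi> (s + of_real t)) + c * exp (\<mu> * Re s) * t)"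
  have "y T \<le> y 0"
  proof (rule DERIV_nonpos_imp_nonincreasing[OF T])
    fix t :: real assume t: "0 \<le> t" "t \<le> T"
    have p: "((\<lambda>t. s + of_real t) has_vector_derivative 1) (at t)" by (auto intro!: derivative_eq_intros)
    have "Re (s + of_real t) > \<rho>0" using s t g by simp
    from bounded_linear.has_vector_derivative[OF bounded_linear_Im field_vector_diff_chain_at[OF p dPhi[OF this]]]
    have "((\<lambda>t. Im (\<Phi> (s + of_real t))) has_real_derivative Im (H (s + of_real t))) (at t)"
      by (simp add: o_def has_real_derivative_iff_has_vector_derivative)
    then have d: "(y has_real_derivative Im (H (s + of_real t)) + c * exp (\<mu> * Re s)) (at t)"
      unfolding y_def by (intro DERIV_add DERIV_cmult_Id)
    have "Im (H (s + of_real t)) \<le> - (c * exp (\<mu> * Re (s + of_real t)))"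
      using g(4)[of "s + of_real t"] s t by simp
    moreover have "c * exp (\<mu> * Re s) \<le> c * exp (\<mu> * Re (s + of_real t))"
      using t mu g(2) by simp
    ultimately have "Im (H (s + of_real t)) + c * exp (\<mu> * Re s) \<le> 0" by linarith
    with d show "\<exists>d. (y has_real_derivative d) (at t) \<and> d \<le> 0" by blast
  qed
  then show ?thesis by (simp add: y_def)
qed

lemma strip_horizontal:
  assumes G: "growth_strip t1 t2 c \<rho>1" and s: "\<rho>1 \<le> Re s" "t1 \<le> Im s" "Im s \<le> t2" and T: "T \<ge> 0"
    and e: "eps (Re s) \<le> 1/2"
  shows "norm (al (s + of_real T) - al s) \<le> eps (Re s) * amp s"
    and "norm (be (s + of_real T) - be s) \<le> eps (Re s) * amp s * exp (- 2 * Im (\<Phi> (s + of_real T)))"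
proof -
  note g = growth_stripD[OF G]
  have "Im (H (s + of_real t)) \<le> 0" if "0 \<le> t" for t
  proof -
    have "Im (H (s + of_real t)) \<le> - (c * exp (\<mu> * Re (s + of_real t)))"
      using g(4)[of "s + of_real t"] s that by simp
    also have "\<dots> \<le> 0" using g(2) by simp
    finally show ?thesis .
  qed
  then show "norm (al (s + of_real T) - al s) \<le> eps (Re s) * amp s"
    and "norm (be (s + of_real T) - be s) \<le> eps (Re s) * amp s * exp (- 2 * Im (\<Phi> (s + of_real T)))"
    using horizontal_bound[of s T] s(1) g(3) T e by auto
qed

lemma strip_be:
  assumes G: "growth_strip t1 t2 c \<rho>1" and s: "\<rho>1 \<le> Re s" "t1 \<le> Im s" "Im s \<le> t2" and T: "T \<ge> 0"
    and e: "eps (Re s) \<le> 1/2"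
  shows "norm (be (s + of_real T)) * exp (2 * Im (\<Phi> (s + of_real T)))
    \<le> norm (be s) * exp (2 * Im (\<Phi> s)) * exp (- (2 * c * exp (\<mu> * Re s) * T)) + eps (Re s) * amp s"
proof -
  let ?y = "Im (\<Phi> (s + of_real T))"
  have "norm (be (s + of_real T)) \<le> norm (be s) + eps (Re s) * amp s * exp (- 2 * ?y)"
    using strip_horizontal(2)[OF assms] norm_triangle_ineq2[of "be (s + of_real T)" "be s"] by linarith
  then have "norm (be (s + of_real T)) * exp (2 * ?y) \<le> (norm (be s) + eps (Re s) * amp s * exp (- 2 * ?y)) * exp (2 * ?y)"
    by (rule mult_right_mono) simp
  also have "\<dots> = norm (be s) * exp (2 * ?y) + eps (Re s) * amp s * (exp (- 2 * ?y) * exp (2 * ?y))"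
    by (simp only: ring_distribs mult_ac)
  also have "exp (- 2 * ?y) * exp (2 * ?y) = 1" by (simp add: exp_add[symmetric])
  also have "norm (be s) * exp (2 * ?y) \<le> norm (be s) * exp (2 * Im (\<Phi> s) + - (2 * c * exp (\<mu> * Re s) * T))"
    using Im_Phi_decay[OF G s T] by (intro mult_left_mono) auto
  finally show ?thesis by (simp only: exp_add mult.assoc mult_1_right)
qed

text \<open>A compact vertical segment at abscissa \<open>\<rho>2\<close> supplies initial bounds,
  and horizontal paths carry them to the right. With \<open>eps\<close> at most 1/4 the two
  increments add at most half of the initial \<open>amp\<close>.\<close>

lemma strip_amp_bounded:
  assumes G: "growth_strip t1 t2 c \<rho>1"
  obtains M \<rho>2 where "M > 0" "\<rho>1 \<le> \<rho>2" "eps \<rho>2 \<le> 1/4"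
    "\<And>s. \<rho>2 \<le> Re s \<Longrightarrow> t1 \<le> Im s \<Longrightarrow> Im s \<le> t2 \<Longrightarrow> amp s \<le> M"
    "\<And>s. Re s = \<rho>2 \<Longrightarrow> t1 \<le> Im s \<Longrightarrow> Im s \<le> t2 \<Longrightarrow> norm (be s) \<le> M"
    "\<And>s. \<rho>2 \<le> Re s \<Longrightarrow> t1 \<le> Im s \<Longrightarrow> Im s \<le> t2 \<Longrightarrow> Im (\<Phi> s) \<le> M - c * exp (- \<mu>) * exp (\<mu> * Re s)"
proof -
  note g = growth_stripD[OF G]
  have "\<forall>\<^sub>F \<rho> in at_top. \<rho>1 \<le> \<rho> \<and> eps \<rho> \<le> 1/4"
    using eventually_conj[OF eventually_ge_at_top[of \<rho>1] eps_small[of "1/4"]]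
    by (auto elim!: eventually_mono)
  then obtain \<rho>2 where r2: "\<rho>1 \<le> \<rho>2" "eps \<rho>2 \<le> 1/4" by (auto simp: eventually_at_top_linorder)
  define K where "K = (\<lambda>t. Complex \<rho>2 t) ` {t1..t2}"
  have cK: "compact K" unfolding K_def Complex_eq
    by (intro compact_continuous_image continuous_intros) auto
  have sub: "K \<subseteq> {s. Re s > \<rho>0}" using g r2 by (auto simp: K_def)
  obtain M1 where M1: "\<And>s. s \<in> K \<Longrightarrow> norm (amp s) \<le> M1"
    using compact_imp_bounded[OF compact_continuous_image[OF continuous_on_amp[OF sub] cK]] by (auto simp: bounded_iff)
  obtain M2 where M2: "\<And>s. s \<in> K \<Longrightarrow> norm (be s) \<le> M2"
    using compact_imp_bounded[OF compact_continuous_image[OF continuous_on_be[OF sub] cK]] by (auto simp: bounded_iff)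
  obtain M3 where M3: "\<And>s. s \<in> K \<Longrightarrow> norm (\<Phi> s) \<le> M3"
    using compact_imp_bounded[OF compact_continuous_image[OF continuous_on_Phi[OF sub] cK]] by (auto simp: bounded_iff)
  define r3 where "r3 = \<rho>2 + 1"
  define M where "M = max 1 (max (2 * M1) (max M2 (M3 + c * exp (- \<mu>) * exp (\<mu> * \<rho>2 + \<mu>))))"
  have inK: "Complex \<rho>2 (Im s) \<in> K" if "t1 \<le> Im s" "Im s \<le> t2" for s using that by (auto simp: K_def)
  have amp: "amp s \<le> M" if s: "\<rho>2 \<le> Re s" "t1 \<le> Im s" "Im s \<le> t2" for s
  proof -
    let ?s = "Complex \<rho>2 (Im s)" and ?T = "Re s - \<rho>2"
    have se: "s = ?s + of_real ?T" by (simp add: complex_eq_iff)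
    have h: "\<rho>1 \<le> Re ?s" "t1 \<le> Im ?s" "Im ?s \<le> t2" "?T \<ge> 0" "eps (Re ?s) \<le> 1/2" using s r2 by auto
    have 1: "norm (al s) \<le> norm (al ?s) + eps \<rho>2 * amp ?s"
      using strip_horizontal(1)[OF G h] norm_triangle_ineq2[of "al s" "al ?s"] unfolding se[symmetric] by simp
    have "exp (- (2 * c * exp (\<mu> * Re ?s) * ?T)) \<le> 1" using g(2) s by simp
    then have "norm (be ?s) * exp (2 * Im (\<Phi> ?s)) * exp (- (2 * c * exp (\<mu> * Re ?s) * ?T)) \<le> norm (be ?s) * exp (2 * Im (\<Phi> ?s)) * 1"
      by (intro mult_left_mono) auto
    then have "norm (be s) * exp (2 * Im (\<Phi> s)) \<le> norm (be ?s) * exp (2 * Im (\<Phi> ?s)) + eps \<rho>2 * amp ?s"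
      using strip_be[OF G h] unfolding se[symmetric] by simp
    then have "amp s \<le> amp ?s + 2 * (eps \<rho>2 * amp ?s)" using 1 by (simp add: amp_def)
    also have "eps \<rho>2 * amp ?s \<le> 1/4 * amp ?s" using r2 amp_nonneg by (intro mult_right_mono) auto
    finally have "amp s \<le> 2 * amp ?s" using amp_nonneg[of ?s] by linarith
    then show ?thesis using M1[OF inK[OF s(2,3)]] unfolding M_def by simp
  qed
  have Im: "Im (\<Phi> s) \<le> M - c * exp (- \<mu>) * exp (\<mu> * Re s)" if s: "\<rho>2 \<le> Re s" "t1 \<le> Im s" "Im s \<le> t2" for s
  proof (cases "Re s \<le> \<rho>2 + 1")
    case True
    let ?s = "Complex \<rho>2 (Im s)" and ?T = "Re s - \<rho>2"
    have se: "s = ?s + of_real ?T" by (simp add: complex_eq_iff)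
    have "Im (\<Phi> s) \<le> Im (\<Phi> ?s) - c * exp (\<mu> * Re ?s) * ?T"
      using Im_Phi_decay[OF G, of ?s ?T] s r2 unfolding se[symmetric] by simp
    also have "\<dots> \<le> Im (\<Phi> ?s)" using g(2) s by simp
    also have "\<dots> \<le> M3" using M3[OF inK[OF s(2,3)]] abs_Im_le_cmod[of "\<Phi> ?s"] by linarith
    also have "\<dots> \<le> M - c * exp (- \<mu>) * exp (\<mu> * Re s)"
    proof -
      have "\<mu> * Re s \<le> \<mu> * (\<rho>2 + 1)" using True mu by (intro mult_left_mono) auto
      then have "c * exp (- \<mu>) * exp (\<mu> * Re s) \<le> c * exp (- \<mu>) * exp (\<mu> * \<rho>2 + \<mu>)"
        using g(2) by (intro mult_left_mono) (auto simp: algebra_simps)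
      then show ?thesis unfolding M_def by linarith
    qed
    finally show ?thesis .
  next
    \<comment> \<open>The decay is read off the last unit step alone. \<open>Im_Phi_decay\<close>
      uses the rate at the left end of the path, so starting at \<open>s - 1\<close> costs only the
      factor exp(- \<mu>), however far \<open>s\<close> is from \<open>\<rho>2\<close>.\<close>
    case False
    let ?so = "Complex \<rho>2 (Im s)"
    define T where "T = Re s - \<rho>2 - 1"
    let ?s = "s - 1"
    have se: "s = ?s + of_real 1" by simp
    have se2: "?s = ?so + of_real T" 
      by (simp only: complex_eq_iff plus_complex.sel complex.sel Re_complex_of_real Im_complex_of_real minus_complex.sel one_complex.sel T_def) linarith
    have T0: "T \<ge> 0" using False by (simp add: T_def)
    have "Im (\<Phi> s) \<le> Im (\<Phi> ?s) - c * exp (\<mu> * Re ?s) * 1"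
      using Im_Phi_decay[OF G, of ?s 1] s False r2 unfolding se[symmetric] by simp
    moreover have "Im (\<Phi> ?s) \<le> Im (\<Phi> ?so) - c * exp (\<mu> * Re ?so) * T"
      using Im_Phi_decay[OF G, of ?so T] s T0 r2 unfolding se2[symmetric] by simp
    moreover have "c * exp (\<mu> * Re ?so) * T \<ge> 0" using g(2) T0 by simp
    moreover have "Im (\<Phi> ?so) \<le> M3" using M3[OF inK[OF s(2,3)]] abs_Im_le_cmod[of "\<Phi> ?so"] by linarith
    moreover have "c * exp (\<mu> * Re ?s) = c * exp (- \<mu>) * exp (\<mu> * Re s)"
      by (simp add: exp_add[symmetric] algebra_simps)
    moreover have "M3 \<le> M"
    proof -
      have "M3 \<le> M3 + c * exp (- \<mu>) * exp (\<mu> * \<rho>2 + \<mu>)" using g(2) by simp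
      then show ?thesis unfolding M_def by linarith
    qed
    ultimately show ?thesis by linarith
  qed
  show ?thesis
  proof (rule that[OF _ r2 amp _ Im])
    show "M > 0" by (simp add: M_def)
    fix s assume "Re s = \<rho>2" "t1 \<le> Im s" "Im s \<le> t2"
    then show "norm (be s) \<le> M" using M2[OF inK[of s]] complex_surj[of s] by (simp add: M_def)
  qed auto
qed

text \<open>Along the lower edge the horizontal estimate makes \<open>al\<close> a Cauchy function.
  The derivative of \<open>al\<close> is at most \<open>eps\<close> times \<open>amp\<close>, so
  moving vertically changes \<open>al\<close> by an exponentially small amount and the limit is the
  same, uniformly, in the whole strip.\<close>

lemma strip_limit:
  assumes G: "growth_strip t1 t2 c \<rho>1"
  obtains L where "\<And>e. e > 0 \<Longrightarrow> \<exists>\<rho>2. \<forall>s. \<rho>2 \<le> Re s \<longrightarrow> t1 \<le> Im s \<longrightarrow> Im s \<le> t2 \<longrightarrow>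
      norm (al s - L) \<le> e \<and> norm (be s) * exp (2 * Im (\<Phi> s)) \<le> e"
proof -
  note g = growth_stripD[OF G]
  obtain M \<rho>2 where M: "M > 0" "\<rho>1 \<le> \<rho>2" "eps \<rho>2 \<le> 1/4"
    and amp: "\<And>s. \<rho>2 \<le> Re s \<Longrightarrow> t1 \<le> Im s \<Longrightarrow> Im s \<le> t2 \<Longrightarrow> amp s \<le> M"
    using strip_amp_bounded[OF G] by metis
  have e4: "eps \<rho> \<le> 1/4" if "\<rho> \<ge> \<rho>2" for \<rho> using eps_antimono[OF that] M(3) by linarith
  define X where "X = (\<lambda>\<rho>. al (Complex \<rho> t1))"
  have X: "norm (X \<rho>' - X \<rho>) \<le> eps \<rho> * M" if "\<rho>2 \<le> \<rho>" "\<rho> \<le> \<rho>'" for \<rho> \<rho>'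
  proof -
    have "norm (al (Complex \<rho> t1 + of_real (\<rho>' - \<rho>)) - al (Complex \<rho> t1)) \<le> eps (Re (Complex \<rho> t1)) * amp (Complex \<rho> t1)"
      using e4[OF that(1)] that M(2) g(1) by (intro strip_horizontal[OF G]) auto
    also have "\<dots> \<le> eps \<rho> * M"
      using amp[of "Complex \<rho> t1"] that g C by (intro mult_mono) (auto simp: amp_nonneg)
    also have "Complex \<rho> t1 + of_real (\<rho>' - \<rho>) = Complex \<rho>' t1" by (simp add: complex_eq_iff)
    finally show ?thesis by (simp add: X_def)
  qed
  have eps0: "((\<lambda>\<rho>. eps \<rho> * K) \<longlongrightarrow> 0) at_top" for K using mu by real_asymp
  have "Cauchy (\<lambda>n. X (real n))"
  proof (rule metric_CauchyI)
    fix e :: real assume "e > 0"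
    then have "\<forall>\<^sub>F \<rho> in at_top. eps \<rho> * M < e \<and> \<rho>2 \<le> \<rho>"
      using order_tendstoD(2)[OF eps0[of M]] eventually_ge_at_top[of \<rho>2] by (simp add: eventually_conj_iff)
    then obtain r where r: "\<And>\<rho>. \<rho> \<ge> r \<Longrightarrow> eps \<rho> * M < e \<and> \<rho>2 \<le> \<rho>" by (auto simp: eventually_at_top_linorder)
    obtain n0 :: nat where n0: "real n0 \<ge> r" using real_arch_simple by blast
    have W: "dist (X (real m)) (X (real n)) < e" if "n0 \<le> m" "m \<le> n" for m n
    proof -
      have a: "real n0 \<le> real m" using that by simp
      have b: "r \<le> real m" using a n0 by linarith
      have c: "real m \<le> real n" using that by simp
      have "norm (X (real n) - X (real m)) \<le> eps (real m) * M" using r[OF b] c by (intro X) auto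
      also have "\<dots> < e" using r[OF b] by simp
      finally show ?thesis by (simp add: dist_norm norm_minus_commute)
    qed
    show "\<exists>M. \<forall>m\<ge>M. \<forall>n\<ge>M. dist (X (real m)) (X (real n)) < e"
    proof (intro exI allI impI)
      fix m n assume "m \<ge> n0" "n \<ge> n0"
      then show "dist (X (real m)) (X (real n)) < e"
        using W[of m n] W[of n m] by (cases "m \<le> n") (auto simp: dist_commute)
    qed
  qed
  then obtain L where L: "(\<lambda>n. X (real n)) \<longlonglongrightarrow> L" by (auto simp: Cauchy_convergent_iff convergent_def)
  have XL: "norm (X \<rho> - L) \<le> eps \<rho> * M" if "\<rho>2 \<le> \<rho>" for \<rho>
  proof (rule Lim_norm_ubound[of sequentially "\<lambda>n. X \<rho> - X (real n)"])
    show "(\<lambda>n. X \<rho> - X (real n)) \<longlonglongrightarrow> X \<rho> - L" by (intro tendsto_intros L)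
    have "\<forall>\<^sub>F n in sequentially. \<rho> \<le> real n"
      using filterlim_real_sequentially by (simp add: filterlim_at_top)
    then show "\<forall>\<^sub>F n in sequentially. norm (X \<rho> - X (real n)) \<le> eps \<rho> * M"
    proof eventually_elim
      case (elim n)
      show ?case using X[OF that elim] by (simp add: norm_minus_commute)
    qed
  qed simp
  have alL: "norm (al s - L) \<le> eps (Re s) * (M * (1 + (t2 - t1)))"
    if s: "\<rho>2 \<le> Re s" "t1 \<le> Im s" "Im s \<le> t2" for s
  proof -
    have "norm (al s - al (Complex (Re s) t1)) \<le> eps (Re s) * M * norm (s - Complex (Re s) t1)"
    proof (rule field_differentiable_bound[of "closed_segment (Complex (Re s) t1) s" al])
      fix z assume z: "z \<in> closed_segment (Complex (Re s) t1) s"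
      have zz: "Re z = Re s" "t1 \<le> Im z" "Im z \<le> t2"
      proof -
        obtain q where q: "0 \<le> q" "q \<le> 1" "z = (1 - q) *\<^sub>R Complex (Re s) t1 + q *\<^sub>R s" using z by (auto simp: in_segment)
        show "Re z = Re s" unfolding q(3) by (simp add: algebra_simps)
        have "Im z = t1 + q * (Im s - t1)" unfolding q(3) by (simp add: algebra_simps)
        moreover have "0 \<le> q * (Im s - t1)" "q * (Im s - t1) \<le> Im s - t1"
          using q(1,2) s by (auto intro!: mult_left_le_one_le mult_nonneg_nonneg)
        ultimately show "t1 \<le> Im z" "Im z \<le> t2" using s by linarith+
      qed
      have z0: "Re z > \<rho>0" using zz s M g by linarith
      show "(al has_field_derivative \<i> * Sg z / 2 * exp (- (\<i> * \<Phi> z)) * u z) (at z within closed_segment (Complex (Re s) t1) s)"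
        using d_al[OF z0] by (rule has_field_derivative_at_within)
      have "eps (Re z) * amp z \<le> eps (Re s) * M"
        using zz amp[of z] s C amp_nonneg[of z] by (intro mult_mono) auto
      then show "norm (\<i> * Sg z / 2 * exp (- (\<i> * \<Phi> z)) * u z) \<le> eps (Re s) * M"
        using norm_d_al[OF z0] by linarith
    qed auto
    also have "norm (s - Complex (Re s) t1) = Im s - t1"
    proof -
      have "s - Complex (Re s) t1 = \<i> * of_real (Im s - t1)" by (simp add: complex_eq_iff)
      then have "norm (s - Complex (Re s) t1) = \<bar>Im s - t1\<bar>" by (simp add: norm_mult del: of_real_diff)
      then show ?thesis using s by simp
    qed
    also have "eps (Re s) * M * (Im s - t1) \<le> eps (Re s) * M * (t2 - t1)"
      using s M eps_pos[of "Re s"] by (intro mult_left_mono) auto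
    finally have "norm (al s - X (Re s)) \<le> eps (Re s) * M * (t2 - t1)" by (simp add: X_def)
    moreover have "norm (X (Re s) - L) \<le> eps (Re s) * M" using XL s by simp
    moreover have "norm (al s - L) \<le> norm (al s - X (Re s)) + norm (X (Re s) - L)"
      using norm_triangle_ineq[of "al s - X (Re s)" "X (Re s) - L"] by simp
    ultimately show ?thesis by (simp add: algebra_simps)
  qed
  show ?thesis
  proof (rule that)
    fix e :: real assume e: "e > 0"
    have "((\<lambda>\<rho>. M * exp (- (2 * c * exp (\<mu> * (\<rho> - 1)))) + eps (\<rho> - 1) * M) \<longlongrightarrow> 0) at_top"
      using mu g(2) by real_asymp
    from order_tendstoD(2)[OF this e] order_tendstoD(2)[OF eps0[of "M * (1 + (t2 - t1))"] e] eventually_ge_at_top[of "\<rho>2 + 1"]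
    have "\<forall>\<^sub>F \<rho> in at_top. M * exp (- (2 * c * exp (\<mu> * (\<rho> - 1)))) + eps (\<rho> - 1) * M < e \<and> eps \<rho> * (M * (1 + (t2 - t1))) < e \<and> \<rho>2 + 1 \<le> \<rho>"
      by eventually_elim auto
    then obtain r where r: "\<And>\<rho>. \<rho> \<ge> r \<Longrightarrow> M * exp (- (2 * c * exp (\<mu> * (\<rho> - 1)))) + eps (\<rho> - 1) * M < e \<and> eps \<rho> * (M * (1 + (t2 - t1))) < e \<and> \<rho>2 + 1 \<le> \<rho>"
      by (auto simp: eventually_at_top_linorder)
    show "\<exists>\<rho>2. \<forall>s. \<rho>2 \<le> Re s \<longrightarrow> t1 \<le> Im s \<longrightarrow> Im s \<le> t2 \<longrightarrow> norm (al s - L) \<le> e \<and> norm (be s) * exp (2 * Im (\<Phi> s)) \<le> e"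
    proof (intro exI[of _ r] allI impI conjI)
      fix s assume s: "r \<le> Re s" "t1 \<le> Im s" "Im s \<le> t2"
      note rs = r[OF s(1)]
      show "norm (al s - L) \<le> e" using alL[of s] rs s by linarith
      \<comment> \<open>Over one unit to the right the previous value of this term is damped doubly
        exponentially; only an error proportional to \<open>eps\<close> survives.\<close>
      let ?s = "s - 1"
      have se: "s = ?s + of_real 1" by simp
      have h: "\<rho>1 \<le> Re ?s" "t1 \<le> Im ?s" "Im ?s \<le> t2" "(1::real) \<ge> 0" "eps (Re ?s) \<le> 1/2"
        using s rs M e4[of "Re ?s"] by auto
      have aM: "amp ?s \<le> M" using amp[of ?s] rs s by simp
      have bM: "norm (be ?s) * exp (2 * Im (\<Phi> ?s)) \<le> M" using aM norm_ge_zero[of "al ?s"] unfolding amp_def by linarith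
      have "norm (be s) * exp (2 * Im (\<Phi> s)) \<le> norm (be ?s) * exp (2 * Im (\<Phi> ?s)) * exp (- (2 * c * exp (\<mu> * Re ?s) * 1)) + eps (Re ?s) * amp ?s"
        using strip_be[OF G h] unfolding se[symmetric] .
      also have "\<dots> \<le> M * exp (- (2 * c * exp (\<mu> * Re ?s) * 1)) + eps (Re ?s) * M"
        using aM bM eps_pos[of "Re ?s"] by (intro add_mono mult_right_mono mult_left_mono) auto
      also have "\<dots> \<le> e" using rs by simp
      finally show "norm (be s) * exp (2 * Im (\<Phi> s)) \<le> e" .
    qed
  qed
qed

text \<open>If \<open>al\<close> tends to 0, the horizontal estimate read from infinity bounds
  \<open>al\<close> by \<open>eps\<close> times \<open>amp\<close>, and the part of
  \<open>amp\<close> that contains \<open>al\<close> is absorbed. Then \<open>be\<close> satisfies a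
  scalar inequality of its own and is bounded outright, not merely up to the large weight exp(- 2 Im
  \<Phi>).\<close>

lemma strip_recessive:
  assumes G: "growth_strip t1 t2 c \<rho>1"
    and lim: "\<And>\<tau>. t1 \<le> \<tau> \<Longrightarrow> \<tau> \<le> t2 \<Longrightarrow> ((\<lambda>\<rho>. al (Complex \<rho> \<tau>)) \<longlongrightarrow> 0) at_top"
  obtains \<rho>2 K where "K > 0" "\<rho>1 \<le> \<rho>2" "eps \<rho>2 \<le> 1/4"
    "\<And>s. \<rho>2 \<le> Re s \<Longrightarrow> t1 \<le> Im s \<Longrightarrow> Im s \<le> t2 \<Longrightarrow> norm (al s) \<le> 2 * eps (Re s) * (norm (be s) * exp (2 * Im (\<Phi> s)))"
    "\<And>s. \<rho>2 \<le> Re s \<Longrightarrow> t1 \<le> Im s \<Longrightarrow> Im s \<le> t2 \<Longrightarrow> norm (be s) \<le> K"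
proof -
  note g = growth_stripD[OF G]
  obtain M \<rho>2 where M: "M > 0" "\<rho>1 \<le> \<rho>2" "eps \<rho>2 \<le> 1/4"
    and beM: "\<And>s. Re s = \<rho>2 \<Longrightarrow> t1 \<le> Im s \<Longrightarrow> Im s \<le> t2 \<Longrightarrow> norm (be s) \<le> M"
    using strip_amp_bounded[OF G] by metis
  have e4: "eps \<rho> \<le> 1/4" if "\<rho> \<ge> \<rho>2" for \<rho> using eps_antimono[OF that] M(3) by linarith
  have 1: "norm (al s) \<le> 2 * eps (Re s) * (norm (be s) * exp (2 * Im (\<Phi> s)))"
    if s: "\<rho>2 \<le> Re s" "t1 \<le> Im s" "Im s \<le> t2" for s
  proof -
    have "norm (0 - al s) \<le> eps (Re s) * amp s"
    proof (rule Lim_norm_ubound[of at_top "\<lambda>\<rho>. al (Complex \<rho> (Im s)) - al s"])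
      show "((\<lambda>\<rho>. al (Complex \<rho> (Im s)) - al s) \<longlongrightarrow> 0 - al s) at_top"
        by (intro tendsto_intros lim s)
      show "\<forall>\<^sub>F \<rho> in at_top. norm (al (Complex \<rho> (Im s)) - al s) \<le> eps (Re s) * amp s"
        using eventually_ge_at_top[of "Re s"]
      proof eventually_elim
        case (elim \<rho>)
        have "Complex \<rho> (Im s) = s + of_real (\<rho> - Re s)" by (simp add: complex_eq_iff)
        then show ?case using strip_horizontal(1)[OF G _ s(2,3), of "\<rho> - Re s"] e4[OF s(1)] elim s M by simp
      qed
    qed simp
    then have "norm (al s) \<le> eps (Re s) * norm (al s) + eps (Re s) * (norm (be s) * exp (2 * Im (\<Phi> s)))"
      by (simp add: amp_def algebra_simps)
    moreover have "eps (Re s) * norm (al s) \<le> 1/2 * norm (al s)" using e4[OF s(1)] by (intro mult_right_mono) auto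
    ultimately show ?thesis by simp
  qed
  have 2: "norm (be s) \<le> 2 * M" if s: "\<rho>2 \<le> Re s" "t1 \<le> Im s" "Im s \<le> t2" for s
  proof -
    define T where "T = Re s - \<rho>2"
    define p where "p = (\<lambda>t::real. Complex (\<rho>2 + t) (Im s))"
    have pT: "p T = s" by (simp add: p_def T_def)
    have T: "0 \<le> T" using s by (simp add: T_def)
    have dp: "(p has_vector_derivative 1) (at t)" for t
      unfolding p_def Complex_eq by (auto intro!: derivative_eq_intros)
    have p0: "Re (p t) > \<rho>0" if "t \<in> {0..T}" for t using that M g by (auto simp: p_def)
    define k where "k = (\<lambda>t. - (C / \<mu>) * exp (- \<mu> * (\<rho>2 + t)))"
    have dk: "(k has_real_derivative eps (\<rho>2 + t)) (at t)" for t
      unfolding k_def using mu by (auto intro!: derivative_eq_intros)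
    have kT: "k T - k 0 \<le> 1/4"
    proof -
      have "k T - k 0 \<le> C / \<mu> * exp (- \<mu> * \<rho>2)" using C mu by (simp add: k_def)
      also have "\<dots> \<le> C / 1 * exp (- \<mu> * \<rho>2)" using C mu by (intro mult_right_mono divide_left_mono) auto
      finally show ?thesis using M by simp
    qed
    have D: "((\<lambda>t. be (p t)) has_vector_derivative - (\<i> * Sg (p t) / 2 * exp (\<i> * \<Phi> (p t)) * u (p t))) (at t)"
      if "t \<in> {0..T}" for t
      using field_vector_diff_chain_at[OF dp d_be[OF p0[OF that]]] by (simp add: o_def)
    have D0: "((\<lambda>t::real. 0::complex) has_vector_derivative 0) (at t)" for t by simp
    have B: "norm (- (\<i> * Sg (p t) / 2 * exp (\<i> * \<Phi> (p t)) * u (p t))) \<le> eps (\<rho>2 + t) * (norm (be (p t)) + norm (0::complex) * exp (2 * 0))"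
      if t: "t \<in> {0..T}" for t
    proof -
      let ?y = "Im (\<Phi> (p t))"
      have ps: "\<rho>2 \<le> Re (p t)" "t1 \<le> Im (p t)" "Im (p t) \<le> t2" using t s by (auto simp: p_def)
      have "exp (- ?y) * norm (u (p t)) \<le> exp (- ?y) * (norm (al (p t)) * exp (- ?y) + norm (be (p t)) * exp ?y)"
        using u_bound by simp
      also have "\<dots> = exp (- ?y) * exp (- ?y) * norm (al (p t)) + norm (be (p t)) * (exp (- ?y) * exp ?y)"
        by (simp only: ring_distribs mult_ac)
      also have "\<dots> \<le> exp (- ?y) * exp (- ?y) * (2 * (1/4) * (norm (be (p t)) * exp (2 * ?y))) + norm (be (p t)) * (exp (- ?y) * exp ?y)"
        using 1[OF ps] mult_right_mono[OF e4[OF ps(1)], of "norm (be (p t)) * exp (2 * ?y)"]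
        by (intro add_right_mono mult_left_mono) auto
      also have "exp (- ?y) * exp (- ?y) * (2 * (1/4) * (norm (be (p t)) * exp (2 * ?y))) = 1/2 * norm (be (p t)) * (exp (- ?y) * exp (- ?y) * exp (2 * ?y))"
        by simp
      also have "exp (- ?y) * exp (- ?y) * exp (2 * ?y) = 1" by (simp add: exp_add[symmetric])
      also have "exp (- ?y) * exp ?y = 1" by (simp add: exp_add[symmetric])
      finally have U: "exp (- ?y) * norm (u (p t)) \<le> 2 * norm (be (p t))" using norm_ge_zero[of "be (p t)"] by linarith
      have S: "norm (Sg (p t)) / 2 \<le> eps (\<rho>2 + t) / 2" using Sg[OF p0[OF t]] by (simp add: p_def)
      have "norm (Sg (p t)) / 2 * (exp (- ?y) * norm (u (p t))) \<le> eps (\<rho>2 + t) / 2 * (2 * norm (be (p t)))"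
        by (rule mult_mono[OF S U]) (use C in auto)
      then show ?thesis by (simp add: norm_mult)
    qed
    have B0: "norm (0::complex) \<le> eps (\<rho>2 + t) * (norm (be (p t)) * exp (- 2 * 0) + norm (0::complex))" for t
      using C by simp
    \<comment> \<open>The coupled estimate with the zero function as partner and weight exponent 0
      acts as the scalar one.\<close>
    have "norm (be (p T) - be (p 0)) \<le> 2 * (k T - k 0) * (norm (be (p 0)) + norm (0::complex) * exp (2 * 0))"
      by (rule coupled_bound(1)[OF T D D0 dk B B0]) (use C T kT in auto)
    also have "\<dots> \<le> 2 * (1/4) * (norm (be (p 0)) + norm (0::complex) * exp (2 * 0))"
      using kT by (intro mult_right_mono mult_left_mono) auto
    finally have "norm (be (p T) - be (p 0)) \<le> norm (be (p 0))"
      using norm_ge_zero[of "be (p 0)"] unfolding norm_zero mult_zero_left add_0_right by linarith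
    then have "norm (be s) \<le> 2 * norm (be (p 0))"
      using norm_triangle_ineq2[of "be (p T)" "be (p 0)"] unfolding pT by linarith
    also have "norm (be (p 0)) \<le> M" using s by (intro beM) (auto simp: p_def)
    finally show ?thesis by simp
  qed
  show ?thesis by (rule that[of "2 * M" \<rho>2]) (use 1 2 M in auto)
qed

end

context wkb_system
begin

definition "lim_on t1 t2 L \<longleftrightarrow> (\<forall>e>0. \<exists>\<rho>2. \<forall>s. \<rho>2 \<le> Re s \<longrightarrow> t1 \<le> Im s \<longrightarrow> Im s \<le> t2 \<longrightarrow>
      norm (al s - L) \<le> e \<and> norm (be s) * exp (2 * Im (\<Phi> s)) \<le> e)"

lemma lim_onD:
  assumes "lim_on t1 t2 L" "e > 0"
  obtains \<rho>2 where "\<rho>2 \<ge> B" "\<And>s. \<rho>2 \<le> Re s \<Longrightarrow> t1 \<le> Im s \<Longrightarrow> Im s \<le> t2 \<Longrightarrow> norm (al s - L) \<le> e"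
    "\<And>s. \<rho>2 \<le> Re s \<Longrightarrow> t1 \<le> Im s \<Longrightarrow> Im s \<le> t2 \<Longrightarrow> norm (be s) * exp (2 * Im (\<Phi> s)) \<le> e"
proof -
  obtain r where r: "\<And>s. r \<le> Re s \<Longrightarrow> t1 \<le> Im s \<Longrightarrow> Im s \<le> t2 \<Longrightarrow> norm (al s - L) \<le> e \<and> norm (be s) * exp (2 * Im (\<Phi> s)) \<le> e"
    using assms unfolding lim_on_def by meson
  show ?thesis by (rule that[of "max r B"]) (use r in auto)
qed

lemma lim_on_tendsto:
  assumes "lim_on t1 t2 L" "t1 \<le> \<tau>" "\<tau> \<le> t2"
  shows "((\<lambda>\<rho>. al (Complex \<rho> \<tau>)) \<longlongrightarrow> L) at_top"
proof (rule tendstoI)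
  fix e :: real assume "e > 0"
  then have "e / 2 > 0" by simp
  then obtain r where r: "r \<ge> 0" "\<And>s. r \<le> Re s \<Longrightarrow> t1 \<le> Im s \<Longrightarrow> Im s \<le> t2 \<Longrightarrow> norm (al s - L) \<le> e / 2"
    using lim_onD[OF assms(1)] by metis
  show "\<forall>\<^sub>F \<rho> in at_top. dist (al (Complex \<rho> \<tau>)) L < e"
    using eventually_ge_at_top[of r]
  proof eventually_elim
    case (elim \<rho>)
    have "norm (al (Complex \<rho> \<tau>) - L) \<le> e / 2" using assms elim by (intro r) auto
    then show ?case using \<open>e > 0\<close> by (simp add: dist_norm)
  qed
qed

text \<open>The strips for different \<delta> share the line at height \<open>\<tau>\<close>. The
  limit along this line determines L, so one number serves all of them.\<close>

lemma nested_limit: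
  assumes G: "\<And>\<delta>. 0 < \<delta> \<Longrightarrow> \<delta> \<le> \<delta>0 \<Longrightarrow> \<exists>c \<rho>1. growth_strip (t1 \<delta>) (t2 \<delta>) c \<rho>1"
    and t: "\<And>\<delta>. 0 < \<delta> \<Longrightarrow> \<delta> \<le> \<delta>0 \<Longrightarrow> t1 \<delta> \<le> \<tau> \<and> \<tau> \<le> t2 \<delta>"
  obtains L where "\<And>\<delta>. 0 < \<delta> \<Longrightarrow> \<delta> \<le> \<delta>0 \<Longrightarrow> lim_on (t1 \<delta>) (t2 \<delta>) L"
proof -
  have ex: "\<exists>L. lim_on (t1 \<delta>) (t2 \<delta>) L" if d: "0 < \<delta>" "\<delta> \<le> \<delta>0" for \<delta>
  proof -
    obtain c \<rho>1 where "growth_strip (t1 \<delta>) (t2 \<delta>) c \<rho>1" using G[OF d] by blast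
    from strip_limit[OF this] show ?thesis unfolding lim_on_def by metis
  qed
  show ?thesis
  proof (rule that)
    fix \<delta> assume d: "0 < \<delta>" "\<delta> \<le> \<delta>0"
    obtain L where L: "lim_on (t1 \<delta>) (t2 \<delta>) L" using ex[OF d] by blast
    have "((\<lambda>\<rho>. al (Complex \<rho> \<tau>)) \<longlongrightarrow> L) at_top" using lim_on_tendsto[OF L] t[OF d] by blast
    then have "Lim at_top (\<lambda>\<rho>. al (Complex \<rho> \<tau>)) = L" by (intro tendsto_Lim) auto
    with L show "lim_on (t1 \<delta>) (t2 \<delta>) (Lim at_top (\<lambda>\<rho>. al (Complex \<rho> \<tau>)))" by simp
  qed
qed

lemma u_scaled: "u s = exp (\<i> * \<Phi> s) * (al s + be s * exp (- (\<i> * \<Phi> s)) * exp (- (\<i> * \<Phi> s)))"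
  "u s = exp (- (\<i> * \<Phi> s)) * (be s + al s * exp (\<i> * \<Phi> s) * exp (\<i> * \<Phi> s))"
proof -
  have "exp (\<i> * \<Phi> s) * (al s + be s * exp (- (\<i> * \<Phi> s)) * exp (- (\<i> * \<Phi> s)))
    = al s * exp (\<i> * \<Phi> s) + be s * exp (- (\<i> * \<Phi> s)) * (exp (- (\<i> * \<Phi> s)) * exp (\<i> * \<Phi> s))"
    by (simp only: ring_distribs mult_ac)
  then show "u s = exp (\<i> * \<Phi> s) * (al s + be s * exp (- (\<i> * \<Phi> s)) * exp (- (\<i> * \<Phi> s)))"
    unfolding exp_pm using u_eq[of s] by simp
  have "exp (- (\<i> * \<Phi> s)) * (be s + al s * exp (\<i> * \<Phi> s) * exp (\<i> * \<Phi> s))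
    = be s * exp (- (\<i> * \<Phi> s)) + al s * exp (\<i> * \<Phi> s) * (exp (- (\<i> * \<Phi> s)) * exp (\<i> * \<Phi> s))"
    by (simp only: ring_distribs mult_ac)
  then show "u s = exp (- (\<i> * \<Phi> s)) * (be s + al s * exp (\<i> * \<Phi> s) * exp (\<i> * \<Phi> s))"
    unfolding exp_pm using u_eq[of s] by simp
qed

lemma exp_double: "exp (a::real) * exp a = exp (2 * a)" "exp (- a) * exp (- a) = exp (- 2 * (a::real))"
  by (simp_all add: exp_add[symmetric])

lemma norm_u_ge:
  "norm (u s) \<ge> exp (- Im (\<Phi> s)) * (norm (al s) - norm (be s) * exp (2 * Im (\<Phi> s)))"
  "norm (u s) \<ge> exp (Im (\<Phi> s)) * (norm (be s) - norm (al s) * exp (- 2 * Im (\<Phi> s)))"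
proof -
  have "norm (be s * exp (- (\<i> * \<Phi> s)) * exp (- (\<i> * \<Phi> s))) = norm (be s) * exp (2 * Im (\<Phi> s))"
    by (simp add: norm_mult exp_double)
  then have "norm (al s) - norm (be s) * exp (2 * Im (\<Phi> s)) \<le> norm (al s + be s * exp (- (\<i> * \<Phi> s)) * exp (- (\<i> * \<Phi> s)))"
    using norm_diff_ineq[of "al s" "be s * exp (- (\<i> * \<Phi> s)) * exp (- (\<i> * \<Phi> s))"] by simp
  then have "exp (- Im (\<Phi> s)) * (norm (al s) - norm (be s) * exp (2 * Im (\<Phi> s))) \<le> exp (- Im (\<Phi> s)) * norm (al s + be s * exp (- (\<i> * \<Phi> s)) * exp (- (\<i> * \<Phi> s)))"
    by (rule mult_left_mono) simp
  then show "norm (u s) \<ge> exp (- Im (\<Phi> s)) * (norm (al s) - norm (be s) * exp (2 * Im (\<Phi> s)))"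
    by (subst u_scaled(1)) (simp add: norm_mult)
  have "norm (al s * exp (\<i> * \<Phi> s) * exp (\<i> * \<Phi> s)) = norm (al s) * exp (- 2 * Im (\<Phi> s))"
    by (simp add: norm_mult exp_double[simplified])
  then have "norm (be s) - norm (al s) * exp (- 2 * Im (\<Phi> s)) \<le> norm (be s + al s * exp (\<i> * \<Phi> s) * exp (\<i> * \<Phi> s))"
    using norm_diff_ineq[of "be s" "al s * exp (\<i> * \<Phi> s) * exp (\<i> * \<Phi> s)"] by simp
  then have "exp (Im (\<Phi> s)) * (norm (be s) - norm (al s) * exp (- 2 * Im (\<Phi> s))) \<le> exp (Im (\<Phi> s)) * norm (be s + al s * exp (\<i> * \<Phi> s) * exp (\<i> * \<Phi> s))"
    by (rule mult_left_mono) simp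
  then show "norm (u s) \<ge> exp (Im (\<Phi> s)) * (norm (be s) - norm (al s) * exp (- 2 * Im (\<Phi> s)))"
    by (subst u_scaled(2)) (simp add: norm_mult)
qed

text \<open>The factor exp(- Im \<Phi>) is doubly exponentially large, and what it multiplies stays
  above half of |L|: one quarter of |L| is spent on the error of \<open>al\<close>, another on the
  term with \<open>be\<close>.\<close>

lemma strip_dominant:
  assumes G: "growth_strip t1 t2 c \<rho>1" and lim: "lim_on t1 t2 L" and L: "L \<noteq> 0"
  obtains \<rho>2 k k' where "\<rho>1 \<le> \<rho>2" "k > 0" "k' > 0"
    "\<And>s. \<rho>2 \<le> Re s \<Longrightarrow> t1 \<le> Im s \<Longrightarrow> Im s \<le> t2 \<Longrightarrow> norm (u s) \<ge> k * exp (k' * exp (\<mu> * Re s))"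
proof -
  note g = growth_stripD[OF G]
  obtain M \<rho>2 where M: "M > 0" "\<rho>1 \<le> \<rho>2"
    and Im: "\<And>s. \<rho>2 \<le> Re s \<Longrightarrow> t1 \<le> Im s \<Longrightarrow> Im s \<le> t2 \<Longrightarrow> Im (\<Phi> s) \<le> M - c * exp (- \<mu>) * exp (\<mu> * Re s)"
    using strip_amp_bounded[OF G] by metis
  have "norm L / 4 > 0" using L by simp
  then obtain r where r: "r \<ge> \<rho>2" "\<And>s. r \<le> Re s \<Longrightarrow> t1 \<le> Im s \<Longrightarrow> Im s \<le> t2 \<Longrightarrow> norm (al s - L) \<le> norm L / 4"
    "\<And>s. r \<le> Re s \<Longrightarrow> t1 \<le> Im s \<Longrightarrow> Im s \<le> t2 \<Longrightarrow> norm (be s) * exp (2 * Im (\<Phi> s)) \<le> norm L / 4"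
    using lim_onD[OF lim, of "norm L / 4" \<rho>2] by metis
  show ?thesis
  proof (rule that[of r "norm L / 2 * exp (- M)" "c * exp (- \<mu>)"])
    fix s assume s: "r \<le> Re s" "t1 \<le> Im s" "Im s \<le> t2"
    have 1: "norm L / 2 \<le> norm (al s) - norm (be s) * exp (2 * Im (\<Phi> s))"
      using r(2)[OF s] r(3)[OF s] norm_triangle_ineq2[of L "al s"] norm_minus_commute[of L "al s"] by linarith
    have 2: "- M + c * exp (- \<mu>) * exp (\<mu> * Re s) \<le> - Im (\<Phi> s)" using Im[of s] s r(1) by linarith
    have "norm L / 2 * exp (- M) * exp (c * exp (- \<mu>) * exp (\<mu> * Re s)) = exp (- M + c * exp (- \<mu>) * exp (\<mu> * Re s)) * (norm L / 2)"
      unfolding exp_add by simp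
    also have "\<dots> \<le> exp (- Im (\<Phi> s)) * (norm (al s) - norm (be s) * exp (2 * Im (\<Phi> s)))"
      using 1 2 by (intro mult_mono) auto
    also have "\<dots> \<le> norm (u s)" by (rule norm_u_ge)
    finally show "norm L / 2 * exp (- M) * exp (c * exp (- \<mu>) * exp (\<mu> * Re s)) \<le> norm (u s)" .
  qed (use M r g L in auto)
qed

text \<open>Both coefficients vanish at \<open>s\<close>, and the horizontal estimate is
  proportional to the initial \<open>amp\<close>: uniqueness for the linear system. Its purpose is
  to keep \<open>be\<close> from vanishing in the recessive case.\<close>

lemma strip_zero_propagates:
  assumes G: "growth_strip t1 t2 c \<rho>1" and s: "\<rho>1 \<le> Re s" "t1 \<le> Im s" "Im s \<le> t2" and T: "T \<ge> 0"
    and e: "eps (Re s) \<le> 1/2" and "amp s = 0"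
  shows "u (s + of_real T) = 0"
proof -
  have "al s = 0" "be s = 0" using \<open>amp s = 0\<close> unfolding amp_def
    by (smt (verit) exp_gt_zero mult_nonneg_nonneg norm_ge_zero norm_le_zero_iff zero_less_norm_iff mult_pos_pos)+
  then show ?thesis using strip_horizontal[OF G s T e] \<open>amp s = 0\<close> u_eq[of "s + of_real T"] by simp
qed

text \<open>Here \<open>al\<close> is a small multiple of the weighted \<open>be\<close>. If
  \<open>be\<close> vanished at a point, so would \<open>al\<close>, and \<open>u\<close> would be
  zero on a horizontal half-line, against \<open>nz\<close>. Being nonzero and in control,
  \<open>be\<close> keeps \<open>u\<close> from vanishing, while its boundedness makes
  \<open>u\<close> doubly exponentially small.\<close>

lemma strip_recessive_u:
  assumes G: "growth_strip t1 t2 c \<rho>1" and lim: "lim_on t1 t2 0"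
    and nz: "\<And>s. Re s > \<rho>0 \<Longrightarrow> \<exists>T\<ge>0. u (s + of_real T) \<noteq> 0"
  obtains \<rho>2 k k' where "\<rho>1 \<le> \<rho>2" "k > 0" "k' > 0" "eps \<rho>2 \<le> 1/4"
    "\<And>s. \<rho>2 \<le> Re s \<Longrightarrow> t1 \<le> Im s \<Longrightarrow> Im s \<le> t2 \<Longrightarrow> u s \<noteq> 0"
    "\<And>s. \<rho>2 \<le> Re s \<Longrightarrow> t1 \<le> Im s \<Longrightarrow> Im s \<le> t2 \<Longrightarrow> be s \<noteq> 0"
    "\<And>s. \<rho>2 \<le> Re s \<Longrightarrow> t1 \<le> Im s \<Longrightarrow> Im s \<le> t2 \<Longrightarrow> norm (u s) \<le> k * exp (- (k' * exp (\<mu> * Re s)))"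
    "\<And>s. \<rho>2 \<le> Re s \<Longrightarrow> t1 \<le> Im s \<Longrightarrow> Im s \<le> t2 \<Longrightarrow> norm (al s) \<le> 2 * eps (Re s) * (norm (be s) * exp (2 * Im (\<Phi> s)))"
proof -
  note g = growth_stripD[OF G]
  obtain M \<rho>2 where M: "M > 0" "\<rho>1 \<le> \<rho>2"
    and Im: "\<And>s. \<rho>2 \<le> Re s \<Longrightarrow> t1 \<le> Im s \<Longrightarrow> Im s \<le> t2 \<Longrightarrow> Im (\<Phi> s) \<le> M - c * exp (- \<mu>) * exp (\<mu> * Re s)"
    using strip_amp_bounded[OF G] by metis
  obtain \<rho>3 K where K: "K > 0" "\<rho>1 \<le> \<rho>3" "eps \<rho>3 \<le> 1/4"
    and al: "\<And>s. \<rho>3 \<le> Re s \<Longrightarrow> t1 \<le> Im s \<Longrightarrow> Im s \<le> t2 \<Longrightarrow> norm (al s) \<le> 2 * eps (Re s) * (norm (be s) * exp (2 * Im (\<Phi> s)))"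
    and be: "\<And>s. \<rho>3 \<le> Re s \<Longrightarrow> t1 \<le> Im s \<Longrightarrow> Im s \<le> t2 \<Longrightarrow> norm (be s) \<le> K"
    using strip_recessive[OF G lim_on_tendsto[OF lim]] by metis
  define r where "r = max \<rho>2 \<rho>3"
  have e4: "eps \<rho> \<le> 1/4" if "\<rho> \<ge> r" for \<rho> using eps_antimono[of \<rho>3 \<rho>] that K(3) by (simp add: r_def)
  have half: "norm (al s) * exp (- 2 * Im (\<Phi> s)) \<le> 1/2 * norm (be s)"
    if s: "r \<le> Re s" "t1 \<le> Im s" "Im s \<le> t2" for s
  proof -
    have "norm (al s) \<le> 2 * (1/4) * (norm (be s) * exp (2 * Im (\<Phi> s)))"
      using al[of s] s mult_right_mono[OF e4[OF s(1)], of "norm (be s) * exp (2 * Im (\<Phi> s))"] by (simp add: r_def)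
    then have "norm (al s) * exp (- 2 * Im (\<Phi> s)) \<le> 2 * (1/4) * (norm (be s) * exp (2 * Im (\<Phi> s))) * exp (- 2 * Im (\<Phi> s))"
      by (rule mult_right_mono) simp
    also have "\<dots> = 1/2 * norm (be s) * (exp (2 * Im (\<Phi> s)) * exp (- 2 * Im (\<Phi> s)))" by simp
    also have "exp (2 * Im (\<Phi> s)) * exp (- 2 * Im (\<Phi> s)) = 1" by (simp add: exp_add[symmetric])
    finally show ?thesis by simp
  qed
  have be0: "be s \<noteq> 0" if s: "r \<le> Re s" "t1 \<le> Im s" "Im s \<le> t2" for s
  proof
    assume "be s = 0"
    then have "amp s = 0" using al[of s] s by (simp add: amp_def r_def)
    then have "u (s + of_real T) = 0" if "T \<ge> 0" for T
      using strip_zero_propagates[OF G _ s(2,3) that] s(1) M e4[OF s(1)] by (simp add: r_def)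
    moreover have "Re s > \<rho>0" using s M g by (simp add: r_def)
    ultimately show False using nz by blast
  qed
  show ?thesis
  proof (rule that[of r "2 * K * exp M" "c * exp (- \<mu>)"])
    fix s assume s: "r \<le> Re s" "t1 \<le> Im s" "Im s \<le> t2"
    show "be s \<noteq> 0" by (rule be0[OF s])
    show "norm (al s) \<le> 2 * eps (Re s) * (norm (be s) * exp (2 * Im (\<Phi> s)))" using al s by (simp add: r_def)
    have "0 < norm (be s) - norm (al s) * exp (- 2 * Im (\<Phi> s))" using half[OF s] zero_less_norm_iff[THEN iffD2, OF be0[OF s]] by linarith
    then have "0 < exp (Im (\<Phi> s)) * (norm (be s) - norm (al s) * exp (- 2 * Im (\<Phi> s)))" by simp
    then have "0 < norm (u s)" using norm_u_ge(2)[of s] by linarith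
    then show "u s \<noteq> 0" by simp
    have e: "exp (- Im (\<Phi> s)) = exp (Im (\<Phi> s)) * exp (- 2 * Im (\<Phi> s))" by (simp add: exp_add[symmetric])
    have "norm (u s) \<le> exp (Im (\<Phi> s)) * (norm (al s) * exp (- 2 * Im (\<Phi> s)) + norm (be s))"
      using u_bound[of s] unfolding e by (simp add: algebra_simps)
    also have "\<dots> \<le> exp (Im (\<Phi> s)) * (2 * K)"
    proof (rule mult_left_mono)
      show "norm (al s) * exp (- 2 * Im (\<Phi> s)) + norm (be s) \<le> 2 * K"
        using half[OF s] be[of s] s K norm_ge_zero[of "be s"] unfolding r_def by linarith
    qed simp
    also have "\<dots> \<le> exp (M - c * exp (- \<mu>) * exp (\<mu> * Re s)) * (2 * K)"
      using Im[of s] s K by (intro mult_right_mono) (auto simp: r_def)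
    finally show "norm (u s) \<le> 2 * K * exp M * exp (- (c * exp (- \<mu>) * exp (\<mu> * Re s)))"
      by (simp only: diff_conv_add_uminus exp_add mult_ac)
  qed (use M K g e4 in \<open>auto simp: r_def\<close>)
qed

end

text \<open>In this strip \<mu> |Im s| is at most pi/3, where the cosine is at least 1/2; the
  tolerance uses up half of that.\<close>

lemma Re_ge_of_close:
  assumes m: "\<mu> > 0" and kappa: "\<kappa> > 0" and s: "\<bar>Im s\<bar> \<le> pi / (3 * \<mu>)"
    and cl: "norm (h - of_real \<kappa> * exp (of_real \<mu> * s)) \<le> \<kappa> / 4 * exp (\<mu> * Re s)"
  shows "\<kappa> / 4 * exp (\<mu> * Re s) \<le> Re h"
proof -
  have R: "\<bar>Re h - \<kappa> * (exp (\<mu> * Re s) * cos (\<mu> * Im s))\<bar> \<le> \<kappa> / 4 * exp (\<mu> * Re s)"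
    using order_trans[OF abs_Re_le_cmod cl] by (simp add: Re_exp)
  have "\<mu> * \<bar>Im s\<bar> \<le> \<mu> * (pi / (3 * \<mu>))" using s m by (intro mult_left_mono) auto
  then have "\<mu> * \<bar>Im s\<bar> \<le> pi / 3" using m by simp
  then have "cos (pi / 3) \<le> cos \<bar>\<mu> * Im s\<bar>" using m by (intro cos_monotone_0_pi_le) (auto simp: abs_mult)
  then have "1/2 \<le> cos (\<mu> * Im s)" by (simp add: cos_60)
  then have "\<kappa> * (exp (\<mu> * Re s) * (1/2)) \<le> \<kappa> * (exp (\<mu> * Re s) * cos (\<mu> * Im s))"
    using kappa by (intro mult_left_mono) auto
  then show ?thesis using R by linarith
qed

locale wkb = wkb_system +
  fixes \<kappa> :: real
  assumes kappa: "\<kappa> > 0"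
    and Hasy: "\<And>s. Re s > \<rho>0 \<Longrightarrow> norm (H s - of_real \<kappa> * exp (of_real \<mu> * s)) \<le> C * exp ((\<mu> - 1) * Re s)"
    and nz: "\<And>s. Re s > \<rho>0 \<Longrightarrow> \<exists>T\<ge>0. u (s + of_real T) \<noteq> 0"
begin

lemma H_close:
  assumes "e > 0"
  obtains \<rho>1 where "\<rho>1 > \<rho>0" "\<rho>1 \<ge> B" "\<And>s. \<rho>1 \<le> Re s \<Longrightarrow> norm (H s - of_real \<kappa> * exp (of_real \<mu> * s)) \<le> e * exp (\<mu> * Re s)"
proof -
  have "((\<lambda>\<rho>. C * exp (- \<rho>)) \<longlongrightarrow> 0) at_top" by real_asymp
  then have "\<forall>\<^sub>F \<rho> in at_top. C * exp (- \<rho>) < e \<and> \<rho>0 + 1 \<le> \<rho> \<and> B \<le> \<rho>"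
    using order_tendstoD(2) assms eventually_ge_at_top by (intro eventually_conj) blast+
  then obtain r where r: "\<And>\<rho>. \<rho> \<ge> r \<Longrightarrow> C * exp (- \<rho>) < e \<and> \<rho>0 + 1 \<le> \<rho> \<and> B \<le> \<rho>"
    by (auto simp: eventually_at_top_linorder)
  show ?thesis
  proof (rule that[of r])
    fix s assume s: "r \<le> Re s"
    have "norm (H s - of_real \<kappa> * exp (of_real \<mu> * s)) \<le> C * exp ((\<mu> - 1) * Re s)"
      using r[OF s] by (intro Hasy) auto
    also have "(\<mu> - 1) * Re s = - Re s + \<mu> * Re s" by (simp add: algebra_simps)
    also have "C * exp (- Re s + \<mu> * Re s) = C * exp (- Re s) * exp (\<mu> * Re s)" by (simp only: exp_add mult.assoc)
    also have "\<dots> \<le> e * exp (\<mu> * Re s)" using r[OF s] by (intro mult_right_mono) auto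
    finally show "norm (H s - of_real \<kappa> * exp (of_real \<mu> * s)) \<le> e * exp (\<mu> * Re s)" .
  qed (use r[of r] in auto)
qed

lemma norm_H:
  obtains \<rho>1 where "\<rho>1 > \<rho>0" "\<And>s. \<rho>1 \<le> Re s \<Longrightarrow> norm (H s) \<ge> \<kappa> / 2 * exp (\<mu> * Re s)"
    "\<And>s. \<rho>1 \<le> Re s \<Longrightarrow> norm (H s) \<le> 2 * \<kappa> * exp (\<mu> * Re s)"
proof -
  obtain \<rho>1 where r: "\<rho>1 > \<rho>0" and c: "\<And>s. \<rho>1 \<le> Re s \<Longrightarrow> norm (H s - of_real \<kappa> * exp (of_real \<mu> * s)) \<le> \<kappa> / 2 * exp (\<mu> * Re s)"
    using H_close[OF divide_pos_pos[OF kappa], of 2 0] by (metis zero_less_numeral)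
  have n: "norm (of_real \<kappa> * exp (of_real \<mu> * s)) = \<kappa> * exp (\<mu> * Re s)" for s
    using kappa by (simp add: norm_mult)
  show ?thesis
  proof (rule that[OF r])
    fix s assume s: "\<rho>1 \<le> Re s"
    have p: "\<kappa> * exp (\<mu> * Re s) > 0" using kappa by simp
    show "norm (H s) \<ge> \<kappa> / 2 * exp (\<mu> * Re s)"
      using c[OF s] norm_triangle_ineq2[of "of_real \<kappa> * exp (of_real \<mu> * s)" "H s"]
      unfolding n by (simp add: norm_minus_commute)
    show "norm (H s) \<le> 2 * \<kappa> * exp (\<mu> * Re s)"
      using c[OF s] norm_triangle_ineq2[of "H s" "of_real \<kappa> * exp (of_real \<mu> * s)"] p unfolding n by simp
  qed
qed

lemma sin_ge: "0 \<le> a \<Longrightarrow> a \<le> pi / 2 \<Longrightarrow> a \<le> x \<Longrightarrow> x \<le> pi - a \<Longrightarrow> sin a \<le> sin x"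
proof (cases "x \<le> pi / 2")
  case False
  assume a: "0 \<le> a" "a \<le> pi / 2" "a \<le> x" "x \<le> pi - a"
  have "sin a \<le> sin (pi - x)" using a False by (intro sin_monotone_2pi_le) auto
  then show ?thesis by simp
qed (auto intro!: sin_monotone_2pi_le)

text \<open>The main term has imaginary part \<kappa> exp(\<mu> Re s) sin(\<mu> Im s). At distance
  \<delta> from the edges of a sector the modulus of the sine is at least sin(\<mu> \<delta>), and
  half of it is kept after the error of H.\<close>

lemma Im_H:
  assumes d: "0 < \<delta>" "\<delta> \<le> pi / (2 * \<mu>)"
  obtains \<rho>1 c where "c > 0" "\<rho>1 > \<rho>0"
    "\<And>s. \<rho>1 \<le> Re s \<Longrightarrow> - (pi / \<mu>) + \<delta> \<le> Im s \<Longrightarrow> Im s \<le> - \<delta> \<Longrightarrow> Im (H s) \<le> - (c * exp (\<mu> * Re s))"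
    "\<And>s. \<rho>1 \<le> Re s \<Longrightarrow> \<delta> \<le> Im s \<Longrightarrow> Im s \<le> pi / \<mu> - \<delta> \<Longrightarrow> c * exp (\<mu> * Re s) \<le> Im (H s)"
proof -
  have m: "\<mu> > 0" using mu by simp
  have md: "0 < \<mu> * \<delta>" "\<mu> * \<delta> \<le> pi / 2" using d m by (auto simp: field_simps)
  define c where "c = \<kappa> * sin (\<mu> * \<delta>) / 2"
  have "sin (\<mu> * \<delta>) > 0" using md pi_gt_zero by (intro sin_gt_zero) linarith+
  then have c: "c > 0" using kappa by (simp add: c_def)
  obtain \<rho>1 where r: "\<rho>1 > \<rho>0" and cl: "\<And>s. \<rho>1 \<le> Re s \<Longrightarrow> norm (H s - of_real \<kappa> * exp (of_real \<mu> * s)) \<le> c * exp (\<mu> * Re s)"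
    using H_close[OF c, of 0] by metis
  have I: "\<bar>Im (H s) - \<kappa> * (exp (\<mu> * Re s) * sin (\<mu> * Im s))\<bar> \<le> c * exp (\<mu> * Re s)" if "\<rho>1 \<le> Re s" for s
    using order_trans[OF abs_Im_le_cmod cl[OF that]] by (simp add: Im_exp)
  show ?thesis
  proof (rule that[OF c r])
    fix s assume s: "\<rho>1 \<le> Re s" "\<delta> \<le> Im s" "Im s \<le> pi / \<mu> - \<delta>"
    have "\<mu> * Im s \<le> \<mu> * (pi / \<mu> - \<delta>)" using s m by (intro mult_left_mono) auto
    then have "\<mu> * Im s \<le> pi - \<mu> * \<delta>" using m by (simp add: algebra_simps)
    moreover have "\<mu> * \<delta> \<le> \<mu> * Im s" using s m by simp
    ultimately have "sin (\<mu> * \<delta>) \<le> sin (\<mu> * Im s)" using md by (intro sin_ge) auto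
    then have "\<kappa> * (exp (\<mu> * Re s) * sin (\<mu> * \<delta>)) \<le> \<kappa> * (exp (\<mu> * Re s) * sin (\<mu> * Im s))"
      using kappa by (intro mult_left_mono) auto
    moreover have "\<kappa> * (exp (\<mu> * Re s) * sin (\<mu> * \<delta>)) = 2 * (c * exp (\<mu> * Re s))" by (simp add: c_def)
    ultimately show "c * exp (\<mu> * Re s) \<le> Im (H s)" using I[OF s(1)] by linarith
  next
    fix s assume s: "\<rho>1 \<le> Re s" "- (pi / \<mu>) + \<delta> \<le> Im s" "Im s \<le> - \<delta>"
    have "\<mu> * (- Im s) \<le> \<mu> * (pi / \<mu> - \<delta>)" using s m by (intro mult_left_mono) auto
    then have "\<mu> * (- Im s) \<le> pi - \<mu> * \<delta>" using m by (simp add: algebra_simps)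
    moreover have "\<mu> * \<delta> \<le> \<mu> * (- Im s)" using s m by (intro mult_left_mono) auto
    ultimately have "sin (\<mu> * \<delta>) \<le> sin (\<mu> * (- Im s))" using md by (intro sin_ge) auto
    then have "\<kappa> * (exp (\<mu> * Re s) * sin (\<mu> * \<delta>)) \<le> \<kappa> * (exp (\<mu> * Re s) * (- sin (\<mu> * Im s)))"
      using kappa by (intro mult_left_mono) auto
    moreover have "\<kappa> * (exp (\<mu> * Re s) * sin (\<mu> * \<delta>)) = 2 * (c * exp (\<mu> * Re s))" by (simp add: c_def)
    ultimately show "Im (H s) \<le> - (c * exp (\<mu> * Re s))" using I[OF s(1)] by simp
  qed
qed

lemma Re_H:
  obtains \<rho>1 where "\<rho>1 > \<rho>0"
    "\<And>s. \<rho>1 \<le> Re s \<Longrightarrow> \<bar>Im s\<bar> \<le> pi / (3 * \<mu>) \<Longrightarrow> \<kappa> / 4 * exp (\<mu> * Re s) \<le> Re (H s)"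
proof -
  have m: "\<mu> > 0" using mu by simp
  obtain \<rho>1 where r: "\<rho>1 > \<rho>0" and cl: "\<And>s. \<rho>1 \<le> Re s \<Longrightarrow> norm (H s - of_real \<kappa> * exp (of_real \<mu> * s)) \<le> \<kappa> / 4 * exp (\<mu> * Re s)"
    using H_close[OF divide_pos_pos[OF kappa], of 4 0] by (metis zero_less_numeral)
  show ?thesis
    by (rule that[OF r]) (rule Re_ge_of_close[OF m kappa _ cl])
qed

end

section \<open>Limits of the coefficients in the two adjacent sectors\<close>

context wkb
begin

abbreviation "neg_lim_on \<equiv> wkb_system.lim_on u (\<lambda>s. - V s) (\<lambda>s. - \<Phi> s)"
abbreviation "neg_growth_strip \<equiv> wkb_system.growth_strip (\<lambda>s. - H s) \<rho>0 \<mu>"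

lemma neg_lim_on_iff: "neg_lim_on t1 t2 R \<longleftrightarrow> (\<forall>e>0. \<exists>\<rho>2. \<forall>s. \<rho>2 \<le> Re s \<longrightarrow> t1 \<le> Im s \<longrightarrow> Im s \<le> t2 \<longrightarrow>
      norm (be s - R) \<le> e \<and> norm (al s) * exp (- 2 * Im (\<Phi> s)) \<le> e)"
  unfolding wkb_system.lim_on_def[OF negated] negated_al_be by simp

lemma left_growth:
  assumes "0 < \<delta>" "\<delta> \<le> pi / (2 * \<mu>)"
  shows "\<exists>c \<rho>1. growth_strip (- (pi / \<mu>) + \<delta>) (- \<delta>) c \<rho>1"
proof -
  have "- (pi / \<mu>) + \<delta> \<le> - \<delta>" using assms mu by (simp add: field_simps)
  with Im_H[OF assms] show ?thesis unfolding growth_strip_def by metis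
qed

lemma right_growth:
  assumes "0 < \<delta>" "\<delta> \<le> pi / (2 * \<mu>)"
  shows "\<exists>c \<rho>1. neg_growth_strip \<delta> (pi / \<mu> - \<delta>) c \<rho>1"
proof -
  have "\<delta> \<le> pi / \<mu> - \<delta>" using assms mu by (simp add: field_simps)
  with Im_H[OF assms] show ?thesis unfolding wkb_system.growth_strip_def[OF negated]
    by (simp add: neg_le_iff_le) metis
qed

text \<open>\<open>L\<close> is the coefficient of exp(\<i> \<Phi>) in the sector below the ray, one
  number for all \<delta>; at \<delta> = pi/(2 \<mu>) the strip has shrunk to the middle line of the
  sector. The counterpart \<open>right_lim\<close> concerns exp(- \<i> \<Phi>) in the sector
  above.\<close>

definition "left_lim L \<longleftrightarrow> (\<forall>\<delta>. 0 < \<delta> \<longrightarrow> \<delta> \<le> pi / (2 * \<mu>) \<longrightarrow> lim_on (- (pi / \<mu>) + \<delta>) (- \<delta>) L)"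
definition "right_lim R \<longleftrightarrow> (\<forall>\<delta>. 0 < \<delta> \<longrightarrow> \<delta> \<le> pi / (2 * \<mu>) \<longrightarrow> neg_lim_on \<delta> (pi / \<mu> - \<delta>) R)"

lemma ex_left_lim: "\<exists>L. left_lim L"
proof -
  have m: "\<mu> > 0" using mu by simp
  have "- (pi / \<mu>) + \<delta> \<le> - (pi / (2 * \<mu>)) \<and> - (pi / (2 * \<mu>)) \<le> - \<delta>" if "\<delta> \<le> pi / (2 * \<mu>)" for \<delta>
    using that m by (simp add: field_simps)
  from nested_limit[of "pi / (2 * \<mu>)" "\<lambda>\<delta>. - (pi / \<mu>) + \<delta>" "\<lambda>\<delta>. - \<delta>", OF left_growth this]
  show ?thesis unfolding left_lim_def by metis
qed

lemma ex_right_lim: "\<exists>R. right_lim R"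
proof -
  have m: "\<mu> > 0" using mu by simp
  have "\<delta> \<le> pi / (2 * \<mu>) \<and> pi / (2 * \<mu>) \<le> pi / \<mu> - \<delta>" if "\<delta> \<le> pi / (2 * \<mu>)" for \<delta>
    using that m by (simp add: field_simps)
  from wkb_system.nested_limit[OF negated, of "pi / (2 * \<mu>)" "\<lambda>\<delta>. \<delta>" "\<lambda>\<delta>. pi / \<mu> - \<delta>", OF right_growth this]
  show ?thesis unfolding right_lim_def by metis
qed

lemma left_dominant:
  assumes "left_lim L" "L \<noteq> 0" "0 < \<delta>" "\<delta> \<le> pi / (2 * \<mu>)"
  obtains \<rho>2 k k' where "\<rho>0 < \<rho>2" "k > 0" "k' > 0"
    "\<And>s. \<rho>2 \<le> Re s \<Longrightarrow> - (pi / \<mu>) + \<delta> \<le> Im s \<Longrightarrow> Im s \<le> - \<delta> \<Longrightarrow> norm (u s) \<ge> k * exp (k' * exp (\<mu> * Re s))"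
proof -
  obtain c \<rho>1 where G: "growth_strip (- (pi / \<mu>) + \<delta>) (- \<delta>) c \<rho>1" using left_growth assms by blast
  have "lim_on (- (pi / \<mu>) + \<delta>) (- \<delta>) L" using assms by (auto simp: left_lim_def)
  from strip_dominant[OF G this assms(2)] growth_stripD(3)[OF G] that show ?thesis by (metis less_le_trans)
qed

lemma right_dominant:
  assumes "right_lim R" "R \<noteq> 0" "0 < \<delta>" "\<delta> \<le> pi / (2 * \<mu>)"
  obtains \<rho>2 k k' where "\<rho>0 < \<rho>2" "k > 0" "k' > 0"
    "\<And>s. \<rho>2 \<le> Re s \<Longrightarrow> \<delta> \<le> Im s \<Longrightarrow> Im s \<le> pi / \<mu> - \<delta> \<Longrightarrow> norm (u s) \<ge> k * exp (k' * exp (\<mu> * Re s))"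
proof -
  obtain c \<rho>1 where G: "neg_growth_strip \<delta> (pi / \<mu> - \<delta>) c \<rho>1" using right_growth assms by blast
  have "neg_lim_on \<delta> (pi / \<mu> - \<delta>) R" using assms by (auto simp: right_lim_def)
  from wkb_system.strip_dominant[OF negated G this assms(2)] wkb_system.growth_stripD(3)[OF negated G] that
  show ?thesis by (metis less_le_trans)
qed

lemma left_recessive:
  assumes "left_lim 0" "0 < \<delta>" "\<delta> \<le> pi / (2 * \<mu>)"
  obtains \<rho>2 k k' where "\<rho>0 < \<rho>2" "k > 0" "k' > 0"
    "\<And>s. \<rho>2 \<le> Re s \<Longrightarrow> - (pi / \<mu>) + \<delta> \<le> Im s \<Longrightarrow> Im s \<le> - \<delta> \<Longrightarrow> u s \<noteq> 0"
    "\<And>s. \<rho>2 \<le> Re s \<Longrightarrow> - (pi / \<mu>) + \<delta> \<le> Im s \<Longrightarrow> Im s \<le> - \<delta> \<Longrightarrow> norm (u s) \<le> k * exp (- (k' * exp (\<mu> * Re s)))"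
proof -
  obtain c \<rho>1 where G: "growth_strip (- (pi / \<mu>) + \<delta>) (- \<delta>) c \<rho>1" using left_growth assms by blast
  have lim: "lim_on (- (pi / \<mu>) + \<delta>) (- \<delta>) 0" using assms by (auto simp: left_lim_def)
  show ?thesis
    by (rule strip_recessive_u[OF G lim nz], assumption, rule that[OF less_le_trans[OF growth_stripD(3)[OF G]]])
qed

lemma right_recessive:
  assumes "right_lim 0" "0 < \<delta>" "\<delta> \<le> pi / (2 * \<mu>)"
  obtains \<rho>2 k k' where "\<rho>0 < \<rho>2" "k > 0" "k' > 0"
    "\<And>s. \<rho>2 \<le> Re s \<Longrightarrow> \<delta> \<le> Im s \<Longrightarrow> Im s \<le> pi / \<mu> - \<delta> \<Longrightarrow> norm (u s) \<le> k * exp (- (k' * exp (\<mu> * Re s)))"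
proof -
  obtain c \<rho>1 where G: "neg_growth_strip \<delta> (pi / \<mu> - \<delta>) c \<rho>1" using right_growth assms by blast
  have lim: "neg_lim_on \<delta> (pi / \<mu> - \<delta>) 0" using assms by (auto simp: right_lim_def)
  show ?thesis
    by (rule wkb_system.strip_recessive_u[OF negated G lim nz], assumption,
        rule that[OF less_le_trans[OF wkb_system.growth_stripD(3)[OF negated G]]])
qed

section \<open>Crossing the ray along vertical segments\<close>

lemma Im_Phi_vertical:
  assumes "\<And>t. a \<le> t \<Longrightarrow> t \<le> b \<Longrightarrow> 0 \<le> Re (H (Complex \<rho> t))" "\<rho> > \<rho>0" "a \<le> b"
  shows "Im (\<Phi> (Complex \<rho> a)) \<le> Im (\<Phi> (Complex \<rho> b))"
proof (rule DERIV_nonneg_imp_nondecreasing[OF assms(3)])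
  fix t assume t: "a \<le> t" "t \<le> b"
  have p: "((\<lambda>t. Complex \<rho> t) has_vector_derivative \<i>) (at t)"
    unfolding Complex_eq by (auto intro!: derivative_eq_intros)
  have "Re (Complex \<rho> t) > \<rho>0" using assms by simp
  from bounded_linear.has_vector_derivative[OF bounded_linear_Im field_vector_diff_chain_at[OF p dPhi[OF this]]]
  have "((\<lambda>t. Im (\<Phi> (Complex \<rho> t))) has_real_derivative Re (H (Complex \<rho> t))) (at t)"
    by (simp add: o_def has_real_derivative_iff_has_vector_derivative)
  then show "\<exists>y. ((\<lambda>t. Im (\<Phi> (Complex \<rho> t))) has_real_derivative y) (at t) \<and> 0 \<le> y"
    using assms(1)[OF t] by blast
qed

text \<open>The common threshold for vertical paths near the ray: their length stays below 2 pi, and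
  1/16 leaves room for absorbing errors. Positivity of Re H means that Im \<Phi> increases
  upwards.\<close>

lemma middle_region:
  obtains \<rho>1 where "\<rho>1 > \<rho>0" "eps \<rho>1 * (2 * pi) \<le> 1/16"
    "\<And>s. \<rho>1 \<le> Re s \<Longrightarrow> \<bar>Im s\<bar> \<le> pi / (3 * \<mu>) \<Longrightarrow> 0 < Re (H s)"
proof -
  obtain \<rho>1 where r: "\<rho>1 > \<rho>0" and R: "\<And>s. \<rho>1 \<le> Re s \<Longrightarrow> \<bar>Im s\<bar> \<le> pi / (3 * \<mu>) \<Longrightarrow> \<kappa> / 4 * exp (\<mu> * Re s) \<le> Re (H s)"
    using Re_H by metis
  obtain r2 where r2: "\<And>\<rho>. \<rho> \<ge> r2 \<Longrightarrow> eps \<rho> < 1 / (32 * pi)"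
    using eps_small[of "1 / (32 * pi)"] by (auto simp: eventually_at_top_linorder)
  show ?thesis
  proof (rule that[of "max \<rho>1 r2"])
    have "eps (max \<rho>1 r2) * (2 * pi) \<le> 1 / (32 * pi) * (2 * pi)"
      using r2[of "max \<rho>1 r2"] by (intro mult_right_mono) auto
    then show "eps (max \<rho>1 r2) * (2 * pi) \<le> 1/16" by simp
    fix s assume s: "max \<rho>1 r2 \<le> Re s" "\<bar>Im s\<bar> \<le> pi / (3 * \<mu>)"
    have "0 < \<kappa> / 4 * exp (\<mu> * Re s)" using kappa by simp
    also have "\<dots> \<le> Re (H s)" using R s by simp
    finally show "0 < Re (H s)" .
  qed (use r in auto)
qed

text \<open>The first two estimates come from the negated system on the upward path, the other two
  from the original system on the downward path. Each time the coefficient of the growing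
  exponential is the one compared without a weight.\<close>

lemma up_bound:
  assumes "\<And>s. \<rho>1 \<le> Re s \<Longrightarrow> \<bar>Im s\<bar> \<le> pi / (3 * \<mu>) \<Longrightarrow> 0 < Re (H s)" "\<rho>1 > \<rho>0" "eps \<rho>1 * (2 * pi) \<le> 1/16"
    and "\<rho>1 \<le> \<rho>" "- (pi / (3 * \<mu>)) \<le> a" "a \<le> b" "b \<le> pi / (3 * \<mu>)"
  shows "norm (be (Complex \<rho> b) - be (Complex \<rho> a)) \<le> eps \<rho> * (2 * pi) * (norm (be (Complex \<rho> a)) + norm (al (Complex \<rho> a)) * exp (- 2 * Im (\<Phi> (Complex \<rho> a))))"
    and "norm (al (Complex \<rho> b) - al (Complex \<rho> a)) \<le> eps \<rho> * (2 * pi) * (norm (be (Complex \<rho> a)) + norm (al (Complex \<rho> a)) * exp (- 2 * Im (\<Phi> (Complex \<rho> a)))) * exp (2 * Im (\<Phi> (Complex \<rho> b)))"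
    and "norm (al (Complex \<rho> a) - al (Complex \<rho> b)) \<le> eps \<rho> * (2 * pi) * (norm (al (Complex \<rho> b)) + norm (be (Complex \<rho> b)) * exp (2 * Im (\<Phi> (Complex \<rho> b))))"
    and "norm (be (Complex \<rho> a) - be (Complex \<rho> b)) \<le> eps \<rho> * (2 * pi) * (norm (al (Complex \<rho> b)) + norm (be (Complex \<rho> b)) * exp (2 * Im (\<Phi> (Complex \<rho> b)))) * exp (- 2 * Im (\<Phi> (Complex \<rho> a)))"
proof -
  have m: "\<mu> > 0" using mu by simp
  have "pi / (3 * \<mu>) \<le> pi / (3 * 1)" using mu by (intro divide_left_mono) auto
  then have T: "0 \<le> b - a" "b - a \<le> pi" using assms pi_gt_zero by auto
  have "eps \<rho> * (2 * pi) \<le> 1/16"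
    by (rule order_trans[OF mult_right_mono[OF eps_antimono[OF assms(4)]] assms(3)]) simp
  then have e1: "eps \<rho> * (2 * pi) \<le> 1/2" by linarith
  have e2: "eps \<rho> * (b - a) \<le> eps \<rho> * (2 * pi)" using T C by (intro mult_left_mono) auto
  have e: "eps \<rho> * (b - a) \<le> 1/2" using e1 e2 by linarith
  have H0: "Re (H (Complex \<rho> t)) \<ge> 0" if "a \<le> t" "t \<le> b" for t
  proof -
    have "0 < Re (H (Complex \<rho> t))" using assms(4-7) that by (intro assms(1)) auto
    then show ?thesis by simp
  qed
  have p1: "Complex \<rho> a + \<i> * of_real (1 * t) = Complex \<rho> (a + t)" for t by (simp add: complex_eq_iff)
  have p2: "Complex \<rho> b + \<i> * of_real (- 1 * t) = Complex \<rho> (b - t)" for t by (simp add: complex_eq_iff)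
  have N: "norm (be (Complex \<rho> (a + (b - a))) - be (Complex \<rho> a)) \<le> eps \<rho> * (b - a) * (norm (be (Complex \<rho> a)) + norm (al (Complex \<rho> a)) * exp (- 2 * Im (\<Phi> (Complex \<rho> a))))"
    "norm (al (Complex \<rho> (a + (b - a))) - al (Complex \<rho> a)) \<le> eps \<rho> * (b - a) * (norm (be (Complex \<rho> a)) + norm (al (Complex \<rho> a)) * exp (- 2 * Im (\<Phi> (Complex \<rho> a)))) * exp (2 * Im (\<Phi> (Complex \<rho> (a + (b - a)))))"
    using wkb_system.vertical_bound[OF negated, of "Complex \<rho> a" "b - a" 1] assms T e H0
    unfolding p1 wkb_system.amp_def[OF negated] negated_al_be by simp_all
  have M: "norm (al (Complex \<rho> (b - (b - a))) - al (Complex \<rho> b)) \<le> eps \<rho> * (b - a) * (norm (al (Complex \<rho> b)) + norm (be (Complex \<rho> b)) * exp (2 * Im (\<Phi> (Complex \<rho> b))))"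
    "norm (be (Complex \<rho> (b - (b - a))) - be (Complex \<rho> b)) \<le> eps \<rho> * (b - a) * (norm (al (Complex \<rho> b)) + norm (be (Complex \<rho> b)) * exp (2 * Im (\<Phi> (Complex \<rho> b)))) * exp (- 2 * Im (\<Phi> (Complex \<rho> (b - (b - a)))))"
    using vertical_bound[of "Complex \<rho> b" "b - a" "-1"] assms T e H0
    unfolding p2 amp_def by simp_all
  let ?A = "norm (be (Complex \<rho> a)) + norm (al (Complex \<rho> a)) * exp (- 2 * Im (\<Phi> (Complex \<rho> a)))"
  let ?B = "norm (al (Complex \<rho> b)) + norm (be (Complex \<rho> b)) * exp (2 * Im (\<Phi> (Complex \<rho> b)))"
  have mA: "eps \<rho> * (b - a) * ?A \<le> eps \<rho> * (2 * pi) * ?A" using e2 by (intro mult_right_mono) auto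
  have mB: "eps \<rho> * (b - a) * ?B \<le> eps \<rho> * (2 * pi) * ?B" using e2 by (intro mult_right_mono) auto
  show "norm (be (Complex \<rho> b) - be (Complex \<rho> a)) \<le> eps \<rho> * (2 * pi) * ?A"
    using order_trans[OF N(1) mA] by simp
  show "norm (al (Complex \<rho> b) - al (Complex \<rho> a)) \<le> eps \<rho> * (2 * pi) * ?A * exp (2 * Im (\<Phi> (Complex \<rho> b)))"
    using order_trans[OF N(2) mult_right_mono[OF mA exp_ge_zero]] by simp
  show "norm (al (Complex \<rho> a) - al (Complex \<rho> b)) \<le> eps \<rho> * (2 * pi) * ?B"
    using order_trans[OF M(1) mB] by simp
  show "norm (be (Complex \<rho> a) - be (Complex \<rho> b)) \<le> eps \<rho> * (2 * pi) * ?B * exp (- 2 * Im (\<Phi> (Complex \<rho> a)))"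
    using order_trans[OF M(2) mult_right_mono[OF mB exp_ge_zero]] by simp
qed

text \<open>On the lower edge of the middle strip \<open>be\<close> dominates the weighted
  \<open>al\<close>. Going up, Im \<Phi> increases, so exp(- \<i> \<Phi>) only gains on exp(\<i>
  \<Phi>); the domination persists across the ray and excludes cancellation in
  \<open>u\<close>.\<close>

lemma recessive_no_zeros:
  assumes L: "left_lim 0"
  obtains \<rho>2 where "\<rho>2 > \<rho>0" "\<And>s. \<rho>2 \<le> Re s \<Longrightarrow> \<bar>Im s\<bar> \<le> pi / (3 * \<mu>) \<Longrightarrow> u s \<noteq> 0"
proof -
  have m: "\<mu> > 0" using mu by simp
  define \<delta> where "\<delta> = pi / (3 * \<mu>)"
  have d: "0 < \<delta>" "\<delta> \<le> pi / (2 * \<mu>)" "- (pi / \<mu>) + \<delta> \<le> - \<delta>" using m by (auto simp: \<delta>_def field_simps)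
  obtain c \<rho>1 where G: "growth_strip (- (pi / \<mu>) + \<delta>) (- \<delta>) c \<rho>1" using left_growth d by blast
  have lim: "lim_on (- (pi / \<mu>) + \<delta>) (- \<delta>) 0" using L d by (auto simp: left_lim_def)
  obtain r1 where r1: "\<rho>1 \<le> r1" "eps r1 \<le> 1/4"
    and be0: "\<And>s. r1 \<le> Re s \<Longrightarrow> - (pi / \<mu>) + \<delta> \<le> Im s \<Longrightarrow> Im s \<le> - \<delta> \<Longrightarrow> be s \<noteq> 0"
    and alb: "\<And>s. r1 \<le> Re s \<Longrightarrow> - (pi / \<mu>) + \<delta> \<le> Im s \<Longrightarrow> Im s \<le> - \<delta> \<Longrightarrow> norm (al s) \<le> 2 * eps (Re s) * (norm (be s) * exp (2 * Im (\<Phi> s)))"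
    by (rule strip_recessive_u[OF G lim nz], assumption, rule that)
  obtain r2 where r2: "r2 > \<rho>0" "eps r2 * (2 * pi) \<le> 1/16"
    and H: "\<And>s. r2 \<le> Re s \<Longrightarrow> \<bar>Im s\<bar> \<le> pi / (3 * \<mu>) \<Longrightarrow> 0 < Re (H s)" using middle_region by metis
  show ?thesis
  proof (rule that[of "max r1 r2"])
    fix s assume s: "max r1 r2 \<le> Re s" "\<bar>Im s\<bar> \<le> pi / (3 * \<mu>)"
    define \<rho> where "\<rho> = Re s"
    define a where "a = Complex \<rho> (- \<delta>)"
    have sb: "s = Complex \<rho> (Im s)" by (simp add: \<rho>_def)
    have \<rho>: "r1 \<le> \<rho>" "r2 \<le> \<rho>" using s by (auto simp: \<rho>_def)
    have ea: "exp (2 * Im (\<Phi> a)) * exp (- 2 * Im (\<Phi> a)) = 1" by (simp add: exp_add[symmetric])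
    have e4: "eps \<rho> \<le> 1/4" using eps_antimono[OF \<rho>(1)] r1(2) by linarith
    have e16: "eps \<rho> * (2 * pi) \<le> 1/16" by (rule order_trans[OF mult_right_mono[OF eps_antimono[OF \<rho>(2)]] r2(2)]) simp
    have "\<bar>Im s\<bar> \<le> \<delta>" using s by (simp add: \<delta>_def)
    then have Ims: "- \<delta> \<le> Im s" "Im s \<le> \<delta>" by auto
    have a2: "norm (al a) \<le> 2 * eps \<rho> * (norm (be a) * exp (2 * Im (\<Phi> a)))"
      using alb[of a] d \<rho> by (simp add: a_def)
    have ba: "be a \<noteq> 0" using be0[of a] d \<rho> by (simp add: a_def)
    have e8: "2 * eps \<rho> \<le> 1/16"
    proof -
      have "2 * eps \<rho> * 1 \<le> 2 * eps \<rho> * pi" using C pi_gt3 by (intro mult_left_mono) auto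
      then show ?thesis using e16 by simp
    qed
    have "norm (al a) * exp (- 2 * Im (\<Phi> a)) \<le> 2 * eps \<rho> * (norm (be a) * exp (2 * Im (\<Phi> a))) * exp (- 2 * Im (\<Phi> a))"
      using a2 by (rule mult_right_mono) simp
    also have "\<dots> = 2 * eps \<rho> * norm (be a) * (exp (2 * Im (\<Phi> a)) * exp (- 2 * Im (\<Phi> a)))" by simp
    also have "\<dots> \<le> 1/16 * norm (be a) * 1" unfolding ea using e8 by (intro mult_right_mono) auto
    finally have ala: "norm (al a) * exp (- 2 * Im (\<Phi> a)) \<le> 1/16 * norm (be a)" by simp
    define Am where "Am = norm (be a) + norm (al a) * exp (- 2 * Im (\<Phi> a))"
    have Am: "Am \<le> 2 * norm (be a)" using ala norm_ge_zero[of "be a"] unfolding Am_def by linarith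
    have Am0: "0 \<le> Am" by (simp add: Am_def)
    have eAm: "eps \<rho> * (2 * pi) * Am \<le> 1/8 * norm (be a)"
    proof -
      have "eps \<rho> * (2 * pi) * Am \<le> 1/16 * Am" using e16 Am0 by (intro mult_right_mono) auto
      then show ?thesis using Am by linarith
    qed
    note UB = up_bound[OF H r2(1,2) \<rho>(2), of "- \<delta>" "Im s"]
    have 1: "norm (be s - be a) \<le> 1/8 * norm (be a)"
      using UB(1) Ims eAm unfolding Am_def a_def sb[symmetric] \<delta>_def by simp
    have "norm (al s - al a) \<le> eps \<rho> * (2 * pi) * Am * exp (2 * Im (\<Phi> s))"
      using UB(2) Ims unfolding Am_def a_def sb[symmetric] \<delta>_def by simp
    also have "\<dots> \<le> 1/8 * norm (be a) * exp (2 * Im (\<Phi> s))" using eAm by (intro mult_right_mono) auto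
    finally have "norm (al s) \<le> norm (al a) + 1/8 * norm (be a) * exp (2 * Im (\<Phi> s))"
      using norm_triangle_ineq2[of "al s" "al a"] by linarith
    then have "norm (al s) * exp (- 2 * Im (\<Phi> s)) \<le> (norm (al a) + 1/8 * norm (be a) * exp (2 * Im (\<Phi> s))) * exp (- 2 * Im (\<Phi> s))"
      by (rule mult_right_mono) simp
    also have "\<dots> = norm (al a) * exp (- 2 * Im (\<Phi> s)) + 1/8 * norm (be a) * (exp (2 * Im (\<Phi> s)) * exp (- 2 * Im (\<Phi> s)))"
      by (simp only: ring_distribs mult_ac)
    also have "exp (2 * Im (\<Phi> s)) * exp (- 2 * Im (\<Phi> s)) = 1" by (simp add: exp_add[symmetric])
    also have "norm (al a) * exp (- 2 * Im (\<Phi> s)) \<le> norm (al a) * exp (- 2 * Im (\<Phi> a))"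
    proof -
      have "Im (\<Phi> a) \<le> Im (\<Phi> (Complex \<rho> (Im s)))" unfolding a_def
        by (rule Im_Phi_vertical) (use H[of "Complex \<rho> _"] Ims \<rho> r2 in \<open>auto simp: \<delta>_def less_imp_le\<close>)
      then show ?thesis unfolding sb[symmetric] by (intro mult_left_mono) auto
    qed
    finally have "norm (al s) * exp (- 2 * Im (\<Phi> s)) \<le> 3/16 * norm (be a)" using ala by linarith
    moreover have "norm (be s) \<ge> 7/8 * norm (be a)"
      using 1 norm_triangle_ineq2[of "be a" "be s"] norm_minus_commute[of "be a" "be s"] by linarith
    moreover have "0 < norm (be a)" using ba by simp
    ultimately have "0 < norm (be s) - norm (al s) * exp (- 2 * Im (\<Phi> s))" by linarith
    then have "0 < exp (Im (\<Phi> s)) * (norm (be s) - norm (al s) * exp (- 2 * Im (\<Phi> s)))" by simp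
    then have "0 < norm (u s)" using norm_u_ge(2)[of s] by linarith
    then show "u s \<noteq> 0" by simp
  qed (use r1 r2 in auto)
qed

end

section \<open>Connection across a Stokes ray\<close>

lemma (in wkb_system) strip_Im_Phi:
  assumes G: "growth_strip t1 t2 c \<rho>1"
  obtains \<rho>2 where "\<And>s. \<rho>2 \<le> Re s \<Longrightarrow> t1 \<le> Im s \<Longrightarrow> Im s \<le> t2 \<Longrightarrow> Im (\<Phi> s) \<le> B"
proof -
  obtain M \<rho>2 where Im: "\<And>s. \<rho>2 \<le> Re s \<Longrightarrow> t1 \<le> Im s \<Longrightarrow> Im s \<le> t2 \<Longrightarrow> Im (\<Phi> s) \<le> M - c * exp (- \<mu>) * exp (\<mu> * Re s)"
    using strip_amp_bounded[OF G] by metis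
  have "filterlim (\<lambda>\<rho>. M - c * exp (- \<mu>) * exp (\<mu> * \<rho>)) at_bot at_top"
    using mu growth_stripD(2)[OF G] by real_asymp
  then have "\<forall>\<^sub>F \<rho> in at_top. M - c * exp (- \<mu>) * exp (\<mu> * \<rho>) \<le> B" by (simp add: filterlim_at_bot)
  then obtain r where "\<And>\<rho>. \<rho> \<ge> r \<Longrightarrow> M - c * exp (- \<mu>) * exp (\<mu> * \<rho>) \<le> B" by (auto simp: eventually_at_top_linorder)
  with Im show ?thesis by (intro that[of "max \<rho>2 r"]) (meson max.bounded_iff order_trans)
qed

context wkb
begin

text \<open>Below the ray \<open>al\<close> is known to be near L, above it \<open>be\<close> is
  known to be near R. In the middle a point \<open>w\<close> with Im \<Phi> = 0 on the vertical
  segment is the junction: going down from it compares \<open>al w\<close> with L, going up compares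
  \<open>be w\<close> with R, and from \<open>w\<close> every point of the segment is reached along
  a monotone path.\<close>

lemma connection:
  assumes L: "left_lim L" and R: "right_lim R" and e: "e > 0"
  obtains \<rho>2 where "\<rho>2 > \<rho>0"
    "\<And>s. \<rho>2 \<le> Re s \<Longrightarrow> \<bar>Im s\<bar> \<le> 2 * pi / (3 * \<mu>) \<Longrightarrow>
       norm (al s - L) \<le> e * exp (max 0 (2 * Im (\<Phi> s))) \<and> norm (be s - R) \<le> e * exp (max 0 (- 2 * Im (\<Phi> s)))"
proof -
  have m: "\<mu> > 0" using mu by simp
  define \<eta> where "\<eta> = pi / (3 * \<mu>)"
  have d: "0 < \<eta>" "\<eta> \<le> pi / (2 * \<mu>)" using m by (auto simp: \<eta>_def field_simps)
  have d2: "pi / \<mu> - \<eta> = 2 * pi / (3 * \<mu>)" "- (pi / \<mu>) + \<eta> = - (2 * pi / (3 * \<mu>))" "\<eta> \<le> 2 * pi / (3 * \<mu>)"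
    using m by (auto simp: \<eta>_def field_simps)
  define e1 where "e1 = min 1 (e / 4)"
  have e1: "e1 > 0" "e1 \<le> 1" "e1 \<le> e / 4" using e by (auto simp: e1_def)
  \<comment> \<open>Once |Im \<Phi>| exceeds \<open>B\<close>, the weight makes the limit that
    belongs to the opposite sector negligible. In the lower sector \<open>be\<close> need not be
    close to R; only the weighted difference is small.\<close>
  define B where "B = max 0 (ln ((norm L + norm R + 1) / e1) / 2)"
  have BB: "(norm L + norm R + 1) * exp (- 2 * y) \<le> e1" if "y \<ge> B" for y
  proof -
    have p: "(norm L + norm R + 1) / e1 > 0" using e1 by (simp add: add_nonneg_pos)
    have "ln ((norm L + norm R + 1) / e1) \<le> 2 * y" using that by (simp add: B_def)
    then have "(norm L + norm R + 1) / e1 \<le> exp (2 * y)" using p by (metis exp_le_cancel_iff exp_ln)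
    then have "norm L + norm R + 1 \<le> e1 * exp (2 * y)" using e1 by (simp add: field_simps)
    then have "(norm L + norm R + 1) * exp (- 2 * y) \<le> e1 * exp (2 * y) * exp (- 2 * y)" by (rule mult_right_mono) simp
    also have "\<dots> = e1" by (simp add: mult.assoc exp_add[symmetric])
    finally show ?thesis .
  qed
  obtain c1 \<rho>1 where G1: "growth_strip (- (pi / \<mu>) + \<eta>) (- \<eta>) c1 \<rho>1" using left_growth[OF d] by blast
  obtain c2 \<rho>2 where G2: "neg_growth_strip \<eta> (pi / \<mu> - \<eta>) c2 \<rho>2" using right_growth[OF d] by blast
  have l1: "lim_on (- (pi / \<mu>) + \<eta>) (- \<eta>) L" using L d by (auto simp: left_lim_def)
  have l2: "neg_lim_on \<eta> (pi / \<mu> - \<eta>) R" using R d by (auto simp: right_lim_def)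
  obtain r1 where r1: "\<And>s. r1 \<le> Re s \<Longrightarrow> - (pi / \<mu>) + \<eta> \<le> Im s \<Longrightarrow> Im s \<le> - \<eta> \<Longrightarrow> Im (\<Phi> s) \<le> - B"
    using strip_Im_Phi[OF G1] by metis
  obtain r2 where r2: "\<And>s. r2 \<le> Re s \<Longrightarrow> \<eta> \<le> Im s \<Longrightarrow> Im s \<le> pi / \<mu> - \<eta> \<Longrightarrow> Im (- \<Phi> s) \<le> - B"
    using wkb_system.strip_Im_Phi[OF negated G2] by metis
  obtain r3 where r3: "\<And>s. r3 \<le> Re s \<Longrightarrow> - (pi / \<mu>) + \<eta> \<le> Im s \<Longrightarrow> Im s \<le> - \<eta> \<Longrightarrow>
      norm (al s - L) \<le> e1 \<and> norm (be s) * exp (2 * Im (\<Phi> s)) \<le> e1"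
    using l1 e1 unfolding lim_on_def by metis
  obtain r4 where r4: "\<And>s. r4 \<le> Re s \<Longrightarrow> \<eta> \<le> Im s \<Longrightarrow> Im s \<le> pi / \<mu> - \<eta> \<Longrightarrow>
      norm (be s - R) \<le> e1 \<and> norm (al s) * exp (- 2 * Im (\<Phi> s)) \<le> e1"
    using l2 e1 unfolding neg_lim_on_iff by metis
  obtain r5 where r5: "r5 > \<rho>0" "eps r5 * (2 * pi) \<le> 1/16"
    and H: "\<And>s. r5 \<le> Re s \<Longrightarrow> \<bar>Im s\<bar> \<le> pi / (3 * \<mu>) \<Longrightarrow> 0 < Re (H s)" using middle_region by metis
  \<comment> \<open>An a priori bound for \<open>M\<close>, the sum of the norms of
    \<open>al w\<close> and \<open>be w\<close> at the junction: it follows from M \<le> |L| + |R| +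
    2 e1 + M/8 with e1 \<le> 1.\<close>
  define K where "K = 2 * (norm L + norm R) + 4"
  have K: "K > 0" unfolding K_def by (smt (verit) norm_ge_zero)
  obtain r6 where r6: "\<And>\<rho>. \<rho> \<ge> r6 \<Longrightarrow> eps \<rho> < e / (8 * pi * K)"
    using eps_small[of "e / (8 * pi * K)"] e K by (auto simp: eventually_at_top_linorder)
  define r where "r = max (max (max r1 r2) (max r3 r4)) (max r5 r6)"
  have small: "eps \<rho> * (2 * pi) * K \<le> e / 4" if "\<rho> \<ge> r" for \<rho>
  proof -
    have "eps \<rho> * (2 * pi * K) \<le> e / (8 * pi * K) * (2 * pi * K)"
      using r6[of \<rho>] that K by (intro mult_right_mono) (auto simp: r_def)
    also have "\<dots> = e / 4" using K by (simp add: field_simps)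
    finally show ?thesis by (simp add: mult.assoc)
  qed
  show ?thesis
  proof (rule that[of r])
    show "r > \<rho>0" using r5 by (auto simp: r_def)
    fix s assume s: "r \<le> Re s" "\<bar>Im s\<bar> \<le> 2 * pi / (3 * \<mu>)"
    have sr: "r1 \<le> Re s" "r2 \<le> Re s" "r3 \<le> Re s" "r4 \<le> Re s" "r5 \<le> Re s" "r6 \<le> Re s"
      using s by (auto simp: r_def)
    consider (left) "- (pi / \<mu>) + \<eta> \<le> Im s" "Im s \<le> - \<eta>" | (right) "\<eta> \<le> Im s" "Im s \<le> pi / \<mu> - \<eta>"
      | (mid) "- \<eta> \<le> Im s" "Im s \<le> \<eta>"
      using s unfolding d2 by linarith
    then show "norm (al s - L) \<le> e * exp (max 0 (2 * Im (\<Phi> s))) \<and> norm (be s - R) \<le> e * exp (max 0 (- 2 * Im (\<Phi> s)))"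
    proof cases
      case left
      have y: "Im (\<Phi> s) \<le> - B" using r1 sr left by auto
      then have y0: "Im (\<Phi> s) \<le> 0" by (simp add: B_def)
      have a: "norm (al s - L) \<le> e1" and b: "norm (be s) * exp (2 * Im (\<Phi> s)) \<le> e1" using r3 sr left by auto
      have "(norm L + norm R + 1) * exp (- 2 * (- Im (\<Phi> s))) \<le> e1" using y by (intro BB) auto
      moreover have "norm R * exp (- 2 * (- Im (\<Phi> s))) \<le> (norm L + norm R + 1) * exp (- 2 * (- Im (\<Phi> s)))"
        by (intro mult_right_mono) auto
      ultimately have "norm R * exp (- 2 * (- Im (\<Phi> s))) \<le> e1" by linarith
      then have "norm R * exp (2 * Im (\<Phi> s)) \<le> e1" by simp
      moreover have "norm (be s - R) * exp (2 * Im (\<Phi> s)) \<le> (norm (be s) + norm R) * exp (2 * Im (\<Phi> s))"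
        by (intro mult_right_mono norm_triangle_ineq4) auto
      ultimately have "norm (be s - R) * exp (2 * Im (\<Phi> s)) \<le> e" using b e1 by (simp add: ring_distribs)
      then have "norm (be s - R) * exp (2 * Im (\<Phi> s)) * exp (- 2 * Im (\<Phi> s)) \<le> e * exp (- 2 * Im (\<Phi> s))"
        by (rule mult_right_mono) simp
      moreover have "norm (be s - R) * exp (2 * Im (\<Phi> s)) * exp (- 2 * Im (\<Phi> s)) = norm (be s - R)"
        by (simp add: mult.assoc exp_add[symmetric])
      ultimately have "norm (be s - R) \<le> e * exp (- 2 * Im (\<Phi> s))" by linarith
      then show ?thesis using a e1 y0 e by (auto simp: max_def)
    next
      case right
      have y: "Im (\<Phi> s) \<ge> B" using r2[of s] sr right by auto
      then have y0: "Im (\<Phi> s) \<ge> 0" by (simp add: B_def)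
      have a: "norm (be s - R) \<le> e1" and b: "norm (al s) * exp (- 2 * Im (\<Phi> s)) \<le> e1" using r4 sr right by auto
      have "(norm L + norm R + 1) * exp (- 2 * Im (\<Phi> s)) \<le> e1" using y by (intro BB) auto
      moreover have "norm L * exp (- 2 * Im (\<Phi> s)) \<le> (norm L + norm R + 1) * exp (- 2 * Im (\<Phi> s))"
        by (intro mult_right_mono) auto
      ultimately have "norm L * exp (- 2 * Im (\<Phi> s)) \<le> e1" by linarith
      moreover have "norm (al s - L) * exp (- 2 * Im (\<Phi> s)) \<le> (norm (al s) + norm L) * exp (- 2 * Im (\<Phi> s))"
        by (intro mult_right_mono norm_triangle_ineq4) auto
      moreover have "(norm (al s) + norm L) * exp (- 2 * Im (\<Phi> s)) = norm (al s) * exp (- 2 * Im (\<Phi> s)) + norm L * exp (- 2 * Im (\<Phi> s))"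
        by (rule ring_distribs)
      ultimately have "norm (al s - L) * exp (- 2 * Im (\<Phi> s)) \<le> e" using b e1 e by linarith
      then have "norm (al s - L) * exp (- 2 * Im (\<Phi> s)) * exp (2 * Im (\<Phi> s)) \<le> e * exp (2 * Im (\<Phi> s))"
        by (rule mult_right_mono) simp
      moreover have "norm (al s - L) * exp (- 2 * Im (\<Phi> s)) * exp (2 * Im (\<Phi> s)) = norm (al s - L)"
        by (simp add: mult.assoc exp_add[symmetric])
      ultimately have "norm (al s - L) \<le> e * exp (2 * Im (\<Phi> s))" by linarith
      then show ?thesis using a e1 y0 e by (auto simp: max_def)
    next
      case mid
      define \<rho> where "\<rho> = Re s"
      have rr: "r \<le> \<rho>" "r5 \<le> \<rho>" using s sr by (auto simp: \<rho>_def)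
      have sb: "s = Complex \<rho> (Im s)" by (simp add: \<rho>_def)
      define y where "y = (\<lambda>t. Im (\<Phi> (Complex \<rho> t)))"
      have "continuous_on {- \<eta>..\<eta>} y"
        unfolding y_def Complex_eq
        by (intro continuous_intros continuous_on_compose2[OF continuous_on_Phi[OF order_refl]]) (use rr r5 in auto)
      moreover have "y (- \<eta>) \<le> 0"
        using r1[of "Complex \<rho> (- \<eta>)"] sr d2 unfolding y_def B_def by (simp add: \<rho>_def)
      moreover have "0 \<le> y \<eta>"
        using r2[of "Complex \<rho> \<eta>"] sr d2 unfolding y_def B_def by (simp add: \<rho>_def)
      ultimately obtain ts where ts: "- \<eta> \<le> ts" "ts \<le> \<eta>" "y ts = 0"
        using IVT'[of y "- \<eta>" 0 \<eta>] d by auto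
      define w where "w = Complex \<rho> ts"
      have yw: "Im (\<Phi> w) = 0" using ts by (simp add: w_def y_def)
      define E where "E = eps \<rho> * (2 * pi)"
      have E: "0 \<le> E" "E * K \<le> e / 4" "E \<le> 1/16"
      proof -
        show "0 \<le> E" using C by (simp add: E_def)
        show "E * K \<le> e / 4" using small[OF rr(1)] by (simp add: E_def)
        show "E \<le> 1/16" unfolding E_def by (rule order_trans[OF mult_right_mono[OF eps_antimono[OF rr(2)]] r5(2)]) simp
      qed
      define M where "M = norm (al w) + norm (be w)"
      note UB = up_bound[OF H r5 rr(2)]
      have 1: "norm (al (Complex \<rho> (- \<eta>)) - al w) \<le> E * M"
        using UB(3)[of "- \<eta>" ts] ts yw unfolding w_def[symmetric] by (simp add: \<eta>_def E_def M_def)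
      have 2: "norm (be (Complex \<rho> \<eta>) - be w) \<le> E * M"
        using UB(1)[of ts \<eta>] ts yw unfolding w_def[symmetric] by (simp add: \<eta>_def E_def M_def add.commute)
      have 3: "norm (al (Complex \<rho> (- \<eta>)) - L) \<le> e1"
        using r3[of "Complex \<rho> (- \<eta>)"] sr d2 by (simp add: \<rho>_def)
      have 4: "norm (be (Complex \<rho> \<eta>) - R) \<le> e1"
        using r4[of "Complex \<rho> \<eta>"] sr d2 by (simp add: \<rho>_def)
      have aw: "norm (al w - L) \<le> e1 + E * M"
        using 1 3 norm_triangle_ineq4[of "al (Complex \<rho> (- \<eta>)) - L" "al (Complex \<rho> (- \<eta>)) - al w"] by simp
      have bw: "norm (be w - R) \<le> e1 + E * M"
        using 2 4 norm_triangle_ineq4[of "be (Complex \<rho> \<eta>) - R" "be (Complex \<rho> \<eta>) - be w"] by simp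
      have M0: "M \<ge> 0" by (simp add: M_def)
      obtain X where X: "X = E * M" by blast
      have "X \<le> 1/16 * M" unfolding X using E M0 by (intro mult_right_mono) auto
      moreover have "M \<le> norm L + norm R + 2 * e1 + 2 * X"
        unfolding X using aw bw norm_triangle_ineq2[of "al w" L] norm_triangle_ineq2[of "be w" R] unfolding M_def by linarith
      ultimately have MK: "M \<le> K" using e1 M0 norm_ge_zero[of L] norm_ge_zero[of R] unfolding K_def by argo
      have EM: "E * M \<le> e / 4" using mult_left_mono[OF MK E(1)] E(2) by linarith
      show ?thesis
      proof (cases "Im s \<le> ts")
        case True
        have ys: "Im (\<Phi> s) \<le> 0"
        proof -
          have "Im (\<Phi> (Complex \<rho> (Im s))) \<le> Im (\<Phi> (Complex \<rho> ts))"
            by (rule Im_Phi_vertical) (use H[of "Complex \<rho> _"] mid ts rr r5 True in \<open>auto simp: \<eta>_def less_imp_le\<close>)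
          then show ?thesis using yw unfolding sb[symmetric] w_def[symmetric] by simp
        qed
        have 5: "norm (al s - al w) \<le> E * M"
          using UB(3)[of "Im s" ts] mid ts True yw unfolding w_def[symmetric] sb[symmetric] by (simp add: \<eta>_def E_def M_def)
        have 6: "norm (be s - be w) \<le> E * M * exp (- 2 * Im (\<Phi> s))"
          using UB(4)[of "Im s" ts] mid ts True yw unfolding w_def[symmetric] sb[symmetric] by (simp add: \<eta>_def E_def M_def)
        have 7: "norm (al s - L) \<le> e"
          using 5 aw EM e1 norm_triangle_ineq[of "al s - al w" "al w - L"] by simp
        have "norm (be w - R) \<le> 2 * (e / 4) * exp (- 2 * Im (\<Phi> s))"
        proof -
          have "norm (be w - R) \<le> 2 * (e / 4) * 1" using bw EM e1 by simp
          also have "\<dots> \<le> 2 * (e / 4) * exp (- 2 * Im (\<Phi> s))" using ys e by (intro mult_left_mono) auto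
          finally show ?thesis .
        qed
        moreover have "norm (be s - be w) \<le> e / 4 * exp (- 2 * Im (\<Phi> s))"
          by (rule order_trans[OF 6 mult_right_mono[OF EM]]) simp
        moreover have "norm (be s - R) \<le> norm (be s - be w) + norm (be w - R)"
          using norm_triangle_ineq[of "be s - be w" "be w - R"] by simp
        moreover have "0 < e * exp (- 2 * Im (\<Phi> s))" using e by simp
        ultimately have "norm (be s - R) \<le> e * exp (- 2 * Im (\<Phi> s))" by linarith
        then show ?thesis using 7 ys by (simp add: max_def)
      next
        case False
        have ys: "Im (\<Phi> s) \<ge> 0"
        proof -
          have "Im (\<Phi> (Complex \<rho> ts)) \<le> Im (\<Phi> (Complex \<rho> (Im s)))"
            by (rule Im_Phi_vertical) (use H[of "Complex \<rho> _"] mid ts rr r5 False in \<open>auto simp: \<eta>_def less_imp_le\<close>)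
          then show ?thesis using yw unfolding sb[symmetric] w_def[symmetric] by simp
        qed
        have 5: "norm (be s - be w) \<le> E * M"
          using UB(1)[of ts "Im s"] mid ts False yw unfolding w_def[symmetric] sb[symmetric] by (simp add: \<eta>_def E_def M_def add.commute)
        have 6: "norm (al s - al w) \<le> E * M * exp (2 * Im (\<Phi> s))"
          using UB(2)[of ts "Im s"] mid ts False yw unfolding w_def[symmetric] sb[symmetric] by (simp add: \<eta>_def E_def M_def add.commute)
        have 7: "norm (be s - R) \<le> e"
          using 5 bw EM e1 norm_triangle_ineq[of "be s - be w" "be w - R"] by simp
        have "norm (al w - L) \<le> 2 * (e / 4) * exp (2 * Im (\<Phi> s))"
        proof -
          have "norm (al w - L) \<le> 2 * (e / 4) * 1" using aw EM e1 by simp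
          also have "\<dots> \<le> 2 * (e / 4) * exp (2 * Im (\<Phi> s))" using ys e by (intro mult_left_mono) auto
          finally show ?thesis .
        qed
        moreover have "norm (al s - al w) \<le> e / 4 * exp (2 * Im (\<Phi> s))"
          by (rule order_trans[OF 6 mult_right_mono[OF EM]]) simp
        moreover have "norm (al s - L) \<le> norm (al s - al w) + norm (al w - L)"
          using norm_triangle_ineq[of "al s - al w" "al w - L"] by simp
        moreover have "0 < e * exp (2 * Im (\<Phi> s))" using e by simp
        ultimately have "norm (al s - L) \<le> e * exp (2 * Im (\<Phi> s))" by linarith
        then show ?thesis using 7 ys by (simp add: max_def)
      qed
    qed
  qed
qed

text \<open>With y = Im \<Phi>, both max 0 (2 y) - y and max 0 (- 2 y) + y equal |y|. So the two
  weighted errors merge into a single one relative to exp |y|, the size of a cosine.\<close>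

lemma connection_u:
  assumes L: "left_lim L" and R: "right_lim R" and e: "e > 0"
  obtains \<rho>2 where "\<rho>2 > \<rho>0"
    "\<And>s. \<rho>2 \<le> Re s \<Longrightarrow> \<bar>Im s\<bar> \<le> 2 * pi / (3 * \<mu>) \<Longrightarrow>
       norm (u s - (L * exp (\<i> * \<Phi> s) + R * exp (- (\<i> * \<Phi> s)))) \<le> e * exp \<bar>Im (\<Phi> s)\<bar>"
    "\<And>s. \<rho>2 \<le> Re s \<Longrightarrow> \<bar>Im s\<bar> \<le> 2 * pi / (3 * \<mu>) \<Longrightarrow>
       norm (V s - \<i> * (L * exp (\<i> * \<Phi> s) - R * exp (- (\<i> * \<Phi> s)))) \<le> e * exp \<bar>Im (\<Phi> s)\<bar>"
proof -
  have "e / 2 > 0" using e by simp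
  from connection[OF L R this] obtain \<rho>2 where r: "\<rho>2 > \<rho>0"
    and c: "\<And>s. \<rho>2 \<le> Re s \<Longrightarrow> \<bar>Im s\<bar> \<le> 2 * pi / (3 * \<mu>) \<Longrightarrow>
       norm (al s - L) \<le> e / 2 * exp (max 0 (2 * Im (\<Phi> s))) \<and> norm (be s - R) \<le> e / 2 * exp (max 0 (- 2 * Im (\<Phi> s)))"
    by metis
  show ?thesis
  proof (rule that[OF r])
    fix s assume s: "\<rho>2 \<le> Re s" "\<bar>Im s\<bar> \<le> 2 * pi / (3 * \<mu>)"
    let ?y = "Im (\<Phi> s)"
    have "norm ((al s - L) * exp (\<i> * \<Phi> s)) = norm (al s - L) * exp (- ?y)" by (simp add: norm_mult)
    also have "\<dots> \<le> e / 2 * exp (max 0 (2 * ?y)) * exp (- ?y)" using c[OF s] by (intro mult_right_mono) auto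
    also have "\<dots> = e / 2 * exp \<bar>?y\<bar>" by (simp add: mult.assoc exp_add[symmetric] max_def)
    finally have A: "norm ((al s - L) * exp (\<i> * \<Phi> s)) \<le> e / 2 * exp \<bar>?y\<bar>" .
    have "norm ((be s - R) * exp (- (\<i> * \<Phi> s))) = norm (be s - R) * exp ?y" by (simp add: norm_mult)
    also have "\<dots> \<le> e / 2 * exp (max 0 (- 2 * ?y)) * exp ?y" using c[OF s] by (intro mult_right_mono) auto
    also have "\<dots> = e / 2 * exp \<bar>?y\<bar>" by (simp add: mult.assoc exp_add[symmetric] max_def)
    finally have B: "norm ((be s - R) * exp (- (\<i> * \<Phi> s))) \<le> e / 2 * exp \<bar>?y\<bar>" .
    have "u s - (L * exp (\<i> * \<Phi> s) + R * exp (- (\<i> * \<Phi> s))) = (al s - L) * exp (\<i> * \<Phi> s) + (be s - R) * exp (- (\<i> * \<Phi> s))"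
      by (subst u_eq) (simp add: algebra_simps)
    then show "norm (u s - (L * exp (\<i> * \<Phi> s) + R * exp (- (\<i> * \<Phi> s)))) \<le> e * exp \<bar>?y\<bar>"
      using A B norm_triangle_ineq[of "(al s - L) * exp (\<i> * \<Phi> s)" "(be s - R) * exp (- (\<i> * \<Phi> s))"] by simp
    have "V s - \<i> * (L * exp (\<i> * \<Phi> s) - R * exp (- (\<i> * \<Phi> s))) = \<i> * ((al s - L) * exp (\<i> * \<Phi> s) - (be s - R) * exp (- (\<i> * \<Phi> s)))"
      by (subst V_eq) (simp add: algebra_simps)
    then show "norm (V s - \<i> * (L * exp (\<i> * \<Phi> s) - R * exp (- (\<i> * \<Phi> s)))) \<le> e * exp \<bar>?y\<bar>"
      using A B norm_triangle_ineq4[of "(al s - L) * exp (\<i> * \<Phi> s)" "(be s - R) * exp (- (\<i> * \<Phi> s))"] by (simp add: norm_mult)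
  qed
qed

end

text \<open>What remains of the system when both sectors are dominant, after normalising amplitude
  and phase. The condition \<open>outer\<close> keeps zeros out of the sectors, and
  \<open>Im_ends\<close> yields a point with real \<Phi> on every vertical segment far out, by the
  intermediate value theorem.\<close>

locale cosine_like =
  fixes u V H \<Phi> :: "complex \<Rightarrow> complex" and \<rho>0 \<mu> \<kappa> :: real
  assumes mu: "\<mu> \<ge> 1" and kappa: "\<kappa> > 0" and rho0: "\<rho>0 \<ge> 0"
    and du: "\<And>s. Re s > \<rho>0 \<Longrightarrow> (u has_field_derivative H s * V s) (at s)"
    and dPhi: "\<And>s. Re s > \<rho>0 \<Longrightarrow> (\<Phi> has_field_derivative H s) (at s)"
    and Hasy: "\<And>e. e > 0 \<Longrightarrow> \<exists>\<rho>1. \<forall>s. \<rho>1 \<le> Re s \<longrightarrow> norm (H s - of_real \<kappa> * exp (of_real \<mu> * s)) \<le> e * exp (\<mu> * Re s)"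
    and u_cos: "\<And>e. e > 0 \<Longrightarrow> \<exists>\<rho>1. \<forall>s. \<rho>1 \<le> Re s \<longrightarrow> \<bar>Im s\<bar> \<le> 2 * pi / (3 * \<mu>) \<longrightarrow>
       norm (u s - cos (\<Phi> s)) \<le> e * exp \<bar>Im (\<Phi> s)\<bar>"
    and V_sin: "\<And>e. e > 0 \<Longrightarrow> \<exists>\<rho>1. \<forall>s. \<rho>1 \<le> Re s \<longrightarrow> \<bar>Im s\<bar> \<le> 2 * pi / (3 * \<mu>) \<longrightarrow>
       norm (V s + sin (\<Phi> s)) \<le> e * exp \<bar>Im (\<Phi> s)\<bar>"
    and outer: "\<exists>k>0. \<exists>k'>0. \<exists>\<rho>1. \<forall>s. \<rho>1 \<le> Re s \<longrightarrow> pi / (3 * \<mu>) \<le> \<bar>Im s\<bar> \<longrightarrow> \<bar>Im s\<bar> \<le> 2 * pi / (3 * \<mu>) \<longrightarrow>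
       k * exp (k' * exp (\<mu> * Re s)) \<le> norm (u s)"
    and Im_ends: "\<exists>\<rho>1. \<forall>\<rho>\<ge>\<rho>1. Im (\<Phi> (Complex \<rho> (- (pi / (3 * \<mu>))))) \<le> 0 \<and> 0 \<le> Im (\<Phi> (Complex \<rho> (pi / (3 * \<mu>))))"

context wkb
begin

text \<open>The sum of L exp(\<i> \<Phi>) and R exp(- \<i> \<Phi>) is l cos(\<Phi> + c0) as soon as
  exp(2 \<i> c0) = L/R; this c0 exists because neither coefficient is 0.\<close>

lemma cosine_like:
  assumes L: "left_lim L" "L \<noteq> 0" and R: "right_lim R" "R \<noteq> 0"
  obtains l c0 where "l \<noteq> 0" "cosine_like (\<lambda>s. u s / l) (\<lambda>s. V s / l) H (\<lambda>s. \<Phi> s + c0) \<rho>0 \<mu> \<kappa>"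
proof -
  have m: "\<mu> > 0" using mu by simp
  define c0 where "c0 = - (\<i> / 2) * Ln (L / R)"
  define l where "l = 2 * L * exp (- (\<i> * c0))"
  have ic: "\<i> * c0 + \<i> * c0 = Ln (L / R)" by (simp add: c0_def field_simps)
  have ee: "exp (\<i> * c0) * exp (\<i> * c0) = L / R" unfolding exp_add[symmetric] ic using L R by simp
  have l0: "l \<noteq> 0" using L by (simp add: l_def)
  have Ll: "L = l / 2 * exp (\<i> * c0)" by (simp add: l_def exp_minus field_simps)
  have Rl: "R = l / 2 * exp (- (\<i> * c0))"
  proof -
    have "l / 2 * exp (- (\<i> * c0)) * (exp (\<i> * c0) * exp (\<i> * c0)) = L"
      by (simp add: l_def exp_minus field_simps)
    then show ?thesis unfolding ee using L R by (simp add: field_simps)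
  qed
  have cs: "L * exp (\<i> * \<Phi> s) + R * exp (- (\<i> * \<Phi> s)) = l * cos (\<Phi> s + c0)" for s
    unfolding cos_exp_eq by (subst Ll, subst Rl) (simp add: exp_add[symmetric] algebra_simps add_divide_distrib)
  have sn: "\<i> * (L * exp (\<i> * \<Phi> s) - R * exp (- (\<i> * \<Phi> s))) = - (l * sin (\<Phi> s + c0))" for s
  proof -
    have S: "sin z = - (\<i> / 2) * (exp (\<i> * z) - exp (- (\<i> * z)))" for z by (simp add: sin_exp_eq field_simps)
    show ?thesis unfolding S by (subst Ll, subst Rl) (simp add: exp_add[symmetric] algebra_simps)
  qed
  have Imc: "exp \<bar>Im (\<Phi> s)\<bar> \<le> exp \<bar>Im c0\<bar> * exp \<bar>Im (\<Phi> s + c0)\<bar>" for s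
    unfolding exp_add[symmetric] exp_le_cancel_iff plus_complex.sel by linarith
  \<comment> \<open>A complex phase shift changes exp |Im \<Phi>| by a bounded factor, which is
    compensated by a smaller tolerance.\<close>
  have scale: "norm (w / l) \<le> e * exp \<bar>Im (\<Phi> s + c0)\<bar>"
    if "norm w \<le> e * norm l * exp (- \<bar>Im c0\<bar>) * exp \<bar>Im (\<Phi> s)\<bar>" "e > 0" for w e s
  proof -
    have "norm w \<le> e * norm l * exp (- \<bar>Im c0\<bar>) * (exp \<bar>Im c0\<bar> * exp \<bar>Im (\<Phi> s + c0)\<bar>)"
      using that(2) by (intro order_trans[OF that(1)] mult_left_mono[OF Imc]) auto
    also have "\<dots> = e * norm l * (exp (- \<bar>Im c0\<bar>) * exp \<bar>Im c0\<bar>) * exp \<bar>Im (\<Phi> s + c0)\<bar>" by simp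
    also have "exp (- \<bar>Im c0\<bar>) * exp \<bar>Im c0\<bar> = 1" by (simp add: exp_add[symmetric])
    finally have "norm w \<le> e * norm l * exp \<bar>Im (\<Phi> s + c0)\<bar>" by simp
    then show ?thesis using l0 by (simp add: norm_divide field_simps)
  qed
  define \<eta> where "\<eta> = pi / (3 * \<mu>)"
  have d: "0 < \<eta>" "\<eta> \<le> pi / (2 * \<mu>)" using m by (auto simp: \<eta>_def field_simps)
  have d2: "pi / \<mu> - \<eta> = 2 * pi / (3 * \<mu>)" "- (pi / \<mu>) + \<eta> = - (2 * pi / (3 * \<mu>))" "\<eta> \<le> 2 * pi / (3 * \<mu>)"
    using m by (auto simp: \<eta>_def field_simps)
  have "cosine_like (\<lambda>s. u s / l) (\<lambda>s. V s / l) H (\<lambda>s. \<Phi> s + c0) \<rho>0 \<mu> \<kappa>"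
  proof unfold_locales
    show "((\<lambda>s. u s / l) has_field_derivative H s * (V s / l)) (at s)" if "Re s > \<rho>0" for s
      using DERIV_cdivide[OF du[OF that], of l] by simp
    show "((\<lambda>s. \<Phi> s + c0) has_field_derivative H s) (at s)" if "Re s > \<rho>0" for s
      using DERIV_add[OF dPhi[OF that] DERIV_const[of c0]] by simp
    show "\<exists>\<rho>1. \<forall>s. \<rho>1 \<le> Re s \<longrightarrow> norm (H s - of_real \<kappa> * exp (of_real \<mu> * s)) \<le> e * exp (\<mu> * Re s)" if "e > 0" for e
      using H_close[OF that, of 0] by metis
    fix e :: real assume e: "e > 0"
    have e': "e * norm l * exp (- \<bar>Im c0\<bar>) > 0" using e l0 by simp
    obtain \<rho>2 where r: "\<rho>2 > \<rho>0"
     and A: "\<And>s. \<rho>2 \<le> Re s \<Longrightarrow> \<bar>Im s\<bar> \<le> 2 * pi / (3 * \<mu>) \<Longrightarrow>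
       norm (u s - (L * exp (\<i> * \<Phi> s) + R * exp (- (\<i> * \<Phi> s)))) \<le> e * norm l * exp (- \<bar>Im c0\<bar>) * exp \<bar>Im (\<Phi> s)\<bar>"
     and B: "\<And>s. \<rho>2 \<le> Re s \<Longrightarrow> \<bar>Im s\<bar> \<le> 2 * pi / (3 * \<mu>) \<Longrightarrow>
       norm (V s - \<i> * (L * exp (\<i> * \<Phi> s) - R * exp (- (\<i> * \<Phi> s)))) \<le> e * norm l * exp (- \<bar>Im c0\<bar>) * exp \<bar>Im (\<Phi> s)\<bar>"
      using connection_u[OF L(1) R(1) e'] by metis
    show "\<exists>\<rho>1. \<forall>s. \<rho>1 \<le> Re s \<longrightarrow> \<bar>Im s\<bar> \<le> 2 * pi / (3 * \<mu>) \<longrightarrow>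
       norm (u s / l - cos (\<Phi> s + c0)) \<le> e * exp \<bar>Im (\<Phi> s + c0)\<bar>"
    proof (intro exI[of _ \<rho>2] allI impI)
      fix s assume s: "\<rho>2 \<le> Re s" "\<bar>Im s\<bar> \<le> 2 * pi / (3 * \<mu>)"
      have "norm ((u s - l * cos (\<Phi> s + c0)) / l) \<le> e * exp \<bar>Im (\<Phi> s + c0)\<bar>"
        using scale[OF _ e] A[OF s] unfolding cs by blast
      then show "norm (u s / l - cos (\<Phi> s + c0)) \<le> e * exp \<bar>Im (\<Phi> s + c0)\<bar>"
        using l0 by (simp add: diff_divide_distrib)
    qed
    show "\<exists>\<rho>1. \<forall>s. \<rho>1 \<le> Re s \<longrightarrow> \<bar>Im s\<bar> \<le> 2 * pi / (3 * \<mu>) \<longrightarrow>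
       norm (V s / l + sin (\<Phi> s + c0)) \<le> e * exp \<bar>Im (\<Phi> s + c0)\<bar>"
    proof (intro exI[of _ \<rho>2] allI impI)
      fix s assume s: "\<rho>2 \<le> Re s" "\<bar>Im s\<bar> \<le> 2 * pi / (3 * \<mu>)"
      have "norm ((V s - - (l * sin (\<Phi> s + c0))) / l) \<le> e * exp \<bar>Im (\<Phi> s + c0)\<bar>"
        using scale[OF _ e] B[OF s] unfolding sn by blast
      then show "norm (V s / l + sin (\<Phi> s + c0)) \<le> e * exp \<bar>Im (\<Phi> s + c0)\<bar>"
        using l0 by (simp add: add_divide_distrib)
    qed
  next
    obtain r1 k1 k1' where 1: "k1 > 0" "k1' > 0" "\<And>s. r1 \<le> Re s \<Longrightarrow> - (pi / \<mu>) + \<eta> \<le> Im s \<Longrightarrow> Im s \<le> - \<eta> \<Longrightarrow> norm (u s) \<ge> k1 * exp (k1' * exp (\<mu> * Re s))"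
      by (rule left_dominant[OF L d]) (rule that, assumption+)
    obtain r2 k2 k2' where 2: "k2 > 0" "k2' > 0" "\<And>s. r2 \<le> Re s \<Longrightarrow> \<eta> \<le> Im s \<Longrightarrow> Im s \<le> pi / \<mu> - \<eta> \<Longrightarrow> norm (u s) \<ge> k2 * exp (k2' * exp (\<mu> * Re s))"
      by (rule right_dominant[OF R d]) (rule that, assumption+)
    show "\<exists>k>0. \<exists>k'>0. \<exists>\<rho>1. \<forall>s. \<rho>1 \<le> Re s \<longrightarrow> pi / (3 * \<mu>) \<le> \<bar>Im s\<bar> \<longrightarrow> \<bar>Im s\<bar> \<le> 2 * pi / (3 * \<mu>) \<longrightarrow>
       k * exp (k' * exp (\<mu> * Re s)) \<le> norm (u s / l)"
    proof (intro exI conjI allI impI)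
      show "min k1 k2 / norm l > 0" "min k1' k2' > 0" using 1 2 l0 by auto
      fix s assume s: "max r1 r2 \<le> Re s" "pi / (3 * \<mu>) \<le> \<bar>Im s\<bar>" "\<bar>Im s\<bar> \<le> 2 * pi / (3 * \<mu>)"
      have "min k1 k2 * exp (min k1' k2' * exp (\<mu> * Re s)) \<le> norm (u s)"
      proof (cases "Im s \<le> 0")
        case True
        have "min k1 k2 * exp (min k1' k2' * exp (\<mu> * Re s)) \<le> k1 * exp (k1' * exp (\<mu> * Re s))"
          using 1 2 by (intro mult_mono) auto
        also have "\<dots> \<le> norm (u s)" using s True d2 by (intro 1(3)) (auto simp: \<eta>_def)
        finally show ?thesis .
      next
        case False
        have "min k1 k2 * exp (min k1' k2' * exp (\<mu> * Re s)) \<le> k2 * exp (k2' * exp (\<mu> * Re s))"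
          using 1 2 by (intro mult_mono) auto
        also have "\<dots> \<le> norm (u s)" using s False d2 by (intro 2(3)) (auto simp: \<eta>_def)
        finally show ?thesis .
      qed
      then show "min k1 k2 / norm l * exp (min k1' k2' * exp (\<mu> * Re s)) \<le> norm (u s / l)"
        using l0 by (simp add: norm_divide divide_right_mono)
    qed
    obtain c1 \<rho>1 where G1: "growth_strip (- (pi / \<mu>) + \<eta>) (- \<eta>) c1 \<rho>1" using left_growth[OF d] by blast
    obtain c2 \<rho>2 where G2: "neg_growth_strip \<eta> (pi / \<mu> - \<eta>) c2 \<rho>2" using right_growth[OF d] by blast
    obtain r1 where r1: "\<And>s. r1 \<le> Re s \<Longrightarrow> - (pi / \<mu>) + \<eta> \<le> Im s \<Longrightarrow> Im s \<le> - \<eta> \<Longrightarrow> Im (\<Phi> s) \<le> - \<bar>Im c0\<bar>"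
      using strip_Im_Phi[OF G1] by metis
    obtain r2 where r2: "\<And>s. r2 \<le> Re s \<Longrightarrow> \<eta> \<le> Im s \<Longrightarrow> Im s \<le> pi / \<mu> - \<eta> \<Longrightarrow> Im (- \<Phi> s) \<le> - \<bar>Im c0\<bar>"
      using wkb_system.strip_Im_Phi[OF negated G2] by metis
    show "\<exists>\<rho>1. \<forall>\<rho>\<ge>\<rho>1. Im (\<Phi> (Complex \<rho> (- (pi / (3 * \<mu>)))) + c0) \<le> 0 \<and> 0 \<le> Im (\<Phi> (Complex \<rho> (pi / (3 * \<mu>))) + c0)"
      using r1[of "Complex _ (- \<eta>)"] r2[of "Complex _ \<eta>"] d2 unfolding \<eta>_def[symmetric]
      by (intro exI[of _ "max r1 r2"]) fastforce
  qed (use mu kappa rho0 in auto)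
  with l0 show ?thesis by (rule that)
qed

end

section \<open>Zeros of functions close to the cosine\<close>

definition cos_zero :: "int \<Rightarrow> complex" where "cos_zero n = of_real ((of_int n + 1/2) * pi)"

lemma cos_cos_zero [simp]: "cos (cos_zero n) = 0"
  by (auto simp: cos_zero_def cos_eq_0 algebra_simps intro!: exI[of _ n])

lemma sin_cos_zero: "norm (sin (cos_zero n)) = 1"
proof -
  have "sin (cos_zero n) ^ 2 = 1" using sin_cos_squared_add[of "cos_zero n"] by simp
  then show ?thesis by (metis norm_one norm_power power2_eq_1_iff norm_minus_cancel)
qed

lemma cos_zero_dist: "m \<noteq> n \<Longrightarrow> norm (cos_zero m - cos_zero n) \<ge> pi"
proof -
  assume "m \<noteq> n"
  then have "\<bar>of_int m - of_int n :: real\<bar> \<ge> 1" by linarith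
  then have "\<bar>of_int m - of_int n :: real\<bar> * pi \<ge> 1 * pi" by (intro mult_right_mono) auto
  moreover have "cos_zero m - cos_zero n = of_real ((of_int m - of_int n) * pi)"
    by (simp add: cos_zero_def algebra_simps)
  ultimately show ?thesis by (simp add: norm_mult abs_mult del: of_real_mult of_real_diff)
qed

lemma nearest_cos_zero: "\<bar>Re w - Re (cos_zero \<lfloor>Re w / pi\<rfloor>)\<bar> \<le> pi / 2"
proof -
  have "of_int \<lfloor>Re w / pi\<rfloor> \<le> Re w / pi" "Re w / pi \<le> of_int \<lfloor>Re w / pi\<rfloor> + 1" by linarith+
  then have "of_int \<lfloor>Re w / pi\<rfloor> * pi \<le> Re w" "Re w \<le> (of_int \<lfloor>Re w / pi\<rfloor> + 1) * pi"
    by (simp_all only: pos_le_divide_eq[OF pi_gt_zero] pos_divide_le_eq[OF pi_gt_zero])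
  moreover have "Re (cos_zero \<lfloor>Re w / pi\<rfloor>) = of_int \<lfloor>Re w / pi\<rfloor> * pi + pi / 2" by (simp add: cos_zero_def algebra_simps)
  moreover have "(of_int \<lfloor>Re w / pi\<rfloor> + 1) * pi = of_int \<lfloor>Re w / pi\<rfloor> * pi + pi" by (simp add: algebra_simps)
  ultimately show ?thesis by linarith
qed

text \<open>Off the real axis one exponential in the cosine beats the other. Near the axis Re w
  itself stays away from the zeros, and the norm of cos w is at least |cos (Re w)|.\<close>

lemma cos_lower:
  assumes \<delta>: "0 < \<delta>" "\<delta> \<le> 1"
  obtains k where "k > 0" "\<And>w. (\<And>n. \<delta> \<le> norm (w - cos_zero n)) \<Longrightarrow> k * exp \<bar>Im w\<bar> \<le> norm (cos w)"
proof -
  define k where "k = min ((1 - exp (- \<delta>)) / 2) (sin (\<delta> / 2) / exp 1)"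
  have s0: "0 < sin (\<delta> / 2)" using \<delta> pi_gt3 by (intro sin_gt_zero) auto
  have k: "k > 0" using \<delta> s0 by (auto simp: k_def)
  show ?thesis
  proof (rule that[OF k])
    fix w assume w: "\<And>n. \<delta> \<le> norm (w - cos_zero n)"
    let ?x = "Re w" and ?y = "Im w"
    show "k * exp \<bar>?y\<bar> \<le> norm (cos w)"
    proof (cases "\<bar>?y\<bar> \<ge> \<delta> / 2")
      case True
      have "2 * cos w = exp (\<i> * w) + exp (- (\<i> * w))" by (simp add: cos_exp_eq)
      then have "2 * norm (cos w) = norm (exp (\<i> * w) + exp (- (\<i> * w)))" by (metis norm_mult norm_numeral)
      moreover have "norm (exp (\<i> * w) + exp (- (\<i> * w))) \<ge> exp \<bar>?y\<bar> - exp (- \<bar>?y\<bar>)"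
        using norm_diff_ineq[of "exp (\<i> * w)" "exp (- (\<i> * w))"] norm_diff_ineq[of "exp (- (\<i> * w))" "exp (\<i> * w)"]
        by (auto simp: abs_if add.commute)
      moreover have "exp (- \<bar>?y\<bar>) \<le> exp (- \<delta>) * exp \<bar>?y\<bar>" using True by (simp add: exp_add[symmetric])
      ultimately have "(1 - exp (- \<delta>)) / 2 * exp \<bar>?y\<bar> \<le> norm (cos w)" by (simp add: algebra_simps)
      moreover have "k * exp \<bar>?y\<bar> \<le> (1 - exp (- \<delta>)) / 2 * exp \<bar>?y\<bar>" unfolding k_def by (intro mult_right_mono min.cobounded1) simp
      ultimately show ?thesis by linarith
    next
      case False
      define n where "n = \<lfloor>?x / pi\<rfloor>"
      define v where "v = ?x - (of_int n + 1/2) * pi"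
      have v: "\<bar>v\<bar> \<le> pi / 2" using nearest_cos_zero[of w] by (simp add: v_def n_def cos_zero_def)
      have "norm (w - cos_zero n) \<le> \<bar>v\<bar> + \<bar>?y\<bar>"
        using cmod_le[of "w - cos_zero n"] by (simp add: cos_zero_def v_def)
      then have v2: "\<delta> / 2 \<le> \<bar>v\<bar>" using w[of n] False by linarith
      have "\<bar>cos ?x\<bar> = \<bar>sin v\<bar>"
      proof -
        have "?x = v + of_int n * pi + pi / 2" by (simp add: v_def algebra_simps)
        then have "cos ?x = - sin (v + of_int n * pi)" by (simp add: cos_add sin_add)
        moreover have "sin (of_int n * pi) = 0" by (simp add: sin_integer_2pi sin_int_times_real mult.commute)
        moreover have "\<bar>cos (of_int n * pi)\<bar> = 1" using \<open>sin (of_int n * pi) = 0\<close>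
          by (simp add: sin_zero_abs_cos_one)
        ultimately show ?thesis by (simp add: sin_add abs_mult)
      qed
      also have "\<bar>sin v\<bar> = sin \<bar>v\<bar>"
        using sin_ge_zero[of "\<bar>v\<bar>"] v pi_gt_zero by (cases "v \<ge> 0") auto
      also have "sin \<bar>v\<bar> \<ge> sin (\<delta> / 2)" using v v2 \<delta> by (intro sin_monotone_2pi_le) auto
      finally have c1: "sin (\<delta> / 2) \<le> \<bar>cos ?x\<bar>" .
      have "\<bar>cos ?x\<bar> ^ 2 \<le> norm (cos w) ^ 2" unfolding norm_cos_squared by simp
      then have "\<bar>cos ?x\<bar> \<le> norm (cos w)" using power2_le_imp_le norm_ge_zero by blast
      then have "sin (\<delta> / 2) \<le> norm (cos w)" using c1 by linarith
      moreover have "k * exp \<bar>?y\<bar> \<le> sin (\<delta> / 2) / exp 1 * exp 1"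
        using False \<delta> k s0 by (intro mult_mono) (auto simp: k_def)
      ultimately show ?thesis by simp
    qed
  qed
qed

lemma norm_cos_le_exp: "norm (cos w) \<le> exp \<bar>Im w\<bar>" for w :: complex
proof -
  have "2 * cos w = exp (\<i> * w) + exp (- (\<i> * w))" by (simp add: cos_exp_eq)
  then have "2 * norm (cos w) = norm (exp (\<i> * w) + exp (- (\<i> * w)))" by (metis norm_mult norm_numeral)
  also have "\<dots> \<le> exp (- Im w) + exp (Im w)" by (rule order_trans[OF norm_triangle_ineq]) simp
  also have "exp (- Im w) + exp (Im w) \<le> 2 * exp \<bar>Im w\<bar>" by (simp add: abs_if)
  finally show ?thesis by simp
qed

lemma convex_comb_self: "(1 - t) * k + t * k = (k::real)"
  by (simp add: algebra_simps)

text \<open>In the strip the derivative is bounded by exp(1/3), which is at most 1 + 1/3 + 1/9 <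
  3/2.\<close>

lemma sin_lipschitz:
  assumes "\<bar>Im w\<bar> \<le> 1/3" "\<bar>Im z\<bar> \<le> 1/3"
  shows "norm (sin w - sin z) \<le> 3/2 * norm (w - z)"
proof -
  have cv: "convex {s. \<bar>Im s\<bar> \<le> 1/3}"
  proof -
    have "{s. \<bar>Im s\<bar> \<le> 1/3} = {s. Im s \<le> 1/3} \<inter> {s. Im s \<ge> - (1/3)}" by auto
    then show ?thesis by (simp only:) (intro convex_Int convex_halfspace_Im_le convex_halfspace_Im_ge)
  qed
  show ?thesis
  proof (rule field_differentiable_bound[OF cv, where f' = cos])
    fix s assume s: "s \<in> {s. \<bar>Im s\<bar> \<le> 1/3}"
    show "(sin has_field_derivative cos s) (at s within {s. \<bar>Im s\<bar> \<le> 1/3})"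
      by (auto intro!: derivative_eq_intros)
    have "exp (1/3 :: real) \<le> 1 + 1/3 + (1/3)^2" by (rule exp_bound) auto
    then have "exp (1/3 :: real) \<le> 3/2" by (simp add: power2_eq_square)
    moreover have "exp \<bar>Im s\<bar> \<le> exp (1/3)" using s by simp
    ultimately show "norm (cos s) \<le> 3/2" using norm_cos_le_exp[of s] by linarith
  qed (use assms in auto)
qed

context cosine_like
begin

lemma obtains_ge:
  assumes "\<exists>\<rho>1. \<forall>s. \<rho>1 \<le> Re s \<longrightarrow> X s"
  obtains \<rho>1 where "\<rho>1 > \<rho>0" "\<rho>1 \<ge> B" "\<And>s. \<rho>1 \<le> Re s \<Longrightarrow> X s"
proof -
  obtain r where "\<And>s. r \<le> Re s \<Longrightarrow> X s" using assms by blast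
  then show ?thesis by (intro that[of "max (max r B) (\<rho>0 + 1)"]) auto
qed

text \<open>Since \<Phi> stretches by about \<kappa> exp(\<mu> \<rho>), a disc of this tiny radius
  is mapped onto a region containing several zeros of the cosine. The number 12 leaves room for
  radii up to 10/|H|.\<close>

lemma small_disc:
  assumes "e > 0"
  obtains \<rho>1 where "\<And>\<rho>. \<rho>1 \<le> \<rho> \<Longrightarrow> 12 / (\<kappa> * exp (\<mu> * \<rho>)) < e"
proof -
  have "((\<lambda>\<rho>. 12 / (\<kappa> * exp (\<mu> * \<rho>))) \<longlongrightarrow> 0) at_top" using kappa mu by real_asymp
  from order_tendstoD(2)[OF this assms] show ?thesis using that by (auto simp: eventually_at_top_linorder)
qed

lemma H_bounds:
  assumes "0 < e"
  obtains \<rho>1 where "\<rho>1 > \<rho>0"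
    "\<And>s. \<rho>1 \<le> Re s \<Longrightarrow> norm (H s - of_real \<kappa> * exp (of_real \<mu> * s)) \<le> e * (\<kappa> * exp (\<mu> * Re s))"
    "\<And>s. \<rho>1 \<le> Re s \<Longrightarrow> (1 - e) * (\<kappa> * exp (\<mu> * Re s)) \<le> norm (H s)"
    "\<And>s. \<rho>1 \<le> Re s \<Longrightarrow> norm (H s) \<le> (1 + e) * (\<kappa> * exp (\<mu> * Re s))"
proof -
  have n: "norm (of_real \<kappa> * exp (of_real \<mu> * s)) = \<kappa> * exp (\<mu> * Re s)" for s
    using kappa by (simp add: norm_mult)
  have "\<exists>\<rho>1. \<forall>s. \<rho>1 \<le> Re s \<longrightarrow> norm (H s - of_real \<kappa> * exp (of_real \<mu> * s)) \<le> (e * \<kappa>) * exp (\<mu> * Re s)"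
    using assms kappa by (intro Hasy) auto
  from obtains_ge[OF this, of 0] obtain r where r: "r > \<rho>0"
    and c: "\<And>s. r \<le> Re s \<Longrightarrow> norm (H s - of_real \<kappa> * exp (of_real \<mu> * s)) \<le> (e * \<kappa>) * exp (\<mu> * Re s)" by metis
  show ?thesis
  proof (rule that[OF r])
    fix s assume s: "r \<le> Re s"
    show "norm (H s - of_real \<kappa> * exp (of_real \<mu> * s)) \<le> e * (\<kappa> * exp (\<mu> * Re s))"
      using c[OF s] by (simp add: mult.assoc)
    then show "(1 - e) * (\<kappa> * exp (\<mu> * Re s)) \<le> norm (H s)" "norm (H s) \<le> (1 + e) * (\<kappa> * exp (\<mu> * Re s))"
      using norm_triangle_ineq2[of "of_real \<kappa> * exp (of_real \<mu> * s)" "H s"]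
        norm_triangle_ineq2[of "H s" "of_real \<kappa> * exp (of_real \<mu> * s)"]
      unfolding n by (simp_all add: norm_minus_commute algebra_simps)
  qed
qed

text \<open>On such a disc exp(\<mu> s) changes only by a factor within 1/200 of 1. Hence H is
  almost constant and its primitive \<Phi> almost affine.\<close>

lemma Phi_linear:
  obtains \<rho>1 where "\<rho>1 > \<rho>0"
    "\<And>s0. \<rho>1 \<le> Re s0 \<Longrightarrow> 9/10 * (\<kappa> * exp (\<mu> * Re s0)) \<le> norm (H s0)"
    "\<And>s0. \<rho>1 \<le> Re s0 \<Longrightarrow> norm (H s0) \<le> 11/10 * (\<kappa> * exp (\<mu> * Re s0))"
    "\<And>s s0. \<rho>1 \<le> Re s0 \<Longrightarrow> norm (s - s0) \<le> 12 / (\<kappa> * exp (\<mu> * Re s0)) \<Longrightarrow> norm (H s - H s0) \<le> 1/20 * norm (H s0)"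
    "\<And>s s0. \<rho>1 \<le> Re s0 \<Longrightarrow> norm (s - s0) \<le> 12 / (\<kappa> * exp (\<mu> * Re s0)) \<Longrightarrow> Re s > \<rho>0"
    "\<And>s s0. \<rho>1 \<le> Re s0 \<Longrightarrow> norm (s - s0) \<le> 12 / (\<kappa> * exp (\<mu> * Re s0)) \<Longrightarrow>
       norm (\<Phi> s - \<Phi> s0 - H s0 * (s - s0)) \<le> 1/20 * norm (H s0) * norm (s - s0)"
proof -
  obtain r1 where r1: "r1 > \<rho>0"
    and a: "\<And>s. r1 \<le> Re s \<Longrightarrow> norm (H s - of_real \<kappa> * exp (of_real \<mu> * s)) \<le> 1/200 * (\<kappa> * exp (\<mu> * Re s))"
    and lo: "\<And>s. r1 \<le> Re s \<Longrightarrow> (1 - 1/200) * (\<kappa> * exp (\<mu> * Re s)) \<le> norm (H s)"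
    and up: "\<And>s. r1 \<le> Re s \<Longrightarrow> norm (H s) \<le> (1 + 1/200) * (\<kappa> * exp (\<mu> * Re s))"
    using H_bounds[of "1/200"] by auto
  have "((\<lambda>z::complex. exp z) \<longlongrightarrow> exp 0) (at 0)" by (intro tendsto_intros)
  then have "\<forall>\<^sub>F z in at (0::complex). dist (exp z) (exp 0) < 1/200" by (rule tendstoD) simp
  then obtain d where d: "d > 0" "\<And>z::complex. z \<noteq> 0 \<Longrightarrow> norm z < d \<Longrightarrow> norm (exp z - 1) < 1/200"
    by (auto simp: eventually_at dist_norm)
  have d': "norm (exp z - 1) \<le> 1/200" if "norm z < d" for z :: complex
    using d(2)[of z] that by (cases "z = 0") auto
  define e0 where "e0 = min (d / \<mu>) 1"
  have e0: "e0 > 0" using d mu by (simp add: e0_def)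
  obtain r2 where r2: "\<And>\<rho>. r2 \<le> \<rho> \<Longrightarrow> 12 / (\<kappa> * exp (\<mu> * \<rho>)) < e0" using small_disc[OF e0] by auto
  define r where "r = max (r1 + 1) r2"
  have pos: "\<kappa> * exp (\<mu> * Re s) > 0" for s using kappa by simp
  have near: "r1 \<le> Re s" if "r \<le> Re s0" "norm (s - s0) \<le> 12 / (\<kappa> * exp (\<mu> * Re s0))" for s s0
  proof -
    have "norm (s - s0) \<le> 1" using r2[of "Re s0"] that by (simp add: r_def e0_def)
    then have "\<bar>Re (s - s0)\<bar> \<le> 1" using abs_Re_le_cmod order_trans by blast
    moreover have "r1 + 1 \<le> Re s0" using that(1) by (simp add: r_def)
    ultimately show ?thesis unfolding minus_complex.sel by linarith
  qed
  have HH: "norm (H s - H s0) \<le> 1/20 * norm (H s0)"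
    if s: "r \<le> Re s0" "norm (s - s0) \<le> 12 / (\<kappa> * exp (\<mu> * Re s0))" for s s0
  proof -
    let ?K = "\<kappa> * exp (\<mu> * Re s0)"
    have rs: "r1 \<le> Re s" "r1 \<le> Re s0" using near[OF s] s(1) by (auto simp: r_def)
    have "norm (s - s0) < d / \<mu>" using r2[of "Re s0"] s by (simp add: r_def e0_def)
    then have "norm (of_real \<mu> * (s - s0)) < d" using mu by (simp add: norm_mult pos_less_divide_eq mult.commute)
    then have ex: "norm (exp (of_real \<mu> * (s - s0)) - 1) \<le> 1/200" by (rule d')
    have eq: "of_real \<kappa> * exp (of_real \<mu> * s) - of_real \<kappa> * exp (of_real \<mu> * s0)
       = of_real \<kappa> * exp (of_real \<mu> * s0) * (exp (of_real \<mu> * (s - s0)) - 1)"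
      by (simp add: algebra_simps exp_diff)
    have 1: "norm (of_real \<kappa> * exp (of_real \<mu> * s) - of_real \<kappa> * exp (of_real \<mu> * s0)) \<le> ?K * (1/200)"
      unfolding eq norm_mult using ex kappa by (intro mult_mono) auto
    have "norm (exp (of_real \<mu> * (s - s0))) \<le> 2"
      using ex norm_triangle_ineq2[of "exp (of_real \<mu> * (s - s0))" 1] by simp
    then have "exp (\<mu> * (Re s - Re s0)) \<le> 2" by simp
    then have "?K * exp (\<mu> * (Re s - Re s0)) \<le> ?K * 2" using kappa by (intro mult_left_mono) auto
    then have 2: "\<kappa> * exp (\<mu> * Re s) \<le> 2 * ?K" by (simp add: algebra_simps exp_diff)
    have tri: "norm (x - y + z) \<le> norm x + norm y + norm z" for x y z :: complex
      using norm_triangle_ineq[of "x - y" z] norm_triangle_ineq4[of x y] by linarith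
    have "H s - H s0 = (H s - of_real \<kappa> * exp (of_real \<mu> * s)) - (H s0 - of_real \<kappa> * exp (of_real \<mu> * s0))
       + (of_real \<kappa> * exp (of_real \<mu> * s) - of_real \<kappa> * exp (of_real \<mu> * s0))" by simp
    then have "norm (H s - H s0) \<le> norm (H s - of_real \<kappa> * exp (of_real \<mu> * s)) + norm (H s0 - of_real \<kappa> * exp (of_real \<mu> * s0))
       + norm (of_real \<kappa> * exp (of_real \<mu> * s) - of_real \<kappa> * exp (of_real \<mu> * s0))"
      by (simp only: tri)
    also have "\<dots> \<le> 1/200 * (2 * ?K) + 1/200 * ?K + ?K * (1/200)"
      using a[OF rs(1)] a[OF rs(2)] 1 2 by linarith
    also have "\<dots> \<le> 1/20 * ((1 - 1/200) * ?K)" using pos[of s0] by simp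
    also have "\<dots> \<le> 1/20 * norm (H s0)" using lo[OF rs(2)] by linarith
    finally show ?thesis .
  qed
  show ?thesis
  proof (rule that[of r])
    show "r > \<rho>0" using r1 by (simp add: r_def)
    show "9/10 * (\<kappa> * exp (\<mu> * Re s0)) \<le> norm (H s0)" "norm (H s0) \<le> 11/10 * (\<kappa> * exp (\<mu> * Re s0))" if "r \<le> Re s0" for s0
      using lo[of s0] up[of s0] pos[of s0] that by (simp_all add: r_def)
    fix s s0 assume s: "r \<le> Re s0" "norm (s - s0) \<le> 12 / (\<kappa> * exp (\<mu> * Re s0))"
    show "norm (H s - H s0) \<le> 1/20 * norm (H s0)" by (rule HH[OF s])
    show "Re s > \<rho>0" using near[OF s] r1 by simp
    have cb: "norm (x - s0) \<le> 12 / (\<kappa> * exp (\<mu> * Re s0))" if "x \<in> cball s0 (norm (s - s0))" for x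
      using that s(2) by (simp add: dist_norm norm_minus_commute)
    have "norm ((\<Phi> s - H s0 * s) - (\<Phi> s0 - H s0 * s0)) \<le> 1/20 * norm (H s0) * norm (s - s0)"
    proof (rule field_differentiable_bound[of "cball s0 (norm (s - s0))"])
      fix x assume x: "x \<in> cball s0 (norm (s - s0))"
      have "Re x > \<rho>0" using near[OF s(1) cb[OF x]] r1 by simp
      then have "((\<lambda>x. \<Phi> x - H s0 * x) has_field_derivative H x - H s0) (at x)"
        by (auto intro!: derivative_eq_intros dPhi)
      then show "((\<lambda>x. \<Phi> x - H s0 * x) has_field_derivative H x - H s0) (at x within cball s0 (norm (s - s0)))"
        by (rule has_field_derivative_at_within)
      show "norm (H x - H s0) \<le> 1/20 * norm (H s0)" by (rule HH[OF s(1) cb[OF x]])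
    qed (auto simp: dist_norm norm_minus_commute)
    then show "norm (\<Phi> s - \<Phi> s0 - H s0 * (s - s0)) \<le> 1/20 * norm (H s0) * norm (s - s0)"
      by (simp add: algebra_simps)
  qed
qed

lemma Phi_ratio:
  assumes "norm (\<Phi> s - \<Phi> s0 - H s0 * (s - s0)) \<le> 1/20 * norm (H s0) * norm (s - s0)"
  shows "norm (\<Phi> s - \<Phi> s0) \<ge> 19/20 * (norm (H s0) * norm (s - s0))"
    and "norm (\<Phi> s - \<Phi> s0) \<le> 21/20 * (norm (H s0) * norm (s - s0))"
  using assms norm_triangle_ineq2[of "H s0 * (s - s0)" "\<Phi> s - \<Phi> s0"] norm_triangle_ineq2[of "\<Phi> s - \<Phi> s0" "H s0 * (s - s0)"]
  by (auto simp: norm_mult norm_minus_commute)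

lemma Re_H:
  obtains \<rho>1 where "\<rho>1 > \<rho>0"
    "\<And>s. \<rho>1 \<le> Re s \<Longrightarrow> \<bar>Im s\<bar> \<le> pi / (3 * \<mu>) \<Longrightarrow> \<kappa> / 4 * exp (\<mu> * Re s) \<le> Re (H s)"
proof -
  obtain r where r: "r > \<rho>0" and cl: "\<And>s. r \<le> Re s \<Longrightarrow> norm (H s - of_real \<kappa> * exp (of_real \<mu> * s)) \<le> \<kappa> / 4 * exp (\<mu> * Re s)"
    using obtains_ge[OF Hasy[of "\<kappa> / 4"]] kappa by (metis divide_pos_pos zero_less_numeral)
  have "\<mu> > 0" using mu by simp
  from that[OF r] Re_ge_of_close[OF this kappa _ cl] show ?thesis by blast
qed

text \<open>A quantitative form of the classical fact that a derivative with positive real part on a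
  convex set makes a function injective: along a segment with direction v the derivative of Re (cnj
  v * \<Phi>) is |v|^2 Re H.\<close>

lemma Phi_expanding:
  assumes R: "\<And>s. \<rho>1 \<le> Re s \<Longrightarrow> \<bar>Im s\<bar> \<le> pi / (3 * \<mu>) \<Longrightarrow> \<kappa> / 4 * exp (\<mu> * Re s) \<le> Re (H s)" "\<rho>1 > \<rho>0"
    and s: "\<rho>1 \<le> Re s" "Re s \<le> Re s'" "\<bar>Im s\<bar> \<le> pi / (3 * \<mu>)" "\<bar>Im s'\<bar> \<le> pi / (3 * \<mu>)"
  shows "\<kappa> / 4 * exp (\<mu> * Re s) * norm (s' - s) \<le> norm (\<Phi> s' - \<Phi> s)"
proof -
  define v where "v = s' - s"
  define K where "K = \<kappa> / 4 * exp (\<mu> * Re s)"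
  define y where "y = (\<lambda>t. Re (cnj v * \<Phi> (s + of_real t * v)) - K * (norm v)\<^sup>2 * t)"
  have "y 0 \<le> y 1"
  proof (rule DERIV_nonneg_imp_nondecreasing[of 0 1])
    fix t :: real assume t: "0 \<le> t" "t \<le> 1"
    let ?x = "s + of_real t * v"
    have tr: "Re s \<le> Re ?x" using t s by (simp add: v_def)
    have "Im ?x = (1 - t) * Im s + t * Im s'" by (simp add: v_def algebra_simps)
    moreover have "\<bar>(1 - t) * Im s + t * Im s'\<bar> \<le> (1 - t) * (pi / (3 * \<mu>)) + t * (pi / (3 * \<mu>))"
    proof (rule order_trans[OF abs_triangle_ineq add_mono])
      show "\<bar>(1 - t) * Im s\<bar> \<le> (1 - t) * (pi / (3 * \<mu>))" "\<bar>t * Im s'\<bar> \<le> t * (pi / (3 * \<mu>))"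
        unfolding abs_mult using s t by (intro mult_mono; simp)+
    qed
    moreover have "(1 - t) * (pi / (3 * \<mu>)) + t * (pi / (3 * \<mu>)) = pi / (3 * \<mu>)"
      by (rule convex_comb_self)
    ultimately have ti: "\<bar>Im ?x\<bar> \<le> pi / (3 * \<mu>)" by (simp only:)
    have x0: "Re ?x > \<rho>0" using tr s R(2) by linarith
    have "K \<le> \<kappa> / 4 * exp (\<mu> * Re ?x)" unfolding K_def using tr kappa mu by (intro mult_left_mono) (auto intro!: mult_left_mono)
    also have "\<dots> \<le> Re (H ?x)" using tr ti s by (intro R) auto
    finally have KH: "K \<le> Re (H ?x)" .
    have p: "((\<lambda>t. s + of_real t * v) has_vector_derivative v) (at t)" by (auto intro!: derivative_eq_intros)
    have "((\<lambda>x. cnj v * \<Phi> x) has_field_derivative cnj v * H ?x) (at ?x)"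
      by (auto intro!: derivative_eq_intros dPhi[OF x0])
    from bounded_linear.has_vector_derivative[OF bounded_linear_Re field_vector_diff_chain_at[OF p this]]
    have "((\<lambda>t. Re (cnj v * \<Phi> (s + of_real t * v))) has_real_derivative Re (v * (cnj v * H ?x))) (at t)"
      by (simp add: o_def has_real_derivative_iff_has_vector_derivative)
    then have "(y has_real_derivative Re (v * (cnj v * H ?x)) - K * (norm v)\<^sup>2) (at t)"
      unfolding y_def by (intro DERIV_diff DERIV_cmult_Id)
    moreover have "v * (cnj v * H ?x) = of_real ((norm v)\<^sup>2) * H ?x" by (simp only: complex_norm_square mult.assoc)
    moreover have "K * (norm v)\<^sup>2 \<le> (norm v)\<^sup>2 * Re (H ?x)" using mult_left_mono[OF KH, of "(norm v)\<^sup>2"] by (simp add: mult.commute)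
    ultimately show "\<exists>d. (y has_real_derivative d) (at t) \<and> 0 \<le> d"
      by (metis Re_complex_of_real Im_complex_of_real diff_ge_0_iff_ge times_complex.sel(1) mult_zero_left diff_zero)
  qed simp
  then have "K * (norm v)\<^sup>2 \<le> Re (cnj v * (\<Phi> s' - \<Phi> s))" by (simp add: y_def v_def algebra_simps)
  also have "\<dots> \<le> norm v * norm (\<Phi> s' - \<Phi> s)" by (metis complex_Re_le_cmod norm_mult complex_mod_cnj)
  finally have "norm v * (K * norm v) \<le> norm v * norm (\<Phi> s' - \<Phi> s)" by (simp add: power2_eq_square algebra_simps)
  then show ?thesis unfolding K_def v_def by (cases "s' = s") auto
qed

text \<open>One constant appears in both conclusions so that they can be played off against each
  other: at a zero of the cosine \<open>u\<close> is at most c/2, on a suitable circle around it at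
  least c.\<close>

lemma near_cos_zero:
  assumes d: "0 < \<delta>" "\<delta> \<le> 1"
  obtains \<rho>1 c where "\<rho>1 > \<rho>0" "c > 0"
    "\<And>s. \<rho>1 \<le> Re s \<Longrightarrow> \<bar>Im s\<bar> \<le> 2 * pi / (3 * \<mu>) \<Longrightarrow> (\<forall>n. \<delta> \<le> norm (\<Phi> s - cos_zero n)) \<Longrightarrow> c \<le> norm (u s)"
    "\<And>s. \<rho>1 \<le> Re s \<Longrightarrow> \<bar>Im s\<bar> \<le> 2 * pi / (3 * \<mu>) \<Longrightarrow> norm (u s - cos (\<Phi> s)) \<le> c / 2 * exp \<bar>Im (\<Phi> s)\<bar>"
proof -
  obtain k where k: "k > 0" and kc: "\<And>w. (\<And>n. \<delta> \<le> norm (w - cos_zero n)) \<Longrightarrow> k * exp \<bar>Im w\<bar> \<le> norm (cos w)"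
    using cos_lower[OF d] by metis
  have "k / 4 > 0" using k by simp
  from obtains_ge[OF u_cos[OF this], of 0] obtain r where r: "r > \<rho>0"
    and uc: "\<And>s. r \<le> Re s \<Longrightarrow> \<bar>Im s\<bar> \<le> 2 * pi / (3 * \<mu>) \<longrightarrow> norm (u s - cos (\<Phi> s)) \<le> k / 4 * exp \<bar>Im (\<Phi> s)\<bar>"
    by metis
  show ?thesis
  proof (rule that[OF r, of "k / 2"])
    fix s assume s: "r \<le> Re s" "\<bar>Im s\<bar> \<le> 2 * pi / (3 * \<mu>)"
    show "norm (u s - cos (\<Phi> s)) \<le> k / 2 / 2 * exp \<bar>Im (\<Phi> s)\<bar>" using uc s by simp
    assume n: "\<forall>n. \<delta> \<le> norm (\<Phi> s - cos_zero n)"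
    have "k * exp \<bar>Im (\<Phi> s)\<bar> \<le> norm (cos (\<Phi> s))" by (rule kc[OF n[rule_format]])
    moreover have "norm (u s - cos (\<Phi> s)) \<le> k / 4 * exp \<bar>Im (\<Phi> s)\<bar>" using uc s by simp
    moreover have "norm (cos (\<Phi> s)) - norm (u s - cos (\<Phi> s)) \<le> norm (u s)"
      using norm_triangle_ineq2[of "cos (\<Phi> s)" "cos (\<Phi> s) - u s"] by (simp add: norm_minus_commute)
    moreover have "k * 1 \<le> k * exp \<bar>Im (\<Phi> s)\<bar>" using k by (intro mult_left_mono) auto
    ultimately show "k / 2 \<le> norm (u s)" using k by argo
  qed (use k in auto)
qed

text \<open>At a zero of \<open>u\<close> the phase is near a zero of the cosine, where the sine has
  modulus 1. So V stays away from 0, which both makes the zero simple and later bounds the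
  coefficient of the double pole.\<close>

lemma zeros:
  assumes d: "0 < \<delta>" "\<delta> \<le> 1/20"
  obtains \<rho>1 where "\<rho>1 > \<rho>0"
    "\<And>s. \<rho>1 \<le> Re s \<Longrightarrow> \<bar>Im s\<bar> \<le> 2 * pi / (3 * \<mu>) \<Longrightarrow> u s = 0 \<Longrightarrow> \<exists>n. norm (\<Phi> s - cos_zero n) < \<delta>"
    "\<And>s. \<rho>1 \<le> Re s \<Longrightarrow> \<bar>Im s\<bar> \<le> 2 * pi / (3 * \<mu>) \<Longrightarrow> u s = 0 \<Longrightarrow> \<bar>Im s\<bar> \<le> pi / (3 * \<mu>)"
    "\<And>s. \<rho>1 \<le> Re s \<Longrightarrow> \<bar>Im s\<bar> \<le> 2 * pi / (3 * \<mu>) \<Longrightarrow> u s = 0 \<Longrightarrow> 1/2 \<le> norm (V s)"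
proof -
  obtain r1 c where r1: "r1 > \<rho>0" "c > 0"
    and lo: "\<And>s. r1 \<le> Re s \<Longrightarrow> \<bar>Im s\<bar> \<le> 2 * pi / (3 * \<mu>) \<Longrightarrow> (\<forall>n. \<delta> \<le> norm (\<Phi> s - cos_zero n)) \<Longrightarrow> c \<le> norm (u s)"
    by (rule near_cos_zero[of \<delta>]) (use d in simp, use d in simp, rule that, assumption+)
  obtain k k' r2 where k: "k > 0" and
    out: "\<And>s. r2 \<le> Re s \<Longrightarrow> pi / (3 * \<mu>) \<le> \<bar>Im s\<bar> \<Longrightarrow> \<bar>Im s\<bar> \<le> 2 * pi / (3 * \<mu>) \<Longrightarrow> k * exp (k' * exp (\<mu> * Re s)) \<le> norm (u s)"
    using outer by blast
  obtain r3 where r3: "r3 > \<rho>0" and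
    Vs: "\<And>s. r3 \<le> Re s \<Longrightarrow> \<bar>Im s\<bar> \<le> 2 * pi / (3 * \<mu>) \<longrightarrow> norm (V s + sin (\<Phi> s)) \<le> 1/10 * exp \<bar>Im (\<Phi> s)\<bar>"
    using obtains_ge[OF V_sin[of "1/10"], of 0] by auto
  show ?thesis
  proof (rule that[of "max r1 (max r2 r3)"])
    fix s assume s: "max r1 (max r2 r3) \<le> Re s" "\<bar>Im s\<bar> \<le> 2 * pi / (3 * \<mu>)" "u s = 0"
    show ex: "\<exists>n. norm (\<Phi> s - cos_zero n) < \<delta>"
    proof (rule ccontr)
      assume "\<not> ?thesis"
      then have "c \<le> norm (u s)" using s by (intro lo) (auto simp: not_less)
      then show False using s r1 by simp
    qed
    show "\<bar>Im s\<bar> \<le> pi / (3 * \<mu>)"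
    proof (rule ccontr)
      assume "\<not> ?thesis"
      then have "k * exp (k' * exp (\<mu> * Re s)) \<le> norm (u s)" using s by (intro out) auto
      moreover have "0 < k * exp (k' * exp (\<mu> * Re s))" using k by simp
      ultimately show False using s by simp
    qed
    from ex obtain n where n: "norm (\<Phi> s - cos_zero n) < \<delta>" by blast
    have "\<bar>Im (\<Phi> s - cos_zero n)\<bar> < \<delta>" using abs_Im_le_cmod n by (rule order_le_less_trans)
    then have im: "\<bar>Im (\<Phi> s)\<bar> \<le> 1/3" using d by (simp add: cos_zero_def)
    have "norm (sin (\<Phi> s) - sin (cos_zero n)) \<le> 3/2 * norm (\<Phi> s - cos_zero n)"
      by (rule sin_lipschitz) (use im in \<open>auto simp: cos_zero_def\<close>)
    then have "norm (sin (\<Phi> s)) \<ge> 1 - 3/2 * (1/20)"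
      using n d sin_cos_zero[of n] norm_triangle_ineq2[of "sin (cos_zero n)" "sin (\<Phi> s)"]
      by (simp add: norm_minus_commute)
    moreover have "norm (V s + sin (\<Phi> s)) \<le> 1/10 * (3/2)"
    proof -
      have "exp (1/3 :: real) \<le> 1 + 1/3 + (1/3)^2" by (rule exp_bound) auto
      then have "exp (1/3 :: real) \<le> 3/2" by (simp add: power2_eq_square)
      then have "exp \<bar>Im (\<Phi> s)\<bar> \<le> 3/2" using im by (meson exp_le_cancel_iff order_trans)
      then show ?thesis using Vs[of s] s by simp
    qed
    moreover have "norm (sin (\<Phi> s)) \<le> norm (V s + sin (\<Phi> s)) + norm (V s)"
      using norm_triangle_ineq4[of "V s + sin (\<Phi> s)" "V s"] by simp
    ultimately show "1/2 \<le> norm (V s)" by linarith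
  qed (use r1 in auto)
qed

text \<open>The minimum modulus principle is used twice: from a point with real \<Phi> to a nearby
  point where \<Phi> is exactly a zero of the cosine, and from there to a zero of
  \<open>u\<close>.\<close>

lemma ex_zeros:
  obtains \<rho>1 where "\<rho>1 > \<rho>0" "\<And>\<rho>. \<rho>1 \<le> \<rho> \<Longrightarrow> \<exists>s. \<rho> \<le> Re s \<and> \<bar>Im s\<bar> \<le> 2 * pi / (3 * \<mu>) \<and> u s = 0"
proof -
  have m: "\<mu> > 0" using mu by simp
  obtain r1 where r1: "r1 > \<rho>0"
    and H1: "\<And>s0. r1 \<le> Re s0 \<Longrightarrow> 9/10 * (\<kappa> * exp (\<mu> * Re s0)) \<le> norm (H s0)"
    and dom: "\<And>s s0. r1 \<le> Re s0 \<Longrightarrow> norm (s - s0) \<le> 12 / (\<kappa> * exp (\<mu> * Re s0)) \<Longrightarrow> Re s > \<rho>0"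
    and lin: "\<And>s s0. r1 \<le> Re s0 \<Longrightarrow> norm (s - s0) \<le> 12 / (\<kappa> * exp (\<mu> * Re s0)) \<Longrightarrow>
       norm (\<Phi> s - \<Phi> s0 - H s0 * (s - s0)) \<le> 1/20 * norm (H s0) * norm (s - s0)"
    by (rule Phi_linear) (rule that, assumption+)
  obtain r2 c where r2: "r2 > \<rho>0" "c > 0"
    and lo: "\<And>s. r2 \<le> Re s \<Longrightarrow> \<bar>Im s\<bar> \<le> 2 * pi / (3 * \<mu>) \<Longrightarrow> (\<forall>n. 1/10 \<le> norm (\<Phi> s - cos_zero n)) \<Longrightarrow> c \<le> norm (u s)"
    and uc: "\<And>s. r2 \<le> Re s \<Longrightarrow> \<bar>Im s\<bar> \<le> 2 * pi / (3 * \<mu>) \<Longrightarrow> norm (u s - cos (\<Phi> s)) \<le> c / 2 * exp \<bar>Im (\<Phi> s)\<bar>"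
    by (rule near_cos_zero[of "1/10"]) (simp, simp, rule that, assumption+)
  obtain r3 where r3: "\<And>\<rho>. r3 \<le> \<rho> \<Longrightarrow> 12 / (\<kappa> * exp (\<mu> * \<rho>)) < min (1/2) (pi / (6 * \<mu>))"
    using small_disc[of "min (1/2) (pi / (6 * \<mu>))"] m by auto
  obtain r4 where r4: "\<And>\<rho>. r4 \<le> \<rho> \<Longrightarrow> Im (\<Phi> (Complex \<rho> (- (pi / (3 * \<mu>))))) \<le> 0 \<and> 0 \<le> Im (\<Phi> (Complex \<rho> (pi / (3 * \<mu>))))"
    using Im_ends by blast
  define R where "R = max (max r1 r2) (max r3 r4)"
  have radius: "k / norm (H s) \<le> 12 / (\<kappa> * exp (\<mu> * Re s))" if "r1 \<le> Re s" "0 \<le> k" "k \<le> 10" for s and k :: real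
  proof -
    have K: "\<kappa> * exp (\<mu> * Re s) > 0" using kappa by simp
    then have "k / norm (H s) \<le> 10 / (9/10 * (\<kappa> * exp (\<mu> * Re s)))"
      using H1[OF that(1)] that by (intro frac_le) auto
    also have "\<dots> \<le> 12 / (\<kappa> * exp (\<mu> * Re s))" using K by (simp add: field_simps)
    finally show ?thesis .
  qed
  have Hpos: "norm (H s) > 0" if "r1 \<le> Re s" for s
  proof -
    have "0 < 9/10 * (\<kappa> * exp (\<mu> * Re s))" using kappa by simp
    then show ?thesis using H1[OF that] by linarith
  qed
  have "\<exists>s. \<rho> - 1 \<le> Re s \<and> \<bar>Im s\<bar> \<le> 2 * pi / (3 * \<mu>) \<and> u s = 0" if \<rho>: "R + 1 \<le> \<rho>" for \<rho>
  proof -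
    define y where "y = (\<lambda>t. Im (\<Phi> (Complex \<rho> t)))"
    have \<rho>': "r1 + 1 \<le> \<rho>" "r2 + 1 \<le> \<rho>" "r3 + 1 \<le> \<rho>" "r4 + 1 \<le> \<rho>" using \<rho> by (auto simp: R_def)
    have "continuous_on {- (pi / (3 * \<mu>))..pi / (3 * \<mu>)} y"
    proof -
      have c: "continuous_on {s. Re s > \<rho>0} \<Phi>"
        by (intro continuous_at_imp_continuous_on ballI DERIV_isCont[OF dPhi]) auto
      have "\<rho>0 < \<rho>" using \<rho>'(1) r1 by linarith
      then have "continuous_on {- (pi / (3 * \<mu>))..pi / (3 * \<mu>)} (\<lambda>t. \<Phi> (of_real \<rho> + \<i> * of_real t))"
        by (intro continuous_on_compose2[OF c] continuous_intros) auto
      then show ?thesis unfolding y_def Complex_eq by (rule continuous_on_Im)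
    qed
    then obtain t0 where t0: "- (pi / (3 * \<mu>)) \<le> t0" "t0 \<le> pi / (3 * \<mu>)" "y t0 = 0"
      using IVT'[of y "- (pi / (3 * \<mu>))" 0 "pi / (3 * \<mu>)"] r4[of \<rho>] \<rho>' m unfolding y_def by auto
    define s0 where "s0 = Complex \<rho> t0"
    have s0: "Re s0 = \<rho>" "\<bar>Im s0\<bar> \<le> pi / (3 * \<mu>)" "Im (\<Phi> s0) = 0" using t0 by (auto simp: s0_def y_def)
    have rs0: "r1 \<le> Re s0" using \<rho>' s0 by simp
    define n where "n = \<lfloor>Re (\<Phi> s0) / pi\<rfloor>"
    have "\<Phi> s0 - cos_zero n = of_real (Re (\<Phi> s0) - Re (cos_zero n))"
      using s0 by (simp add: complex_eq_iff cos_zero_def)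
    then have n: "norm (\<Phi> s0 - cos_zero n) \<le> pi / 2"
      using nearest_cos_zero[of "\<Phi> s0"] by (simp only: n_def norm_of_real)
    \<comment> \<open>On this circle \<Phi> has moved by at least 19/20 * 5 > pi, whereas at the
      centre it is within pi/2 of \<open>cos_zero n\<close>.\<close>
    define \<epsilon>1 where "\<epsilon>1 = 5 / norm (H s0)"
    have \<epsilon>1: "\<epsilon>1 > 0" using Hpos[OF rs0] by (simp add: \<epsilon>1_def)
    have e1r: "\<epsilon>1 \<le> 12 / (\<kappa> * exp (\<mu> * Re s0))" using radius[OF rs0, of 5] by (simp add: \<epsilon>1_def)
    have cont1: "continuous_on (cball s0 \<epsilon>1) (\<lambda>s. \<Phi> s - cos_zero n)"
    proof (intro continuous_intros continuous_at_imp_continuous_on ballI)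
      fix x assume "x \<in> cball s0 \<epsilon>1"
      then have "norm (x - s0) \<le> 12 / (\<kappa> * exp (\<mu> * Re s0))" using e1r by (simp add: dist_norm norm_minus_commute)
      then show "isCont \<Phi> x" using DERIV_isCont[OF dPhi[OF dom[OF rs0]]] by blast
    qed
    have hol1: "(\<lambda>s. \<Phi> s - cos_zero n) holomorphic_on ball s0 \<epsilon>1"
    proof (intro holomorphic_intros)
      show "\<Phi> holomorphic_on ball s0 \<epsilon>1"
      proof (rule holomorphic_onI)
        fix x assume "x \<in> ball s0 \<epsilon>1"
        then have "norm (x - s0) \<le> 12 / (\<kappa> * exp (\<mu> * Re s0))" using e1r by (simp add: dist_norm norm_minus_commute)
        then show "\<Phi> field_differentiable (at x within ball s0 \<epsilon>1)"
          using dPhi[OF dom[OF rs0]] field_differentiable_at_within field_differentiable_def by blast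
      qed
    qed
    obtain s1 where s1: "s1 \<in> ball s0 \<epsilon>1" "\<Phi> s1 - cos_zero n = 0"
    proof (rule holomorphic_contract_to_zero[OF cont1 hol1 \<epsilon>1])
      fix z assume z: "norm (s0 - z) = \<epsilon>1"
      then have z': "norm (z - s0) = \<epsilon>1" by (simp add: norm_minus_commute)
      have "19/20 * (norm (H s0) * norm (z - s0)) \<le> norm (\<Phi> z - \<Phi> s0)"
        by (rule Phi_ratio(1)[OF lin[OF rs0]]) (use z' e1r in simp)
      moreover have "norm (H s0) * norm (z - s0) = 5" using z' Hpos[OF rs0] by (simp add: \<epsilon>1_def)
      moreover have "norm (\<Phi> z - \<Phi> s0) \<le> norm (\<Phi> z - cos_zero n) + norm (\<Phi> s0 - cos_zero n)"
        using norm_triangle_ineq4[of "\<Phi> z - cos_zero n" "\<Phi> s0 - cos_zero n"] by simp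
      ultimately show "norm (\<Phi> s0 - cos_zero n) < norm (\<Phi> z - cos_zero n)" using n pi_less_4 by linarith
    qed
    have "norm (s1 - s0) \<le> \<epsilon>1" using s1 by (simp add: dist_norm norm_minus_commute)
    then have d1: "norm (s1 - s0) < min (1/2) (pi / (6 * \<mu>))" using e1r r3[of "Re s0"] \<rho>' s0 by simp
    have rs1: "\<rho> - 1/2 \<le> Re s1" "r1 \<le> Re s1" using abs_Re_le_cmod[of "s1 - s0"] d1 s0 \<rho>' by auto
    \<comment> \<open>On this circle \<Phi> is at distance between 19/20 and 21/20 from
      \<open>cos_zero n\<close>, hence at least 1/10 away from every zero of the cosine, these being
      pi apart.\<close>
    define \<epsilon>2 where "\<epsilon>2 = 1 / norm (H s1)"
    have \<epsilon>2: "\<epsilon>2 > 0" using Hpos[OF rs1(2)] by (simp add: \<epsilon>2_def)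
    have e2r: "\<epsilon>2 \<le> 12 / (\<kappa> * exp (\<mu> * Re s1))" using radius[OF rs1(2), of 1] by (simp add: \<epsilon>2_def)
    have e2s: "\<epsilon>2 < min (1/2) (pi / (6 * \<mu>))" using e2r r3[of "Re s1"] rs1 \<rho>' by simp
    have loc: "\<rho> - 1 \<le> Re x \<and> \<bar>Im x\<bar> \<le> 2 * pi / (3 * \<mu>)" if "norm (x - s1) \<le> \<epsilon>2" for x
    proof -
      have "\<bar>Re (x - s1)\<bar> \<le> 1/2" using abs_Re_le_cmod[of "x - s1"] that e2s by simp
      then have 1: "\<rho> - 1 \<le> Re x" using rs1(1) unfolding minus_complex.sel by linarith
      have "\<bar>Im (x - s1)\<bar> \<le> pi / (6 * \<mu>)" using abs_Im_le_cmod[of "x - s1"] that e2s by simp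
      moreover have "\<bar>Im (s1 - s0)\<bar> \<le> pi / (6 * \<mu>)" using abs_Im_le_cmod[of "s1 - s0"] d1 by simp
      moreover have "pi / (6 * \<mu>) + pi / (6 * \<mu>) + pi / (3 * \<mu>) = 2 * pi / (3 * \<mu>)" using m by (simp add: field_simps)
      ultimately show ?thesis using 1 s0(2) unfolding minus_complex.sel by linarith
    qed
    have dom2: "Re x > \<rho>0" if "norm (x - s1) \<le> \<epsilon>2" for x using loc[OF that] \<rho>' r1 by linarith
    have cont2: "continuous_on (cball s1 \<epsilon>2) u"
      by (intro continuous_at_imp_continuous_on ballI DERIV_isCont[OF du[OF dom2]]) (simp add: dist_norm norm_minus_commute)
    have hol2: "u holomorphic_on ball s1 \<epsilon>2"
    proof (rule holomorphic_onI)
      fix x assume "x \<in> ball s1 \<epsilon>2"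
      then have "norm (x - s1) \<le> \<epsilon>2" by (simp add: dist_norm norm_minus_commute)
      then show "u field_differentiable (at x within ball s1 \<epsilon>2)"
        using du[OF dom2] field_differentiable_at_within field_differentiable_def by blast
    qed
    obtain s2 where s2: "s2 \<in> ball s1 \<epsilon>2" "u s2 = 0"
    proof (rule holomorphic_contract_to_zero[OF cont2 hol2 \<epsilon>2])
      fix z assume "norm (s1 - z) = \<epsilon>2"
      then have z: "norm (z - s1) = \<epsilon>2" by (simp add: norm_minus_commute)
      have lz: "norm (\<Phi> z - \<Phi> s1 - H s1 * (z - s1)) \<le> 1/20 * norm (H s1) * norm (z - s1)"
        by (rule lin[OF rs1(2)]) (use z e2r in simp)
      have hz: "norm (H s1) * norm (z - s1) = 1" using z Hpos[OF rs1(2)] by (simp add: \<epsilon>2_def)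
      have P: "19/20 \<le> norm (\<Phi> z - cos_zero n)" "norm (\<Phi> z - cos_zero n) \<le> 21/20"
        using Phi_ratio[OF lz] s1(2) unfolding hz by auto
      have "1/10 \<le> norm (\<Phi> z - cos_zero m)" for m
      proof (cases "m = n")
        case False
        then have "pi \<le> norm (cos_zero m - cos_zero n)" by (rule cos_zero_dist)
        also have "\<dots> \<le> norm (\<Phi> z - cos_zero n) + norm (\<Phi> z - cos_zero m)"
          using norm_triangle_ineq4[of "\<Phi> z - cos_zero n" "\<Phi> z - cos_zero m"] by simp
        finally show ?thesis using P pi_gt3 by linarith
      next
        case True
        then show ?thesis using P by simp
      qed
      then have "c \<le> norm (u z)" using loc[of z] z \<rho>' by (intro lo) auto
      moreover have "norm (u s1) \<le> c / 2"
      proof -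
        have "\<Phi> s1 = cos_zero n" using s1 by simp
        then have "cos (\<Phi> s1) = 0" "Im (\<Phi> s1) = 0" by (simp, simp add: cos_zero_def)
        then show ?thesis using uc[of s1] loc[of s1] \<epsilon>2 rs1 \<rho>' by simp
      qed
      ultimately show "norm (u s1) < norm (u z)" using r2 by linarith
    qed
    have "norm (s2 - s1) \<le> \<epsilon>2" using s2 by (simp add: dist_norm norm_minus_commute)
    from loc[OF this] s2 show ?thesis by blast
  qed
  note E = this
  show ?thesis
  proof (rule that[of "max R r1"])
    show "max R r1 > \<rho>0" using r1 by simp
    fix \<rho> assume "max R r1 \<le> \<rho>"
    then show "\<exists>s. \<rho> \<le> Re s \<and> \<bar>Im s\<bar> \<le> 2 * pi / (3 * \<mu>) \<and> u s = 0" using E[of "\<rho> + 1"] by simp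
  qed
qed

text \<open>
  The zeros of the cosine are \<open>\<pi>\<close> apart, so for every point one of the circles of radius
  \<open>1/10\<close> and \<open>1/2\<close> about it keeps away from all of them.
\<close>
lemma circle_lower:
  obtains \<rho>1 c where "\<rho>1 > \<rho>0" "c > 0"
    "\<And>s0. \<rho>1 \<le> Re s0 \<Longrightarrow> \<bar>Im s0\<bar> \<le> pi / (2 * \<mu>) \<Longrightarrow>
       \<exists>r\<in>{1/10, 1/2}. \<forall>s. 24/25 * r \<le> norm (H s0) * norm (s - s0) \<longrightarrow> norm (H s0) * norm (s - s0) \<le> 26/25 * r \<longrightarrow> c \<le> norm (u s)"
proof -
  have m: "\<mu> > 0" using mu by simp
  obtain r1 where r1: "r1 > \<rho>0"
    and H1: "\<And>s0. r1 \<le> Re s0 \<Longrightarrow> 9/10 * (\<kappa> * exp (\<mu> * Re s0)) \<le> norm (H s0)"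
    and lin: "\<And>s s0. r1 \<le> Re s0 \<Longrightarrow> norm (s - s0) \<le> 12 / (\<kappa> * exp (\<mu> * Re s0)) \<Longrightarrow>
       norm (\<Phi> s - \<Phi> s0 - H s0 * (s - s0)) \<le> 1/20 * norm (H s0) * norm (s - s0)"
    by (rule Phi_linear) (rule that, assumption+)
  obtain r2 c where r2: "r2 > \<rho>0" "c > 0"
    and lo: "\<And>s. r2 \<le> Re s \<Longrightarrow> \<bar>Im s\<bar> \<le> 2 * pi / (3 * \<mu>) \<Longrightarrow> (\<forall>n. 1/10 \<le> norm (\<Phi> s - cos_zero n)) \<Longrightarrow> c \<le> norm (u s)"
    by (rule near_cos_zero[of "1/10"]) (simp, simp, rule that, assumption+)
  obtain r3 where r3: "\<And>\<rho>. r3 \<le> \<rho> \<Longrightarrow> 12 / (\<kappa> * exp (\<mu> * \<rho>)) < min 1 (pi / (6 * \<mu>))"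
    using small_disc[of "min 1 (pi / (6 * \<mu>))"] m by auto
  show ?thesis
  proof (rule that[of "max r1 (max (r2 + 1) r3)", OF _ r2(2)])
    show "\<rho>0 < max r1 (max (r2 + 1) r3)" using r1 by simp
    fix s0 assume s0: "max r1 (max (r2 + 1) r3) \<le> Re s0" "\<bar>Im s0\<bar> \<le> pi / (2 * \<mu>)"
    have rs: "r1 \<le> Re s0" "r2 + 1 \<le> Re s0" "r3 \<le> Re s0" using s0 by auto
    have K: "\<kappa> * exp (\<mu> * Re s0) > 0" using kappa by simp
    \<comment> \<open>The slack of 1/25 in the radius anticipates that circles in the z-plane are
      slightly distorted in the s-plane. Combined with the factors 19/20 and 21/20 it still gives
      9/10 and 11/10.\<close>
    have main: "c \<le> norm (u s)"
      if a: "24/25 * r \<le> norm (H s0) * norm (s - s0)" "norm (H s0) * norm (s - s0) \<le> 26/25 * r" "r \<le> 1"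
        and away: "\<And>w n. 9/10 * r \<le> norm (w - \<Phi> s0) \<Longrightarrow> norm (w - \<Phi> s0) \<le> 11/10 * r \<Longrightarrow> 1/10 \<le> norm (w - cos_zero n)"
        for r s
    proof -
      have "9/10 * (\<kappa> * exp (\<mu> * Re s0)) * norm (s - s0) \<le> norm (H s0) * norm (s - s0)"
        using H1[OF rs(1)] by (intro mult_right_mono) auto
      also have "\<dots> \<le> 26/25" using a by simp
      finally have "norm (s - s0) * (\<kappa> * exp (\<mu> * Re s0)) \<le> 12" by (simp add: algebra_simps)
      then have ss: "norm (s - s0) \<le> 12 / (\<kappa> * exp (\<mu> * Re s0))" using K by (simp add: pos_le_divide_eq)
      then have sm: "norm (s - s0) < min 1 (pi / (6 * \<mu>))" using r3[OF rs(3)] by linarith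
      have R: "\<bar>Re (s - s0)\<bar> \<le> 1" using abs_Re_le_cmod[of "s - s0"] sm by simp
      have I: "\<bar>Im (s - s0)\<bar> \<le> pi / (6 * \<mu>)" using abs_Im_le_cmod[of "s - s0"] sm by simp
      have "pi / (6 * \<mu>) + pi / (2 * \<mu>) = 2 * pi / (3 * \<mu>)" using m by (simp add: field_simps)
      then have I': "\<bar>Im s\<bar> \<le> 2 * pi / (3 * \<mu>)" using I s0(2) unfolding minus_complex.sel by linarith
      have R': "r2 \<le> Re s" using R rs unfolding minus_complex.sel by linarith
      have "9/10 * r \<le> norm (\<Phi> s - \<Phi> s0)" "norm (\<Phi> s - \<Phi> s0) \<le> 11/10 * r"
        using Phi_ratio[OF lin[OF rs(1) ss]] a by linarith+
      then show ?thesis using lo[OF R' I'] away by blast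
    qed
    show "\<exists>r\<in>{1/10, 1/2}. \<forall>s. 24/25 * r \<le> norm (H s0) * norm (s - s0) \<longrightarrow> norm (H s0) * norm (s - s0) \<le> 26/25 * r \<longrightarrow> c \<le> norm (u s)"
    proof (cases "\<forall>n. 1/4 \<le> norm (\<Phi> s0 - cos_zero n)")
      case True
      have "1/10 \<le> norm (w - cos_zero n)" if "norm (w - \<Phi> s0) \<le> 11/10 * (1/10)" for w n
        using True[rule_format, of n] that norm_triangle_ineq4[of "w - cos_zero n" "w - \<Phi> s0"] by (simp add: norm_minus_commute)
      then show ?thesis by (intro bexI[of _ "1/10"] allI impI main[of "1/10"]) auto
    next
      case False
      then obtain n where n: "norm (\<Phi> s0 - cos_zero n) < 1/4" by (auto simp: not_le)
      have "1/10 \<le> norm (w - cos_zero l)" if w: "9/10 * (1/2) \<le> norm (w - \<Phi> s0)" "norm (w - \<Phi> s0) \<le> 11/10 * (1/2)" for w l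
      proof (cases "l = n")
        case True
        then show ?thesis using n w norm_triangle_ineq4[of "w - cos_zero n" "\<Phi> s0 - cos_zero n"] by simp
      next
        case False
        then have "pi \<le> norm (cos_zero l - cos_zero n)" by (rule cos_zero_dist)
        also have "cos_zero l - cos_zero n = (w - \<Phi> s0) - (w - cos_zero l) + (\<Phi> s0 - cos_zero n)" by simp
        also have "norm \<dots> \<le> norm (w - \<Phi> s0) + norm (w - cos_zero l) + norm (\<Phi> s0 - cos_zero n)"
          using norm_triangle_ineq[of "(w - \<Phi> s0) - (w - cos_zero l)" "\<Phi> s0 - cos_zero n"]
            norm_triangle_ineq4[of "w - \<Phi> s0" "w - cos_zero l"] by linarith
        finally show ?thesis using n w pi_gt3 by linarith
      qed
      then show ?thesis by (intro bexI[of _ "1/2"] allI impI main[of "1/2"]) auto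
    qed
  qed
qed

text \<open>By \<open>Phi_expanding\<close> two zeros with the same index are so close that the
  derivative H V of \<open>u\<close> is almost constant on the segment between them. The mean value
  estimate for \<open>u\<close> minus a linear function then contradicts \<open>u = 0\<close> at
  both ends.\<close>

lemma zeros_injective:
  obtains \<rho>1 where "\<rho>1 > \<rho>0"
    "inj_on (\<lambda>s. \<lfloor>Re (\<Phi> s) / pi\<rfloor>) {s. \<rho>1 \<le> Re s \<and> \<bar>Im s\<bar> \<le> pi / (3 * \<mu>) \<and> u s = 0}"
proof -
  have m: "\<mu> > 0" using mu by simp
  obtain r1 where r1: "r1 > \<rho>0"
    and H1: "\<And>s0. r1 \<le> Re s0 \<Longrightarrow> 9/10 * (\<kappa> * exp (\<mu> * Re s0)) \<le> norm (H s0)"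
    and H2: "\<And>s0. r1 \<le> Re s0 \<Longrightarrow> norm (H s0) \<le> 11/10 * (\<kappa> * exp (\<mu> * Re s0))"
    and HH: "\<And>s s0. r1 \<le> Re s0 \<Longrightarrow> norm (s - s0) \<le> 12 / (\<kappa> * exp (\<mu> * Re s0)) \<Longrightarrow> norm (H s - H s0) \<le> 1/20 * norm (H s0)"
    and lin: "\<And>s s0. r1 \<le> Re s0 \<Longrightarrow> norm (s - s0) \<le> 12 / (\<kappa> * exp (\<mu> * Re s0)) \<Longrightarrow>
       norm (\<Phi> s - \<Phi> s0 - H s0 * (s - s0)) \<le> 1/20 * norm (H s0) * norm (s - s0)"
    by (rule Phi_linear) (rule that, assumption+)
  obtain r2 where r2: "r2 > \<rho>0"
    and zn: "\<And>s. r2 \<le> Re s \<Longrightarrow> \<bar>Im s\<bar> \<le> 2 * pi / (3 * \<mu>) \<Longrightarrow> u s = 0 \<Longrightarrow> \<exists>n. norm (\<Phi> s - cos_zero n) < 1/40"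
    by (rule zeros[of "1/40"]) (simp, simp, rule that, assumption+)
  obtain r3 where r3: "r3 > \<rho>0" and
    Vs: "\<And>s. r3 \<le> Re s \<Longrightarrow> \<bar>Im s\<bar> \<le> 2 * pi / (3 * \<mu>) \<longrightarrow> norm (V s + sin (\<Phi> s)) \<le> 1/100 * exp \<bar>Im (\<Phi> s)\<bar>"
    using obtains_ge[OF V_sin[of "1/100"], of 0] by auto
  obtain r4 where r4: "r4 > \<rho>0"
    and R: "\<And>s. r4 \<le> Re s \<Longrightarrow> \<bar>Im s\<bar> \<le> pi / (3 * \<mu>) \<Longrightarrow> \<kappa> / 4 * exp (\<mu> * Re s) \<le> Re (H s)"
    using Re_H by metis
  define r where "r = max (max r1 r2) (max r3 r4)"
  have wide: "\<bar>Im s\<bar> \<le> 2 * pi / (3 * \<mu>)" if "\<bar>Im s\<bar> \<le> pi / (3 * \<mu>)" for s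
  proof -
    have "pi / (3 * \<mu>) \<le> 2 * pi / (3 * \<mu>)" using m by (simp add: field_simps)
    then show ?thesis using that by linarith
  qed
  \<comment> \<open>At a zero, \<Phi> lies within 1/40 of the midpoint of an interval of length pi,
    so the floor recovers the index of the zero of the cosine.\<close>
  have fl: "norm (\<Phi> s - cos_zero \<lfloor>Re (\<Phi> s) / pi\<rfloor>) < 1/40"
    if s: "r \<le> Re s" "\<bar>Im s\<bar> \<le> pi / (3 * \<mu>)" "u s = 0" for s
  proof -
    obtain n where n: "norm (\<Phi> s - cos_zero n) < 1/40" using zn[of s] wide[OF s(2)] s by (auto simp: r_def)
    have "\<bar>Re (\<Phi> s) - (of_int n + 1/2) * pi\<bar> < 1/40"
      using abs_Re_le_cmod[of "\<Phi> s - cos_zero n"] n by (simp add: cos_zero_def)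
    then have "of_int n * pi \<le> Re (\<Phi> s)" "Re (\<Phi> s) < (of_int n + 1) * pi"
      using pi_gt3 unfolding ring_distribs by linarith+
    then have "\<lfloor>Re (\<Phi> s) / pi\<rfloor> = n"
      by (intro floor_unique) (simp_all only: pos_le_divide_eq[OF pi_gt_zero] pos_divide_less_eq[OF pi_gt_zero])
    then show ?thesis using n by simp
  qed
  have key: "s = s'"
    if s: "r \<le> Re s" "\<bar>Im s\<bar> \<le> pi / (3 * \<mu>)" "u s = 0" and s': "\<bar>Im s'\<bar> \<le> pi / (3 * \<mu>)" "u s' = 0"
      and le: "Re s \<le> Re s'" and eq: "\<lfloor>Re (\<Phi> s) / pi\<rfloor> = \<lfloor>Re (\<Phi> s') / pi\<rfloor>" for s s'
  proof (rule ccontr)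
    assume ne: "s \<noteq> s'"
    define n where "n = \<lfloor>Re (\<Phi> s) / pi\<rfloor>"
    have rs: "r1 \<le> Re s" "r2 \<le> Re s" "r3 \<le> Re s" "r4 \<le> Re s" using s by (auto simp: r_def)
    have K: "\<kappa> * exp (\<mu> * Re s) > 0" using kappa by simp
    have n1: "norm (\<Phi> s - cos_zero n) < 1/40" using fl[OF s] by (simp add: n_def)
    have n2: "norm (\<Phi> s' - cos_zero n) < 1/40" using fl[of s'] s s' le eq by (simp add: n_def)
    have "norm (\<Phi> s' - \<Phi> s) \<le> 1/20"
      using n1 n2 norm_triangle_ineq4[of "\<Phi> s' - cos_zero n" "\<Phi> s - cos_zero n"] by simp
    moreover have "\<kappa> / 4 * exp (\<mu> * Re s) * norm (s' - s) \<le> norm (\<Phi> s' - \<Phi> s)"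
      by (rule Phi_expanding[OF R r4 rs(4) le s(2) s'(1)])
    ultimately have d: "\<kappa> * exp (\<mu> * Re s) * norm (s' - s) \<le> 1/5" by simp
    have near: "norm (x - s) \<le> 12 / (\<kappa> * exp (\<mu> * Re s))" "\<kappa> * exp (\<mu> * Re s) * norm (x - s) \<le> 1/5"
      "Re s \<le> Re x" "\<bar>Im x\<bar> \<le> pi / (3 * \<mu>)"
      if x: "x \<in> closed_segment s s'" for x
    proof -
      obtain t where t: "0 \<le> t" "t \<le> 1" "x = (1 - t) *\<^sub>R s + t *\<^sub>R s'" using x by (auto simp: in_segment)
      have "norm (x - s) \<le> norm (s' - s)" using segment_bound1[OF x] .
      then have "\<kappa> * exp (\<mu> * Re s) * norm (x - s) \<le> \<kappa> * exp (\<mu> * Re s) * norm (s' - s)"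
        using kappa by (intro mult_left_mono) auto
      then show b: "\<kappa> * exp (\<mu> * Re s) * norm (x - s) \<le> 1/5" using d by linarith
      then have "norm (x - s) * (\<kappa> * exp (\<mu> * Re s)) \<le> 12" by (simp add: mult.commute)
      then show "norm (x - s) \<le> 12 / (\<kappa> * exp (\<mu> * Re s))" using K by (simp add: pos_le_divide_eq)
      have "Re x = Re s + t * (Re s' - Re s)" unfolding t(3) by (simp add: algebra_simps)
      then show "Re s \<le> Re x" using t le by simp
      have "Im x = (1 - t) * Im s + t * Im s'" unfolding t(3) by simp
      moreover have "\<bar>(1 - t) * Im s + t * Im s'\<bar> \<le> (1 - t) * (pi / (3 * \<mu>)) + t * (pi / (3 * \<mu>))"
      proof (rule order_trans[OF abs_triangle_ineq add_mono])
        show "\<bar>(1 - t) * Im s\<bar> \<le> (1 - t) * (pi / (3 * \<mu>))" "\<bar>t * Im s'\<bar> \<le> t * (pi / (3 * \<mu>))"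
          unfolding abs_mult using s s' t by (intro mult_mono; simp)+
      qed
      moreover have "(1 - t) * (pi / (3 * \<mu>)) + t * (pi / (3 * \<mu>)) = pi / (3 * \<mu>)" by (rule convex_comb_self)
      ultimately show "\<bar>Im x\<bar> \<le> pi / (3 * \<mu>)" by (simp only:)
    qed
    define V0 where "V0 = - sin (cos_zero n)"
    have V0: "norm V0 = 1" by (simp add: V0_def sin_cos_zero)
    \<comment> \<open>All that matters is a factor below 1. The variation of H contributes 1/20 *
      3/2 and that of V contributes 1/2.\<close>
    have HV: "norm (H x * V x - H s * V0) \<le> 3/4 * norm (H s)" if x: "x \<in> closed_segment s s'" for x
    proof -
      note nx = near[OF x]
      have "norm (\<Phi> x - \<Phi> s) \<le> 21/20 * (norm (H s) * norm (x - s))" by (rule Phi_ratio(2)[OF lin[OF rs(1) nx(1)]])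
      also have "norm (H s) * norm (x - s) \<le> 11/10 * (\<kappa> * exp (\<mu> * Re s)) * norm (x - s)"
        using H2[OF rs(1)] by (intro mult_right_mono) auto
      also have "\<dots> \<le> 11/10 * (1/5)" using nx(2) by (simp add: mult_ac)
      finally have "norm (\<Phi> x - \<Phi> s) \<le> 1/4" by simp
      then have px: "norm (\<Phi> x - cos_zero n) \<le> 3/10"
        using n1 norm_triangle_ineq[of "\<Phi> x - \<Phi> s" "\<Phi> s - cos_zero n"] by simp
      then have im: "\<bar>Im (\<Phi> x)\<bar> \<le> 1/3" using abs_Im_le_cmod[of "\<Phi> x - cos_zero n"] by (simp add: cos_zero_def)
      have "norm (sin (\<Phi> x) - sin (cos_zero n)) \<le> 3/2 * norm (\<Phi> x - cos_zero n)"
        by (rule sin_lipschitz) (use im in \<open>auto simp: cos_zero_def\<close>)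
      then have sn: "norm (sin (\<Phi> x) - sin (cos_zero n)) \<le> 9/20" using px by simp
      have "exp (1/3 :: real) \<le> 1 + 1/3 + (1/3)^2" by (rule exp_bound) auto
      then have "exp (1/3 :: real) \<le> 3/2" by (simp add: power2_eq_square)
      then have "exp \<bar>Im (\<Phi> x)\<bar> \<le> 3/2" using im by (meson exp_le_cancel_iff order_trans)
      moreover have "norm (V x + sin (\<Phi> x)) \<le> 1/100 * exp \<bar>Im (\<Phi> x)\<bar>"
        using Vs[of x] wide[OF nx(4)] nx(3) rs(3) by simp
      ultimately have vx: "norm (V x + sin (\<Phi> x)) \<le> 1/50" by linarith
      have e: "V x - V0 = (V x + sin (\<Phi> x)) - (sin (\<Phi> x) - sin (cos_zero n))" by (simp add: V0_def)
      have VV: "norm (V x - V0) \<le> 1/2" unfolding e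
        using vx sn norm_triangle_ineq4[of "V x + sin (\<Phi> x)" "sin (\<Phi> x) - sin (cos_zero n)"] by linarith
      then have Vx: "norm (V x) \<le> 3/2" using V0 norm_triangle_ineq2[of "V x" V0] by linarith
      have "H x * V x - H s * V0 = (H x - H s) * V x + H s * (V x - V0)" by (simp add: algebra_simps)
      then have "norm (H x * V x - H s * V0) \<le> norm (H x - H s) * norm (V x) + norm (H s) * norm (V x - V0)"
        by (metis norm_mult norm_triangle_ineq)
      also have "\<dots> \<le> (1/20 * norm (H s)) * (3/2) + norm (H s) * (1/2)"
        using HH[OF rs(1) nx(1)] Vx VV by (intro add_mono mult_mono) auto
      also have "\<dots> \<le> 3/4 * norm (H s)" using norm_ge_zero[of "H s"] by argo
      finally show ?thesis .
    qed
    have "norm ((u s' - H s * V0 * s') - (u s - H s * V0 * s)) \<le> 3/4 * norm (H s) * norm (s' - s)"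
    proof (rule field_differentiable_bound[of "closed_segment s s'" _ "\<lambda>x. H x * V x - H s * V0"])
      fix x assume x: "x \<in> closed_segment s s'"
      have "Re x > \<rho>0" using near(3)[OF x] rs r1 by linarith
      then have "((\<lambda>x. u x - H s * V0 * x) has_field_derivative H x * V x - H s * V0) (at x)"
        by (auto intro!: derivative_eq_intros du)
      then show "((\<lambda>x. u x - H s * V0 * x) has_field_derivative H x * V x - H s * V0) (at x within closed_segment s s')"
        by (rule has_field_derivative_at_within)
      show "norm (H x * V x - H s * V0) \<le> 3/4 * norm (H s)" by (rule HV[OF x])
    qed auto
    moreover have "(u s' - H s * V0 * s') - (u s - H s * V0 * s) = - (H s * V0 * (s' - s))"
      using s(3) s'(2) by (simp add: algebra_simps)
    ultimately have "norm (H s) * norm (s' - s) \<le> 3/4 * (norm (H s) * norm (s' - s))" by (simp add: norm_mult V0)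
    moreover have "0 < norm (H s) * norm (s' - s)"
    proof -
      have "0 < 9/10 * (\<kappa> * exp (\<mu> * Re s))" using K by simp
      then have "0 < norm (H s)" using H1[OF rs(1)] by linarith
      then show ?thesis using ne by simp
    qed
    ultimately show False by linarith
  qed
  show ?thesis
  proof (rule that[of r])
    show "r > \<rho>0" using r1 by (simp add: r_def)
    show "inj_on (\<lambda>s. \<lfloor>Re (\<Phi> s) / pi\<rfloor>) {s. r \<le> Re s \<and> \<bar>Im s\<bar> \<le> pi / (3 * \<mu>) \<and> u s = 0}"
    proof (rule inj_onI)
      fix s s' assume "s \<in> {s. r \<le> Re s \<and> \<bar>Im s\<bar> \<le> pi / (3 * \<mu>) \<and> u s = 0}"
        "s' \<in> {s. r \<le> Re s \<and> \<bar>Im s\<bar> \<le> pi / (3 * \<mu>) \<and> u s = 0}" "\<lfloor>Re (\<Phi> s) / pi\<rfloor> = \<lfloor>Re (\<Phi> s') / pi\<rfloor>"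
      then show "s = s'" using key[of s s'] key[of s' s] by (cases "Re s \<le> Re s'") auto
    qed
  qed
qed

end

section \<open>The Liouville transformation\<close>

lemma int_powr_summable:
  fixes p :: real
  assumes "p > 1"
  shows "(\<lambda>j::int. (1 + \<bar>of_int j\<bar>) powr (- p)) summable_on UNIV"
proof -
  have "summable (\<lambda>n. of_nat (Suc n) powr (- p) :: real)"
    by (subst summable_Suc_iff) (use assms in \<open>simp add: summable_real_powr_iff\<close>)
  then have n: "(\<lambda>n::nat. (1 + of_nat n) powr (- p) :: real) summable_on UNIV"
    by (intro summable_nonneg_imp_summable_on) (auto simp: add.commute)
  have A: "(\<lambda>j::int. (1 + \<bar>of_int j\<bar>) powr (- p)) summable_on range (\<lambda>n. int n)"
    by (subst summable_on_reindex) (use n in \<open>auto simp: o_def\<close>)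
  have B: "(\<lambda>j::int. (1 + \<bar>of_int j\<bar>) powr (- p)) summable_on range (\<lambda>n. - int n)"
    by (subst summable_on_reindex) (use n in \<open>auto simp: o_def inj_on_def\<close>)
  have "(UNIV :: int set) = range (\<lambda>n. int n) \<union> range (\<lambda>n. - int n)"
  proof -
    have "j \<in> range (\<lambda>n. int n) \<union> range (\<lambda>n. - int n)" for j :: int
      by (cases "j \<ge> 0") (auto simp: image_iff intro: exI[of _ "nat j"] exI[of _ "nat (- j)"])
    then show ?thesis by blast
  qed
  then show ?thesis using summable_on_union[OF A B] by simp
qed

context cosine_like
begin

text \<open>Integration of H along a segment; the extra 1/2 in the exponent generously absorbs the
  length of the segment.\<close>

lemma norm_Phi_upper:
  obtains \<rho>1 K where "\<rho>1 > \<rho>0" "K > 0"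
    "\<And>s. \<rho>1 \<le> Re s \<Longrightarrow> \<bar>Im s\<bar> \<le> pi \<Longrightarrow> norm (\<Phi> s) \<le> K * exp ((\<mu> + 1/2) * Re s)"
proof -
  obtain r where r: "r > \<rho>0" and up: "\<And>s. r \<le> Re s \<Longrightarrow> norm (H s) \<le> (1 + 1) * (\<kappa> * exp (\<mu> * Re s))"
    by (rule H_bounds[OF zero_less_one]) (rule that, assumption+)
  have r0: "r > 0" using r rho0 by simp
  define w where "w = Complex r 0"
  define K where "K = norm (\<Phi> w) + 4 * pi * \<kappa> "
  have K: "K > 0" using kappa by (simp add: K_def add_nonneg_pos)
  show ?thesis
  proof (rule that[OF r K])
    fix s assume s: "r \<le> Re s" "\<bar>Im s\<bar> \<le> pi"
    have seg: "r \<le> Re x \<and> Re x \<le> Re s" if x: "x \<in> closed_segment w s" for x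
    proof -
      obtain t where t: "0 \<le> t" "t \<le> 1" "x = (1 - t) *\<^sub>R w + t *\<^sub>R s" using x by (auto simp: in_segment)
      have e: "Re x = r + t * (Re s - r)" unfolding t(3) by (simp add: w_def algebra_simps)
      have "0 \<le> t * (Re s - r)" "t * (Re s - r) \<le> Re s - r" using t s by (auto intro!: mult_left_le_one_le)
      then show ?thesis using e by linarith
    qed
    have "norm (\<Phi> s - \<Phi> w) \<le> 2 * (\<kappa> * exp (\<mu> * Re s)) * norm (s - w)"
    proof (rule field_differentiable_bound[of "closed_segment w s"])
      fix x assume x: "x \<in> closed_segment w s"
      have "Re x > \<rho>0" using seg[OF x] r by linarith
      then show "(\<Phi> has_field_derivative H x) (at x within closed_segment w s)"
        using dPhi has_field_derivative_at_within by blast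
      have "norm (H x) \<le> 2 * (\<kappa> * exp (\<mu> * Re x))" using up[of x] seg[OF x] by simp
      also have "\<dots> \<le> 2 * (\<kappa> * exp (\<mu> * Re s))"
        using seg[OF x] kappa mu by (intro mult_left_mono) (auto intro!: mult_left_mono)
      finally show "norm (H x) \<le> 2 * (\<kappa> * exp (\<mu> * Re s))" .
    qed auto
    also have "norm (s - w) \<le> 2 * pi * exp (Re s / 2)"
    proof -
      have "norm (s - w) \<le> \<bar>Re s - r\<bar> + \<bar>Im s\<bar>" using cmod_le[of "s - w"] by (simp add: w_def)
      also have "\<dots> \<le> Re s + pi" using s r0 by simp
      also have "\<dots> \<le> 2 * pi * (1 + Re s / 2)"
      proof -
        have "1 * Re s \<le> pi * Re s" using s r0 pi_gt3 by (intro mult_right_mono) auto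
        moreover have "2 * pi * (1 + Re s / 2) = 2 * pi + pi * Re s" by (simp add: algebra_simps)
        ultimately show ?thesis using pi_gt3 by linarith
      qed
      also have "\<dots> \<le> 2 * pi * exp (Re s / 2)" by (intro mult_left_mono exp_ge_add_one_self) auto
      finally show ?thesis .
    qed
    finally have "norm (\<Phi> s - \<Phi> w) \<le> 2 * (\<kappa> * exp (\<mu> * Re s)) * (2 * pi * exp (Re s / 2))"
      using kappa by (simp add: mult_left_mono)
    also have "\<dots> = 4 * pi * \<kappa> * exp ((\<mu> + 1/2) * Re s)"
      by (simp add: exp_add[symmetric] algebra_simps)
    finally have "norm (\<Phi> s) \<le> norm (\<Phi> w) + 4 * pi * \<kappa> * exp ((\<mu> + 1/2) * Re s)"
      using norm_triangle_ineq2[of "\<Phi> s" "\<Phi> w"] by linarith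
    moreover have "norm (\<Phi> w) * 1 \<le> norm (\<Phi> w) * exp ((\<mu> + 1/2) * Re s)"
      using s r0 mu by (intro mult_left_mono) auto
    ultimately show "norm (\<Phi> s) \<le> K * exp ((\<mu> + 1/2) * Re s)" by (simp add: K_def algebra_simps)
  qed
qed

text \<open>The summand is the size of a double-pole coefficient of P/g^2 divided by |z|^2. The
  zeros are numbered injectively by an integer j of size O(exp((\<mu> + 1/2) Re s)), so the sum is
  dominated by that of (1 + |j|)^(-p) with p > 1.\<close>

lemma zeros_summable:
  obtains \<rho>1 where "\<rho>1 > \<rho>0"
    "(\<lambda>s. exp (- ((1 + \<mu>) * Re s))) summable_on {s. \<rho>1 \<le> Re s \<and> \<bar>Im s\<bar> \<le> 2 * pi / (3 * \<mu>) \<and> u s = 0}"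
proof -
  have m: "\<mu> > 0" using mu by simp
  obtain r1 where r1: "r1 > \<rho>0"
    and z: "\<And>s. r1 \<le> Re s \<Longrightarrow> \<bar>Im s\<bar> \<le> 2 * pi / (3 * \<mu>) \<Longrightarrow> u s = 0 \<Longrightarrow> \<bar>Im s\<bar> \<le> pi / (3 * \<mu>)"
    by (rule zeros[of "1/40"]) (simp, simp, rule that, assumption+)
  obtain r2 where r2: "r2 > \<rho>0"
    and inj: "inj_on (\<lambda>s. \<lfloor>Re (\<Phi> s) / pi\<rfloor>) {s. r2 \<le> Re s \<and> \<bar>Im s\<bar> \<le> pi / (3 * \<mu>) \<and> u s = 0}"
    by (rule zeros_injective)
  obtain r3 K where r3: "r3 > \<rho>0" "K > 0"
    and Phi: "\<And>s. r3 \<le> Re s \<Longrightarrow> \<bar>Im s\<bar> \<le> pi \<Longrightarrow> norm (\<Phi> s) \<le> K * exp ((\<mu> + 1/2) * Re s)"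
    by (rule norm_Phi_upper) (rule that, assumption+)
  define r where "r = max r1 (max r2 r3)"
  define Y where "Y = {s. r \<le> Re s \<and> \<bar>Im s\<bar> \<le> 2 * pi / (3 * \<mu>) \<and> u s = 0}"
  define j where "j = (\<lambda>s. \<lfloor>Re (\<Phi> s) / pi\<rfloor>)"
  \<comment> \<open>Chosen so that p (\<mu> + 1/2) = 1 + \<mu>. The loss of 1/2 in the bound for
    \<Phi> is affordable precisely because this is still greater than 1.\<close>
  define p where "p = (1 + \<mu>) / (\<mu> + 1/2)"
  have p: "p > 1" "p * (\<mu> + 1/2) = 1 + \<mu>" using m by (auto simp: p_def field_simps)
  have "inj_on j Y" unfolding j_def by (rule inj_on_subset[OF inj]) (use z in \<open>auto simp: Y_def r_def\<close>)
  moreover have "(\<lambda>j::int. (1 + \<bar>of_int j\<bar>) powr (- p)) summable_on j ` Y"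
    by (rule summable_on_subset_banach[OF int_powr_summable[OF p(1)]]) auto
  ultimately have S: "(\<lambda>s. (1 + \<bar>of_int (j s)\<bar>) powr (- p)) summable_on Y"
    by (simp add: summable_on_reindex o_def)
  have "(\<lambda>s. exp (- ((1 + \<mu>) * Re s))) summable_on Y"
  proof (rule summable_on_comparison_test[OF summable_on_cmult_right[OF S, of "(K + 2) powr p"]])
    fix s assume s: "s \<in> Y"
    then have sr: "r1 \<le> Re s" "r3 \<le> Re s" "\<bar>Im s\<bar> \<le> pi / (3 * \<mu>)" using z[of s] by (auto simp: Y_def r_def)
    have "pi / (3 * \<mu>) \<le> pi / 1" using mu by (intro divide_left_mono) auto
    then have "norm (\<Phi> s) \<le> K * exp ((\<mu> + 1/2) * Re s)" using sr by (intro Phi) auto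
    moreover have "\<bar>of_int (j s)\<bar> \<le> \<bar>Re (\<Phi> s) / pi\<bar> + (1::real)" unfolding j_def by linarith
    moreover have "\<bar>Re (\<Phi> s) / pi\<bar> \<le> norm (\<Phi> s)"
    proof -
      have "\<bar>Re (\<Phi> s)\<bar> / pi \<le> \<bar>Re (\<Phi> s)\<bar> / 1" using pi_gt3 by (intro divide_left_mono) auto
      then show ?thesis using abs_Re_le_cmod[of "\<Phi> s"] by simp
    qed
    moreover have "1 \<le> exp ((\<mu> + 1/2) * Re s)" using sr r3 rho0 m by simp
    moreover have "(K + 2) * exp ((\<mu> + 1/2) * Re s) = K * exp ((\<mu> + 1/2) * Re s) + 2 * exp ((\<mu> + 1/2) * Re s)"
      by (rule distrib_right)
    ultimately have le: "1 + \<bar>of_int (j s)\<bar> \<le> (K + 2) * exp ((\<mu> + 1/2) * Re s)" by linarith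
    have "(K + 2) powr p * (1 + \<bar>of_int (j s)\<bar>) powr (- p) \<ge> (K + 2) powr p * ((K + 2) * exp ((\<mu> + 1/2) * Re s)) powr (- p)"
      using le p by (intro mult_left_mono powr_mono2') auto
    also have "((K + 2) * exp ((\<mu> + 1/2) * Re s)) powr (- p) = (K + 2) powr (- p) * exp ((\<mu> + 1/2) * Re s) powr (- p)"
      using r3 by (simp add: powr_mult)
    also have "(K + 2) powr p * ((K + 2) powr (- p) * exp ((\<mu> + 1/2) * Re s) powr (- p)) = exp ((\<mu> + 1/2) * Re s) powr (- p)"
      using r3 by (simp add: powr_minus field_simps)
    also have "\<dots> = exp (- ((1 + \<mu>) * Re s))"
    proof -
      have "- p * ((\<mu> + 1/2) * Re s) = - (p * (\<mu> + 1/2)) * Re s" by (simp add: algebra_simps)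
      then show ?thesis unfolding p(2) by (simp add: powr_def algebra_simps)
    qed
    finally show "exp (- ((1 + \<mu>) * Re s)) \<le> (K + 2) powr p * (1 + \<bar>of_int (j s)\<bar>) powr (- p)" .
  qed auto
  then show ?thesis using that[of r] r1 by (simp add: Y_def r_def)
qed

end

section \<open>The change of the unknown function\<close>

lemma halfplane: "open {s. Re s > a}" "convex {s. Re s > a}"
  by (simp_all add: open_halfspace_Re_gt convex_halfspace_Re_gt)

lemma deriv_bound_halfplane:
  assumes hol: "f holomorphic_on {s. Re s > a}" and B: "\<And>s. Re s > a \<Longrightarrow> norm (f s) \<le> B" and s: "Re s > a + 1"
  shows "norm (deriv f s) \<le> B"
proof -
  have sub: "cball s 1 \<subseteq> {s. Re s > a}"
  proof
    fix x assume "x \<in> cball s 1"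
    then have "\<bar>Re (s - x)\<bar> \<le> 1" using abs_Re_le_cmod[of "s - x"] by (simp add: dist_norm)
    then show "x \<in> {s. Re s > a}" using s by simp
  qed
  have "norm ((deriv ^^ 1) f s) \<le> fact 1 * B / 1 ^ 1"
  proof (rule Cauchy_inequality)
    show "f holomorphic_on ball s 1" using hol sub holomorphic_on_subset ball_subset_cball by blast
    show "continuous_on (cball s 1) f" using hol sub holomorphic_on_imp_continuous_on holomorphic_on_subset by blast
    fix x assume "norm (s - x) = 1"
    then have "x \<in> cball s 1" by (simp add: dist_norm)
    then show "norm (f x) \<le> B" using sub B by blast
  qed simp
  then show ?thesis by simp
qed

text \<open>The equation is G'' = l1 G' - H^2 G. An amplitude with A^2 H = P1 has logarithmic
  derivative \<alpha> = (l1 - h1)/2, which removes the first-order term and leaves (\<alpha>' -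
  \<alpha>^2 - \<alpha> h1)/H as the perturbation. The half-plane shrinks by 1 since \<alpha>' is
  estimated by Cauchy's inequality on unit discs.\<close>

lemma liouville_transform:
  fixes G G1 l1 h1 H P1 :: "complex \<Rightarrow> complex"
  assumes dG: "\<And>s. Re s > \<rho>a \<Longrightarrow> (G has_field_derivative G1 s) (at s)"
    and dG1: "\<And>s. Re s > \<rho>a \<Longrightarrow> (G1 has_field_derivative l1 s * G1 s - (H s)\<^sup>2 * G s) (at s)"
    and dP1: "\<And>s. Re s > \<rho>a \<Longrightarrow> (P1 has_field_derivative l1 s * P1 s) (at s)"
    and dH: "\<And>s. Re s > \<rho>a \<Longrightarrow> (H has_field_derivative h1 s * H s) (at s)"
    and P1: "\<And>s. Re s > \<rho>a \<Longrightarrow> P1 s \<noteq> 0" and H0: "\<And>s. Re s > \<rho>a \<Longrightarrow> H s \<noteq> 0"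
    and l1: "l1 holomorphic_on {s. Re s > \<rho>a}" "\<And>s. Re s > \<rho>a \<Longrightarrow> norm (l1 s) \<le> B"
    and h1: "h1 holomorphic_on {s. Re s > \<rho>a}" "\<And>s. Re s > \<rho>a \<Longrightarrow> norm (h1 s) \<le> B"
  obtains u V Sg \<Phi> A where
    "\<And>s. Re s > \<rho>a + 1 \<Longrightarrow> (u has_field_derivative H s * V s) (at s)"
    "\<And>s. Re s > \<rho>a + 1 \<Longrightarrow> (V has_field_derivative - (H s + Sg s) * u s) (at s)"
    "\<And>s. Re s > \<rho>a + 1 \<Longrightarrow> (\<Phi> has_field_derivative H s) (at s)"
    "\<And>s. Re s > \<rho>a + 1 \<Longrightarrow> norm (Sg s) \<le> (B + 2 * B\<^sup>2) / norm (H s)"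
    "\<And>s. Re s > \<rho>a + 1 \<Longrightarrow> G s = A s * u s"
    "\<And>s. Re s > \<rho>a + 1 \<Longrightarrow> (A s)\<^sup>2 * H s = P1 s"
proof -
  define \<Omega> where "\<Omega> = {s. Re s > \<rho>a}"
  have op: "open \<Omega>" and cv: "convex \<Omega>" by (simp_all add: \<Omega>_def halfplane)
  have hol: "f holomorphic_on \<Omega>" if "\<And>s. Re s > \<rho>a \<Longrightarrow> (f has_field_derivative f' s) (at s)" for f f'
    using that op by (auto simp: holomorphic_on_open \<Omega>_def)
  define W where "W = (\<lambda>s. P1 s / H s)"
  have dW: "(W has_field_derivative (l1 s - h1 s) * W s) (at s)" if "Re s > \<rho>a" for s
    unfolding W_def using H0[OF that]
    by (auto intro!: derivative_eq_intros dP1 dH that simp: field_simps)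
  \<comment> \<open>The half-plane is contractible and W has no zeros, so a holomorphic square root
    exists.\<close>
  obtain A where A: "A holomorphic_on \<Omega>" "\<And>s. s \<in> \<Omega> \<Longrightarrow> W s = (A s)\<^sup>2"
    using contractible_imp_holomorphic_sqrt[OF hol[OF dW] convex_imp_contractible[OF cv]] P1 H0
    by (auto simp: W_def \<Omega>_def)
  have A0: "A s \<noteq> 0" if "Re s > \<rho>a" for s
    using A(2)[of s] P1[OF that] H0[OF that] that by (auto simp: W_def \<Omega>_def)
  define \<alpha> where "\<alpha> = (\<lambda>s. (l1 s - h1 s) / 2)"
  have dA: "(A has_field_derivative \<alpha> s * A s) (at s)" if s: "Re s > \<rho>a" for s
  proof -
    have sO: "s \<in> \<Omega>" using s by (simp add: \<Omega>_def)
    have d: "(A has_field_derivative deriv A s) (at s)" using A(1) op sO by (rule holomorphic_derivI)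
    then have "((\<lambda>s. (A s)\<^sup>2) has_field_derivative 2 * A s * deriv A s) (at s)"
      by (auto intro!: derivative_eq_intros)
    moreover have "((\<lambda>s. (A s)\<^sup>2) has_field_derivative (l1 s - h1 s) * W s) (at s)"
      by (rule has_field_derivative_transform_within_open[OF dW[OF s] op sO]) (use A in auto)
    ultimately have "2 * A s * deriv A s = (l1 s - h1 s) * W s" by (rule DERIV_unique)
    then have "A s * (2 * deriv A s) = A s * ((l1 s - h1 s) * A s)" using A(2)[OF sO] by (simp add: power2_eq_square mult_ac)
    then have "2 * deriv A s = (l1 s - h1 s) * A s" using A0[OF s] by (simp only: mult_left_cancel simp_thms)
    then have "deriv A s = \<alpha> s * A s" by (simp add: \<alpha>_def mult.commute)
    then show ?thesis using d by simp
  qed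
  have Hhol: "H holomorphic_on \<Omega>" by (rule hol[OF dH])
  obtain \<Phi> where Phi: "\<And>s. s \<in> \<Omega> \<Longrightarrow> (\<Phi> has_field_derivative H s) (at s within \<Omega>)"
    using holomorphic_convex_primitive'[OF cv op Hhol] by blast
  have \<alpha>hol: "\<alpha> holomorphic_on {s. Re s > \<rho>a}" unfolding \<alpha>_def by (intro holomorphic_intros l1 h1) auto
  have \<alpha>B: "norm (\<alpha> s) \<le> B" if "Re s > \<rho>a" for s
    using l1(2)[OF that] h1(2)[OF that] norm_triangle_ineq4[of "l1 s" "h1 s"] by (simp add: \<alpha>_def norm_divide)
  define u where "u = (\<lambda>s. G s / A s)"
  define V where "V = (\<lambda>s. (G1 s - \<alpha> s * G s) / (A s * H s))"
  define Sg where "Sg = (\<lambda>s. (deriv \<alpha> s - (\<alpha> s)\<^sup>2 - \<alpha> s * h1 s) / H s)"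
  show ?thesis
  proof (rule that[of u V Sg \<Phi> A])
    fix s assume s1: "Re s > \<rho>a + 1"
    then have s: "Re s > \<rho>a" by simp
    have sO: "s \<in> \<Omega>" using s by (simp add: \<Omega>_def)
    show "(u has_field_derivative H s * V s) (at s)" unfolding u_def
      by (rule DERIV_cong[OF DERIV_divide[OF dG[OF s] dA[OF s] A0[OF s]]])
        (use A0[OF s] H0[OF s] in \<open>simp add: V_def field_simps power2_eq_square\<close>)
    have d\<alpha>: "(\<alpha> has_field_derivative deriv \<alpha> s) (at s)"
      using \<alpha>hol op sO unfolding \<Omega>_def by (rule holomorphic_derivI)
    have AH: "A s * H s \<noteq> 0" using A0[OF s] H0[OF s] by simp
    have l: "l1 s = 2 * \<alpha> s + h1 s" unfolding \<alpha>_def by (simp add: field_simps)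
    show "(V has_field_derivative - (H s + Sg s) * u s) (at s)" unfolding V_def
    proof (rule DERIV_cong[OF DERIV_divide[OF DERIV_diff[OF dG1[OF s] DERIV_mult[OF d\<alpha> dG[OF s]]] DERIV_mult[OF dA[OF s] dH[OF s]] AH]])
      have cancel: "X \<noteq> 0 \<Longrightarrow> n * X / (X * X) = n / X" for n X :: complex by simp
      have split: "- X * y / (v * w) = - (X / w) * (y / v)" for X y v w :: complex by (simp add: mult.commute)
      define q where "q = deriv \<alpha> s - (\<alpha> s)\<^sup>2 - \<alpha> s * h1 s"
      have "(l1 s * G1 s - (H s)\<^sup>2 * G s - (deriv \<alpha> s * G s + G1 s * \<alpha> s)) * (A s * H s)
         - (G1 s - \<alpha> s * G s) * (\<alpha> s * A s * H s + h1 s * H s * A s)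
         = - ((H s)\<^sup>2 + q) * G s * (A s * H s)"
        unfolding l q_def by algebra
      then have "((l1 s * G1 s - (H s)\<^sup>2 * G s - (deriv \<alpha> s * G s + G1 s * \<alpha> s)) * (A s * H s)
         - (G1 s - \<alpha> s * G s) * (\<alpha> s * A s * H s + h1 s * H s * A s)) / (A s * H s * (A s * H s))
         = - ((H s)\<^sup>2 + q) * G s / (A s * H s)"
        by (simp only: cancel[OF AH])
      also have "\<dots> = - (((H s)\<^sup>2 + q) / H s) * (G s / A s)" by (rule split)
      also have "((H s)\<^sup>2 + q) / H s = H s + q / H s"
        using H0[OF s] by (simp add: add_divide_distrib power2_eq_square)
      finally show "((l1 s * G1 s - (H s)\<^sup>2 * G s - (deriv \<alpha> s * G s + G1 s * \<alpha> s)) * (A s * H s)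
         - (G1 s - \<alpha> s * G s) * (\<alpha> s * A s * H s + h1 s * H s * A s)) / (A s * H s * (A s * H s)) = - (H s + Sg s) * u s"
        by (simp only: u_def Sg_def q_def)
    qed
    show "(\<Phi> has_field_derivative H s) (at s)" using Phi[OF sO] unfolding at_within_open[OF sO op] .
    show "G s = A s * u s" using A0[OF s] by (simp add: u_def)
    show "(A s)\<^sup>2 * H s = P1 s" using A(2)[OF sO, symmetric] H0[OF s] by (simp add: W_def)
    have B0: "B \<ge> 0" using \<alpha>B[OF s] norm_ge_zero order_trans by blast
    have "norm (deriv \<alpha> s - (\<alpha> s)\<^sup>2 - \<alpha> s * h1 s) \<le> norm (deriv \<alpha> s) + norm ((\<alpha> s)\<^sup>2) + norm (\<alpha> s * h1 s)"
      using norm_triangle_ineq4[of "deriv \<alpha> s - (\<alpha> s)\<^sup>2" "\<alpha> s * h1 s"] norm_triangle_ineq4[of "deriv \<alpha> s" "(\<alpha> s)\<^sup>2"] by linarith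
    also have "\<dots> \<le> B + B\<^sup>2 + B * B"
    proof (intro add_mono)
      show "norm (deriv \<alpha> s) \<le> B" by (rule deriv_bound_halfplane[OF \<alpha>hol \<alpha>B s1])
      show "norm ((\<alpha> s)\<^sup>2) \<le> B\<^sup>2" unfolding norm_power by (intro power_mono \<alpha>B s) auto
      show "norm (\<alpha> s * h1 s) \<le> B * B" unfolding norm_mult using B0 by (intro mult_mono \<alpha>B h1(2) s) auto
    qed
    finally show "norm (Sg s) \<le> (B + 2 * B\<^sup>2) / norm (H s)"
      by (simp add: Sg_def norm_divide divide_right_mono power2_eq_square)
  qed
qed

section \<open>The differential equation in logarithmic coordinates\<close>

lemma poly_shift_upper:
  fixes R :: "complex poly"
  assumes "degree R \<le> n"
  obtains K where "K > 0" "\<And>x. norm x \<ge> 1 \<Longrightarrow> norm (poly R (d + x)) \<le> K * norm x ^ n"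
proof -
  define T where "T = pcompose R [:d, 1:]"
  define K where "K = (\<Sum>i\<le>degree T. norm (coeff T i)) + 1"
  have "degree T \<le> n" using assms by (simp add: T_def degree_pcompose)
  show ?thesis
  proof (rule that[of K])
    show "K > 0" unfolding K_def by (intro add_nonneg_pos sum_nonneg) auto
    fix x :: complex assume x: "norm x \<ge> 1"
    have "poly R (d + x) = poly T x" by (simp add: T_def poly_pcompose)
    also have "\<dots> = (\<Sum>i\<le>degree T. coeff T i * x ^ i)" by (rule poly_altdef)
    also have "norm \<dots> \<le> (\<Sum>i\<le>degree T. norm (coeff T i) * norm x ^ n)"
    proof (rule sum_norm_le)
      fix i assume "i \<in> {..degree T}"
      then have "i \<le> n" using \<open>degree T \<le> n\<close> by simp
      then show "norm (coeff T i * x ^ i) \<le> norm (coeff T i) * norm x ^ n"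
        unfolding norm_mult norm_power using x by (intro mult_left_mono power_increasing) auto
    qed
    also have "\<dots> = (\<Sum>i\<le>degree T. norm (coeff T i)) * norm x ^ n" by (simp add: sum_distrib_right)
    also have "\<dots> \<le> K * norm x ^ n" by (intro mult_right_mono) (auto simp: K_def)
    finally show "norm (poly R (d + x)) \<le> K * norm x ^ n" .
  qed
qed

lemma monic_shift:
  fixes P :: "complex poly"
  assumes "lead_coeff P = 1"
  obtains K where "K > 0" "\<And>x. norm x \<ge> 1 \<Longrightarrow> norm (poly P (d + x) / x ^ degree P - 1) \<le> K / norm x"
proof -
  define T where "T = pcompose P [:d, 1:]"
  have dT: "degree T = degree P" by (simp add: T_def degree_pcompose)
  have lT: "lead_coeff T = 1" using assms by (simp add: T_def lead_coeff_comp)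
  define R where "R = T - monom 1 (degree P)"
  have pT: "poly P (d + x) = poly R x + x ^ degree P" for x
    by (simp add: R_def poly_monom T_def poly_pcompose)
  show ?thesis
  proof (cases "degree P = 0")
    case True
    then have "P = 1" using assms by (auto elim!: degree_eq_zeroE simp: one_pCons)
    then show ?thesis by (intro that[of 1]) auto
  next
    case False
    have "coeff R i = 0" if "i > degree P - 1" for i
      using that False lT dT coeff_eq_0[of T i] by (cases "i = degree P") (auto simp: R_def)
    then have "degree R \<le> degree P - 1" by (intro degree_le) auto
    then obtain K where K: "K > 0" "\<And>x. norm x \<ge> 1 \<Longrightarrow> norm (poly R (0 + x)) \<le> K * norm x ^ (degree P - 1)"
      using poly_shift_upper by blast
    show ?thesis
    proof (rule that[OF K(1)])
      fix x :: complex assume x: "norm x \<ge> 1"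
      then have x0: "x \<noteq> 0" by auto
      have "poly P (d + x) / x ^ degree P - 1 = poly R x / x ^ degree P"
        using x0 by (simp add: pT field_simps)
      also have "norm \<dots> \<le> K * norm x ^ (degree P - 1) / norm x ^ degree P"
        using K(2)[OF x] by (simp add: norm_divide norm_power divide_right_mono)
      also have "norm x ^ degree P = norm x ^ (degree P - 1) * norm x"
        using False by (metis power_minus_mult neq0_conv)
      finally show "norm (poly P (d + x) / x ^ degree P - 1) \<le> K / norm x" using x0 by simp
    qed
  qed
qed

text \<open>Each factor X - d keeps the leading coefficient and lowers the next one by d. This is
  what makes the cancellation in \<open>coeff_Rem\<close> computable.\<close>

lemma linear_power_coeffs:
  fixes P :: "complex poly"
  assumes P: "lead_coeff P = 1"
  defines "a \<equiv> (if degree P = 0 then 0 else coeff P (degree P - 1))"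
  shows "degree ([:- d, 1:] ^ n * P) = degree P + n"
    and "coeff ([:- d, 1:] ^ n * P) (degree P + n) = 1"
    and "degree P + n \<noteq> 0 \<Longrightarrow> coeff ([:- d, 1:] ^ n * P) (degree P + n - 1) = a - of_nat n * d"
proof -
  have P0: "P \<noteq> 0" using P by auto
  have deg: "degree ([:- d, 1:] ^ n * P) = degree P + n" for n
    using P0 by (subst degree_mult_eq) (auto simp: degree_power_eq)
  then show "degree ([:- d, 1:] ^ n * P) = degree P + n" .
  have lead: "coeff ([:- d, 1:] ^ n * P) (degree P + n) = 1" for n
    unfolding deg[symmetric] lead_coeff_mult lead_coeff_power using P by simp
  then show "coeff ([:- d, 1:] ^ n * P) (degree P + n) = 1" .
  show "degree P + n \<noteq> 0 \<Longrightarrow> coeff ([:- d, 1:] ^ n * P) (degree P + n - 1) = a - of_nat n * d"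
  proof (induction n)
    case 0
    then show ?case by (simp add: a_def)
  next
    case (Suc n)
    define F where "F = [:- d, 1:] ^ n * P"
    have "[:- d, 1:] ^ Suc n * P = pCons 0 F - smult d F" by (simp add: F_def algebra_simps)
    then have e: "coeff ([:- d, 1:] ^ Suc n * P) (degree P + Suc n - 1) = coeff (pCons 0 F) (degree P + n) - d * coeff F (degree P + n)"
      by simp
    have l: "coeff F (degree P + n) = 1" using lead by (simp add: F_def)
    show ?case
    proof (cases "degree P + n")
      case 0
      then show ?thesis using e l by (simp add: a_def)
    next
      case (Suc m)
      then have "coeff (pCons 0 F) (degree P + n) = coeff F (degree P + n - 1)" by simp
      also have "\<dots> = a - of_nat n * d" using Suc.IH Suc by (simp add: F_def)
      finally have h: "coeff (pCons 0 F) (degree P + n) = a - of_nat n * d" .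
      show ?thesis unfolding e l h by (simp add: algebra_simps)
    qed
  qed
qed

locale stokes =
  fixes P Q S :: "complex poly"
    and p q N :: nat
    and a b c d D :: complex
    and pz Dj :: "nat \<Rightarrow> complex"
    and r0 :: real
    and g :: "complex \<Rightarrow> complex"
  assumes p: "p = degree P" and q: "q = degree Q" and pq: "p \<le> q" and N: "N = q - p"
    and P_monic: "lead_coeff P = 1"
    and a: "a = (if p = 0 then 0 else coeff P (p - 1))"
    and b: "b = lead_coeff Q" "b \<noteq> 0"
    and c: "c = (if q = 0 then 0 else coeff Q (q - 1))"
    and deg_S: "degree S = N"
    and partial_fractions: "\<And>z. poly P z \<noteq> 0 \<Longrightarrow>
          poly Q z / poly P z = poly S z + (\<Sum>j=1..p. Dj j / (z - pz j))"
    and d: "d = (if N = 0 then 0 else (a * b - c) / (b * of_nat N))"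
    and D: "D = (\<Sum>j=1..p. Dj j) / csqrt b"
    and r0: "r0 > 1"
    and entire: "g holomorphic_on UNIV"
    and nontrivial: "\<exists>z. g z \<noteq> 0"
    and ode: "\<And>z. poly P z \<noteq> 0 \<Longrightarrow>
          deriv (deriv g) z - poly (pderiv P) z / poly P z * deriv g z
            + poly Q z / poly P z * g z = 0"
    and no_common_zeros: "\<And>z. \<not> (poly P z = 0 \<and> g z = 0)"
begin

text \<open>With x = z - d, the function H will be a square root of x^2 Q/P, hence of order \<mu> in
  x with leading coefficient of modulus \<kappa>. \<open>Rem\<close> is what is left of Q after its
  model b (X - d)^N P, and \<psi> is the relative deviation of Q/P from b x^N.\<close>

definition "\<mu> = real N / 2 + 1"
definition "\<kappa> = sqrt (cmod b)"
definition "Rem = Q - smult b ([:- d, 1:] ^ N * P)"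
definition "\<psi> x = poly Rem (d + x) / (b * x ^ N * poly P (d + x))"

lemma mu_ge: "\<mu> \<ge> 1" by (simp add: \<mu>_def)
lemma kappa_pos: "\<kappa> > 0" using b(2) by (simp add: \<kappa>_def)
lemma q_eq: "q = p + N" using pq N by simp

lemma Q_factor: "x \<noteq> 0 \<Longrightarrow> poly P (d + x) \<noteq> 0 \<Longrightarrow> poly Q (d + x) / poly P (d + x) = b * x ^ N * (1 + \<psi> x)"
proof -
  assume x: "x \<noteq> 0" "poly P (d + x) \<noteq> 0"
  have "poly Q (d + x) = b * x ^ N * poly P (d + x) + poly Rem (d + x)"
    by (simp add: Rem_def)
  then show ?thesis using x b(2) by (simp add: \<psi>_def field_simps)
qed

text \<open>The top coefficient cancels in any case. For N \<ge> 1 the next one cancels too, because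
  N d = a - c/b is exactly the choice of the vertex d.\<close>

lemma coeff_Rem: "i \<ge> q \<Longrightarrow> coeff Rem i = 0" "N \<ge> 1 \<Longrightarrow> i \<ge> q - 1 \<Longrightarrow> coeff Rem i = 0"
proof -
  note l = linear_power_coeffs[OF P_monic, where d = d and n = N, folded p, folded q_eq]
  have big: "coeff Rem i = 0" if "i > q" for i
    using that l(1) q coeff_eq_0[of Q i] coeff_eq_0[of "[:- d, 1:] ^ N * P" i] by (simp add: Rem_def)
  have "coeff Q q = b" by (simp only: b(1) q)
  then have lead: "coeff Rem q = 0" using l(2) by (simp add: Rem_def)
  have 1: "coeff Rem i = 0" if "i \<ge> q" for i using big lead that by (cases "i = q") auto
  then show "i \<ge> q \<Longrightarrow> coeff Rem i = 0" .
  assume N1: "N \<ge> 1" and i: "i \<ge> q - 1"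
  have q1: "q \<ge> 1" using N1 q_eq by simp
  have "coeff ([:- d, 1:] ^ N * P) (q - 1) = a - of_nat N * d"
    using l(3) q1 unfolding a p[symmetric] by simp
  also have "of_nat N * d = a - c / b" using N1 b(2) by (simp add: d field_simps)
  finally have "coeff Rem (q - 1) = 0" using q1 b(2) by (simp add: Rem_def c)
  then show "coeff Rem i = 0" using 1 i q1 by (cases "i = q - 1") auto
qed

lemma Rem_bound:
  obtains K where "K > 0" "\<And>x. norm x \<ge> 1 \<Longrightarrow> norm (poly Rem (d + x)) * norm x ^ (if N = 0 then 1 else 2) \<le> K * norm x ^ q"
proof (cases "Rem = 0")
  case True
  then show ?thesis by (intro that[of 1]) auto
next
  case False
  define m where "m = (if N = 0 then 1 else 2 :: nat)"
  have dm: "degree Rem + m \<le> q"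
  proof -
    have l: "coeff Rem (degree Rem) \<noteq> 0" using False by simp
    have "degree Rem < q" using l coeff_Rem(1)[of "degree Rem"] by (meson not_le)
    moreover have "N \<ge> 1 \<Longrightarrow> degree Rem < q - 1" using l coeff_Rem(2)[of "degree Rem"] by (meson not_le)
    ultimately show ?thesis by (auto simp: m_def)
  qed
  then have "degree Rem \<le> q - m" by simp
  then obtain K where K: "K > 0" "\<And>x. norm x \<ge> 1 \<Longrightarrow> norm (poly Rem (d + x)) \<le> K * norm x ^ (q - m)"
    using poly_shift_upper by blast
  show ?thesis
  proof (rule that[OF K(1)])
    fix x :: complex assume "norm x \<ge> 1"
    then have "norm (poly Rem (d + x)) * norm x ^ m \<le> K * norm x ^ (q - m) * norm x ^ m"
      by (intro mult_right_mono K) auto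
    also have "\<dots> = K * norm x ^ q" using dm by (simp add: mult.assoc power_add[symmetric])
    finally show "norm (poly Rem (d + x)) * norm x ^ (if N = 0 then 1 else 2) \<le> K * norm x ^ q" by (simp add: m_def)
  qed
qed

lemma P_asymp:
  obtains r where "r \<ge> 1" "\<And>x. norm x \<ge> r \<Longrightarrow> norm (poly P (d + x) / x ^ p - 1) \<le> 1/2"
    "\<And>x. norm x \<ge> r \<Longrightarrow> norm (poly P (d + x)) \<ge> norm x ^ p / 2"
proof -
  obtain K where K: "K > 0" "\<And>x. norm x \<ge> 1 \<Longrightarrow> norm (poly P (d + x) / x ^ p - 1) \<le> K / norm x"
    using monic_shift[OF P_monic] unfolding p by metis
  show ?thesis
  proof (rule that[of "max 1 (2 * K)"])
    fix x :: complex assume x: "norm x \<ge> max 1 (2 * K)"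
    then have x0: "norm x > 0" by linarith
    have "norm (poly P (d + x) / x ^ p - 1) \<le> K / norm x" using K x by simp
    also have "\<dots> \<le> 1/2" using x x0 by (simp add: field_simps)
    finally show 1: "norm (poly P (d + x) / x ^ p - 1) \<le> 1/2" .
    have "norm (poly P (d + x) / x ^ p) \<ge> 1/2"
      using 1 norm_triangle_ineq2[of 1 "1 - poly P (d + x) / x ^ p"] by (simp add: norm_minus_commute)
    then show "norm (poly P (d + x)) \<ge> norm x ^ p / 2" using x0 by (simp add: norm_divide norm_power field_simps)
  qed simp
qed

lemma psi_bound:
  obtains K r where "K > 0" "r \<ge> 1" "\<And>x. norm x \<ge> r \<Longrightarrow> norm (\<psi> x) * norm x ^ (if N = 0 then 1 else 2) \<le> K"
proof -
  obtain K where K: "K > 0" "\<And>x. norm x \<ge> 1 \<Longrightarrow> norm (poly Rem (d + x)) * norm x ^ (if N = 0 then 1 else 2) \<le> K * norm x ^ q"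
    using Rem_bound by metis
  obtain r where r: "r \<ge> 1" "\<And>x. norm x \<ge> r \<Longrightarrow> norm (poly P (d + x)) \<ge> norm x ^ p / 2"
    using P_asymp by metis
  show ?thesis
  proof (rule that[of "2 * K / norm b" r])
    fix x :: complex assume x: "norm x \<ge> r"
    let ?m = "if N = 0 then 1 else 2 :: nat"
    have x1: "norm x \<ge> 1" using x r by simp
    have den: "norm (b * x ^ N * poly P (d + x)) \<ge> norm b * norm x ^ q / 2"
    proof -
      have "norm b * norm x ^ N * (norm x ^ p / 2) \<le> norm b * norm x ^ N * norm (poly P (d + x))"
        using r(2)[OF x] by (intro mult_left_mono) auto
      then show ?thesis by (simp add: norm_mult norm_power q_eq power_add mult_ac)
    qed
    have pos: "norm b * norm x ^ q / 2 > 0" using b(2) x1 by (intro divide_pos_pos mult_pos_pos zero_less_power) auto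
    have "norm (\<psi> x) * norm x ^ ?m = norm (poly Rem (d + x)) * norm x ^ ?m / norm (b * x ^ N * poly P (d + x))"
      by (simp add: \<psi>_def norm_divide)
    also have "\<dots> \<le> K * norm x ^ q / (norm b * norm x ^ q / 2)"
      using den pos K(2)[OF x1] K(1) by (intro frac_le) auto
    also have "\<dots> = 2 * K / norm b" using pos x1 by (auto simp: field_simps)
    finally show "norm (\<psi> x) * norm x ^ ?m \<le> 2 * K / norm b" .
  qed (use K(1) r(1) b(2) in auto)
qed

text \<open>For N = 0 only one order cancels in general. The partial fractions identify the 1/x term
  of \<psi> as the sum of the D_j divided by b, and this is the source of D in the width.\<close>

lemma psi_bound_zero:
  assumes N0: "N = 0"
  obtains K r where "K > 0" "r \<ge> 1"
    "\<And>x. norm x \<ge> r \<Longrightarrow> norm (\<psi> x) \<le> norm (\<Sum>j=1..p. Dj j) / norm b / norm x + K / norm x ^ 2"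
proof -
  have d0: "d = 0" using N0 d by simp
  obtain r1 where r1: "r1 \<ge> 1" "\<And>x. norm x \<ge> r1 \<Longrightarrow> norm (poly P (d + x)) \<ge> norm x ^ p / 2"
    using P_asymp by metis
  obtain K1 r2 where K1: "K1 > 0" "r2 \<ge> 1" "\<And>x. norm x \<ge> r2 \<Longrightarrow> norm (\<psi> x) * norm x ^ 1 \<le> K1"
    using psi_bound N0 by auto
  define M where "M = (\<Sum>j=1..p. norm (pz j)) + 1"
  have Mp: "M > 0" unfolding M_def by (intro add_nonneg_pos sum_nonneg) auto
  have Mj: "norm (pz j) \<le> M" if "j \<in> {1..p}" for j
    using member_le_sum[OF that, of "\<lambda>j. norm (pz j)"] by (simp add: M_def)
  define r where "r = max (max r1 r2) (2 * M)"
  obtain s0 where s0: "S = [:s0:]" using deg_S N0 by (auto elim: degree_eq_zeroE)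
  define K where "K = (\<Sum>j=1..p. norm (Dj j) * (2 * M)) + 1"
  have K0: "K > 0" unfolding K_def using Mp by (intro add_nonneg_pos sum_nonneg) auto
  have main: "norm (b * (1 + \<psi> x) - s0 - (\<Sum>j=1..p. Dj j) / x) \<le> K / norm x ^ 2" if x: "norm x \<ge> r" for x
  proof -
    have x0: "x \<noteq> 0" "norm x \<ge> 1" using x r1 by (auto simp: r_def)
    have "0 < norm x ^ p / 2" using x0 by simp
    then have P0: "poly P (d + x) \<noteq> 0" using r1(2)[of x] x by (auto simp: r_def)
    have "b * (1 + \<psi> x) = s0 + (\<Sum>j=1..p. Dj j / (x - pz j))"
      using Q_factor[OF x0(1) P0] partial_fractions[OF P0] by (simp add: N0 d0 s0)
    then have "b * (1 + \<psi> x) - s0 - (\<Sum>j=1..p. Dj j) / x = (\<Sum>j=1..p. Dj j / (x - pz j) - Dj j / x)"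
      by (simp add: sum_subtractf sum_divide_distrib)
    also have "norm \<dots> \<le> (\<Sum>j=1..p. norm (Dj j) * (2 * M) / norm x ^ 2)"
    proof (rule sum_norm_le)
      fix j assume j: "j \<in> {1..p}"
      have xp: "norm (x - pz j) \<ge> norm x / 2"
        using Mj[OF j] x norm_triangle_ineq2[of x "pz j"] by (simp add: r_def)
      then have xp0: "x - pz j \<noteq> 0" using x0 by auto
      have "Dj j / (x - pz j) - Dj j / x = Dj j * pz j / (x * (x - pz j))"
        using x0 xp0 by (simp add: field_simps)
      also have "norm \<dots> = norm (Dj j) * norm (pz j) / (norm x * norm (x - pz j))" by (simp add: norm_mult norm_divide)
      also have "\<dots> \<le> norm (Dj j) * M / (norm x * (norm x / 2))"
        using xp x0 Mj[OF j] by (intro frac_le mult_left_mono mult_pos_pos) (auto intro!: mult_nonneg_nonneg simp: less_imp_le[OF Mp])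
      also have "\<dots> = norm (Dj j) * (2 * M) / norm x ^ 2" by (simp add: power2_eq_square)
      finally show "norm (Dj j / (x - pz j) - Dj j / x) \<le> norm (Dj j) * (2 * M) / norm x ^ 2" .
    qed
    also have "\<dots> = (\<Sum>j=1..p. norm (Dj j) * (2 * M)) / norm x ^ 2" by (simp add: sum_divide_distrib)
    also have "\<dots> \<le> K / norm x ^ 2" by (intro divide_right_mono) (auto simp: K_def)
    finally show ?thesis .
  qed
  define E where "E = norm (\<Sum>j=1..p. Dj j)"
  \<comment> \<open>The constant term of the partial fractions is b. Otherwise, at a large real t, a
    fixed positive number would be bounded by terms that are all O(1/t).\<close>
  have "norm (b - s0) \<le> 0"
  proof (rule ccontr)
    assume "\<not> norm (b - s0) \<le> 0"
    then have e: "norm (b - s0) > 0" by linarith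
    define t where "t = max r ((K + E + norm b * K1) / norm (b - s0) + 1)"
    have t1: "t \<ge> 1" "t \<ge> r" "t \<ge> r2" using r1 by (auto simp: t_def r_def)
    have "norm (b * (1 + \<psi> (of_real t)) - s0 - (\<Sum>j=1..p. Dj j) / of_real t) \<le> K / t ^ 2"
      using main[of "of_real t"] t1 by simp
    moreover have "b - s0 = (b * (1 + \<psi> (of_real t)) - s0 - (\<Sum>j=1..p. Dj j) / of_real t) + (\<Sum>j=1..p. Dj j) / of_real t - b * \<psi> (of_real t)"
      by (simp add: algebra_simps)
    moreover have "norm (u + v - w) \<le> norm u + norm v + norm w" for u v w :: complex
      using norm_triangle_ineq4[of "u + v" w] norm_triangle_ineq[of u v] by linarith
    ultimately have "norm (b - s0) \<le> K / t ^ 2 + norm ((\<Sum>j=1..p. Dj j) / of_real t) + norm (b * \<psi> (of_real t))"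
      by (smt (verit, ccfv_threshold))
    also have "norm ((\<Sum>j=1..p. Dj j) / of_real t) = E / t" using t1 by (simp add: norm_divide E_def)
    also have "norm (b * \<psi> (of_real t)) \<le> norm b * (K1 / t)"
      unfolding norm_mult using K1(3)[of "of_real t"] t1 by (intro mult_left_mono) (auto simp: field_simps)
    also have "K / t ^ 2 \<le> K / t" using t1 K0 by (intro divide_left_mono) (auto simp: power2_eq_square)
    finally have "norm (b - s0) \<le> K / t + E / t + norm b * (K1 / t)" by simp
    also have "\<dots> = (K + E + norm b * K1) / t" by (simp add: add_divide_distrib)
    finally have "norm (b - s0) * t \<le> K + E + norm b * K1" using t1 by (simp add: pos_le_divide_eq)
    moreover have "(K + E + norm b * K1) / norm (b - s0) < t" by (simp add: t_def)
    then have "K + E + norm b * K1 < norm (b - s0) * t" using e by (simp add: field_simps)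
    ultimately show False by linarith
  qed
  then have bs: "s0 = b" by simp
  show ?thesis
  proof (rule that[of "K / norm b" r])
    show "K / norm b > 0" using K0 b(2) by simp
    show "r \<ge> 1" using r1 by (simp add: r_def)
    fix x :: complex assume x: "norm x \<ge> r"
    have "norm (b * \<psi> x) \<le> norm (b * \<psi> x - (\<Sum>j=1..p. Dj j) / x) + norm ((\<Sum>j=1..p. Dj j) / x)"
      using norm_triangle_ineq[of "b * \<psi> x - (\<Sum>j=1..p. Dj j) / x" "(\<Sum>j=1..p. Dj j) / x"] by simp
    also have "norm (b * \<psi> x - (\<Sum>j=1..p. Dj j) / x) \<le> K / norm x ^ 2"
      using main[OF x] by (simp add: bs algebra_simps)
    finally have "norm b * norm (\<psi> x) \<le> K / norm x ^ 2 + E / norm x" by (simp add: norm_mult norm_divide E_def)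
    then have "norm (\<psi> x) \<le> (K / norm x ^ 2 + E / norm x) / norm b" using b(2) by (simp add: field_simps)
    then show "norm (\<psi> x) \<le> norm (\<Sum>j=1..p. Dj j) / norm b / norm x + K / norm b / norm x ^ 2"
      by (simp add: E_def add_divide_distrib mult_ac)
  qed
qed

end

text \<open>From (csqrt (1 + w) - 1) (csqrt (1 + w) + 1) = w, where the second factor has real part
  at least 1.\<close>

lemma csqrt_near_1:
  assumes "norm w \<le> 1/2"
  shows "Re (1 + w) > 0" "norm (csqrt (1 + w) - 1) \<le> norm w" "norm (csqrt (1 + w)) \<ge> 1/2"
proof -
  show R: "Re (1 + w) > 0" using abs_Re_le_cmod[of w] assms by simp
  have "1 \<le> Re (csqrt (1 + w) + 1)" using Re_csqrt[of "1 + w"] by simp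
  then have n: "1 \<le> norm (csqrt (1 + w) + 1)" using complex_Re_le_cmod order_trans by blast
  have "(csqrt (1 + w) - 1) * (csqrt (1 + w) + 1) = (csqrt (1 + w))\<^sup>2 - 1" by (simp add: algebra_simps power2_eq_square)
  also have "\<dots> = w" by simp
  finally have "norm (csqrt (1 + w) - 1) * norm (csqrt (1 + w) + 1) = norm w" by (metis norm_mult)
  moreover have "norm (csqrt (1 + w) - 1) * 1 \<le> norm (csqrt (1 + w) - 1) * norm (csqrt (1 + w) + 1)"
    using n by (intro mult_left_mono) auto
  ultimately show 1: "norm (csqrt (1 + w) - 1) \<le> norm w" by simp
  then show "norm (csqrt (1 + w)) \<ge> 1/2"
    using assms norm_triangle_ineq2[of 1 "1 - csqrt (1 + w)"] by (simp add: norm_minus_commute)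
qed

context stokes
begin

definition "ray \<theta> s = exp (\<i> * of_real \<theta> + s)"

lemma norm_ray [simp]: "norm (ray \<theta> s) = exp (Re s)" by (simp add: ray_def)
lemma ray_nz [simp]: "ray \<theta> s \<noteq> 0" by (simp add: ray_def)
lemma d_ray: "(ray \<theta> has_field_derivative ray \<theta> s) (at s)"
  unfolding ray_def[abs_def] by (auto intro!: derivative_eq_intros)

lemma d_comp_ray:
  "(f has_field_derivative f') (at (d + ray \<theta> s)) \<Longrightarrow> ((\<lambda>s. f (d + ray \<theta> s)) has_field_derivative f' * ray \<theta> s) (at s)"
  by (rule DERIV_chain2) (auto intro!: derivative_eq_intros d_ray)

text \<open>The identity theorem: a half-ray of zeros accumulates at its starting point.\<close>

lemma g_nonzero_ray: "\<exists>T\<ge>0. g (d + ray \<theta> (s + of_real T)) \<noteq> 0"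
proof (rule ccontr)
  assume "\<not> ?thesis"
  then have z: "\<And>T. T \<ge> 0 \<Longrightarrow> g (d + ray \<theta> (s + of_real T)) = 0" by auto
  define f where "f = (\<lambda>T::real. d + ray \<theta> (s + of_real T))"
  have "((\<lambda>T. f T) \<longlongrightarrow> f 0) (at 0)"
    unfolding f_def ray_def by (intro tendsto_intros)
  have lim: "f 0 islimpt (f ` {0..})"
  proof (rule islimpt_approachable[THEN iffD2], intro allI impI)
    fix e :: real assume "e > 0"
    have "\<forall>\<^sub>F T in at 0. dist (f T) (f 0) < e"
      using \<open>((\<lambda>T. f T) \<longlongrightarrow> f 0) (at 0)\<close> \<open>e > 0\<close> by (rule tendstoD)
    then obtain \<delta> where "\<delta> > 0" "\<And>T. T \<noteq> 0 \<Longrightarrow> dist T 0 < \<delta> \<Longrightarrow> dist (f T) (f 0) < e"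
      by (auto simp: eventually_at)
    then have "dist (f (\<delta> / 2)) (f 0) < e" by auto
    moreover have "f (\<delta> / 2) \<noteq> f 0"
    proof
      assume "f (\<delta> / 2) = f 0"
      then have "norm (ray \<theta> (s + of_real (\<delta> / 2))) = norm (ray \<theta> (s + of_real 0))" by (simp add: f_def)
      then show False using \<open>\<delta> > 0\<close> by simp
    qed
    ultimately show "\<exists>x'\<in>f ` {0..}. x' \<noteq> f 0 \<and> dist x' (f 0) < e" using \<open>\<delta> > 0\<close> by (intro bexI[of _ "f (\<delta> / 2)"]) auto
  qed
  have "g w = 0" for w
    by (rule analytic_continuation[OF entire open_UNIV connected_UNIV _ _ lim]) (use z in \<open>auto simp: f_def\<close>)
  then show False using nontrivial by blast
qed

lemma d_g: "(g has_field_derivative deriv g z) (at z)" "(deriv g has_field_derivative deriv (deriv g) z) (at z)"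
  using entire holomorphic_deriv[OF entire open_UNIV] by (auto intro: holomorphic_derivI[OF _ open_UNIV])

text \<open>The hypothesis on \<theta> turns b x^(N+2) into |b| exp((N+2) s). So H can be taken as
  \<kappa> exp(\<mu> s) times a square root close to 1, with a main term that is positive on the
  ray.\<close>

lemma bridge:
  assumes \<theta>: "b * exp (\<i> * of_real \<theta>) ^ (N + 2) = of_real (cmod b)"
  obtains u V H Sg \<Phi> A \<rho>0 C where "wkb u V H Sg \<Phi> \<rho>0 \<mu> C \<kappa>"
    "\<And>s. Re s > \<rho>0 \<Longrightarrow> g (d + ray \<theta> s) = A s * u s"
    "\<And>s. Re s > \<rho>0 \<Longrightarrow> (A s)\<^sup>2 * H s = exp s * poly P (d + ray \<theta> s)"
    "\<And>s. Re s > \<rho>0 \<Longrightarrow> poly P (d + ray \<theta> s) \<noteq> 0"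
    "\<And>s. Re s > \<rho>0 \<Longrightarrow> norm (H s - of_real \<kappa> * exp (of_real \<mu> * s)) \<le> \<kappa> * exp (\<mu> * Re s) * norm (\<psi> (ray \<theta> s))"
proof -
  obtain r1 where r1: "r1 \<ge> 1" "\<And>x. norm x \<ge> r1 \<Longrightarrow> norm (poly P (d + x) / x ^ p - 1) \<le> 1/2"
    "\<And>x. norm x \<ge> r1 \<Longrightarrow> norm (poly P (d + x)) \<ge> norm x ^ p / 2"
    using P_asymp by metis
  obtain K r2 where K: "K > 0" "r2 \<ge> 1" "\<And>x. norm x \<ge> r2 \<Longrightarrow> norm (\<psi> x) * norm x ^ (if N = 0 then 1 else 2) \<le> K"
    using psi_bound by metis
  have psiK: "norm (\<psi> x) \<le> K / norm x" if "norm x \<ge> r2" for x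
  proof -
    have x1: "norm x \<ge> 1" using that K by linarith
    have "norm (\<psi> x) * norm x ^ 1 \<le> norm (\<psi> x) * norm x ^ (if N = 0 then 1 else 2)"
      using x1 by (intro mult_left_mono power_increasing) auto
    then have "norm (\<psi> x) * norm x \<le> K" using K(3)[OF that] by simp
    moreover have "norm x > 0" using x1 by linarith
    ultimately show ?thesis by (simp add: pos_le_divide_eq)
  qed
  \<comment> \<open>To the right of this abscissa P has no zeros and \<psi> is at most 1/2 in norm,
    so 1 + \<psi> stays in the domain of the principal square root.\<close>
  define \<rho>a where "\<rho>a = ln (max (max r1 r2) (2 * K))"
  have mx: "max (max r1 r2) (2 * K) \<ge> 1" using r1 by simp
  have \<rho>a0: "\<rho>a \<ge> 0" using mx by (simp add: \<rho>a_def)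
  have big: "exp (Re s) \<ge> r1" "exp (Re s) \<ge> r2" "exp (Re s) \<ge> 2 * K" if "Re s > \<rho>a" for s
  proof -
    have "exp \<rho>a \<le> exp (Re s)" using that by simp
    moreover have "exp \<rho>a = max (max r1 r2) (2 * K)" using mx by (simp add: \<rho>a_def)
    ultimately show "exp (Re s) \<ge> r1" "exp (Re s) \<ge> r2" "exp (Re s) \<ge> 2 * K" by auto
  qed
  define \<Omega> where "\<Omega> = {s. Re s > \<rho>a}"
  have op: "open \<Omega>" by (simp add: \<Omega>_def halfplane)
  let ?x = "ray \<theta>"
  have P0: "poly P (d + ?x s) \<noteq> 0" if "Re s > \<rho>a" for s
  proof -
    have "norm (?x s) \<ge> r1" using big[OF that] by simp
    then have "norm (?x s) ^ p / 2 \<le> norm (poly P (d + ?x s))" by (rule r1(3))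
    moreover have "0 < norm (?x s) ^ p / 2" by simp
    ultimately have "0 < norm (poly P (d + ?x s))" by linarith
    then show ?thesis by auto
  qed
  define \<phi> where "\<phi> = (\<lambda>s. poly P (d + ?x s) / ?x s ^ p - 1)"
  define w where "w = (\<lambda>s. \<psi> (?x s))"
  have \<phi>half: "norm (\<phi> s) \<le> 1/2" if "Re s > \<rho>a" for s using r1(2)[of "?x s"] big[OF that] by (simp add: \<phi>_def)
  have wK: "norm (w s) \<le> K / exp (Re s)" if "Re s > \<rho>a" for s using psiK[of "?x s"] big[OF that] by (simp add: w_def)
  have whalf: "norm (w s) \<le> 1/2" if "Re s > \<rho>a" for s
  proof -
    have "K / exp (Re s) \<le> 1/2" using big(3)[OF that] by (simp add: field_simps)
    then show ?thesis using wK[OF that] by linarith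
  qed
  have polyhol: "(\<lambda>s. poly R (d + ?x s)) holomorphic_on \<Omega>" for R
    using d_comp_ray[OF poly_DERIV] op by (auto simp: holomorphic_on_open)
  have xhol: "?x holomorphic_on \<Omega>" using d_ray op by (auto simp: holomorphic_on_open)
  have \<phi>hol: "\<phi> holomorphic_on \<Omega>" unfolding \<phi>_def by (intro holomorphic_intros polyhol xhol) auto
  have whol: "w holomorphic_on \<Omega>" unfolding w_def \<psi>_def
    by (intro holomorphic_intros polyhol xhol) (use P0 b(2) in \<open>auto simp: \<Omega>_def\<close>)
  have d\<phi>: "(\<phi> has_field_derivative deriv \<phi> s) (at s)" and dw: "(w has_field_derivative deriv w s) (at s)"
    if "Re s > \<rho>a" for s
    using holomorphic_derivI[OF \<phi>hol op] holomorphic_derivI[OF whol op] that by (auto simp: \<Omega>_def)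
  have ne1: "1 + z \<noteq> 0" "norm (1 + z) \<ge> 1/2" if "norm z \<le> 1/2" for z :: complex
    using that norm_triangle_ineq2[of 1 "- z"] by auto
  define H where "H = (\<lambda>s. of_real \<kappa> * exp (of_real \<mu> * s) * csqrt (1 + w s))"
  define h1 where "h1 = (\<lambda>s. of_real \<mu> + deriv w s / (2 * (1 + w s)))"
  \<comment> \<open>With G1 = dG/ds the equation becomes dG1/ds = l1 G1 - H^2 G, and l1 is the
    logarithmic derivative of \<open>P1\<close>. The summand 1 comes from differentiating the factor
    x in G1.\<close>
  define l1 where "l1 = (\<lambda>s. 1 + ?x s * poly (pderiv P) (d + ?x s) / poly P (d + ?x s))"
  define P1 where "P1 = (\<lambda>s. exp s * poly P (d + ?x s))"
  define G where "G = (\<lambda>s. g (d + ?x s))"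
  define G1 where "G1 = (\<lambda>s. deriv g (d + ?x s) * ?x s)"
  have H2: "(H s)\<^sup>2 = ?x s ^ 2 * (poly Q (d + ?x s) / poly P (d + ?x s))" if s: "Re s > \<rho>a" for s
  proof -
    have "exp (of_real \<mu> * s) ^ 2 = exp (2 * (of_real \<mu> * s))" by (metis exp_of_nat_mult of_nat_numeral)
    also have "2 * (of_real \<mu> * s) = of_nat (N + 2) * s" by (simp add: \<mu>_def algebra_simps)
    also have "exp (of_nat (N + 2) * s) = exp s ^ (N + 2)" by (rule exp_of_nat_mult)
    finally have e: "exp (of_real \<mu> * s) ^ 2 = exp s ^ (N + 2)" .
    have k: "of_real \<kappa> ^ 2 = (of_real (cmod b) :: complex)" by (simp add: \<kappa>_def flip: of_real_power)
    have "(H s)\<^sup>2 = of_real (cmod b) * exp s ^ (N + 2) * (1 + w s)"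
      by (simp add: H_def power_mult_distrib e k)
    also have "of_real (cmod b) * exp s ^ (N + 2) = b * (exp (\<i> * of_real \<theta>) * exp s) ^ (N + 2)"
      unfolding \<theta>[symmetric] power_mult_distrib by (simp only: mult.assoc)
    also have "exp (\<i> * of_real \<theta>) * exp s = ?x s" by (simp add: ray_def exp_add)
    also have "b * ?x s ^ (N + 2) * (1 + w s) = ?x s ^ 2 * (b * ?x s ^ N * (1 + \<psi> (?x s)))"
      by (simp add: power_add power2_eq_square w_def mult_ac)
    finally show ?thesis using Q_factor[OF ray_nz P0[OF s]] by simp
  qed
  have dH: "(H has_field_derivative h1 s * H s) (at s)" if s: "Re s > \<rho>a" for s
  proof -
    have "1 + w s \<notin> \<real>\<^sub>\<le>\<^sub>0" using csqrt_near_1(1)[OF whalf[OF s]] by (auto simp: complex_nonpos_Reals_iff)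
    then have X: "((\<lambda>s. csqrt (1 + w s)) has_field_derivative inverse (2 * csqrt (1 + w s)) * deriv w s) (at s)"
      by (intro DERIV_chain2[OF has_field_derivative_csqrt]) (auto intro!: derivative_eq_intros dw s)
    have cz: "csqrt (1 + w s) \<noteq> 0" using ne1(1)[OF whalf[OF s]] by simp
    have "inverse (2 * csqrt (1 + w s)) * deriv w s = deriv w s / (2 * (csqrt (1 + w s))\<^sup>2) * csqrt (1 + w s)"
      using cz by (simp add: power2_eq_square field_simps)
    then have eq: "inverse (2 * csqrt (1 + w s)) * deriv w s = deriv w s / (2 * (1 + w s)) * csqrt (1 + w s)"
      by (simp only: power2_csqrt)
    have dc: "((\<lambda>s. csqrt (1 + w s)) has_field_derivative deriv w s / (2 * (1 + w s)) * csqrt (1 + w s)) (at s)"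
      using X by (simp only: eq)
    have de: "((\<lambda>s. of_real \<kappa> * exp (of_real \<mu> * s)) has_field_derivative of_real \<mu> * (of_real \<kappa> * exp (of_real \<mu> * s))) (at s)"
      by (auto intro!: derivative_eq_intros)
    show ?thesis unfolding H_def
      by (rule DERIV_cong[OF DERIV_mult[OF de dc]]) (simp add: h1_def algebra_simps)
  qed
  have H0: "H s \<noteq> 0" if "Re s > \<rho>a" for s
    using kappa_pos ne1(1)[OF whalf[OF that]] by (simp add: H_def)
  have dG: "(G has_field_derivative G1 s) (at s)" for s
    unfolding G_def G1_def by (rule d_comp_ray[OF d_g(1)])
  have dG1: "(G1 has_field_derivative l1 s * G1 s - (H s)\<^sup>2 * G s) (at s)" if s: "Re s > \<rho>a" for s
  proof -
    let ?z = "d + ?x s"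
    have o: "deriv (deriv g) ?z = poly (pderiv P) ?z / poly P ?z * deriv g ?z - poly Q ?z / poly P ?z * g ?z"
      using ode[OF P0[OF s]] by (simp add: algebra_simps)
    show ?thesis unfolding G1_def
      by (rule DERIV_cong[OF DERIV_mult[OF d_comp_ray[OF d_g(2)] d_ray]])
        (simp only: o l1_def H2[OF s] G_def, simp add: algebra_simps power2_eq_square)
  qed
  have dP1: "(P1 has_field_derivative l1 s * P1 s) (at s)" if s: "Re s > \<rho>a" for s
    unfolding P1_def
    by (rule DERIV_cong[OF DERIV_mult[OF DERIV_exp d_comp_ray[OF poly_DERIV]]])
      (use P0[OF s] in \<open>simp add: l1_def field_simps\<close>)
  \<comment> \<open>Expressed through \<phi> = P/x^p - 1, which is bounded, so that Cauchy's
    estimate for \<phi> bounds l1.\<close>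
  have l1eq: "l1 s = of_nat p + 1 + deriv \<phi> s / (1 + \<phi> s)" if s: "Re s > \<rho>a" for s
  proof -
    let ?z = "d + ?x s"
    have xp: "((\<lambda>s. ?x s ^ p) has_field_derivative of_nat p * ?x s ^ p) (at s)"
      by (rule DERIV_cong[OF DERIV_power[OF d_ray]]) (cases p; simp)
    have "(\<phi> has_field_derivative (poly (pderiv P) ?z * ?x s * ?x s ^ p - poly P ?z * (of_nat p * ?x s ^ p)) / (?x s ^ p * ?x s ^ p) - 0) (at s)"
      unfolding \<phi>_def by (intro DERIV_diff DERIV_divide d_comp_ray poly_DERIV xp DERIV_const) simp
    then have "deriv \<phi> s = (poly (pderiv P) ?z * ?x s * ?x s ^ p - poly P ?z * (of_nat p * ?x s ^ p)) / (?x s ^ p * ?x s ^ p)"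
      using DERIV_imp_deriv by simp blast
    also have "\<dots> = (poly (pderiv P) ?z * ?x s - poly P ?z * of_nat p) / ?x s ^ p"
      by (simp add: field_simps)
    finally have "deriv \<phi> s / (1 + \<phi> s) = (poly (pderiv P) ?z * ?x s - poly P ?z * of_nat p) / poly P ?z"
      using P0[OF s] by (simp add: \<phi>_def)
    then show ?thesis using P0[OF s] by (simp add: l1_def field_simps)
  qed
  define B where "B = real p + 2 + \<mu>"
  have l1B: "norm (l1 s) \<le> B" if s: "Re s > \<rho>a + 1" for s
  proof -
    have sa: "Re s > \<rho>a" using s by simp
    have "norm (deriv \<phi> s) \<le> 1/2" by (rule deriv_bound_halfplane[OF \<phi>hol[unfolded \<Omega>_def] \<phi>half s])
    then have "norm (deriv \<phi> s / (1 + \<phi> s)) \<le> (1/2) / (1/2)"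
      unfolding norm_divide using ne1(2)[OF \<phi>half[OF sa]] by (intro frac_le) auto
    moreover have "norm (l1 s) \<le> norm (of_nat p + 1 :: complex) + norm (deriv \<phi> s / (1 + \<phi> s))"
      unfolding l1eq[OF sa] by (rule norm_triangle_ineq)
    moreover have "norm (of_nat p + 1 :: complex) = real p + 1" by (metis norm_of_nat of_nat_Suc add.commute)
    ultimately show ?thesis using mu_ge by (simp add: B_def)
  qed
  have h1B: "norm (h1 s) \<le> B" if s: "Re s > \<rho>a + 1" for s
  proof -
    have sa: "Re s > \<rho>a" using s by simp
    have "norm (deriv w s) \<le> 1/2" by (rule deriv_bound_halfplane[OF whol[unfolded \<Omega>_def] whalf s])
    then have "norm (deriv w s / (2 * (1 + w s))) \<le> (1/2) / (2 * (1/2))"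
      unfolding norm_divide norm_mult using ne1(2)[OF whalf[OF sa]] by (intro frac_le) auto
    moreover have "norm (h1 s) \<le> norm (of_real \<mu> :: complex) + norm (deriv w s / (2 * (1 + w s)))"
      unfolding h1_def by (rule norm_triangle_ineq)
    ultimately show ?thesis using mu_ge by (simp add: B_def)
  qed
  have sub: "{s. Re s > \<rho>a + 1} \<subseteq> \<Omega>" by (auto simp: \<Omega>_def)
  have l1hol: "l1 holomorphic_on {s. Re s > \<rho>a + 1}" unfolding l1_def
    by (rule holomorphic_on_subset[OF _ sub], intro holomorphic_intros polyhol xhol) (use P0 in \<open>auto simp: \<Omega>_def\<close>)
  have ne2: "2 * (1 + w s) \<noteq> 0" if "Re s > \<rho>a" for s using ne1(1)[OF whalf[OF that]] by (simp del: distrib_left_numeral)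
  have h1hol: "h1 holomorphic_on {s. Re s > \<rho>a + 1}" unfolding h1_def
    by (rule holomorphic_on_subset[OF _ sub], intro holomorphic_intros holomorphic_deriv whol op)
      (use ne2 in \<open>auto simp: \<Omega>_def\<close>)
  have up: "Re s > \<rho>a" if "Re s > \<rho>a + 1" for s using that by simp
  have P1n: "P1 s \<noteq> 0" if "Re s > \<rho>a" for s using P0[OF that] by (simp add: P1_def)
  obtain u V Sg \<Phi> A where
    T: "\<And>s. Re s > \<rho>a + 1 + 1 \<Longrightarrow> (u has_field_derivative H s * V s) (at s)"
    "\<And>s. Re s > \<rho>a + 1 + 1 \<Longrightarrow> (V has_field_derivative - (H s + Sg s) * u s) (at s)"
    "\<And>s. Re s > \<rho>a + 1 + 1 \<Longrightarrow> (\<Phi> has_field_derivative H s) (at s)"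
    "\<And>s. Re s > \<rho>a + 1 + 1 \<Longrightarrow> norm (Sg s) \<le> (B + 2 * B\<^sup>2) / norm (H s)"
    "\<And>s. Re s > \<rho>a + 1 + 1 \<Longrightarrow> G s = A s * u s"
    "\<And>s. Re s > \<rho>a + 1 + 1 \<Longrightarrow> (A s)\<^sup>2 * H s = P1 s"
    by (rule liouville_transform[OF dG dG1[OF up] dP1[OF up] dH[OF up] P1n[OF up] H0[OF up] l1hol l1B h1hol h1B])
      (assumption+, rule that, assumption+)
  define \<rho>0 where "\<rho>0 = \<rho>a + 1 + 1"
  have Hc: "norm (H s - of_real \<kappa> * exp (of_real \<mu> * s)) \<le> \<kappa> * exp (\<mu> * Re s) * norm (\<psi> (?x s))"
    if s: "Re s > \<rho>a" for s
  proof -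
    have "H s - of_real \<kappa> * exp (of_real \<mu> * s) = of_real \<kappa> * exp (of_real \<mu> * s) * (csqrt (1 + w s) - 1)"
      by (simp add: H_def algebra_simps)
    then have "norm (H s - of_real \<kappa> * exp (of_real \<mu> * s)) = \<kappa> * exp (\<mu> * Re s) * norm (csqrt (1 + w s) - 1)"
      using kappa_pos by (simp add: norm_mult)
    also have "\<dots> \<le> \<kappa> * exp (\<mu> * Re s) * norm (w s)"
      using csqrt_near_1(2)[OF whalf[OF s]] kappa_pos by (intro mult_left_mono) auto
    finally show ?thesis by (simp add: w_def)
  qed
  define C where "C = max (2 * (B + 2 * B\<^sup>2) / \<kappa>) (\<kappa> * K)"
  have B0: "B \<ge> 0" using mu_ge by (simp add: B_def)
  have "wkb u V H Sg \<Phi> \<rho>0 \<mu> C \<kappa>"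
  proof unfold_locales
    show "0 < C" using kappa_pos K(1) by (simp add: C_def less_max_iff_disj)
    fix s assume s: "\<rho>0 < Re s"
    then have sa: "Re s > \<rho>a" by (simp add: \<rho>0_def)
    have Hlow: "norm (H s) \<ge> \<kappa> / 2 * exp (\<mu> * Re s)"
    proof -
      have "\<kappa> * exp (\<mu> * Re s) * (1/2) \<le> \<kappa> * exp (\<mu> * Re s) * norm (csqrt (1 + w s))"
        using csqrt_near_1(3)[OF whalf[OF sa]] kappa_pos by (intro mult_left_mono) auto
      then show ?thesis using kappa_pos by (simp add: H_def norm_mult)
    qed
    have "norm (Sg s) \<le> (B + 2 * B\<^sup>2) / norm (H s)" using T(4) s by (simp add: \<rho>0_def)
    also have "\<dots> \<le> (B + 2 * B\<^sup>2) / (\<kappa> / 2 * exp (\<mu> * Re s))"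
      using Hlow kappa_pos B0 by (intro divide_left_mono) (auto intro!: mult_pos_pos simp: H0[OF sa])
    also have "\<dots> = 2 * (B + 2 * B\<^sup>2) / \<kappa> * exp (- \<mu> * Re s)"
      using kappa_pos by (simp add: exp_minus field_simps)
    also have "\<dots> \<le> C * exp (- \<mu> * Re s)" by (intro mult_right_mono) (auto simp: C_def)
    finally show "norm (Sg s) \<le> C * exp (- \<mu> * Re s)" .
    have "norm (H s - of_real \<kappa> * exp (of_real \<mu> * s)) \<le> \<kappa> * exp (\<mu> * Re s) * (K / exp (Re s))"
      using Hc[OF sa] wK[OF sa] kappa_pos by (intro order_trans[OF Hc[OF sa]] mult_left_mono) (auto simp: w_def)
    also have "\<dots> = \<kappa> * K * exp ((\<mu> - 1) * Re s)" by (simp add: left_diff_distrib exp_diff)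
    also have "\<dots> \<le> C * exp ((\<mu> - 1) * Re s)" by (intro mult_right_mono) (auto simp: C_def)
    finally show "norm (H s - of_real \<kappa> * exp (of_real \<mu> * s)) \<le> C * exp ((\<mu> - 1) * Re s)" .
    obtain t where t: "t \<ge> 0" "g (d + ray \<theta> (s + of_real t)) \<noteq> 0" using g_nonzero_ray by blast
    then have "u (s + of_real t) \<noteq> 0" using T(5)[of "s + of_real t"] s by (auto simp: \<rho>0_def G_def)
    then show "\<exists>t\<ge>0. u (s + of_real t) \<noteq> 0" using t by blast
  qed (use T mu_ge kappa_pos \<rho>a0 in \<open>auto simp: \<rho>0_def\<close>)
  then show ?thesis
    by (rule that[of u V H Sg \<Phi> \<rho>0 C A]) (use T(5,6) P0 Hc in \<open>auto simp: \<rho>0_def G_def P1_def\<close>)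
qed

end

section \<open>Rays and sectors in logarithmic coordinates\<close>

context stokes
begin

lemma mu_N: "real N + 2 = 2 * \<mu>" by (simp add: \<mu>_def)

lemma stokes_angle_exp: "b * exp (\<i> * of_real (stokes_angle N b k)) ^ (N + 2) = of_real (cmod b)"
proof -
  have "exp (\<i> * of_real (stokes_angle N b k)) ^ (N + 2) = exp (of_nat (N + 2) * (\<i> * of_real (stokes_angle N b k)))"
    by (rule exp_of_nat_mult[symmetric])
  also have "of_nat (N + 2) * (\<i> * of_real (stokes_angle N b k)) = \<i> * of_real ((real N + 2) * stokes_angle N b k)" by simp
  also have "(real N + 2) * stokes_angle N b k = 2 * pi * of_int k - Arg b" by (simp add: stokes_angle_def)
  also have "\<i> * of_real (2 * pi * of_int k - Arg b) = 2 * of_int k * of_real pi * \<i> - \<i> * of_real (Arg b)"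
    by (simp add: algebra_simps)
  also have "exp \<dots> = exp (2 * of_int k * of_real pi * \<i>) / exp (\<i> * of_real (Arg b))" by (rule exp_diff)
  also have "exp (2 * of_int k * of_real pi * \<i>) = 1" by (simp add: exp_eq_1)
  finally have e: "exp (\<i> * of_real (stokes_angle N b k)) ^ (N + 2) = 1 / exp (\<i> * of_real (Arg b))" .
  have "b = of_real (cmod b) * exp (\<i> * of_real (Arg b))" using Arg_eq[OF b(2)] .
  then show ?thesis unfolding e by (metis exp_not_eq_zero mult.right_neutral nonzero_mult_div_cancel_right times_divide_eq_right)
qed

lemma stokes_angle_Suc: "stokes_angle N b (k + 1) = stokes_angle N b k + pi / \<mu>"
  using mu_ge by (simp add: stokes_angle_def mu_N field_simps)

lemma ray_of_Arg:
  assumes "z \<noteq> d" "is_Arg (z - d) t"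
  shows "z = d + ray \<theta> (Complex (ln (cmod (z - d))) (t - \<theta>))"
proof -
  have e: "\<i> * of_real \<theta> + Complex (ln (cmod (z - d))) (t - \<theta>) = of_real (ln (cmod (z - d))) + \<i> * of_real t"
    by (simp add: complex_eq_iff)
  have "ray \<theta> (Complex (ln (cmod (z - d))) (t - \<theta>)) = exp (of_real (ln (cmod (z - d)))) * exp (\<i> * of_real t)"
    unfolding ray_def e by (rule exp_add)
  also have "exp (of_real (ln (cmod (z - d)))) = (of_real (cmod (z - d)) :: complex)"
    using assms(1) by (simp add: exp_of_real)
  also have "of_real (cmod (z - d)) * exp (\<i> * of_real t) = z - d" using assms(2) by (simp add: is_Arg_def)
  finally show ?thesis by simp
qed

lemma Arg_ray: "is_Arg (ray \<theta> s) (\<theta> + Im s)"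
proof -
  have "\<i> * of_real \<theta> + s = of_real (Re s) + \<i> * of_real (\<theta> + Im s)" by (simp add: complex_eq_iff)
  then show ?thesis unfolding is_Arg_def ray_def by (simp only: exp_add norm_mult) (simp add: exp_of_real)
qed

text \<open>Seen from ray k, sector k becomes the strip 0 < Im s < pi/\<mu> and sector k - 1 its
  mirror image. Each sector therefore has two coordinates, one from each bounding ray.\<close>

lemma right_subsector:
  "z \<in> stokes_subsector N b d k \<delta> \<longleftrightarrow> (\<exists>s. z = d + ray (stokes_angle N b k) s \<and> \<delta> < Im s \<and> Im s < pi / \<mu> - \<delta>)"
proof
  assume "z \<in> stokes_subsector N b d k \<delta>"
  then obtain t where t: "z \<noteq> d" "is_Arg (z - d) t" "stokes_angle N b k + \<delta> < t" "t < stokes_angle N b k + pi / \<mu> - \<delta>"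
    by (auto simp: stokes_subsector_def stokes_angle_Suc)
  show "\<exists>s. z = d + ray (stokes_angle N b k) s \<and> \<delta> < Im s \<and> Im s < pi / \<mu> - \<delta>"
    by (rule exI, rule conjI[OF ray_of_Arg[OF t(1,2)]]) (use t in auto)
next
  assume "\<exists>s. z = d + ray (stokes_angle N b k) s \<and> \<delta> < Im s \<and> Im s < pi / \<mu> - \<delta>"
  then show "z \<in> stokes_subsector N b d k \<delta>"
    using Arg_ray[of "stokes_angle N b k"] by (force simp: stokes_subsector_def stokes_angle_Suc)
qed

lemma left_subsector:
  "z \<in> stokes_subsector N b d (k - 1) \<delta> \<longleftrightarrow> (\<exists>s. z = d + ray (stokes_angle N b k) s \<and> - (pi / \<mu>) + \<delta> < Im s \<and> Im s < - \<delta>)"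
proof -
  have a: "stokes_angle N b (k - 1) = stokes_angle N b k - pi / \<mu>" using stokes_angle_Suc[of "k - 1"] by simp
  show ?thesis
  proof
    assume "z \<in> stokes_subsector N b d (k - 1) \<delta>"
    then obtain t where t: "z \<noteq> d" "is_Arg (z - d) t" "stokes_angle N b k - pi / \<mu> + \<delta> < t" "t < stokes_angle N b k - \<delta>"
      by (auto simp: stokes_subsector_def a)
    show "\<exists>s. z = d + ray (stokes_angle N b k) s \<and> - (pi / \<mu>) + \<delta> < Im s \<and> Im s < - \<delta>"
      by (rule exI, rule conjI[OF ray_of_Arg[OF t(1,2)]]) (use t in auto)
  next
    assume "\<exists>s. z = d + ray (stokes_angle N b k) s \<and> - (pi / \<mu>) + \<delta> < Im s \<and> Im s < - \<delta>"
    then show "z \<in> stokes_subsector N b d (k - 1) \<delta>"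
      using Arg_ray[of "stokes_angle N b k"] by (force simp: stokes_subsector_def a)
  qed
qed

text \<open>The criterion uses the square of |g| because the amplitude is known only through A^2.
  The predicate \<open>X\<close> describes the subsector in the coordinate s.\<close>

lemma infinity_in_sectorI:
  assumes sub: "\<And>\<delta> z. \<lbrakk>0 < \<delta>; \<delta> < \<delta>0; z \<in> stokes_subsector N b d j \<delta>\<rbrakk> \<Longrightarrow> \<exists>s. z = d + ray \<theta> s \<and> X \<delta> s"
    and \<delta>0: "\<delta>0 > 0"
    and low: "\<And>\<delta>. \<lbrakk>0 < \<delta>; \<delta> < \<delta>0\<rbrakk> \<Longrightarrow> \<exists>f \<rho>1. filterlim f at_top at_top \<and> (\<forall>s. \<rho>1 \<le> Re s \<longrightarrow> X \<delta> s \<longrightarrow> f (Re s) \<le> (norm (g (d + ray \<theta> s)))\<^sup>2)"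
  shows "infinity_in_stokes_sector N b d j g"
proof -
  have "filterlim g at_infinity (inf at_infinity (principal (stokes_subsector N b d j \<delta>)))" if \<delta>: "0 < \<delta>" "\<delta> < \<delta>0" for \<delta>
  proof (subst filterlim_at_infinity[OF order_refl], intro allI impI)
    fix r :: real assume r: "r > 0"
    obtain f \<rho>1 where f: "filterlim f at_top at_top"
      and lo: "\<And>s. \<rho>1 \<le> Re s \<Longrightarrow> X \<delta> s \<Longrightarrow> f (Re s) \<le> (norm (g (d + ray \<theta> s)))\<^sup>2" using low[OF \<delta>] by blast
    have "\<forall>\<^sub>F \<rho> in at_top. r\<^sup>2 \<le> f \<rho> \<and> \<rho>1 \<le> \<rho>"
      using f eventually_ge_at_top by (intro eventually_conj) (auto simp: filterlim_at_top)
    then obtain R where R: "\<And>\<rho>. \<rho> \<ge> R \<Longrightarrow> r\<^sup>2 \<le> f \<rho> \<and> \<rho>1 \<le> \<rho>" by (auto simp: eventually_at_top_linorder)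
    have main: "r \<le> norm (g z)" if z: "norm z \<ge> exp R + norm d" "z \<in> stokes_subsector N b d j \<delta>" for z
    proof -
      obtain s where s: "z = d + ray \<theta> s" "X \<delta> s" using sub[OF \<delta> z(2)] by blast
      have "norm z \<le> norm d + exp (Re s)" unfolding s(1) by (rule order_trans[OF norm_triangle_ineq]) simp
      then have "exp R \<le> exp (Re s)" using z(1) by linarith
      then have "R \<le> Re s" by simp
      then have "r\<^sup>2 \<le> (norm (g z))\<^sup>2" using R[of "Re s"] lo[of s] s by force
      then show ?thesis by (rule power2_le_imp_le) simp
    qed
    show "\<forall>\<^sub>F z in inf at_infinity (principal (stokes_subsector N b d j \<delta>)). r \<le> norm (g z)"
      unfolding eventually_inf_principal eventually_at_infinity using main by blast
  qed
  then show ?thesis unfolding infinity_in_stokes_sector_def eventually_at_right_field using \<delta>0 by blast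
qed

text \<open>A single half-line on which g tends to 0, lying in the subsectors for all small
  \<delta>, refutes the limit.\<close>

lemma not_infinity_in_sectorI:
  assumes mem: "\<And>\<delta> \<rho>. \<lbrakk>0 < \<delta>; \<delta> < \<delta>0\<rbrakk> \<Longrightarrow> d + ray \<theta> (Complex \<rho> \<tau>) \<in> stokes_subsector N b d j \<delta>"
    and \<delta>0: "\<delta>0 > 0"
    and f: "(f \<longlongrightarrow> 0) at_top"
    and up: "\<And>\<rho>. \<rho>1 \<le> \<rho> \<Longrightarrow> (norm (g (d + ray \<theta> (Complex \<rho> \<tau>))))\<^sup>2 \<le> f \<rho>"
  shows "\<not> infinity_in_stokes_sector N b d j g"
proof
  assume "infinity_in_stokes_sector N b d j g"
  then have "\<forall>\<^sub>F \<delta> in at_right 0. filterlim g at_infinity (inf at_infinity (principal (stokes_subsector N b d j \<delta>)))"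
    by (simp add: infinity_in_stokes_sector_def)
  moreover have "\<forall>\<^sub>F \<delta> in at_right 0. 0 < \<delta> \<and> \<delta> < \<delta>0"
    using \<delta>0 eventually_at_right_field by blast
  ultimately have "\<forall>\<^sub>F \<delta> in at_right 0. 0 < \<delta> \<and> \<delta> < \<delta>0 \<and> filterlim g at_infinity (inf at_infinity (principal (stokes_subsector N b d j \<delta>)))"
    by eventually_elim auto
  then obtain \<delta> where \<delta>: "0 < \<delta>" "\<delta> < \<delta>0" "filterlim g at_infinity (inf at_infinity (principal (stokes_subsector N b d j \<delta>)))"
    using eventually_happens'[of "at_right (0::real)"] by auto
  then have "\<forall>\<^sub>F z in inf at_infinity (principal (stokes_subsector N b d j \<delta>)). 1 \<le> norm (g z)"
    by (subst (asm) filterlim_at_infinity[OF order_refl]) auto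
  then obtain B where B: "\<And>z. norm z \<ge> B \<Longrightarrow> z \<in> stokes_subsector N b d j \<delta> \<Longrightarrow> 1 \<le> norm (g z)"
    unfolding eventually_inf_principal eventually_at_infinity by blast
  have "\<forall>\<^sub>F \<rho> in at_top. f \<rho> < 1 \<and> \<rho>1 \<le> \<rho> \<and> ln (\<bar>B\<bar> + norm d + 1) \<le> \<rho>"
    using order_tendstoD(2)[OF f, of 1] by (intro eventually_conj eventually_ge_at_top) auto
  then obtain \<rho> where \<rho>: "f \<rho> < 1" "\<rho>1 \<le> \<rho>" "ln (\<bar>B\<bar> + norm d + 1) \<le> \<rho>"
    using eventually_happens'[of "at_top :: real filter"] by auto
  let ?z = "d + ray \<theta> (Complex \<rho> \<tau>)"
  have "\<bar>B\<bar> + norm d + 1 > 0" by (smt (verit) norm_ge_zero)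
  then have "\<bar>B\<bar> + norm d + 1 \<le> exp \<rho>" using \<rho>(3) by (metis exp_le_cancel_iff exp_ln)
  moreover have "exp \<rho> \<le> norm ?z + norm d"
    using norm_triangle_ineq4[of ?z d] by simp
  ultimately have "norm ?z \<ge> B" by linarith
  then have "1 \<le> norm (g ?z)" using B mem \<delta> by blast
  then have "1 \<le> (norm (g ?z))\<^sup>2" by (simp add: one_le_power)
  then show False using up[OF \<rho>(2)] \<rho>(1) by linarith
qed

end

text \<open>One ray together with the output of \<open>bridge\<close>. A dedicated context allows
  the same ray data to serve both adjacent sectors, the zeros near the ray and the circles around
  far points.\<close>

locale stokes_ray = stokes +
  fixes k :: int and \<theta> :: real and u V H Sg \<Phi> A :: "complex \<Rightarrow> complex" and \<rho>0 C :: real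
  assumes \<theta>: "\<theta> = stokes_angle N b k"
    and W: "wkb u V H Sg \<Phi> \<rho>0 \<mu> C \<kappa>"
    and gA: "\<And>s. Re s > \<rho>0 \<Longrightarrow> g (d + ray \<theta> s) = A s * u s"
    and AH: "\<And>s. Re s > \<rho>0 \<Longrightarrow> (A s)\<^sup>2 * H s = exp s * poly P (d + ray \<theta> s)"
    and P0: "\<And>s. Re s > \<rho>0 \<Longrightarrow> poly P (d + ray \<theta> s) \<noteq> 0"
    and Hpsi: "\<And>s. Re s > \<rho>0 \<Longrightarrow> norm (H s - of_real \<kappa> * exp (of_real \<mu> * s)) \<le> \<kappa> * exp (\<mu> * Re s) * norm (\<psi> (ray \<theta> s))"
begin

sublocale w: wkb u V H Sg \<Phi> \<rho>0 \<mu> C \<kappa> by (rule W)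

lemma A_nz: "Re s > \<rho>0 \<Longrightarrow> A s \<noteq> 0" and H_nz: "Re s > \<rho>0 \<Longrightarrow> H s \<noteq> 0"
  using AH[of s] P0[of s] by auto

text \<open>By A^2 H = exp s * P both bounds are powers of |z - d|. They are negligible against the
  doubly exponential growth or decay of \<open>u\<close>, so the latter alone decides about
  g.\<close>

lemma A_bounds:
  obtains \<rho>1 K where "\<rho>1 > \<rho>0" "K > 0"
    "\<And>s. \<rho>1 \<le> Re s \<Longrightarrow> exp (- \<mu> * Re s) / (4 * \<kappa>) \<le> (norm (A s))\<^sup>2"
    "\<And>s. \<rho>1 \<le> Re s \<Longrightarrow> (norm (A s))\<^sup>2 \<le> K * exp ((real p + 1) * Re s)"
proof -
  obtain r1 where r1: "r1 \<ge> 1" "\<And>x. norm x \<ge> r1 \<Longrightarrow> norm (poly P (d + x)) \<ge> norm x ^ p / 2"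
    using P_asymp by metis
  obtain K where K: "K > 0" "\<And>x. norm x \<ge> 1 \<Longrightarrow> norm (poly P (d + x)) \<le> K * norm x ^ p"
    by (rule poly_shift_upper[of P p d]) (use p in simp, rule that, assumption+)
  obtain r2 where r2: "r2 > \<rho>0" "\<And>s. r2 \<le> Re s \<Longrightarrow> norm (H s) \<ge> \<kappa> / 2 * exp (\<mu> * Re s)"
    "\<And>s. r2 \<le> Re s \<Longrightarrow> norm (H s) \<le> 2 * \<kappa> * exp (\<mu> * Re s)"
    using w.norm_H by metis
  show ?thesis
  proof (rule that[of "max r2 (ln r1)" "2 * K / \<kappa>"])
    show "2 * K / \<kappa> > 0" using K kappa_pos by simp
    fix s assume s: "max r2 (ln r1) \<le> Re s"
    have s0: "Re s > \<rho>0" "r2 \<le> Re s" using s r2 by auto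
    have "exp (ln r1) \<le> exp (Re s)" using s by simp
    then have er: "r1 \<le> exp (Re s)" using r1 by simp
    then have e1: "1 \<le> exp (Re s)" using r1(1) by linarith
    then have Re0: "Re s \<ge> 0" by (simp only: one_le_exp_iff)
    have H0: "norm (H s) > 0" using H_nz[OF s0(1)] by simp
    have "(norm (A s))\<^sup>2 * norm (H s) = exp (Re s) * norm (poly P (d + ray \<theta> s))"
      using arg_cong[OF AH[OF s0(1)], of norm] by (simp add: norm_mult norm_power)
    then have A2: "(norm (A s))\<^sup>2 = exp (Re s) * norm (poly P (d + ray \<theta> s)) / norm (H s)" using H0 by (simp add: field_simps)
    have "1 / 2 \<le> exp (Re s) ^ p / 2" using e1 by (simp add: one_le_power)
    also have "\<dots> \<le> norm (poly P (d + ray \<theta> s))" using r1(2)[of "ray \<theta> s"] er by simp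
    finally have "1 * (1/2) \<le> exp (Re s) * norm (poly P (d + ray \<theta> s))" using e1 by (intro mult_mono) auto
    then have "1/2 / (2 * \<kappa> * exp (\<mu> * Re s)) \<le> (norm (A s))\<^sup>2"
      unfolding A2 using r2(3)[OF s0(2)] H0 by (intro frac_le) auto
    then show "exp (- \<mu> * Re s) / (4 * \<kappa>) \<le> (norm (A s))\<^sup>2" by (simp add: exp_minus field_simps)
    have "exp (Re s) * norm (poly P (d + ray \<theta> s)) \<le> exp (Re s) * (K * exp (Re s) ^ p)"
      using K(2)[of "ray \<theta> s"] e1 by (intro mult_left_mono) auto
    also have "\<dots> = K * exp ((real p + 1) * Re s)" by (simp add: exp_of_nat_mult[symmetric] exp_add[symmetric] algebra_simps)
    finally have 1: "exp (Re s) * norm (poly P (d + ray \<theta> s)) \<le> K * exp ((real p + 1) * Re s)" .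
    have "\<kappa> / 2 * 1 \<le> \<kappa> / 2 * exp (\<mu> * Re s)" using kappa_pos Re0 mu_ge by (intro mult_left_mono) auto
    then have "\<kappa> / 2 \<le> norm (H s)" using r2(2)[OF s0(2)] by linarith
    then have "(norm (A s))\<^sup>2 \<le> K * exp ((real p + 1) * Re s) / (\<kappa> / 2)"
      unfolding A2 using 1 kappa_pos K(1) by (intro frac_le) auto
    then show "(norm (A s))\<^sup>2 \<le> 2 * K / \<kappa> * exp ((real p + 1) * Re s)" by (simp add: field_simps)
  qed (use r2 in auto)
qed

lemma sector_dominant:
  assumes u: "\<And>\<delta>. \<lbrakk>0 < \<delta>; \<delta> < \<delta>0\<rbrakk> \<Longrightarrow> \<exists>\<rho>2 K K'. K > 0 \<and> K' > 0 \<and> (\<forall>s. \<rho>2 \<le> Re s \<longrightarrow> X \<delta> s \<longrightarrow> K * exp (K' * exp (\<mu> * Re s)) \<le> norm (u s))"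
    and sub: "\<And>\<delta> z. \<lbrakk>0 < \<delta>; \<delta> < \<delta>0; z \<in> stokes_subsector N b d j \<delta>\<rbrakk> \<Longrightarrow> \<exists>s. z = d + ray \<theta> s \<and> X \<delta> s" and "\<delta>0 > 0"
  shows "infinity_in_stokes_sector N b d j g"
proof (rule infinity_in_sectorI[OF sub \<open>\<delta>0 > 0\<close>])
  fix \<delta> assume d: "0 < \<delta>" "\<delta> < \<delta>0"
  obtain \<rho>2 K K' where K: "K > 0" "K' > 0" and lo: "\<And>s. \<rho>2 \<le> Re s \<Longrightarrow> X \<delta> s \<Longrightarrow> K * exp (K' * exp (\<mu> * Re s)) \<le> norm (u s)"
    using u[OF d] by blast
  obtain \<rho>1 where r: "\<rho>1 > \<rho>0" and AL: "\<And>s. \<rho>1 \<le> Re s \<Longrightarrow> exp (- \<mu> * Re s) / (4 * \<kappa>) \<le> (norm (A s))\<^sup>2"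
    using A_bounds by metis
  define f where "f = (\<lambda>\<rho>. exp (- \<mu> * \<rho>) / (4 * \<kappa>) * (K * exp (K' * exp (\<mu> * \<rho>)))\<^sup>2)"
  have "filterlim f at_top at_top" unfolding f_def using K kappa_pos mu_ge by real_asymp
  moreover have "\<forall>s. max \<rho>1 \<rho>2 \<le> Re s \<longrightarrow> X \<delta> s \<longrightarrow> f (Re s) \<le> (norm (g (d + ray \<theta> s)))\<^sup>2"
  proof (intro allI impI)
    fix s assume s: "max \<rho>1 \<rho>2 \<le> Re s" "X \<delta> s"
    have "f (Re s) \<le> (norm (A s))\<^sup>2 * (norm (u s))\<^sup>2"
      unfolding f_def using AL[of s] lo[of s] s K kappa_pos by (intro mult_mono power_mono) auto
    then show "f (Re s) \<le> (norm (g (d + ray \<theta> s)))\<^sup>2"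
      using gA[of s] s r by (simp add: norm_mult power_mult_distrib)
  qed
  ultimately show "\<exists>f \<rho>1. filterlim f at_top at_top \<and> (\<forall>s. \<rho>1 \<le> Re s \<longrightarrow> X \<delta> s \<longrightarrow> f (Re s) \<le> (norm (g (d + ray \<theta> s)))\<^sup>2)"
    by blast
qed

lemma sector_recessive:
  assumes u: "\<And>\<rho>. \<rho>2 \<le> \<rho> \<Longrightarrow> norm (u (Complex \<rho> \<tau>)) \<le> K * exp (- (K' * exp (\<mu> * \<rho>)))" and K: "K > 0" "K' > 0"
    and mem: "\<And>\<delta> \<rho>. \<lbrakk>0 < \<delta>; \<delta> < \<delta>0\<rbrakk> \<Longrightarrow> d + ray \<theta> (Complex \<rho> \<tau>) \<in> stokes_subsector N b d j \<delta>" and "\<delta>0 > 0"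
  shows "\<not> infinity_in_stokes_sector N b d j g"
proof -
  obtain \<rho>1 L where r: "\<rho>1 > \<rho>0" "L > 0" and AU: "\<And>s. \<rho>1 \<le> Re s \<Longrightarrow> (norm (A s))\<^sup>2 \<le> L * exp ((real p + 1) * Re s)"
    using A_bounds by metis
  define f where "f = (\<lambda>\<rho>. L * exp ((real p + 1) * \<rho>) * (K * exp (- (K' * exp (\<mu> * \<rho>))))\<^sup>2)"
  define p' where "p' = real p + 1"
  have "p' > 0" by (simp add: p'_def)
  then have f0: "(f \<longlongrightarrow> 0) at_top" unfolding f_def p'_def[symmetric] using K mu_ge r by real_asymp
  show ?thesis
  proof (rule not_infinity_in_sectorI[OF mem \<open>\<delta>0 > 0\<close> f0])
    fix \<rho> assume \<rho>: "max \<rho>1 \<rho>2 \<le> \<rho>"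
    let ?s = "Complex \<rho> \<tau>"
    have "(norm (A ?s))\<^sup>2 * (norm (u ?s))\<^sup>2 \<le> f \<rho>"
      unfolding f_def using AU[of ?s] u[of \<rho>] \<rho> r by (intro mult_mono power_mono) auto
    then show "(norm (g (d + ray \<theta> ?s)))\<^sup>2 \<le> f \<rho>"
      using gA[of ?s] \<rho> r by (simp add: norm_mult power_mult_distrib)
  qed
qed

text \<open>Sector k - 1 lies below ray k in this coordinate and is governed by L. When L = 0, the
  middle line of the sector is the half-line on which g tends to 0.\<close>

lemma left_infinity_iff:
  assumes L: "w.left_lim L"
  shows "infinity_in_stokes_sector N b d (k - 1) g \<longleftrightarrow> L \<noteq> 0"
proof
  have m: "\<mu> > 0" using mu_ge by simp
  define \<delta>0 where "\<delta>0 = pi / (2 * \<mu>)"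
  have d0: "\<delta>0 > 0" using m by (simp add: \<delta>0_def)
  show "L \<noteq> 0 \<Longrightarrow> infinity_in_stokes_sector N b d (k - 1) g"
  proof (rule sector_dominant[where X = "\<lambda>\<delta> s. - (pi / \<mu>) + \<delta> \<le> Im s \<and> Im s \<le> - \<delta>", OF _ _ d0])
    fix \<delta> assume "L \<noteq> 0" "0 < \<delta>" "\<delta> < \<delta>0"
    then show "\<exists>\<rho>2 K K'. K > 0 \<and> K' > 0 \<and> (\<forall>s. \<rho>2 \<le> Re s \<longrightarrow> - (pi / \<mu>) + \<delta> \<le> Im s \<and> Im s \<le> - \<delta> \<longrightarrow> K * exp (K' * exp (\<mu> * Re s)) \<le> norm (u s))"
      using w.left_dominant[OF L, of \<delta>] unfolding \<delta>0_def by (metis less_imp_le)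
  next
    fix \<delta> z assume "z \<in> stokes_subsector N b d (k - 1) \<delta>"
    then show "\<exists>s. z = d + ray \<theta> s \<and> - (pi / \<mu>) + \<delta> \<le> Im s \<and> Im s \<le> - \<delta>"
      unfolding left_subsector \<theta>[symmetric] by (auto intro: less_imp_le)
  qed
  assume inf: "infinity_in_stokes_sector N b d (k - 1) g"
  show "L \<noteq> 0"
  proof
    assume "L = 0"
    with L have L0: "w.left_lim 0" by simp
    have dd: "\<delta>0 \<le> pi / (2 * \<mu>)" by (simp add: \<delta>0_def)
    have c: "- (pi / \<mu>) + \<delta>0 = - \<delta>0" using m by (simp add: \<delta>0_def field_simps)
    obtain \<rho>2 K K' where K: "K > 0" "K' > 0"
      and ub: "\<And>s. \<rho>2 \<le> Re s \<Longrightarrow> - (pi / \<mu>) + \<delta>0 \<le> Im s \<Longrightarrow> Im s \<le> - \<delta>0 \<Longrightarrow> norm (u s) \<le> K * exp (- (K' * exp (\<mu> * Re s)))"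
      by (rule w.left_recessive[OF L0 d0 dd]) (rule that, assumption+)
    have "\<not> infinity_in_stokes_sector N b d (k - 1) g"
    proof (rule sector_recessive[where \<tau> = "- \<delta>0", OF _ K _ d0])
      show "norm (u (Complex \<rho> (- \<delta>0))) \<le> K * exp (- (K' * exp (\<mu> * \<rho>)))" if "\<rho>2 \<le> \<rho>" for \<rho>
        using ub[of "Complex \<rho> (- \<delta>0)"] that c by simp
      show "d + ray \<theta> (Complex \<rho> (- \<delta>0)) \<in> stokes_subsector N b d (k - 1) \<delta>" if "0 < \<delta>" "\<delta> < \<delta>0" for \<delta> \<rho>
        unfolding left_subsector \<theta> using that c by (intro exI[of _ "Complex \<rho> (- \<delta>0)"]) auto
    qed
    with inf show False by simp
  qed
qed

lemma right_infinity_iff: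
  assumes R: "w.right_lim R"
  shows "infinity_in_stokes_sector N b d k g \<longleftrightarrow> R \<noteq> 0"
proof
  have m: "\<mu> > 0" using mu_ge by simp
  define \<delta>0 where "\<delta>0 = pi / (2 * \<mu>)"
  have d0: "\<delta>0 > 0" using m by (simp add: \<delta>0_def)
  show "R \<noteq> 0 \<Longrightarrow> infinity_in_stokes_sector N b d k g"
  proof (rule sector_dominant[where X = "\<lambda>\<delta> s. \<delta> \<le> Im s \<and> Im s \<le> pi / \<mu> - \<delta>", OF _ _ d0])
    fix \<delta> assume "R \<noteq> 0" "0 < \<delta>" "\<delta> < \<delta>0"
    then show "\<exists>\<rho>2 K K'. K > 0 \<and> K' > 0 \<and> (\<forall>s. \<rho>2 \<le> Re s \<longrightarrow> \<delta> \<le> Im s \<and> Im s \<le> pi / \<mu> - \<delta> \<longrightarrow> K * exp (K' * exp (\<mu> * Re s)) \<le> norm (u s))"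
      using w.right_dominant[OF R, of \<delta>] unfolding \<delta>0_def by (metis less_imp_le)
  next
    fix \<delta> z assume "z \<in> stokes_subsector N b d k \<delta>"
    then show "\<exists>s. z = d + ray \<theta> s \<and> \<delta> \<le> Im s \<and> Im s \<le> pi / \<mu> - \<delta>"
      unfolding right_subsector \<theta>[symmetric] by (auto intro: less_imp_le)
  qed
  assume inf: "infinity_in_stokes_sector N b d k g"
  show "R \<noteq> 0"
  proof
    assume "R = 0"
    with R have R0: "w.right_lim 0" by simp
    have dd: "\<delta>0 \<le> pi / (2 * \<mu>)" by (simp add: \<delta>0_def)
    have c: "pi / \<mu> - \<delta>0 = \<delta>0" using m by (simp add: \<delta>0_def field_simps)
    obtain \<rho>2 K K' where K: "K > 0" "K' > 0"
      and ub: "\<And>s. \<rho>2 \<le> Re s \<Longrightarrow> \<delta>0 \<le> Im s \<Longrightarrow> Im s \<le> pi / \<mu> - \<delta>0 \<Longrightarrow> norm (u s) \<le> K * exp (- (K' * exp (\<mu> * Re s)))"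
      by (rule w.right_recessive[OF R0 d0 dd]) (rule that, assumption+)
    have "\<not> infinity_in_stokes_sector N b d k g"
    proof (rule sector_recessive[where \<tau> = "\<delta>0", OF _ K _ d0])
      show "norm (u (Complex \<rho> \<delta>0)) \<le> K * exp (- (K' * exp (\<mu> * \<rho>)))" if "\<rho>2 \<le> \<rho>" for \<rho>
        using ub[of "Complex \<rho> \<delta>0"] that c by simp
      show "d + ray \<theta> (Complex \<rho> \<delta>0) \<in> stokes_subsector N b d k \<delta>" if "0 < \<delta>" "\<delta> < \<delta>0" for \<delta> \<rho>
        unfolding right_subsector \<theta> using that c by (intro exI[of _ "Complex \<rho> \<delta>0"]) auto
    qed
    with inf show False by simp
  qed
qed

end

section \<open>Zeros near a ray and the width of its neighbourhood\<close>

lemma (in wkb) Im_Phi_vertical_ge: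
  assumes "\<And>t. a \<le> t \<Longrightarrow> t \<le> b \<Longrightarrow> m \<le> Re (H (Complex \<rho> t))" "\<rho> > \<rho>0" "a \<le> b"
  shows "m * (b - a) \<le> Im (\<Phi> (Complex \<rho> b)) - Im (\<Phi> (Complex \<rho> a))"
proof -
  have "Im (\<Phi> (Complex \<rho> a)) - m * a \<le> Im (\<Phi> (Complex \<rho> b)) - m * b"
  proof (rule DERIV_nonneg_imp_nondecreasing[OF assms(3)])
    fix t assume t: "a \<le> t" "t \<le> b"
    have p: "((\<lambda>t. Complex \<rho> t) has_vector_derivative \<i>) (at t)"
      unfolding Complex_eq by (auto intro!: derivative_eq_intros)
    have "Re (Complex \<rho> t) > \<rho>0" using assms by simp
    from bounded_linear.has_vector_derivative[OF bounded_linear_Im field_vector_diff_chain_at[OF p dPhi[OF this]]]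
    have "((\<lambda>t. Im (\<Phi> (Complex \<rho> t))) has_real_derivative Re (H (Complex \<rho> t))) (at t)"
      by (simp add: o_def has_real_derivative_iff_has_vector_derivative)
    then have "((\<lambda>t. Im (\<Phi> (Complex \<rho> t)) - m * t) has_real_derivative Re (H (Complex \<rho> t)) - m) (at t)"
      by (intro DERIV_diff DERIV_cmult_Id)
    moreover have "0 \<le> Re (H (Complex \<rho> t)) - m" using assms(1)[OF t] by simp
    ultimately show "\<exists>y. ((\<lambda>t. Im (\<Phi> (Complex \<rho> t)) - m * t) has_real_derivative y) (at t) \<and> 0 \<le> y" by blast
  qed
  then show ?thesis by (simp add: right_diff_distrib)
qed

lemma (in stokes) finite_zeros_bounded: "finite {z \<in> cball w B. g z = 0}"
proof -
  have "\<not> g constant_on UNIV \<or> (\<forall>z. g z \<noteq> 0)" using nontrivial by (auto simp: constant_on_def)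
  then show ?thesis
  proof
    assume "\<not> g constant_on UNIV"
    from holomorphic_compact_finite_zeros[OF entire open_UNIV connected_UNIV compact_cball _ this]
    show ?thesis by simp
  qed simp
qed

context stokes_ray
begin

text \<open>The width in units of Im \<Phi>: turning off the ray by a small angle at distance exp
  \<rho> changes Im \<Phi> by about \<kappa> exp(\<mu> \<rho>) times the angle.\<close>

definition "Wd \<rho> = exp (\<mu> * \<rho>) * stokes_width N D (exp \<rho>)"

lemma Wd_eq: "Wd \<rho> = (if N \<ge> 3 then exp ((\<mu> - 2) * \<rho>) else if N = 2 then \<rho> else if N = 1 then 1 else 1 + cmod D * \<rho>)"
proof -
  have e: "exp (\<mu> * \<rho>) * exp \<rho> powr a = exp ((\<mu> + a) * \<rho>)" for a
    by (simp add: powr_def exp_add[symmetric] algebra_simps)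
  consider "N \<ge> 3" | "N = 2" | "N = 1" | "N = 0" by linarith
  then show ?thesis
  proof cases
    case 1
    then show ?thesis using e[of "-2"] by (simp add: Wd_def stokes_width_def)
  next
    case 2
    then have "\<mu> + - 2 = 0" unfolding \<mu>_def by simp
    then have "exp (\<mu> * \<rho>) * exp \<rho> powr (-2) = 1" using e[of "-2"] by (simp only: mult_zero_left exp_zero)
    then have "\<rho> * (exp (\<mu> * \<rho>) * exp \<rho> powr (-2)) = \<rho>" by simp
    then show ?thesis unfolding Wd_def stokes_width_def using 2 by (simp add: mult.left_commute)
  next
    case 3
    then have "\<mu> + - 3/2 = 0" unfolding \<mu>_def by simp
    then have "exp (\<mu> * \<rho>) * exp \<rho> powr (-3/2) = 1" using e[of "-3/2"] by (simp only: mult_zero_left exp_zero)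
    then show ?thesis unfolding Wd_def stokes_width_def using 3 by simp
  next
    case 4
    then have "\<mu> + - 1 = 0" unfolding \<mu>_def by simp
    then have "exp (\<mu> * \<rho>) * exp \<rho> powr (-1) = 1" using e[of "-1"] by (simp only: mult_zero_left exp_zero)
    then have "(1 + cmod D * \<rho>) * (exp (\<mu> * \<rho>) * exp \<rho> powr (-1)) = 1 + cmod D * \<rho>" by (simp only: mult_1_right)
    moreover have "Wd \<rho> = exp (\<mu> * \<rho>) * ((1 + cmod D * \<rho>) * exp \<rho> powr (-1))"
      unfolding Wd_def stokes_width_def using 4 by simp
    ultimately have "Wd \<rho> = 1 + cmod D * \<rho>" by (simp only: mult.left_commute)
    moreover have "\<not> N \<ge> 3" "N \<noteq> 2" "N \<noteq> 1" using 4 by auto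
    ultimately show ?thesis by (simp only: if_False)
  qed
qed

lemma width_eq: "stokes_width N D (exp \<rho>) = Wd \<rho> * exp (- \<mu> * \<rho>)"
  by (simp add: Wd_def exp_minus field_simps)

lemma Wd_ge_1: "\<rho> \<ge> 1 \<Longrightarrow> Wd \<rho> \<ge> 1"
  by (auto simp: Wd_eq \<mu>_def)

lemma width_tendsto_0: "((\<lambda>\<rho>. stokes_width N D (exp \<rho>)) \<longlongrightarrow> 0) at_top"
proof -
  consider "N \<ge> 3" | "N = 2" | "N = 1" | "N = 0" by linarith
  then show ?thesis
  proof cases
    case 1
    then have "(\<lambda>\<rho>. stokes_width N D (exp \<rho>)) = (\<lambda>\<rho>. exp \<rho> powr (-2))" by (simp add: stokes_width_def)
    then show ?thesis by simp real_asymp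
  next
    case 2
    then have "(\<lambda>\<rho>. stokes_width N D (exp \<rho>)) = (\<lambda>\<rho>. \<rho> * exp \<rho> powr (-2))" by (simp add: stokes_width_def)
    then show ?thesis by simp real_asymp
  next
    case 3
    then have "(\<lambda>\<rho>. stokes_width N D (exp \<rho>)) = (\<lambda>\<rho>. exp \<rho> powr (-3/2))" by (simp add: stokes_width_def)
    then show ?thesis by simp real_asymp
  next
    case 4
    then have e: "(\<lambda>\<rho>. stokes_width N D (exp \<rho>)) = (\<lambda>\<rho>. exp \<rho> powr (-1) + cmod D * (\<rho> * exp \<rho> powr (-1)))"
      by (simp add: stokes_width_def algebra_simps)
    have "((\<lambda>\<rho>::real. exp \<rho> powr (-1)) \<longlongrightarrow> 0) at_top" "((\<lambda>\<rho>::real. \<rho> * exp \<rho> powr (-1)) \<longlongrightarrow> 0) at_top"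
      by real_asymp+
    from tendsto_add[OF this(1) tendsto_mult_left[OF this(2), of "cmod D"]] show ?thesis
      unfolding e by (simp only: mult_zero_right add_0_right)
  qed
qed

text \<open>On the ray the main term of H is real, so Im H is at most the main term times |\<psi>|.
  \<open>M\<close> is a primitive of a bound for this product.\<close>

lemma axis_primitive:
  assumes "\<rho>1 > \<rho>0" and dM: "\<And>\<rho>. \<rho>1 \<le> \<rho> \<Longrightarrow> (M has_real_derivative M' \<rho>) (at \<rho>)"
    and le: "\<And>\<rho>. \<rho>1 \<le> \<rho> \<Longrightarrow> \<kappa> * exp (\<mu> * \<rho>) * norm (\<psi> (ray \<theta> (Complex \<rho> 0))) \<le> M' \<rho>"
    and "\<rho>1 \<le> \<rho>"
  shows "\<bar>Im (\<Phi> (Complex \<rho> 0))\<bar> \<le> \<bar>Im (\<Phi> (Complex \<rho>1 0))\<bar> + M \<rho> - M \<rho>1"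
proof (cases "\<rho>1 = \<rho>")
  case False
  then have lt: "\<rho>1 < \<rho>" using assms by simp
  define f where "f = (\<lambda>\<rho>. Im (\<Phi> (Complex \<rho> 0)))"
  have df: "(f has_vector_derivative Im (H (Complex t 0))) (at t)" if "\<rho>1 \<le> t" for t
  proof -
    have p: "((\<lambda>t. Complex t 0) has_vector_derivative 1) (at t)"
      unfolding Complex_eq by (auto intro!: derivative_eq_intros)
    have "Re (Complex t 0) > \<rho>0" using assms that by simp
    from bounded_linear.has_vector_derivative[OF bounded_linear_Im field_vector_diff_chain_at[OF p w.dPhi[OF this]]]
    show ?thesis by (simp add: o_def f_def)
  qed
  have "norm (f \<rho> - f \<rho>1) \<le> M \<rho> - M \<rho>1"
  proof (rule differentiable_bound_general[OF lt, where f' = "\<lambda>t. Im (H (Complex t 0))" and \<phi>' = M'])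
    show "continuous_on {\<rho>1..\<rho>} f"
      by (rule continuous_at_imp_continuous_on) (use df has_vector_derivative_continuous in force)
    show "continuous_on {\<rho>1..\<rho>} M"
      by (rule continuous_at_imp_continuous_on) (use dM DERIV_isCont in force)
    fix t assume t: "\<rho>1 < t" "t < \<rho>"
    show "(f has_vector_derivative Im (H (Complex t 0))) (at t)" using df t by simp
    show "(M has_vector_derivative M' t) (at t)" using dM[of t] t by (simp add: has_real_derivative_iff_has_vector_derivative)
    have s: "Re (Complex t 0) > \<rho>0" using assms t by simp
    have "Im (of_real \<kappa> * exp (of_real \<mu> * Complex t 0)) = 0" by (simp add: Im_exp)
    then have i: "Im (H (Complex t 0)) = Im (H (Complex t 0) - of_real \<kappa> * exp (of_real \<mu> * Complex t 0))" by (simp only: minus_complex.sel diff_0_right)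
    have "\<bar>Im (H (Complex t 0))\<bar> \<le> norm (H (Complex t 0) - of_real \<kappa> * exp (of_real \<mu> * Complex t 0))"
      by (subst i) (rule abs_Im_le_cmod)
    also have "\<dots> \<le> \<kappa> * exp (\<mu> * t) * norm (\<psi> (ray \<theta> (Complex t 0)))" using Hpsi[OF s] by simp
    also have "\<dots> \<le> M' t" using le t by simp
    finally show "norm (Im (H (Complex t 0))) \<le> M' t" by simp
  qed
  then show ?thesis by (simp add: f_def)
qed simp

text \<open>The origin of the four cases of the width. For N \<ge> 1 the derivative of Im \<Phi> on
  the ray is O(exp((\<mu> - 2) \<rho>)); its integral is of the same order for N \<ge> 3, linear in
  \<rho> = log r for N = 2 and bounded for N = 1. For N = 0 the 1/x term of \<psi> contributes |D|
  \<rho>.\<close>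

lemma axis_bound:
  obtains K \<rho>1 where "K > 0" "\<rho>1 > \<rho>0" "\<And>\<rho>. \<rho>1 \<le> \<rho> \<Longrightarrow> \<bar>Im (\<Phi> (Complex \<rho> 0))\<bar> \<le> K * Wd \<rho>"
proof -
  note concl = that
  have *: "thesis" if "\<And>\<rho>. r \<le> \<rho> \<Longrightarrow> (M has_real_derivative M' \<rho>) (at \<rho>)"
    "\<And>\<rho>. r \<le> \<rho> \<Longrightarrow> \<kappa> * exp (\<mu> * \<rho>) * norm (\<psi> (ray \<theta> (Complex \<rho> 0))) \<le> M' \<rho>"
    "\<And>\<rho>. r \<le> \<rho> \<Longrightarrow> M \<rho> \<le> K1 * Wd \<rho>" "r > \<rho>0" "r \<ge> 1" "K1 \<ge> 0" for M M' r K1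
  proof (rule concl[of "\<bar>Im (\<Phi> (Complex r 0))\<bar> + \<bar>M r\<bar> + K1 + 1" r])
    show "\<bar>Im (\<Phi> (Complex r 0))\<bar> + \<bar>M r\<bar> + K1 + 1 > 0" using \<open>K1 \<ge> 0\<close> by linarith
    fix \<rho> assume \<rho>: "r \<le> \<rho>"
    have W1: "Wd \<rho> \<ge> 1" using Wd_ge_1 \<rho> \<open>r \<ge> 1\<close> by simp
    have "\<bar>Im (\<Phi> (Complex \<rho> 0))\<bar> \<le> \<bar>Im (\<Phi> (Complex r 0))\<bar> + M \<rho> - M r"
      by (rule axis_primitive[OF \<open>r > \<rho>0\<close> that(1,2) \<rho>])
    also have "\<dots> \<le> (\<bar>Im (\<Phi> (Complex r 0))\<bar> + \<bar>M r\<bar> + 1) * 1 + K1 * Wd \<rho>"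
      using that(3)[OF \<rho>] abs_ge_minus_self[of "M r"] by argo
    also have "\<dots> \<le> (\<bar>Im (\<Phi> (Complex r 0))\<bar> + \<bar>M r\<bar> + 1) * Wd \<rho> + K1 * Wd \<rho>"
      using W1 by (intro add_right_mono mult_left_mono) auto
    also have "\<dots> = (\<bar>Im (\<Phi> (Complex r 0))\<bar> + \<bar>M r\<bar> + K1 + 1) * Wd \<rho>" by (simp add: algebra_simps)
    finally show "\<bar>Im (\<Phi> (Complex \<rho> 0))\<bar> \<le> (\<bar>Im (\<Phi> (Complex r 0))\<bar> + \<bar>M r\<bar> + K1 + 1) * Wd \<rho>" .
  qed (use \<open>r > \<rho>0\<close> in auto)
  show thesis
  proof (cases "N = 0")
    case True
    obtain K r where K: "K > 0" "r \<ge> 1"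
      "\<And>x. norm x \<ge> r \<Longrightarrow> norm (\<psi> x) \<le> norm (\<Sum>j=1..p. Dj j) / norm b / norm x + K / norm x ^ 2"
      using psi_bound_zero[OF True] by metis
    have mu1: "\<mu> = 1" unfolding \<mu>_def using True by simp
    define E where "E = norm (\<Sum>j=1..p. Dj j)"
    have "norm b = \<kappa> * \<kappa>" by (simp add: \<kappa>_def)
    \<comment> \<open>As |b| = \<kappa>^2, this is the factor that \<kappa> times the 1/x term of
      \<psi> produces, so the slope of the primitive is exactly the |D| of the width.\<close>
    then have D': "cmod D = \<kappa> * (E / norm b)" using kappa_pos
      by (simp add: D norm_divide E_def \<kappa>_def norm_csqrt field_simps)
    have "N < 3" "N \<noteq> 2" "N \<noteq> 1" using True by auto
    then have W0: "Wd \<rho> = 1 + cmod D * \<rho>" for \<rho> by (simp add: Wd_eq)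
    show thesis
    proof (rule *[of "max (max (ln r) 1) (\<rho>0 + 1)" "\<lambda>\<rho>. cmod D * \<rho> - \<kappa> * K * exp (- \<rho>)" "\<lambda>\<rho>. cmod D + \<kappa> * K * exp (- \<rho>)" 1])
      fix \<rho> assume \<rho>: "max (max (ln r) 1) (\<rho>0 + 1) \<le> \<rho>"
      show "((\<lambda>\<rho>. cmod D * \<rho> - \<kappa> * K * exp (- \<rho>)) has_real_derivative cmod D + \<kappa> * K * exp (- \<rho>)) (at \<rho>)"
        by (auto intro!: derivative_eq_intros)
      have "exp (ln r) \<le> exp \<rho>" using \<rho> by simp
      then have er: "r \<le> exp \<rho>" using K by simp
      have "norm (\<psi> (ray \<theta> (Complex \<rho> 0))) \<le> E / norm b / exp \<rho> + K / exp \<rho> ^ 2"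
        using K(3)[of "ray \<theta> (Complex \<rho> 0)"] er by (simp add: E_def)
      then have "\<kappa> * exp \<rho> * norm (\<psi> (ray \<theta> (Complex \<rho> 0))) \<le> \<kappa> * exp \<rho> * (E / norm b / exp \<rho> + K / exp \<rho> ^ 2)"
        using kappa_pos by (intro mult_left_mono) auto
      also have "\<dots> = cmod D + \<kappa> * K * exp (- \<rho>)" unfolding D'
        by (simp add: field_simps power2_eq_square exp_minus)
      finally show "\<kappa> * exp (\<mu> * \<rho>) * norm (\<psi> (ray \<theta> (Complex \<rho> 0))) \<le> cmod D + \<kappa> * K * exp (- \<rho>)" by (simp add: mu1)
      have "0 \<le> \<kappa> * K * exp (- \<rho>)" using kappa_pos K by simp
      then show "cmod D * \<rho> - \<kappa> * K * exp (- \<rho>) \<le> 1 * Wd \<rho>" unfolding W0 mult_1 by linarith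
    qed auto
  next
    case False
    obtain K r where K: "K > 0" "r \<ge> 1" "\<And>x. norm x \<ge> r \<Longrightarrow> norm (\<psi> x) * norm x ^ 2 \<le> K"
      using psi_bound False by auto
    define R where "R = max (max (ln r) 1) (\<rho>0 + 1)"
    have le: "\<kappa> * exp (\<mu> * \<rho>) * norm (\<psi> (ray \<theta> (Complex \<rho> 0))) \<le> \<kappa> * K * exp ((\<mu> - 2) * \<rho>)" if \<rho>: "R \<le> \<rho>" for \<rho>
    proof -
      have "exp (ln r) \<le> exp \<rho>" using \<rho> by (simp add: R_def)
      then have er: "r \<le> exp \<rho>" using K by simp
      have e2: "exp (\<mu> * \<rho>) = exp ((\<mu> - 2) * \<rho>) * exp \<rho> ^ 2"
        by (simp add: power2_eq_square exp_add[symmetric] algebra_simps)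
      have "\<kappa> * exp (\<mu> * \<rho>) * norm (\<psi> (ray \<theta> (Complex \<rho> 0))) = \<kappa> * exp ((\<mu> - 2) * \<rho>) * (norm (\<psi> (ray \<theta> (Complex \<rho> 0))) * exp \<rho> ^ 2)"
        unfolding e2 by simp
      also have "\<dots> \<le> \<kappa> * exp ((\<mu> - 2) * \<rho>) * K"
        using K(3)[of "ray \<theta> (Complex \<rho> 0)"] er kappa_pos by (intro mult_left_mono) auto
      finally show ?thesis by (simp add: mult_ac)
    qed
    have kK: "\<kappa> * K \<ge> 0" using kappa_pos K by simp
    consider "N \<ge> 3" | "N = 2" | "N = 1" using False by linarith
    then show thesis
    proof cases
      case 1
      then have m: "\<mu> - 2 > 0" unfolding \<mu>_def by simp
      show thesis
      proof (rule *[of R "\<lambda>\<rho>. \<kappa> * K / (\<mu> - 2) * exp ((\<mu> - 2) * \<rho>)" "\<lambda>\<rho>. \<kappa> * K * exp ((\<mu> - 2) * \<rho>)" "\<kappa> * K / (\<mu> - 2)"])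
        show "((\<lambda>\<rho>. \<kappa> * K / (\<mu> - 2) * exp ((\<mu> - 2) * \<rho>)) has_real_derivative \<kappa> * K * exp ((\<mu> - 2) * \<rho>)) (at \<rho>)" for \<rho>
          using m by (auto intro!: derivative_eq_intros)
        show "\<kappa> * K / (\<mu> - 2) * exp ((\<mu> - 2) * \<rho>) \<le> \<kappa> * K / (\<mu> - 2) * Wd \<rho>" for \<rho> using 1 by (simp add: Wd_eq)
      qed (use le kK m in \<open>auto simp: R_def\<close>)
    next
      case 2
      then have m: "\<mu> = 2" unfolding \<mu>_def by simp
      show thesis
      proof (rule *[of R "\<lambda>\<rho>. \<kappa> * K * \<rho>" "\<lambda>\<rho>. \<kappa> * K" "\<kappa> * K"])
        show "((\<lambda>\<rho>. \<kappa> * K * \<rho>) has_real_derivative \<kappa> * K) (at \<rho>)" for \<rho>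
          by (rule DERIV_cmult_Id)
        show "\<kappa> * K * \<rho> \<le> \<kappa> * K * Wd \<rho>" for \<rho> unfolding Wd_eq using 2 by simp
        show "\<kappa> * exp (\<mu> * \<rho>) * norm (\<psi> (ray \<theta> (Complex \<rho> 0))) \<le> \<kappa> * K" if "R \<le> \<rho>" for \<rho>
          using le[OF that] by (simp add: m)
      qed (use kK in \<open>auto simp: R_def\<close>)
    next
      case 3
      then have m: "\<mu> - 2 = - 1/2" unfolding \<mu>_def by simp
      show thesis
      proof (rule *[of R "\<lambda>\<rho>. - 2 * \<kappa> * K * exp ((\<mu> - 2) * \<rho>)" "\<lambda>\<rho>. \<kappa> * K * exp ((\<mu> - 2) * \<rho>)" 0])
        show "((\<lambda>\<rho>. - 2 * \<kappa> * K * exp ((\<mu> - 2) * \<rho>)) has_real_derivative \<kappa> * K * exp ((\<mu> - 2) * \<rho>)) (at \<rho>)" for \<rho>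
          unfolding m by (auto intro!: derivative_eq_intros)
        show "- 2 * \<kappa> * K * exp ((\<mu> - 2) * \<rho>) \<le> 0 * Wd \<rho>" for \<rho> using kappa_pos K(1) by simp
      qed (use le in \<open>auto simp: R_def\<close>)
    qed
  qed
qed

text \<open>The angular width tends to 0, so far out the neighbourhood lies in the zero-free strip
  of \<open>recessive_no_zeros\<close>; a bounded disc contains only finitely many zeros.\<close>

lemma recessive_few_zeros:
  assumes L: "w.left_lim 0"
  shows "\<not> infinitely_many_zeros_near_ray N b d D r0 k g"
proof
  assume "infinitely_many_zeros_near_ray N b d D r0 k g"
  then obtain K where K: "K > 0" and inf: "infinite {z \<in> stokes_neighbourhood N b d D r0 k K. g z = 0}"
    by (auto simp: infinitely_many_zeros_near_ray_def)
  obtain \<rho>2 where r2: "\<rho>2 > \<rho>0" and nz: "\<And>s. \<rho>2 \<le> Re s \<Longrightarrow> \<bar>Im s\<bar> \<le> pi / (3 * \<mu>) \<Longrightarrow> u s \<noteq> 0"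
    using w.recessive_no_zeros[OF L] by metis
  have "((\<lambda>\<rho>. K * stokes_width N D (exp \<rho>)) \<longlongrightarrow> K * 0) at_top" by (intro tendsto_intros width_tendsto_0)
  moreover have "pi / (3 * \<mu>) > 0" using mu_ge by simp
  ultimately have "\<forall>\<^sub>F \<rho> in at_top. K * stokes_width N D (exp \<rho>) < pi / (3 * \<mu>)" using order_tendstoD(2) by simp blast
  then obtain \<rho>3 where r3: "\<And>\<rho>. \<rho> \<ge> \<rho>3 \<Longrightarrow> K * stokes_width N D (exp \<rho>) < pi / (3 * \<mu>)"
    by (auto simp: eventually_at_top_linorder)
  define B where "B = exp (max \<rho>2 \<rho>3)"
  have "\<not> {z \<in> stokes_neighbourhood N b d D r0 k K. g z = 0} \<subseteq> {z \<in> cball d B. g z = 0}"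
    using inf finite_zeros_bounded finite_subset by blast
  then obtain z where z: "z \<in> stokes_neighbourhood N b d D r0 k K" "g z = 0" and "z \<notin> cball d B"
    by blast
  then have zB: "norm (z - d) > B" by (simp add: dist_norm norm_minus_commute)
  have zd: "z \<noteq> d" using zB by (auto simp: B_def)
  obtain t where t: "is_Arg (z - d) t" "\<bar>t - \<theta>\<bar> < K * stokes_width N D (norm (z - d))"
    using z(1) by (auto simp: stokes_neighbourhood_def \<theta>)
  define s where "s = Complex (ln (norm (z - d))) (t - \<theta>)"
  have zs: "z = d + ray \<theta> s" unfolding s_def by (rule ray_of_Arg[OF zd t(1)])
  have n0: "norm (z - d) > 0" using zd by simp
  have "ln B < ln (norm (z - d))" using zB n0 by (subst ln_less_cancel_iff) (auto simp: B_def)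
  then have Rs: "max \<rho>2 \<rho>3 < Re s" by (simp add: s_def B_def)
  have "exp (Re s) = norm (z - d)" using n0 by (simp add: s_def)
  then have "\<bar>Im s\<bar> < pi / (3 * \<mu>)" using t(2) r3[of "Re s"] Rs by (simp add: s_def)
  then have "u s \<noteq> 0" using nz[of s] Rs by simp
  moreover have "A s \<noteq> 0" using A_nz[of s] Rs r2 by simp
  ultimately show False using z(2) gA[of s] Rs r2 unfolding zs by simp
qed

text \<open>At a zero \<Phi> + c0 is near a real number, so Im \<Phi> is bounded there; on the ray
  at the same distance it is O(Wd). As Im \<Phi> grows vertically at rate at least \<kappa>/4
  exp(\<mu> Re s), Im s must be of the order of the width.\<close>

lemma dominant_many_zeros:
  assumes L: "w.left_lim L" "L \<noteq> 0" and R: "w.right_lim R" "R \<noteq> 0"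
  shows "infinitely_many_zeros_near_ray N b d D r0 k g"
proof -
  obtain l c0 where l: "l \<noteq> 0" and cl: "cosine_like (\<lambda>s. u s / l) (\<lambda>s. V s / l) H (\<lambda>s. \<Phi> s + c0) \<rho>0 \<mu> \<kappa>"
    using w.cosine_like[OF L R] by metis
  interpret c: cosine_like "\<lambda>s. u s / l" "\<lambda>s. V s / l" H "\<lambda>s. \<Phi> s + c0" \<rho>0 \<mu> \<kappa> by (rule cl)
  obtain r1 where r1: "r1 > \<rho>0" "\<And>\<rho>. r1 \<le> \<rho> \<Longrightarrow> \<exists>s. \<rho> \<le> Re s \<and> \<bar>Im s\<bar> \<le> 2 * pi / (3 * \<mu>) \<and> u s / l = 0"
    using c.ex_zeros by metis
  obtain r2 where r2: "r2 > \<rho>0"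
    and zn: "\<And>s. r2 \<le> Re s \<Longrightarrow> \<bar>Im s\<bar> \<le> 2 * pi / (3 * \<mu>) \<Longrightarrow> u s / l = 0 \<Longrightarrow> \<exists>n. norm (\<Phi> s + c0 - cos_zero n) < 1/40"
    and zi: "\<And>s. r2 \<le> Re s \<Longrightarrow> \<bar>Im s\<bar> \<le> 2 * pi / (3 * \<mu>) \<Longrightarrow> u s / l = 0 \<Longrightarrow> \<bar>Im s\<bar> \<le> pi / (3 * \<mu>)"
    by (rule c.zeros[of "1/40"]) (simp, simp, rule that, assumption+)
  obtain r3 where r3: "r3 > \<rho>0" and RH: "\<And>s. r3 \<le> Re s \<Longrightarrow> \<bar>Im s\<bar> \<le> pi / (3 * \<mu>) \<Longrightarrow> \<kappa> / 4 * exp (\<mu> * Re s) \<le> Re (H s)"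
    using w.Re_H by metis
  obtain K r4 where K: "K > 0" "r4 > \<rho>0" "\<And>\<rho>. r4 \<le> \<rho> \<Longrightarrow> \<bar>Im (\<Phi> (Complex \<rho> 0))\<bar> \<le> K * Wd \<rho>"
    using axis_bound by metis
  define M where "M = 4 / \<kappa> * (1 + \<bar>Im c0\<bar> + K)"
  have M: "M > 0" using kappa_pos K by (simp add: M_def)
  define r where "r = max (max (max r1 r2) (max r3 r4)) (max 1 (ln r0))"
  have main: "\<exists>z. B \<le> norm (z - d) \<and> z \<in> stokes_neighbourhood N b d D r0 k (M + 1) \<and> g z = 0" for B
  proof -
    define \<rho>' where "\<rho>' = max (r + 1) (ln (\<bar>B\<bar> + 1))"
    have "r1 \<le> \<rho>'" unfolding \<rho>'_def r_def by linarith
    then obtain s where s: "\<rho>' \<le> Re s" "\<bar>Im s\<bar> \<le> 2 * pi / (3 * \<mu>)" "u s / l = 0" using r1(2) by blast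
    have rs: "r1 \<le> Re s" "r2 \<le> Re s" "r3 \<le> Re s" "r4 \<le> Re s" "1 \<le> Re s" "ln r0 < Re s" "ln (\<bar>B\<bar> + 1) \<le> Re s"
      using s(1) unfolding \<rho>'_def r_def by linarith+
    have Is: "\<bar>Im s\<bar> \<le> pi / (3 * \<mu>)" using zi[OF rs(2) s(2,3)] .
    obtain n where n: "norm (\<Phi> s + c0 - cos_zero n) < 1/40" using zn[OF rs(2) s(2,3)] by blast
    have "\<bar>Im (\<Phi> s + c0 - cos_zero n)\<bar> < 1/40" using abs_Im_le_cmod n by (rule order_le_less_trans)
    moreover have "Im (cos_zero n) = 0" by (simp add: cos_zero_def)
    ultimately have IP: "\<bar>Im (\<Phi> s)\<bar> \<le> 1 + \<bar>Im c0\<bar>" unfolding minus_complex.sel plus_complex.sel by linarith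
    have sb: "s = Complex (Re s) (Im s)" by simp
    have Rr: "Re s > \<rho>0" using rs r1 by linarith
    have mH: "\<kappa> / 4 * exp (\<mu> * Re s) \<le> Re (H (Complex (Re s) t))" if "\<bar>t\<bar> \<le> pi / (3 * \<mu>)" for t
      using RH[of "Complex (Re s) t"] rs that by simp
    have V: "\<kappa> / 4 * exp (\<mu> * Re s) * \<bar>Im s\<bar> \<le> \<bar>Im (\<Phi> s) - Im (\<Phi> (Complex (Re s) 0))\<bar>"
    proof (cases "Im s \<ge> 0")
      case True
      have "\<kappa> / 4 * exp (\<mu> * Re s) * (Im s - 0) \<le> Im (\<Phi> (Complex (Re s) (Im s))) - Im (\<Phi> (Complex (Re s) 0))"
        by (rule w.Im_Phi_vertical_ge) (use mH Is True Rr in auto)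
      moreover have "\<bar>Im s\<bar> = Im s - 0" using True by simp
      ultimately show ?thesis unfolding complex.collapse by (simp only:)
    next
      case False
      have "\<kappa> / 4 * exp (\<mu> * Re s) * (0 - Im s) \<le> Im (\<Phi> (Complex (Re s) 0)) - Im (\<Phi> (Complex (Re s) (Im s)))"
        by (rule w.Im_Phi_vertical_ge) (use mH Is False Rr in auto)
      moreover have "\<bar>Im s\<bar> = 0 - Im s" using False by simp
      ultimately show ?thesis unfolding complex.collapse by (simp only:)
    qed
    have W1: "Wd (Re s) \<ge> 1" using Wd_ge_1 rs by simp
    have "\<bar>Im (\<Phi> s) - Im (\<Phi> (Complex (Re s) 0))\<bar> \<le> (1 + \<bar>Im c0\<bar>) * 1 + K * Wd (Re s)"
      unfolding mult_1_right using IP K(3)[OF rs(4)] by linarith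
    also have "\<dots> \<le> (1 + \<bar>Im c0\<bar>) * Wd (Re s) + K * Wd (Re s)"
      using W1 by (intro add_right_mono mult_left_mono) auto
    also have "\<dots> = (1 + \<bar>Im c0\<bar> + K) * Wd (Re s)" by (simp add: algebra_simps)
    finally have "\<kappa> / 4 * exp (\<mu> * Re s) * \<bar>Im s\<bar> \<le> (1 + \<bar>Im c0\<bar> + K) * Wd (Re s)" using V by linarith
    then have "\<bar>Im s\<bar> \<le> M * (Wd (Re s) * exp (- \<mu> * Re s))" using kappa_pos
      by (simp add: M_def exp_minus field_simps)
    also have "\<dots> < (M + 1) * (Wd (Re s) * exp (- \<mu> * Re s))" using W1 by (intro mult_strict_right_mono) auto
    finally have width: "\<bar>Im s\<bar> < (M + 1) * stokes_width N D (exp (Re s))" by (simp add: width_eq)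
    have "r0 < exp (Re s)" using rs(6) r0 by (metis exp_less_cancel_iff exp_ln less_trans zero_less_one)
    moreover have "\<bar>B\<bar> + 1 \<le> exp (Re s)" using rs(7) by (metis abs_ge_zero exp_le_cancel_iff exp_ln less_add_same_cancel2 add_nonneg_pos zero_less_one)
    moreover have "d + ray \<theta> s \<in> stokes_neighbourhood N b d D r0 k (M + 1)"
      unfolding stokes_neighbourhood_def \<theta>[symmetric] using Arg_ray[of \<theta> s] width \<open>r0 < exp (Re s)\<close>
      by (auto intro!: exI[of _ "\<theta> + Im s"])
    moreover have "g (d + ray \<theta> s) = 0" using gA[OF Rr] s(3) l by simp
    ultimately show ?thesis by (intro exI[of _ "d + ray \<theta> s"]) auto
  qed
  have "infinite {z \<in> stokes_neighbourhood N b d D r0 k (M + 1). g z = 0}"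
  proof
    assume "finite {z \<in> stokes_neighbourhood N b d D r0 k (M + 1). g z = 0}"
    then have "bounded ((\<lambda>z. z - d) ` {z \<in> stokes_neighbourhood N b d D r0 k (M + 1). g z = 0})"
      by (intro finite_imp_bounded finite_imageI)
    then obtain B where "\<And>z. z \<in> stokes_neighbourhood N b d D r0 k (M + 1) \<Longrightarrow> g z = 0 \<Longrightarrow> norm (z - d) \<le> B"
      by (auto simp: bounded_iff)
    then show False using main[of "B + 1"] by force
  qed
  then show ?thesis unfolding infinitely_many_zeros_near_ray_def using M by (intro exI[of _ "M + 1"]) auto
qed

end

section \<open>Double pole series\<close>

text \<open>For t outside this is Cauchy's formula. For t inside, partial fractions leave two simple
  poles whose integrals cancel and a double pole, which has a primitive; for t = z there is a triple
  pole, again with a primitive.\<close>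

lemma circle_average_double_pole:
  fixes z t :: complex
  assumes r: "r > 0" and t: "norm (t - z) \<noteq> r"
  shows "((\<lambda>w. 1 / ((w - t)\<^sup>2 * (w - z))) has_contour_integral
    2 * of_real pi * \<i> * (if norm (t - z) > r then 1 / (z - t)\<^sup>2 else 0)) (circlepath z r)"
proof (cases "norm (t - z) > r")
  case True
  have "(\<lambda>w. 1 / (w - t)\<^sup>2) holomorphic_on cball z r"
    using True by (intro holomorphic_intros) (auto simp: dist_norm norm_minus_commute)
  from Cauchy_integral_circlepath_simple[OF this, of z] r True show ?thesis by simp
next
  case False
  then have lt: "norm (t - z) < r" using t by simp
  show ?thesis
  proof (cases "t = z")
    case True
    have "((\<lambda>w. 1 / (w - z) ^ 3) has_contour_integral 0) (circlepath z r)"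
    proof (rule Cauchy_theorem_primitive[where S = "- {z}" and f = "\<lambda>w. - (1/2) / (w - z)\<^sup>2"])
      fix w assume "w \<in> - {z}"
      then have "w - z \<noteq> 0" by simp
      then show "((\<lambda>w. - (1/2) / (w - z)\<^sup>2) has_field_derivative 1 / (w - z) ^ 3) (at w within - {z})"
        by (auto intro!: derivative_eq_intros simp: divide_simps power2_eq_square power3_eq_cube)
    qed (use r in auto)
    moreover have "(\<lambda>w. 1 / ((w - t)\<^sup>2 * (w - z))) = (\<lambda>w. 1 / (w - z) ^ 3)"
      using True by (auto simp: eval_nat_numeral)
    ultimately show ?thesis using False by simp
  next
    case tz: False
    define e where "e = t - z"
    have e0: "e \<noteq> 0" using tz by (simp add: e_def)
    have c1: "((\<lambda>w. 1 / (w - y)) has_contour_integral 2 * of_real pi * \<i>) (circlepath z r)" if "norm (y - z) < r" for y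
      using Cauchy_integral_circlepath_simple[OF holomorphic_on_const that, of 1] by simp
    have c2: "((\<lambda>w. 1 / (w - t)\<^sup>2) has_contour_integral 0) (circlepath z r)"
    proof (rule Cauchy_theorem_primitive[where S = "- {t}" and f = "\<lambda>w. - 1 / (w - t)"])
      fix w assume "w \<in> - {t}"
      then have "w - t \<noteq> 0" by simp
      then show "((\<lambda>w. - 1 / (w - t)) has_field_derivative 1 / (w - t)\<^sup>2) (at w within - {t})"
        by (auto intro!: derivative_eq_intros simp: field_simps eval_nat_numeral)
    qed (use r lt in \<open>auto simp: path_image_circlepath sphere_def dist_norm norm_minus_commute\<close>)
    have "((\<lambda>w. 1 / e\<^sup>2 * (1 / (w - z)) - 1 / e\<^sup>2 * (1 / (w - t)) + 1 / e * (1 / (w - t)\<^sup>2)) has_contour_integral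
        1 / e\<^sup>2 * (2 * of_real pi * \<i>) - 1 / e\<^sup>2 * (2 * of_real pi * \<i>) + 1 / e * 0) (circlepath z r)"
      by (intro has_contour_integral_add has_contour_integral_diff has_contour_integral_lmul c1 c2) (use r lt in auto)
    then have "((\<lambda>w. 1 / ((w - t)\<^sup>2 * (w - z))) has_contour_integral
        1 / e\<^sup>2 * (2 * of_real pi * \<i>) - 1 / e\<^sup>2 * (2 * of_real pi * \<i>) + 1 / e * 0) (circlepath z r)"
    proof (rule has_contour_integral_eq)
      fix w assume "w \<in> path_image (circlepath z r)"
      then have w: "w - z \<noteq> 0" "w - t \<noteq> 0"
        using r lt by (auto simp: dist_norm norm_minus_commute)
      have wz: "w - z = (w - t) + e" by (simp add: e_def)
      have alg: "1 / e\<^sup>2 * (1 / (y + e)) - 1 / e\<^sup>2 * (1 / y) + 1 / e * (1 / y\<^sup>2) = 1 / (y\<^sup>2 * (y + e))"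
        if "y \<noteq> 0" "y + e \<noteq> 0" for y
        using that e0 by (simp add: divide_simps) algebra
      show "1 / e\<^sup>2 * (1 / (w - z)) - 1 / e\<^sup>2 * (1 / (w - t)) + 1 / e * (1 / (w - t)\<^sup>2) = 1 / ((w - t)\<^sup>2 * (w - z))"
        unfolding wz by (rule alg) (use w wz in auto)
    qed
    then show ?thesis using False by simp
  qed
qed

locale pole_series =
  fixes c t :: "nat \<Rightarrow> complex"
  assumes t_lim: "filterlim (\<lambda>n. cmod (t n)) at_top sequentially"
    and summ: "summable (\<lambda>n. if t n = 0 then 0 else cmod (c n) / (cmod (t n))\<^sup>2)"
begin

text \<open>\<open>m\<close> is the summable majorant. The finitely many terms with
  \<open>t n = 0\<close> are missing from it and are accounted for by \<open>S0\<close>.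
  \<open>out\<close> is the mean of the series over the circle of radius r about z: only the poles
  outside survive, evaluated at the centre.\<close>

definition "m n = (if t n = 0 then 0 else cmod (c n) / (cmod (t n))\<^sup>2)"
definition "F w = (\<Sum>n. c n / (w - t n)\<^sup>2)"
definition "S0 = (\<Sum>n | t n = 0. cmod (c n))"
definition "out_term z r n = (if norm (t n - z) > r then c n / (z - t n)\<^sup>2 else 0)"
definition "out z r = (\<Sum>n. out_term z r n)"

lemma m_nonneg: "m n \<ge> 0" by (simp add: m_def)
lemma m_summable: "summable m" using summ by (simp add: m_def[abs_def])

lemma ev_large: "\<forall>\<^sub>F n in sequentially. B \<le> cmod (t n)"
  using t_lim by (simp add: filterlim_at_top)

lemma finite_small: "finite {n. cmod (t n) \<le> B}"
proof -
  obtain n0 where "\<And>n. n \<ge> n0 \<Longrightarrow> B + 1 \<le> cmod (t n)" using ev_large by (auto simp: eventually_sequentially)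
  then have "{n. cmod (t n) \<le> B} \<subseteq> {..<n0}" by (force simp: not_le[symmetric])
  then show ?thesis using finite_subset by blast
qed

lemma finite_zero: "finite {n. t n = 0}" by (rule finite_subset[OF _ finite_small[of 0]]) auto

lemma term_bound: "\<forall>\<^sub>F n in sequentially. \<forall>w\<in>cball (0::complex) R. norm (c n / (w - t n)\<^sup>2) \<le> 4 * m n"
  using ev_large[of "2 * \<bar>R\<bar> + 1"]
proof eventually_elim
  case (elim n)
  show ?case
  proof
    fix w :: complex assume "w \<in> cball 0 R"
    then have "norm w \<le> \<bar>R\<bar>" by simp
    then have "norm (w - t n) \<ge> norm (t n) / 2" using elim norm_triangle_ineq2[of "t n" w] by (simp add: norm_minus_commute)
    moreover have t0: "t n \<noteq> 0" using elim by auto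
    ultimately have "norm (c n) / (norm (w - t n))\<^sup>2 \<le> norm (c n) / (norm (t n) / 2)\<^sup>2"
      by (intro divide_left_mono power_mono mult_pos_pos zero_less_power) auto
    then show "norm (c n / (w - t n)\<^sup>2) \<le> 4 * m n" using t0 by (simp add: m_def norm_divide norm_power power_divide mult.commute)
  qed
qed

lemma sums_F: "(\<lambda>n. c n / (w - t n)\<^sup>2) sums F w"
  unfolding F_def
proof (rule summable_sums, rule summable_comparison_test_ev)
  show "\<forall>\<^sub>F n in sequentially. norm (c n / (w - t n)\<^sup>2) \<le> 4 * m n"
    using term_bound[of "norm w"] by eventually_elim auto
  show "summable (\<lambda>n. 4 * m n)" by (intro summable_mult m_summable)
qed

text \<open>Points \<open>t n\<close> with coefficient 0 are tolerated in \<open>U\<close>, since a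
  term is later deleted by setting its coefficient to 0 while its index remains.\<close>

lemma F_holomorphic:
  assumes U: "open U" "\<And>n. c n = 0 \<or> t n \<notin> U"
  shows "F holomorphic_on U"
proof (rule holomorphic_uniform_sequence[OF U(1)])
  show "(\<lambda>w. \<Sum>n<k. c n / (w - t n)\<^sup>2) holomorphic_on U" for k
  proof (intro holomorphic_on_sum)
    fix n
    show "(\<lambda>w. c n / (w - t n)\<^sup>2) holomorphic_on U"
    proof (cases "c n = 0")
      case False
      then have "t n \<notin> U" using U(2) by blast
      then show ?thesis by (intro holomorphic_intros) auto
    qed simp
  qed
  fix x assume x: "x \<in> U"
  obtain d where d: "d > 0" "cball x d \<subseteq> U" using U(1) x open_contains_cball by blast
  have "uniform_limit (cball 0 (norm x + d)) (\<lambda>k w. \<Sum>n<k. c n / (w - t n)\<^sup>2) (\<lambda>w. \<Sum>n. c n / (w - t n)\<^sup>2) sequentially"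
    by (rule Weierstrass_m_test_ev[OF term_bound]) (intro summable_mult m_summable)
  then have "uniform_limit (cball x d) (\<lambda>k w. \<Sum>n<k. c n / (w - t n)\<^sup>2) F sequentially"
    unfolding F_def[abs_def]
  proof (rule uniform_limit_on_subset)
    show "cball x d \<subseteq> cball 0 (norm x + d)"
    proof
      fix w assume "w \<in> cball x d"
      then have "norm (w - x) \<le> d" by (simp add: dist_norm norm_minus_commute)
      then show "w \<in> cball 0 (norm x + d)" using norm_triangle_ineq2[of w x] by simp
    qed
  qed
  with d show "\<exists>d>0. cball x d \<subseteq> U \<and> uniform_limit (cball x d) (\<lambda>k w. \<Sum>n<k. c n / (w - t n)\<^sup>2) F sequentially" by blast
qed

lemma remove: "pole_series (c(i := 0)) t"
proof
  show "summable (\<lambda>n. if t n = 0 then 0 else cmod ((c(i := 0)) n) / (cmod (t n))\<^sup>2)"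
    by (rule summable_comparison_test[OF _ m_summable]) (auto simp: m_def)
qed (rule t_lim)

lemma F_remove: "F w = c i / (w - t i)\<^sup>2 + pole_series.F (c(i := 0)) t w"
proof -
  have "(\<lambda>n. if n = i then c n / (w - t n)\<^sup>2 else 0) sums (c i / (w - t i)\<^sup>2)" by (rule sums_single)
  from sums_add[OF this pole_series.sums_F[OF remove[of i], of w]]
  have "(\<lambda>n. c n / (w - t n)\<^sup>2) sums (c i / (w - t i)\<^sup>2 + pole_series.F (c(i := 0)) t w)"
    by (rule sums_cong[THEN iffD1, rotated]) auto
  then show ?thesis using sums_F sums_unique2 by blast
qed

text \<open>For |t - z| > r one has |t| \<le> (1 + |z|/r) |t - z|, which compares the term with
  \<open>m\<close>. Terms with t = 0 can only be bounded through r.\<close>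

lemma out_term_bound:
  assumes r: "r > 0"
  shows "norm (out_term z r n) \<le> (1 + norm z / r)\<^sup>2 * m n + (if t n = 0 then norm (c n) / r\<^sup>2 else 0)"
    and "norm (out_term z r n) \<le> norm (c n) / r\<^sup>2"
proof -
  have P: "norm (out_term z r n) \<le> norm (c n) / r\<^sup>2"
  proof (cases "norm (t n - z) > r")
    case True
    then have "norm (c n) / (norm (z - t n))\<^sup>2 \<le> norm (c n) / r\<^sup>2"
      using r by (intro divide_left_mono power_mono mult_pos_pos zero_less_power) (auto simp: norm_minus_commute)
    then show ?thesis using True by (simp add: out_term_def norm_divide norm_power)
  qed (simp add: out_term_def)
  then show "norm (out_term z r n) \<le> norm (c n) / r\<^sup>2" .
  show "norm (out_term z r n) \<le> (1 + norm z / r)\<^sup>2 * m n + (if t n = 0 then norm (c n) / r\<^sup>2 else 0)"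
  proof (cases "t n = 0")
    case True
    then show ?thesis using P m_nonneg[of n] by (simp add: add_increasing)
  next
    case False
    show ?thesis
    proof (cases "norm (t n - z) > r")
      case True
      have "norm z * r \<le> norm z * norm (t n - z)" using True by (intro mult_left_mono) auto
      then have "norm z \<le> norm z / r * norm (t n - z)" using r by (simp add: field_simps)
      then have "norm (t n) \<le> (1 + norm z / r) * norm (t n - z)"
        using norm_triangle_ineq[of "t n - z" z] by (simp add: distrib_right)
      then have "(norm (t n))\<^sup>2 \<le> ((1 + norm z / r) * norm (t n - z))\<^sup>2" by (rule power_mono) simp
      then have "norm (c n) * (norm (t n))\<^sup>2 \<le> norm (c n) * ((1 + norm z / r)\<^sup>2 * (norm (t n - z))\<^sup>2)"
        by (intro mult_left_mono) (auto simp: power_mult_distrib)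
      moreover have "norm (t n - z) > 0" using True r by linarith
      ultimately have "norm (c n) / (norm (t n - z))\<^sup>2 \<le> (1 + norm z / r)\<^sup>2 * (norm (c n) / (norm (t n))\<^sup>2)"
        using False by (simp add: divide_simps mult_ac)
      then show ?thesis using True False by (simp add: out_term_def m_def norm_divide norm_power norm_minus_commute)
    next
      case F: False
      then show ?thesis using m_nonneg[of n] False by (simp add: out_term_def)
    qed
  qed
qed

lemma out_summable:
  assumes r: "r > 0"
  shows "summable (\<lambda>n. norm (out_term z r n))"
    and "norm (out z r) \<le> (1 + norm z / r)\<^sup>2 * suminf m + S0 / r\<^sup>2"
proof -
  let ?b = "\<lambda>n. (1 + norm z / r)\<^sup>2 * m n + (if t n = 0 then norm (c n) / r\<^sup>2 else 0)"
  have s2: "(\<lambda>n. if n \<in> {n. t n = 0} then norm (c n) / r\<^sup>2 else 0) sums (\<Sum>n | t n = 0. norm (c n) / r\<^sup>2)"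
    by (rule sums_If_finite_set) (rule finite_zero)
  then have b: "?b sums ((1 + norm z / r)\<^sup>2 * suminf m + (\<Sum>n | t n = 0. norm (c n) / r\<^sup>2))"
    by (intro sums_add sums_mult summable_sums m_summable) auto
  then show s: "summable (\<lambda>n. norm (out_term z r n))"
    using summable_comparison_test'[OF sums_summable[OF b], of 0 "\<lambda>n. norm (out_term z r n)"] out_term_bound(1)[OF r] by auto
  have "norm (out z r) \<le> (\<Sum>n. norm (out_term z r n))" unfolding out_def by (rule summable_norm[OF s])
  also have "\<dots> \<le> suminf ?b" by (rule suminf_le[OF out_term_bound(1)[OF r] s sums_summable[OF b]])
  also have "\<dots> = (1 + norm z / r)\<^sup>2 * suminf m + S0 / r\<^sup>2"
    using sums_unique[OF b] by (simp add: S0_def sum_divide_distrib)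
  finally show "norm (out z r) \<le> (1 + norm z / r)\<^sup>2 * suminf m + S0 / r\<^sup>2" .
qed

text \<open>For |z| \<le> K r the factor (1 + |z|/r)^2 is at most \<open>q\<close>, so one tail of
  \<open>m\<close> handles all large indices; the finitely many others are O(1/r^2).\<close>

lemma out_small:
  assumes e: "e > 0" and K: "K > 0"
  obtains R where "R > 0" "\<And>z r. r \<ge> R \<Longrightarrow> norm z \<le> K * r \<Longrightarrow> norm (out z r) \<le> e"
proof -
  define q where "q = (1 + K)\<^sup>2"
  have q: "q > 0" using K by (simp add: q_def)
  obtain n1 where n1: "\<And>n. n \<ge> n1 \<Longrightarrow> 1 \<le> cmod (t n)" using ev_large[of 1] by (auto simp: eventually_sequentially)
  have "e / (2 * q) > 0" using e q by simp
  from suminf_exist_split[OF this m_summable] obtain n2 where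
    n2: "\<And>n. n \<ge> n2 \<Longrightarrow> norm (\<Sum>i. m (i + n)) < e / (2 * q)" by blast
  define n0 where "n0 = max n1 n2"
  have tail: "(\<Sum>i. m (i + n0)) < e / (2 * q)" using n2[of n0] by (simp add: n0_def)
  define S where "S = (\<Sum>n<n0. norm (c n))"
  have S0: "S \<ge> 0" by (simp add: S_def sum_nonneg)
  define R where "R = max 1 (2 * S / e)"
  show ?thesis
  proof (rule that[of R])
    fix z :: complex and r assume r: "r \<ge> R" "norm z \<le> K * r"
    have rpos: "r > 0" "r \<ge> 1" using r by (auto simp: R_def)
    have s: "summable (\<lambda>n. norm (out_term z r n))" by (rule out_summable[OF rpos(1)])
    have "norm (out z r) \<le> (\<Sum>n. norm (out_term z r n))" unfolding out_def by (rule summable_norm[OF s])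
    also have "\<dots> = (\<Sum>n. norm (out_term z r (n + n0))) + (\<Sum>n<n0. norm (out_term z r n))"
      by (rule suminf_split_initial_segment[OF s])
    also have "(\<Sum>n<n0. norm (out_term z r n)) \<le> (\<Sum>n<n0. norm (c n) / r\<^sup>2)" by (intro sum_mono out_term_bound(2) rpos)
    also have "\<dots> = S / r\<^sup>2" by (simp add: S_def sum_divide_distrib)
    also have "\<dots> \<le> S / r" using rpos S0 by (intro divide_left_mono) (auto simp: power2_eq_square)
    also have "\<dots> \<le> e / 2" using r e rpos by (simp add: R_def field_simps)
    also have "(\<Sum>n. norm (out_term z r (n + n0))) \<le> (\<Sum>n. q * m (n + n0))"
    proof (rule suminf_le)
      show "summable (\<lambda>n. norm (out_term z r (n + n0)))" by (rule summable_ignore_initial_segment[OF s])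
      show "summable (\<lambda>n. q * m (n + n0))" by (intro summable_mult summable_ignore_initial_segment m_summable)
      fix n
      have "t (n + n0) \<noteq> 0" using n1[of "n + n0"] by (simp add: n0_def trans_le_add2) auto
      then have "norm (out_term z r (n + n0)) \<le> (1 + norm z / r)\<^sup>2 * m (n + n0)"
        using out_term_bound(1)[OF rpos(1), of z "n + n0"] by simp
      also have "\<dots> \<le> q * m (n + n0)" unfolding q_def
        using r rpos by (intro mult_right_mono power_mono m_nonneg) (auto simp: field_simps)
      finally show "norm (out_term z r (n + n0)) \<le> q * m (n + n0)" .
    qed
    also have "(\<Sum>n. q * m (n + n0)) = q * (\<Sum>n. m (n + n0))"
      by (rule suminf_mult) (rule summable_ignore_initial_segment[OF m_summable])
    also have "\<dots> \<le> q * (e / (2 * q))" using tail q by (intro mult_left_mono) auto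
    also have "q * (e / (2 * q)) = e / 2" using q by simp
    finally show "norm (out z r) \<le> e" by simp
  qed (simp add: R_def)
qed

lemma F_average:
  fixes z :: complex
  assumes r: "r > 0" and av: "\<And>n. norm (t n - z) \<noteq> r"
  shows "((\<lambda>w. F w / (w - z)) has_contour_integral 2 * of_real pi * \<i> * out z r) (circlepath z r)"
proof -
  define f where "f = (\<lambda>n w. c n / ((w - t n)\<^sup>2 * (w - z)))"
  have fi: "(f n has_contour_integral 2 * of_real pi * \<i> * out_term z r n) (circlepath z r)" for n
  proof -
    have "((\<lambda>w. c n * (1 / ((w - t n)\<^sup>2 * (w - z)))) has_contour_integral
       c n * (2 * of_real pi * \<i> * (if norm (t n - z) > r then 1 / (z - t n)\<^sup>2 else 0))) (circlepath z r)"
      by (intro has_contour_integral_lmul circle_average_double_pole r av)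
    moreover have "c n * (2 * of_real pi * \<i> * (if norm (t n - z) > r then 1 / (z - t n)\<^sup>2 else 0)) = 2 * of_real pi * \<i> * out_term z r n"
      by (simp add: out_term_def)
    ultimately show ?thesis by (simp add: f_def)
  qed
  have bound: "\<forall>\<^sub>F n in sequentially. \<forall>w\<in>sphere z r. norm (f n w) \<le> 4 / r * m n"
    using term_bound[of "norm z + r"]
  proof eventually_elim
    case (elim n)
    show ?case
    proof
      fix w assume "w \<in> sphere z r"
      then have wr: "norm (w - z) = r" by (simp add: dist_norm norm_minus_commute)
      then have "w \<in> cball 0 (norm z + r)" using norm_triangle_ineq2[of w z] by simp
      then have "norm (c n / (w - t n)\<^sup>2) \<le> 4 * m n" using elim by blast
      then have "norm (c n / (w - t n)\<^sup>2) / r \<le> 4 * m n / r" using r by (intro divide_right_mono) auto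
      then show "norm (f n w) \<le> 4 / r * m n" using wr by (simp add: f_def norm_divide norm_mult)
    qed
  qed
  have ul: "uniform_limit (sphere z r) (\<lambda>k w. \<Sum>n<k. f n w) (\<lambda>w. \<Sum>n. f n w) sequentially"
    by (rule Weierstrass_m_test_ev[OF bound]) (intro summable_mult m_summable)
  have fs: "((\<lambda>w. \<Sum>n<k. f n w) has_contour_integral (\<Sum>n<k. 2 * of_real pi * \<i> * out_term z r n)) (circlepath z r)" for k
    by (intro has_contour_integral_sum fi) auto
  have int: "(\<lambda>w. \<Sum>n<k. f n w) contour_integrable_on circlepath z r" for k
    using fs contour_integrable_on_def by blast
  have eq: "(\<Sum>n. f n w) = F w / (w - z)" for w
  proof -
    have "(\<lambda>n. c n / (w - t n)\<^sup>2 / (w - z)) sums (F w / (w - z))" by (intro sums_divide sums_F)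
    then show ?thesis by (simp add: f_def sums_iff)
  qed
  note U = contour_integral_uniform_limit_circlepath[OF always_eventually ul sequentially_bot r, OF allI[OF int], unfolded eq]
  have "(\<lambda>k. \<Sum>n<k. 2 * of_real pi * \<i> * out_term z r n) \<longlonglongrightarrow> contour_integral (circlepath z r) (\<lambda>w. F w / (w - z))"
    using U(2) unfolding contour_integral_unique[OF fs] .
  then have "(\<lambda>n. 2 * of_real pi * \<i> * out_term z r n) sums contour_integral (circlepath z r) (\<lambda>w. F w / (w - z))"
    by (simp add: sums_def)
  moreover have "(\<lambda>n. 2 * of_real pi * \<i> * out_term z r n) sums (2 * of_real pi * \<i> * out z r)"
    unfolding out_def by (intro sums_mult summable_sums summable_norm_cancel[OF out_summable(1)[OF r]])
  ultimately have "contour_integral (circlepath z r) (\<lambda>w. F w / (w - z)) = 2 * of_real pi * \<i> * out z r"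
    by (rule sums_unique2)
  with U(1) show ?thesis using has_contour_integral_integral by metis
qed

text \<open>Taking means removes the poles inside the disc, so a bound for f on the circle controls
  D at the centre even when f is unbounded in between.\<close>

lemma D_average:
  assumes r: "r > 0" and D: "D holomorphic_on cball z r" and B: "B \<ge> 0"
    and w: "\<And>w. norm (w - z) = r \<Longrightarrow> w \<notin> range t \<and> f w = D w + F w \<and> norm (f w) \<le> B"
  shows "norm (D z + out z r) \<le> B"
proof -
  have av: "norm (t n - z) \<noteq> r" for n using w[of "t n"] by auto
  have "((\<lambda>w. D w / (w - z) + F w / (w - z)) has_contour_integral 2 * of_real pi * \<i> * D z + 2 * of_real pi * \<i> * out z r) (circlepath z r)"
    by (intro has_contour_integral_add Cauchy_integral_circlepath_simple[OF D] F_average[OF r av]) (use r in auto)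
  then have I: "((\<lambda>w. D w / (w - z) + F w / (w - z)) has_contour_integral 2 * of_real pi * \<i> * (D z + out z r)) (circlepath z r)"
    by (simp add: distrib_left)
  have "norm (2 * of_real pi * \<i> * (D z + out z r)) \<le> B / r * (2 * pi * r)"
  proof (rule has_contour_integral_bound_circlepath[OF I])
    fix x assume x: "norm (x - z) = r"
    have "D x / (x - z) + F x / (x - z) = f x / (x - z)" using w[OF x] by (simp add: add_divide_distrib)
    then have "norm (D x / (x - z) + F x / (x - z)) = norm (f x) / r" using x by (simp only: norm_divide)
    also have "\<dots> \<le> B / r" using w[OF x] r by (intro divide_right_mono) auto
    finally show "norm (D x / (x - z) + F x / (x - z)) \<le> B / r" .
  qed (use r B in auto)
  then show ?thesis using r by (simp add: norm_mult)
qed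

text \<open>For a function holomorphic on the disc the mean is its value at the centre, while in the
  series only the outer terms remain, whatever points \<open>t n\<close> the expansion lists
  inside.\<close>

lemma holomorphic_average:
  assumes r: "r > 0" and f: "f holomorphic_on cball z r"
    and w: "\<And>w. norm (w - z) = r \<Longrightarrow> w \<notin> range t \<and> f w = F w"
  shows "f z = out z r"
proof -
  have av: "norm (t n - z) \<noteq> r" for n using w[of "t n"] by auto
  have "((\<lambda>w. f w / (w - z)) has_contour_integral 2 * of_real pi * \<i> * f z) (circlepath z r)"
    by (rule Cauchy_integral_circlepath_simple[OF f]) (use r in simp)
  then have "((\<lambda>w. F w / (w - z)) has_contour_integral 2 * of_real pi * \<i> * f z) (circlepath z r)"
    by (rule has_contour_integral_eq) (use w r in \<open>auto simp: dist_norm norm_minus_commute\<close>)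
  from has_contour_integral_unique[OF this F_average[OF r av]] show ?thesis by simp
qed

end

section \<open>The entire difference between a function and its pole series\<close>

context pole_series
begin

lemma closed_range: "closed (range t)"
proof -
  have "\<not> x islimpt range t" for x
  proof
    assume "x islimpt range t"
    then have "infinite (range t \<inter> ball x 1)" by (simp add: islimpt_eq_infinite_ball)
    moreover have "range t \<inter> ball x 1 \<subseteq> t ` {n. norm (t n) \<le> norm x + 1}"
    proof
      fix w assume "w \<in> range t \<inter> ball x 1"
      then obtain n where n: "w = t n" "norm (t n - x) < 1" by (auto simp: dist_norm norm_minus_commute)
      then have "norm (t n) \<le> norm x + 1" using norm_triangle_ineq2[of "t n" x] by linarith
      with n show "w \<in> t ` {n. norm (t n) \<le> norm x + 1}" by blast
    qed
    ultimately show False using finite_small finite_subset finite_imageI by metis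
  qed
  then show ?thesis by (simp add: closed_limpt)
qed

text \<open>As \<open>t\<close> is injective, near \<open>t i\<close> the series has just one
  singular term, the one that f has. The value of D at the pole is supplied by the local remainder
  \<open>h\<close> minus the series with that term deleted.\<close>

lemma ex_entire:
  assumes f: "f holomorphic_on - range t" and inj: "inj t"
    and loc: "\<And>i. \<exists>\<epsilon>>0. \<exists>h. h holomorphic_on ball (t i) \<epsilon> \<and> (\<forall>w\<in>ball (t i) \<epsilon> - {t i}. w \<notin> range t \<and> f w = c i / (w - t i)\<^sup>2 + h w)"
  obtains D where "D holomorphic_on UNIV" "\<And>w. w \<notin> range t \<Longrightarrow> f w = D w + F w"
proof -
  obtain \<epsilon> h where \<epsilon>: "\<And>i. \<epsilon> i > 0" and h: "\<And>i. h i holomorphic_on ball (t i) (\<epsilon> i)"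
    and eq: "\<And>i w. w \<in> ball (t i) (\<epsilon> i) - {t i} \<Longrightarrow> w \<notin> range t \<and> f w = c i / (w - t i)\<^sup>2 + h i w"
    using loc by metis
  define D where "D w = (if w \<in> range t then h (inv t w) w - pole_series.F (c(inv t w := 0)) t w else f w - F w)" for w
  have o: "open (- range t)" using closed_range by (simp add: open_Compl)
  have "D field_differentiable at w" for w
  proof (cases "w \<in> range t")
    case False
    have "F holomorphic_on - range t" by (rule F_holomorphic[OF o]) auto
    then have "(\<lambda>w. f w - F w) holomorphic_on - range t" by (intro holomorphic_intros f)
    then have "D holomorphic_on - range t" by (rule holomorphic_transform) (simp add: D_def)
    then show ?thesis using o False by (simp add: holomorphic_on_open field_differentiable_def)
  next
    case True
    then obtain i where i: "w = t i" by blast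
    have nt: "t n \<notin> ball (t i) (\<epsilon> i)" if "n \<noteq> i" for n
      using eq[of "t n" i] that inj by (auto simp: inj_eq)
    have "pole_series.F (c(i := 0)) t holomorphic_on ball (t i) (\<epsilon> i)"
      by (rule pole_series.F_holomorphic[OF remove]) (use nt in auto)
    then have "(\<lambda>w. h i w - pole_series.F (c(i := 0)) t w) holomorphic_on ball (t i) (\<epsilon> i)"
      by (intro holomorphic_intros h)
    then have "D holomorphic_on ball (t i) (\<epsilon> i)"
    proof (rule holomorphic_transform)
      fix x assume x: "x \<in> ball (t i) (\<epsilon> i)"
      show "h i x - pole_series.F (c(i := 0)) t x = D x"
      proof (cases "x = t i")
        case True
        then show ?thesis using inj by (simp add: D_def inv_f_f)
      next
        case False
        then show ?thesis using eq[of x i] x F_remove[of x i] by (simp add: D_def)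
      qed
    qed
    then show ?thesis using \<epsilon>[of i] unfolding i by (simp add: holomorphic_on_open field_differentiable_def)
  qed
  then have "D holomorphic_on UNIV" by (simp add: holomorphic_on_def)
  then show ?thesis by (rule that) (simp add: D_def)
qed

text \<open>Circles of polynomially small radius on which f is polynomially bounded make D a
  polynomial, by averaging and Liouville. Larger circles around \<zeta>, with radius proportional to
  |\<zeta>|, give D(\<zeta>) \<rightarrow> 0 because \<open>out\<close> tends to 0 as well; a
  polynomial tending to 0 along a path to infinity is 0.\<close>

lemma entire_part_zero:
  assumes D: "D holomorphic_on UNIV" and fD: "\<And>w. w \<notin> range t \<Longrightarrow> f w = D w + F w"
    and K: "K > 0" and growth: "\<And>z. B \<le> norm z \<Longrightarrow> \<exists>r>0. 1 / (K * norm z ^ n) \<le> r \<and>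
        (\<forall>w. norm (w - z) = r \<longrightarrow> w \<notin> range t \<and> norm (f w) \<le> K * norm z ^ n)"
    and \<zeta>: "filterlim \<zeta> at_infinity (at_top :: real filter)" and k: "k > 0"
    and small: "\<And>e. e > 0 \<Longrightarrow> \<forall>\<^sub>F x in at_top. \<forall>w. norm (w - \<zeta> x) = k * norm (\<zeta> x) \<longrightarrow> w \<notin> range t \<and> norm (f w) \<le> e"
  shows "D z = 0"
proof -
  define M where "M = suminf m"
  have M: "M \<ge> 0" unfolding M_def by (intro suminf_nonneg m_summable m_nonneg)
  have S0: "S0 \<ge> 0" by (simp add: S0_def sum_nonneg)
  define K' where "K' = K + (1 + K)\<^sup>2 * M + S0 * K\<^sup>2"
  \<comment> \<open>The degree 2 n + 2 comes from (|z|/r)^2 in the bound for \<open>out\<close>,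
    where 1/r is at most K |z|^n.\<close>
  have g: "norm (D z) \<le> K' * norm z ^ (2 * n + 2)" if z: "max 1 B \<le> norm z" for z
  proof -
    define x where "x = norm z"
    have x: "x \<ge> 1" using z by (simp add: x_def)
    obtain r where r: "r > 0" "1 / (K * x ^ n) \<le> r"
      and w: "\<And>w. norm (w - z) = r \<Longrightarrow> w \<notin> range t \<and> norm (f w) \<le> K * x ^ n"
      using growth[of z] z unfolding x_def by auto
    have xn: "K * x ^ n > 0" using K x by simp
    have ir: "1 / r \<le> K * x ^ n" using r xn by (simp add: field_simps)
    have "norm (D z + out z r) \<le> K * x ^ n"
    proof (rule D_average[OF r(1) holomorphic_on_subset[OF D]])
      show "w \<notin> range t \<and> f w = D w + F w \<and> norm (f w) \<le> K * x ^ n" if "norm (w - z) = r" for w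
        using w[OF that] fD by blast
    qed (use xn in auto)
    then have "norm (D z) \<le> K * x ^ n + norm (out z r)" using norm_triangle_ineq4[of "D z + out z r" "out z r"] by simp
    also have "norm (out z r) \<le> (1 + x / r)\<^sup>2 * M + S0 / r\<^sup>2" unfolding x_def M_def by (rule out_summable(2)[OF r(1)])
    also have "(1 + x / r)\<^sup>2 * M \<le> ((1 + K) * x ^ (n + 1))\<^sup>2 * M"
    proof (intro mult_right_mono power_mono M)
      have "x / r \<le> x * (K * x ^ n)" using mult_left_mono[OF ir, of x] x by simp
      moreover have "1 \<le> x ^ (n + 1)" using x by (rule one_le_power)
      ultimately show "1 + x / r \<le> (1 + K) * x ^ (n + 1)" by (simp add: algebra_simps)
    qed (use x r in auto)
    also have "\<dots> = (1 + K)\<^sup>2 * M * x ^ (2 * n + 2)"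
    proof -
      have "(x ^ (n + 1))\<^sup>2 = x ^ ((n + 1) * 2)" by (rule power_mult[symmetric])
      also have "(n + 1) * 2 = 2 * n + 2" by simp
      finally show ?thesis by (simp only: power_mult_distrib) (simp only: mult_ac)
    qed
    also have "S0 / r\<^sup>2 \<le> S0 * K\<^sup>2 * x ^ (2 * n + 2)"
    proof -
      have "(1 / r)\<^sup>2 \<le> (K * x ^ n)\<^sup>2" using ir r by (intro power_mono) auto
      also have "\<dots> = K\<^sup>2 * x ^ (2 * n)" by (simp add: power_mult_distrib power_mult[symmetric] mult.commute)
      also have "\<dots> \<le> K\<^sup>2 * x ^ (2 * n + 2)" using x by (intro mult_left_mono power_increasing) auto
      finally have "S0 * (1 / r)\<^sup>2 \<le> S0 * (K\<^sup>2 * x ^ (2 * n + 2))" using S0 by (rule mult_left_mono)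
      then show ?thesis unfolding power_divide mult.assoc[of S0] by simp
    qed
    also have "K * x ^ n \<le> K * x ^ (2 * n + 2)" using x K by (intro mult_left_mono power_increasing) auto
    finally show ?thesis by (simp add: x_def K'_def algebra_simps)
  qed
  define a where "a i = (deriv ^^ i) D 0 / fact i" for i
  have poly: "D z = (\<Sum>i\<le>2*n+2. a i * z ^ i)" for z
    unfolding a_def by (rule Liouville_polynomial[OF D g])
  have to0: "\<forall>\<^sub>F x in at_top. norm (D (\<zeta> x)) \<le> 2 * e" if e: "e > 0" for e
  proof -
    have "1 / k > 0" using k by simp
    then obtain R where R: "R > 0" "\<And>z r. r \<ge> R \<Longrightarrow> norm z \<le> 1 / k * r \<Longrightarrow> norm (out z r) \<le> e"
      by (rule out_small[OF e]) (rule that, assumption+)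
    have "\<forall>\<^sub>F x in at_top. R / k \<le> norm (\<zeta> x)"
      using filterlim_at_infinity_imp_norm_at_top[OF \<zeta>] by (simp add: filterlim_at_top)
    then show ?thesis using small[OF e]
    proof eventually_elim
      case (elim x)
      have r: "k * norm (\<zeta> x) \<ge> R" using elim(1) k by (simp add: field_simps)
      then have r0: "k * norm (\<zeta> x) > 0" using R by linarith
      have "norm (D (\<zeta> x) + out (\<zeta> x) (k * norm (\<zeta> x))) \<le> e"
      proof (rule D_average[OF r0 holomorphic_on_subset[OF D]])
        show "w \<notin> range t \<and> f w = D w + F w \<and> norm (f w) \<le> e" if "norm (w - \<zeta> x) = k * norm (\<zeta> x)" for w
          using elim(2) that fD by blast
      qed (use e in auto)
      moreover have "norm (out (\<zeta> x) (k * norm (\<zeta> x))) \<le> e" by (rule R(2)[OF r]) (use k in simp)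
      ultimately show ?case
        using norm_triangle_ineq4[of "D (\<zeta> x) + out (\<zeta> x) (k * norm (\<zeta> x))" "out (\<zeta> x) (k * norm (\<zeta> x))"] by simp
    qed
  qed
  have a0: "a i = 0" if i: "1 \<le> i" "i \<le> 2 * n + 2" for i
  proof (rule ccontr)
    assume "a i \<noteq> 0"
    then have "\<forall>\<^sub>F z in at_infinity. 3 \<le> norm (\<Sum>i\<le>2*n+2. a i * z ^ i)" by (intro polyfun_extremal exI[of _ i]) (use i in auto)
    then have "\<forall>\<^sub>F z in at_infinity. 3 \<le> norm (D z)" unfolding poly .
    then have "\<forall>\<^sub>F x in at_top. 3 \<le> norm (D (\<zeta> x))" using \<zeta> by (rule eventually_compose_filterlim)
    then have "\<forall>\<^sub>F x in at_top :: real filter. False" using to0[OF zero_less_one] by eventually_elim auto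
    then show False by simp
  qed
  have const: "D z = a 0" for z
  proof -
    have "D z = (\<Sum>i\<le>2*n+2. if i = 0 then a i else 0)" unfolding poly using a0 by (intro sum.cong) auto
    then show ?thesis by (simp add: sum.delta')
  qed
  have "norm (a 0) \<le> 2 * e" if "e > 0" for e
    using eventually_happens'[OF _ to0[OF that]] by (auto simp: const)
  from this[of "norm (a 0) / 4"] have "a 0 = 0" by (cases "a 0 = 0") auto
  then show ?thesis by (simp add: const)
qed

end

section \<open>Zeros of g as double poles without residue\<close>

context stokes
begin

text \<open>At a zero of order n \<ge> 2 the lowest-order term of the equation would be n (n - 1)
  times nonzero factors, as P does not vanish there. At a simple zero, with g = (w - t) k, the
  equation at t reads 2 P k' = P' k; this says that P/k^2 has derivative 0 at t, so the double pole
  has no residue.\<close>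

lemma double_pole:
  assumes t: "g t = 0"
  shows "deriv g t \<noteq> 0"
    and "\<exists>\<epsilon>>0. \<exists>h. h holomorphic_on ball t \<epsilon> \<and> (\<forall>w\<in>ball t \<epsilon> - {t}. g w \<noteq> 0 \<and>
           poly P w / (g w)\<^sup>2 = (poly P t / (deriv g t)\<^sup>2) / (w - t)\<^sup>2 + h w)"
proof -
  have Pt: "poly P t \<noteq> 0" using no_common_zeros t by blast
  have "\<not> g constant_on UNIV" using t nontrivial by (force simp: constant_on_def)
  then obtain k r n where n: "0 < n" and r: "0 < r" and hk: "k holomorphic_on ball t r"
    and gk: "\<And>w. w \<in> ball t r \<Longrightarrow> g w = (w - t) ^ n * k w" and k0: "\<And>w. w \<in> ball t r \<Longrightarrow> k w \<noteq> 0"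
    using holomorphic_factor_zero_nonconstant[OF entire open_UNIV connected_UNIV UNIV_I t] by metis
  have t_ball: "t \<in> ball t r" using r by simp
  define G where "G w = of_nat n * k w + (w - t) * deriv k w" for w
  have dk: "(k has_field_derivative deriv k w) (at w)" if "w \<in> ball t r" for w
    by (rule holomorphic_derivI[OF hk open_ball that])
  have hG: "G holomorphic_on ball t r" unfolding G_def by (intro holomorphic_intros hk holomorphic_deriv) auto
  have dG: "(G has_field_derivative deriv G w) (at w)" if "w \<in> ball t r" for w
    by (rule holomorphic_derivI[OF hG open_ball that])
  have nn: "n = Suc (n - 1)" using n by simp
  have g1: "deriv g w = (w - t) ^ (n - 1) * G w" if w: "w \<in> ball t r" for w
  proof (rule DERIV_imp_deriv)
    have "((\<lambda>w. (w - t) ^ n * k w) has_field_derivative (w - t) ^ (n - 1) * G w) (at w)"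
      by (rule derivative_eq_intros dk[OF w] refl | simp)+
        (subst (2) nn, simp add: G_def algebra_simps)
    then show "(g has_field_derivative (w - t) ^ (n - 1) * G w) (at w)"
      by (rule DERIV_cong_ev[THEN iffD1, rotated -1])
        (use gk w in \<open>auto intro!: eventually_mono[OF eventually_nhds_in_open[OF open_ball w]]\<close>)
  qed
  have dg2: "deriv (deriv g) w = deriv (\<lambda>w. (w - t) ^ (n - 1) * G w) w" if w: "w \<in> ball t r" for w
    by (rule deriv_cong_ev) (use g1 w in \<open>auto intro!: eventually_mono[OF eventually_nhds_in_open[OF open_ball w]]\<close>)
  have Gt: "G t = of_nat n * k t" by (simp add: G_def)
  have n1: "n = 1"
  proof (rule ccontr)
    assume "n \<noteq> 1"
    then obtain m where m: "n = Suc (Suc m)" using n by (metis One_nat_def Suc_pred neq0_conv)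
    \<comment> \<open>P times the left side of the equation, divided by (w - t)^m, where n = m + 2.
      It vanishes near t off t, but its value at t is (n - 1) n P(t) k(t).\<close>
    define T where "T w = poly P w * (of_nat (Suc m) * G w + (w - t) * deriv G w) - poly (pderiv P) w * (w - t) * G w + poly Q w * (w - t)\<^sup>2 * k w" for w
    have "isCont T t" unfolding T_def
      by (intro continuous_intros poly_isCont DERIV_isCont[OF dG[OF t_ball]] DERIV_isCont[OF dk[OF t_ball]]
          DERIV_isCont[OF holomorphic_derivI[OF holomorphic_deriv[OF hG open_ball] open_ball t_ball]])
    then have lim: "(T \<longlongrightarrow> T t) (at t)" by (simp add: isCont_def)
    have "\<forall>\<^sub>F w in at t. w \<in> ball t r \<and> poly P w \<noteq> 0 \<and> w \<noteq> t"
    proof (intro eventually_conj)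
      show "\<forall>\<^sub>F w in at t. w \<in> ball t r" using r by (intro eventually_at_in_open') auto
      show "\<forall>\<^sub>F w in at t. poly P w \<noteq> 0"
        using Pt poly_isCont[where p = P and x = t] by (intro tendsto_imp_eventually_ne) (auto simp: isCont_def)
      show "\<forall>\<^sub>F w in at t. w \<noteq> t" by (auto simp: eventually_at_filter)
    qed
    then have "\<forall>\<^sub>F w in at t. T w = 0"
    proof eventually_elim
      case (elim w)
      have dp: "((\<lambda>w. (w - t) ^ Suc m) has_field_derivative (1 + of_nat m) * (1 * (w - t) ^ m)) (at w)"
        by (rule DERIV_power_Suc) (auto intro!: derivative_eq_intros)
      have "((\<lambda>w. (w - t) ^ Suc m * G w) has_field_derivative (w - t) ^ m * (of_nat (Suc m) * G w + (w - t) * deriv G w)) (at w)"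
        by (rule DERIV_cong[OF DERIV_mult[OF dp dG]]) (use elim in auto, simp add: algebra_simps)
      then have d2: "deriv (deriv g) w = (w - t) ^ m * (of_nat (Suc m) * G w + (w - t) * deriv G w)"
        using dg2[of w] elim m by (auto dest: DERIV_imp_deriv)
      have d1: "deriv g w = (w - t) ^ m * ((w - t) * G w)" using g1[of w] elim m by simp
      have d0: "g w = (w - t) ^ m * ((w - t)\<^sup>2 * k w)" using gk[of w] elim m by (simp add: power2_eq_square mult_ac)
      have "poly P w * deriv (deriv g) w - poly (pderiv P) w * deriv g w + poly Q w * g w = 0"
        using ode[of w] elim by (simp add: field_simps)
      then have "(w - t) ^ m * T w = 0" unfolding d2 d1 d0 T_def by (simp add: algebra_simps)
      then show ?case using elim by simp
    qed
    then have "(T \<longlongrightarrow> 0) (at t)" by (rule tendsto_eventually)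
    then have "T t = 0" using lim tendsto_unique[of "at t"] by auto
    then show False using Pt Gt k0[OF t_ball] m by (simp add: T_def del: of_nat_Suc)
  qed
  have gt: "deriv g t = k t" using g1[OF t_ball] n1 Gt by simp
  then show "deriv g t \<noteq> 0" using k0[OF t_ball] by simp
  have "(G has_field_derivative 2 * deriv k t) (at t)" unfolding G_def n1
    by (rule derivative_eq_intros dk[OF t_ball] holomorphic_derivI[OF holomorphic_deriv[OF hk open_ball] open_ball t_ball] refl | simp)+
  then have "deriv (deriv g) t = 2 * deriv k t" using dg2[OF t_ball] n1 by (simp add: DERIV_imp_deriv)
  then have ode_t: "poly P t * (2 * deriv k t) = poly (pderiv P) t * k t"
    using ode[OF Pt] Pt t gt by (simp add: field_simps)
  define M where "M w = poly P w / (k w)\<^sup>2" for w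
  have hM: "M holomorphic_on ball t r" unfolding M_def by (intro holomorphic_intros hk) (use k0 in auto)
  have "(M has_field_derivative 0) (at t)"
  proof -
    have "(M has_field_derivative (poly (pderiv P) t * (k t)\<^sup>2 - poly P t * (2 * k t * deriv k t)) / ((k t)\<^sup>2 * (k t)\<^sup>2)) (at t)"
      unfolding M_def by (rule derivative_eq_intros dk[OF t_ball] poly_DERIV refl | use k0[OF t_ball] in simp)+
    moreover have "poly (pderiv P) t * (k t)\<^sup>2 - poly P t * (2 * k t * deriv k t) = 0"
      using ode_t by algebra
    ultimately show ?thesis by simp
  qed
  then have M't: "deriv M t = 0" by (rule DERIV_imp_deriv)
  \<comment> \<open>Two successive divided differences. Since M has derivative 0 at t, dividing
    twice by w - t leaves a holomorphic remainder and only the double pole in front of it.\<close>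
  define M1 where "M1 = (\<lambda>w. if w = t then deriv M t else (M w - M t) / (w - t))"
  have hM1: "M1 holomorphic_on ball t r" unfolding M1_def by (rule pole_lemma_open[OF hM open_ball])
  define h where "h = (\<lambda>w. if w = t then deriv M1 t else (M1 w - M1 t) / (w - t))"
  have hh: "h holomorphic_on ball t r" unfolding h_def by (rule pole_lemma_open[OF hM1 open_ball])
  show "\<exists>\<epsilon>>0. \<exists>h. h holomorphic_on ball t \<epsilon> \<and> (\<forall>w\<in>ball t \<epsilon> - {t}. g w \<noteq> 0 \<and>
           poly P w / (g w)\<^sup>2 = (poly P t / (deriv g t)\<^sup>2) / (w - t)\<^sup>2 + h w)"
  proof (intro exI[of _ r] exI[of _ h] conjI r hh ballI)
    fix w assume w: "w \<in> ball t r - {t}"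
    then have wt: "w - t \<noteq> 0" "w \<in> ball t r" by auto
    show "g w \<noteq> 0" using gk[OF wt(2)] wt k0[OF wt(2)] by simp
    have "h w = (M w - M t) / (w - t)\<^sup>2" using w by (simp add: h_def M1_def M't power2_eq_square)
    then have "M t / (w - t)\<^sup>2 + h w = M w / (w - t)\<^sup>2" by (simp add: diff_divide_distrib)
    moreover have "poly P w / (g w)\<^sup>2 = M w / (w - t)\<^sup>2" using gk[OF wt(2)] n1 by (simp add: M_def power_mult_distrib)
    ultimately show "poly P w / (g w)\<^sup>2 = (poly P t / (deriv g t)\<^sup>2) / (w - t)\<^sup>2 + h w" by (simp add: M_def gt)
  qed
qed

end

section \<open>Discs and circles near infinity\<close>

context stokes
begin

text \<open>Relative to the centre, w is multiplied by 1 + x, so s moves by Ln (1 + x). The passage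
  to the logarithmic coordinate therefore distorts discs only by the quadratic error of the
  logarithm.\<close>

lemma disc_log:
  assumes w: "norm (w - (d + ray \<theta> s0)) \<le> exp (Re s0) / 2"
  obtains s where "w = d + ray \<theta> s" "norm (s - s0 - (w - (d + ray \<theta> s0)) / ray \<theta> s0) \<le> 2 * (norm (w - (d + ray \<theta> s0)) / exp (Re s0))\<^sup>2"
proof -
  define x where "x = (w - (d + ray \<theta> s0)) / ray \<theta> s0"
  have nx: "norm x = norm (w - (d + ray \<theta> s0)) / exp (Re s0)" by (simp add: x_def norm_divide)
  have x2: "norm x \<le> 1/2" using w by (simp add: nx field_simps)
  have x1: "1 + x \<noteq> 0"
  proof
    assume "1 + x = 0"
    then have "x = -1" by (simp add: eq_neg_iff_add_eq_0 add.commute)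
    then show False using x2 by simp
  qed
  have "ray \<theta> (s0 + Ln (1 + x)) = ray \<theta> s0 * (1 + x)"
    unfolding ray_def using x1 by (simp add: exp_add mult.assoc)
  also have "\<dots> = w - d" by (simp add: x_def field_simps)
  finally have "w = d + ray \<theta> (s0 + Ln (1 + x))" by simp
  moreover have "norm (Ln (1 + x) - x) \<le> 2 * (norm x)\<^sup>2"
  proof -
    have "norm (Ln (1 + x) - x) \<le> (norm x)\<^sup>2 / (1 - norm x)" using x2 by (intro Ln_approx_linear) simp
    also have "\<dots> \<le> (norm x)\<^sup>2 / (1/2)" using x2 by (intro divide_left_mono mult_pos_pos) auto
    finally show ?thesis by simp
  qed
  ultimately show ?thesis using that[of "s0 + Ln (1 + x)"] unfolding nx[symmetric] x_def[symmetric] by simp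
qed

text \<open>The nearest ray is found by rounding; neighbouring rays are pi/\<mu> apart. The
  principal argument of z - d keeps k in an explicit finite range, so that ray-wise statements can
  be combined by finite unions and sums.\<close>

lemma ray_cover:
  assumes "z \<noteq> d"
  obtains k s where "k \<in> {- (int N + 4)..int N + 4}" "z = d + ray (stokes_angle N b k) s" "\<bar>Im s\<bar> \<le> pi / (2 * \<mu>)"
proof -
  define t where "t = Arg (z - d)"
  define x where "x = (t * (real N + 2) + Arg b) / (2 * pi)"
  define k where "k = round x"
  have tb: "- pi < t" "t \<le> pi" unfolding t_def using mpi_less_Arg Arg_le_pi by auto
  have xk: "\<bar>of_int k - x\<bar> \<le> 1 / 2" unfolding k_def by (rule of_int_round_abs_le)
  have "\<bar>t\<bar> \<le> pi" using tb by linarith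
  then have "\<bar>t * (real N + 2)\<bar> \<le> pi * (real N + 2)" by (simp add: abs_mult mult_right_mono)
  moreover have "\<bar>Arg b\<bar> \<le> pi" using mpi_less_Arg[of b] Arg_le_pi[of b] by linarith
  ultimately have "\<bar>t * (real N + 2) + Arg b\<bar> \<le> pi * (real N + 3)" unfolding distrib_left by linarith
  then have "\<bar>x\<bar> \<le> pi * (real N + 3) / (2 * pi)" unfolding x_def abs_divide by (intro frac_le) auto
  then have "\<bar>x\<bar> \<le> (real N + 3) / 2" by simp
  then have "- (real N + 3) \<le> of_int k" "of_int k \<le> real N + 3"
    using xk of_nat_0_le_iff[where 'a = real, of N] unfolding abs_le_iff add_divide_distrib by linarith+
  then have kN: "k \<in> {- (int N + 4)..int N + 4}" by auto
  have x2: "2 * pi * x = t * (real N + 2) + Arg b" by (simp add: x_def)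
  have N2: "real N + 2 \<noteq> 0" using of_nat_0_le_iff[where 'a = real, of N] by linarith
  have "t - stokes_angle N b k = (t * (real N + 2) - (2 * pi * of_int k - Arg b)) / (real N + 2)"
    unfolding stokes_angle_def diff_divide_distrib[of "t * (real N + 2)"] using N2 by simp
  also have "t * (real N + 2) - (2 * pi * of_int k - Arg b) = 2 * pi * (x - of_int k)"
    unfolding right_diff_distrib x2 by simp
  also have "2 * pi * (x - of_int k) / (real N + 2) = 2 * pi / (real N + 2) * (x - of_int k)" by simp
  finally have "\<bar>t - stokes_angle N b k\<bar> = 2 * pi / (real N + 2) * \<bar>x - of_int k\<bar>" by (simp add: abs_mult)
  also have "\<dots> \<le> 2 * pi / (real N + 2) * (1/2)" using xk by (intro mult_left_mono) (auto simp: abs_minus_commute)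
  finally have "\<bar>t - stokes_angle N b k\<bar> \<le> pi / (2 * \<mu>)" by (simp add: mu_N)
  moreover have "is_Arg (z - d) t" unfolding t_def is_Arg_def using assms by (intro Arg_eq) simp
  ultimately show ?thesis by (intro that[OF kN ray_of_Arg[OF assms]]) auto
qed

end

context stokes_ray
begin

lemma quotient_eq:
  assumes s: "Re s > \<rho>0"
  shows "poly P (d + ray \<theta> s) / (g (d + ray \<theta> s))\<^sup>2 = H s / (exp s * (u s)\<^sup>2)"
proof -
  have "poly P (d + ray \<theta> s) = (A s)\<^sup>2 * H s / exp s" using AH[OF s] by simp
  then show ?thesis using A_nz[OF s] by (simp add: gA[OF s] power_mult_distrib)
qed

lemma norm_quotient:
  assumes s: "Re s > \<rho>0"
  shows "norm (poly P (d + ray \<theta> s) / (g (d + ray \<theta> s))\<^sup>2) = norm (H s) * exp (- Re s) / (norm (u s))\<^sup>2"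
  unfolding quotient_eq[OF s] by (simp add: norm_divide norm_mult norm_power norm_inverse exp_minus divide_inverse)

text \<open>Formally the derivative of g = A u at a zero of u, squared and multiplied by H. Here A
  is controlled only through the continuous function A^2 H, so the identity is obtained as a limit
  of squared difference quotients.\<close>

lemma residue_at_zero:
  assumes s: "Re s > \<rho>0" "u s = 0"
  shows "(deriv g (d + ray \<theta> s) * ray \<theta> s)\<^sup>2 * H s = exp s * poly P (d + ray \<theta> s) * (H s * V s)\<^sup>2"
proof -
  define \<Omega> where "\<Omega> = {s. Re s > \<rho>0}"
  have o: "open \<Omega>" unfolding \<Omega>_def by (simp add: open_halfspace_Re_gt)
  have "\<Phi> holomorphic_on \<Omega>" unfolding holomorphic_on_open[OF o] using w.dPhi \<Omega>_def by blast
  then have "deriv \<Phi> holomorphic_on \<Omega>" using o by (rule holomorphic_deriv)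
  then have "H holomorphic_on \<Omega>" by (rule holomorphic_transform) (use w.dPhi \<Omega>_def in \<open>auto intro: DERIV_imp_deriv\<close>)
  moreover have "s \<in> \<Omega>" using s by (simp add: \<Omega>_def)
  ultimately obtain H' where "(H has_field_derivative H') (at s)" unfolding holomorphic_on_open[OF o] by blast
  then have Hc: "(H \<longlongrightarrow> H s) (at s)" by (rule DERIV_isCont[unfolded isCont_def])
  have gz: "g (d + ray \<theta> s) = 0" using gA[OF s(1)] s by simp
  have "((\<lambda>s. g (d + ray \<theta> s)) has_field_derivative deriv g (d + ray \<theta> s) * ray \<theta> s) (at s)"
    by (rule DERIV_chain2[OF d_g(1)]) (auto intro!: derivative_eq_intros d_ray)
  then have lg: "((\<lambda>y. g (d + ray \<theta> y) / (y - s)) \<longlongrightarrow> deriv g (d + ray \<theta> s) * ray \<theta> s) (at s)"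
    unfolding has_field_derivative_iff gz diff_zero .
  have lu: "((\<lambda>y. u y / (y - s)) \<longlongrightarrow> H s * V s) (at s)"
    using w.du[OF s(1)] unfolding has_field_derivative_iff s(2) diff_zero .
  have rc: "((\<lambda>y. d + ray \<theta> y) \<longlongrightarrow> d + ray \<theta> s) (at s)"
    by (intro tendsto_add tendsto_const DERIV_isCont[OF d_ray, unfolded isCont_def])
  have 1: "((\<lambda>y. (g (d + ray \<theta> y) / (y - s))\<^sup>2 * H y) \<longlongrightarrow> (deriv g (d + ray \<theta> s) * ray \<theta> s)\<^sup>2 * H s) (at s)"
    by (intro tendsto_mult tendsto_power lg Hc)
  have 2: "((\<lambda>y. exp y * poly P (d + ray \<theta> y) * (u y / (y - s))\<^sup>2) \<longlongrightarrow> exp s * poly P (d + ray \<theta> s) * (H s * V s)\<^sup>2) (at s)"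
    by (intro tendsto_mult tendsto_power tendsto_exp tendsto_ident_at lu tendsto_poly rc)
  have "\<forall>\<^sub>F y in at s. y \<in> \<Omega>" using o s \<Omega>_def by (intro eventually_at_in_open') auto
  then have "\<forall>\<^sub>F y in at s. exp y * poly P (d + ray \<theta> y) * (u y / (y - s))\<^sup>2 = (g (d + ray \<theta> y) / (y - s))\<^sup>2 * H y"
  proof eventually_elim
    case (elim y)
    then have y: "Re y > \<rho>0" by (simp add: \<Omega>_def)
    have "exp y * poly P (d + ray \<theta> y) * (u y / (y - s))\<^sup>2 = (A y)\<^sup>2 * H y * (u y / (y - s))\<^sup>2" by (simp only: AH[OF y])
    also have "\<dots> = (A y * u y / (y - s))\<^sup>2 * H y" by (simp add: power2_eq_square)
    finally show ?case by (simp only: gA[OF y])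
  qed
  from Lim_transform_eventually[OF 2 this] have "((\<lambda>y. (g (d + ray \<theta> y) / (y - s))\<^sup>2 * H y) \<longlongrightarrow> exp s * poly P (d + ray \<theta> s) * (H s * V s)\<^sup>2) (at s)" .
  then show ?thesis using 1 by (rule tendsto_unique[OF at_neq_bot, rotated])
qed

lemma norm_residue:
  assumes s: "Re s > \<rho>0" "u s = 0" and V: "V s \<noteq> 0"
  shows "norm (poly P (d + ray \<theta> s) / (deriv g (d + ray \<theta> s))\<^sup>2) = exp (Re s) / (norm (H s) * (norm (V s))\<^sup>2)"
proof -
  have dg: "deriv g (d + ray \<theta> s) \<noteq> 0" by (rule double_pole(1)) (simp add: gA[OF s(1)] s)
  have E: "(norm (deriv g (d + ray \<theta> s)))\<^sup>2 * (exp (Re s) * exp (Re s)) * norm (H s) = exp (Re s) * norm (poly P (d + ray \<theta> s)) * ((norm (H s))\<^sup>2 * (norm (V s))\<^sup>2)"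
    using arg_cong[OF residue_at_zero[OF s], of norm] by (simp add: norm_mult norm_power power_mult_distrib power2_eq_square mult_ac)
  have alg: "p / x = e / (h * v)" if "x * (e * e) * h = e * p * (h\<^sup>2 * v)" "x \<noteq> 0" "e \<noteq> 0" "h \<noteq> 0" "v \<noteq> 0" for p x e h v :: real
  proof -
    have "(e * h) * (x * e) = (e * h) * (p * (h * v))" using that(1) by (simp add: power2_eq_square mult_ac)
    then have "x * e = p * (h * v)" using that by simp
    then show ?thesis using that by (simp add: divide_simps mult_ac)
  qed
  show ?thesis unfolding norm_divide norm_power
    by (rule alg[OF E]) (use dg V H_nz[OF s(1)] in auto)
qed

text \<open>The double-pole coefficient has modulus exp(Re s) / (|H| |V|^2) with V bounded below at
  zeros. Divided by |z|^2 it is O(exp(- (1 + \<mu>) Re s)), the quantity of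
  \<open>zeros_summable\<close>.\<close>

lemma zeros_residue_summable:
  assumes "w.left_lim L" "L \<noteq> 0" "w.right_lim R" "R \<noteq> 0"
  obtains \<rho>1 where "(\<lambda>z. norm (poly P z / (deriv g z)\<^sup>2) / (norm z)\<^sup>2) summable_on
     {z. g z = 0 \<and> (\<exists>s. z = d + ray \<theta> s \<and> \<rho>1 \<le> Re s \<and> \<bar>Im s\<bar> \<le> pi / (2 * \<mu>))}"
proof -
  obtain l c0 where l: "l \<noteq> 0" and cl: "cosine_like (\<lambda>s. u s / l) (\<lambda>s. V s / l) H (\<lambda>s. \<Phi> s + c0) \<rho>0 \<mu> \<kappa>"
    by (rule w.cosine_like[OF assms])
  interpret c: cosine_like "\<lambda>s. u s / l" "\<lambda>s. V s / l" H "\<lambda>s. \<Phi> s + c0" \<rho>0 \<mu> \<kappa> by (rule cl)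
  obtain r1 where r1: "r1 > \<rho>0" and sm: "(\<lambda>s. exp (- ((1 + \<mu>) * Re s))) summable_on {s. r1 \<le> Re s \<and> \<bar>Im s\<bar> \<le> 2 * pi / (3 * \<mu>) \<and> u s / l = 0}"
    by (rule c.zeros_summable) (rule that, assumption+)
  obtain r2 where r2: "r2 > \<rho>0" and V2: "\<And>s. r2 \<le> Re s \<Longrightarrow> \<bar>Im s\<bar> \<le> 2 * pi / (3 * \<mu>) \<Longrightarrow> u s / l = 0 \<Longrightarrow> 1/2 \<le> norm (V s / l)"
    by (rule c.zeros[of "1/40"]) (simp, simp, rule that, assumption+)
  obtain r3 where r3: "r3 > \<rho>0" and H3: "\<And>s. r3 \<le> Re s \<Longrightarrow> norm (H s) \<ge> \<kappa> / 2 * exp (\<mu> * Re s)"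
    using w.norm_H by metis
  define \<rho>1 where "\<rho>1 = max (max r1 r2) (max r3 (ln (2 * norm d + 1)))"
  define Z where "Z = {s. \<rho>1 \<le> Re s \<and> \<bar>Im s\<bar> \<le> pi / (2 * \<mu>) \<and> u s = 0}"
  \<comment> \<open>32 = 2 * 4 * 4, from |H| \<ge> \<kappa>/2 exp(\<mu> Re s), |V| \<ge> |l|/2 and
    |z| \<ge> exp(Re s)/2.\<close>
  define K where "K = 32 / (\<kappa> * (norm l)\<^sup>2)"
  have "pi / (2 * \<mu>) \<le> 2 * pi / (3 * \<mu>)" using mu_ge by (simp add: field_simps)
  then have Zsub: "Z \<subseteq> {s. r1 \<le> Re s \<and> \<bar>Im s\<bar> \<le> 2 * pi / (3 * \<mu>) \<and> u s / l = 0}"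
    by (auto simp: Z_def \<rho>1_def)
  let ?f = "\<lambda>z. norm (poly P z / (deriv g z)\<^sup>2) / (norm z)\<^sup>2"
  have bnd: "?f (d + ray \<theta> s) \<le> K * exp (- ((1 + \<mu>) * Re s))" if s: "s \<in> Z" for s
  proof -
    have rs: "r1 \<le> Re s" "r2 \<le> Re s" "r3 \<le> Re s" "ln (2 * norm d + 1) \<le> Re s" "u s / l = 0" "\<bar>Im s\<bar> \<le> 2 * pi / (3 * \<mu>)"
      using s Zsub by (auto simp: Z_def \<rho>1_def)
    have s0: "Re s > \<rho>0" "u s = 0" using rs r1 l by auto
    have V: "norm l / 2 \<le> norm (V s)" using V2[OF rs(2,6,5)] l by (simp add: norm_divide field_simps)
    have l0: "norm l > 0" using l by simp
    have V0: "V s \<noteq> 0" using V l0 by (metis half_gt_zero_iff norm_zero not_le)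
    have HV: "\<kappa> / 2 * exp (\<mu> * Re s) * (norm l / 2)\<^sup>2 \<le> norm (H s) * (norm (V s))\<^sup>2"
      using H3[OF rs(3)] V l0 kappa_pos by (intro mult_mono power_mono) auto
    have "?f (d + ray \<theta> s) = exp (Re s) / (norm (H s) * (norm (V s))\<^sup>2) / (norm (d + ray \<theta> s))\<^sup>2"
      by (simp only: norm_residue[OF s0 V0])
    also have "\<dots> \<le> exp (Re s) / (\<kappa> / 2 * exp (\<mu> * Re s) * (norm l / 2)\<^sup>2) / (exp (Re s) / 2)\<^sup>2"
    proof (rule frac_le)
      show "exp (Re s) / (norm (H s) * (norm (V s))\<^sup>2) \<le> exp (Re s) / (\<kappa> / 2 * exp (\<mu> * Re s) * (norm l / 2)\<^sup>2)"
        by (rule divide_left_mono[OF HV]) (use HV kappa_pos l0 V0 H_nz[OF s0(1)] in auto)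
      have "2 * norm d + 1 \<le> exp (Re s)" using rs(4) norm_ge_zero[of d]
        by (metis exp_le_cancel_iff exp_ln add_nonneg_pos mult_nonneg_nonneg zero_le_numeral zero_less_one)
      moreover have "exp (Re s) \<le> norm (d + ray \<theta> s) + norm d" using norm_triangle_ineq4[of "d + ray \<theta> s" d] by simp
      ultimately have "exp (Re s) / 2 \<le> norm (d + ray \<theta> s)" by linarith
      then show "(exp (Re s) / 2)\<^sup>2 \<le> (norm (d + ray \<theta> s))\<^sup>2" by (rule power_mono) simp
    qed (use kappa_pos l0 in auto)
    also have "\<dots> = K * (exp (Re s) / (exp (\<mu> * Re s) * (exp (Re s))\<^sup>2))"
      using kappa_pos l0 by (simp add: K_def power_divide)
    also have "exp (Re s) / (exp (\<mu> * Re s) * (exp (Re s))\<^sup>2) = exp (Re s - (\<mu> * Re s + (Re s + Re s)))"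
      by (simp only: power2_eq_square exp_add exp_diff)
    also have "Re s - (\<mu> * Re s + (Re s + Re s)) = - ((1 + \<mu>) * Re s)" by (simp add: algebra_simps)
    finally show ?thesis .
  qed
  define U where "U = {z. g z = 0 \<and> (\<exists>s. z = d + ray \<theta> s \<and> \<rho>1 \<le> Re s \<and> \<bar>Im s\<bar> \<le> pi / (2 * \<mu>))}"
  have "U \<subseteq> (\<lambda>s. d + ray \<theta> s) ` Z"
  proof
    fix z assume "z \<in> U"
    then obtain s where s: "g z = 0" "z = d + ray \<theta> s" "\<rho>1 \<le> Re s" "\<bar>Im s\<bar> \<le> pi / (2 * \<mu>)" by (auto simp: U_def)
    have "Re s > \<rho>0" using s(3) r1 by (simp add: \<rho>1_def)
    then have "u s = 0" using gA[of s] s A_nz[of s] by simp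
    then show "z \<in> (\<lambda>s. d + ray \<theta> s) ` Z" using s by (auto simp: Z_def)
  qed
  \<comment> \<open>One coordinate is selected for each zero, which gives an injective
    parametrisation without comparing coordinates.\<close>
  then obtain Z' where Z': "Z' \<subseteq> Z" "inj_on (\<lambda>s. d + ray \<theta> s) Z'" "U = (\<lambda>s. d + ray \<theta> s) ` Z'"
    unfolding subset_image_inj by blast
  have "(\<lambda>s. K * exp (- ((1 + \<mu>) * Re s))) summable_on Z'"
    using summable_on_subset_banach[OF sm] Zsub Z'(1) by (intro summable_on_cmult_right) blast
  then have "(?f \<circ> (\<lambda>s. d + ray \<theta> s)) summable_on Z'"
    by (rule summable_on_comparison_test) (use bnd Z'(1) in auto)
  then have "?f summable_on U" unfolding Z'(3) by (simp only: summable_on_reindex[OF Z'(2)])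
  then show ?thesis unfolding U_def by (rule that)
qed

text \<open>\<open>circle_lower\<close> provides a circle in the s-plane, of radius 1/10 or 1/2
  divided by |H|, on which \<open>u\<close> is bounded below; the factor exp(Re s0) converts it to
  the z-plane. Any power of |z - d| is good enough, and N + 2 is a natural exponent above
  \<mu>.\<close>

lemma good_circle:
  assumes "w.left_lim L" "L \<noteq> 0" "w.right_lim R" "R \<noteq> 0"
  obtains \<rho>1 K where "K > 0" "\<And>s0. \<rho>1 \<le> Re s0 \<Longrightarrow> \<bar>Im s0\<bar> \<le> pi / (2 * \<mu>) \<Longrightarrow>
    \<exists>r>0. 1 / (K * exp (Re s0) ^ (N + 2)) \<le> r \<and> (\<forall>w. norm (w - (d + ray \<theta> s0)) = r \<longrightarrow>
       g w \<noteq> 0 \<and> norm (poly P w / (g w)\<^sup>2) \<le> K * exp (Re s0) ^ (N + 2))"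
proof -
  obtain l c0 where l: "l \<noteq> 0" and cl: "cosine_like (\<lambda>s. u s / l) (\<lambda>s. V s / l) H (\<lambda>s. \<Phi> s + c0) \<rho>0 \<mu> \<kappa>"
    by (rule w.cosine_like[OF assms])
  interpret c: cosine_like "\<lambda>s. u s / l" "\<lambda>s. V s / l" H "\<lambda>s. \<Phi> s + c0" \<rho>0 \<mu> \<kappa> by (rule cl)
  obtain r1 c1 where r1: "r1 > \<rho>0" and c1: "c1 > 0"
    and low: "\<And>s0. r1 \<le> Re s0 \<Longrightarrow> \<bar>Im s0\<bar> \<le> pi / (2 * \<mu>) \<Longrightarrow>
       \<exists>r\<in>{1/10, 1/2}. \<forall>s. 24/25 * r \<le> norm (H s0) * norm (s - s0) \<longrightarrow> norm (H s0) * norm (s - s0) \<le> 26/25 * r \<longrightarrow> c1 \<le> norm (u s / l)"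
    by (rule c.circle_lower) (rule that, assumption+)
  obtain r3 where r3: "r3 > \<rho>0" and H3: "\<And>s. r3 \<le> Re s \<Longrightarrow> norm (H s) \<ge> \<kappa> / 2 * exp (\<mu> * Re s)"
    and H4: "\<And>s. r3 \<le> Re s \<Longrightarrow> norm (H s) \<le> 2 * \<kappa> * exp (\<mu> * Re s)"
    using w.norm_H by metis
  have l0: "norm l > 0" using l by simp
  define K1 where "K1 = 2 * \<kappa> * exp \<mu> / (c1 * norm l)\<^sup>2"
  have K1: "K1 > 0" using kappa_pos c1 l0 by (simp add: K1_def)
  define K where "K = max (20 * \<kappa>) K1"
  define \<rho>1 where "\<rho>1 = max (max r1 r3) (max 0 (ln (50 / \<kappa>))) + 1"
  show ?thesis
  proof (rule that[of K \<rho>1])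
    show "K > 0" using K1 by (simp add: K_def)
    fix s0 assume s0: "\<rho>1 \<le> Re s0" "\<bar>Im s0\<bar> \<le> pi / (2 * \<mu>)"
    have rs: "r1 \<le> Re s0" "r3 \<le> Re s0 - 1" "r3 \<le> Re s0" "1 \<le> Re s0" "ln (50 / \<kappa>) \<le> Re s0" using s0(1) by (auto simp: \<rho>1_def)
    have muRe: "Re s0 \<le> \<mu> * Re s0" using mult_right_mono[OF mu_ge, of "Re s0"] rs(4) by simp
    have "50 / \<kappa> \<le> exp (\<mu> * Re s0)"
    proof -
      have "50 / \<kappa> = exp (ln (50 / \<kappa>))" using kappa_pos by simp
      also have "\<dots> \<le> exp (\<mu> * Re s0)" unfolding exp_le_cancel_iff using rs(5) muRe by linarith
      finally show ?thesis .
    qed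
    then have "25 \<le> \<kappa> / 2 * exp (\<mu> * Re s0)" using kappa_pos by (simp add: field_simps)
    \<comment> \<open>This makes the relative radius \<open>q\<close> at most 1/50, so the
      distortion 2 q^2 is at most q/25, the slack that \<open>circle_lower\<close> provides.\<close>
    then have H25: "25 \<le> norm (H s0)" using H3[OF rs(3)] by linarith
    obtain r' where r': "r' \<in> {1/10, 1/2 :: real}"
      and lo: "\<And>s. 24/25 * r' \<le> norm (H s0) * norm (s - s0) \<Longrightarrow> norm (H s0) * norm (s - s0) \<le> 26/25 * r' \<Longrightarrow> c1 \<le> norm (u s / l)"
      using low[OF rs(1) s0(2)] by blast
    have rb: "1/10 \<le> r'" "r' \<le> 1/2" using r' by auto
    define r where "r = r' * exp (Re s0) / norm (H s0)"
    have Hp: "norm (H s0) > 0" using H25 by linarith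
    have e1: "1 \<le> exp (Re s0)" using rs(4) by (simp only: one_le_exp_iff)
    have pw: "exp (\<mu> * Re s0) \<le> exp (Re s0) ^ (N + 2)"
    proof -
      have "exp (\<mu> * Re s0) \<le> exp (real (N + 2) * Re s0)" unfolding exp_le_cancel_iff
        using rs(4) by (intro mult_right_mono) (auto simp: \<mu>_def)
      then show ?thesis by (simp only: exp_of_nat_mult)
    qed
    have rpos: "r > 0" using rb Hp by (simp add: r_def)
    have rlow: "1 / (K * exp (Re s0) ^ (N + 2)) \<le> r"
    proof -
      have "1 / (K * exp (Re s0) ^ (N + 2)) \<le> 1 / (20 * \<kappa> * exp (\<mu> * Re s0))"
        using kappa_pos pw by (intro divide_left_mono mult_mono mult_pos_pos) (auto simp: K_def)
      also have "\<dots> = 1/10 * 1 / (2 * \<kappa> * exp (\<mu> * Re s0))" by simp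
      also have "\<dots> \<le> r" unfolding r_def using rb e1 H4[OF rs(3)] Hp by (intro frac_le mult_mono) auto
      finally show ?thesis .
    qed
    have main: "g w \<noteq> 0 \<and> norm (poly P w / (g w)\<^sup>2) \<le> K * exp (Re s0) ^ (N + 2)" if w: "norm (w - (d + ray \<theta> s0)) = r" for w
    proof -
      define q where "q = norm (w - (d + ray \<theta> s0)) / exp (Re s0)"
      have q: "q = r' / norm (H s0)" by (simp add: q_def w r_def)
      have q50: "q \<le> 1/50" unfolding q using frac_le[of "1/2" r' 25 "norm (H s0)"] rb H25 by simp
      have q0: "q \<ge> 0" by (simp add: q_def)
      have "norm (w - (d + ray \<theta> s0)) = q * exp (Re s0)" by (simp add: q_def)
      also have "\<dots> \<le> 1/2 * exp (Re s0)" using q50 by (intro mult_right_mono) auto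
      finally have "norm (w - (d + ray \<theta> s0)) \<le> exp (Re s0) / 2" by simp
      then obtain s where s: "w = d + ray \<theta> s" "norm (s - s0 - (w - (d + ray \<theta> s0)) / ray \<theta> s0) \<le> 2 * q\<^sup>2"
        unfolding q_def by (rule disc_log)
      have nq: "norm ((w - (d + ray \<theta> s0)) / ray \<theta> s0) = q" by (simp add: q_def norm_divide)
      have q2: "2 * q\<^sup>2 \<le> q / 25" using mult_left_mono[OF q50 q0] by (simp add: power2_eq_square)
      have up: "norm (s - s0) \<le> q + q / 25" and dn: "q - q / 25 \<le> norm (s - s0)"
        using norm_triangle_ineq2[of "s - s0" "(w - (d + ray \<theta> s0)) / ray \<theta> s0"]
          norm_triangle_ineq3[of "s - s0" "(w - (d + ray \<theta> s0)) / ray \<theta> s0"] s(2) q2 nq by linarith+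
      have Hq: "norm (H s0) * q = r'" using Hp by (simp add: q)
      have "norm (H s0) * (q - q / 25) \<le> norm (H s0) * norm (s - s0)" by (rule mult_left_mono[OF dn]) simp
      then have b1: "24/25 * r' \<le> norm (H s0) * norm (s - s0)" using Hq by (simp add: algebra_simps)
      have "norm (H s0) * norm (s - s0) \<le> norm (H s0) * (q + q / 25)" by (rule mult_left_mono[OF up]) simp
      then have b2: "norm (H s0) * norm (s - s0) \<le> 26/25 * r'" using Hq by (simp add: algebra_simps)
      have ul: "c1 * norm l \<le> norm (u s)" using lo[OF b1 b2] l0 by (simp add: norm_divide field_simps)
      have "norm (s - s0) \<le> 1" using up q50 by linarith
      then have Re1: "\<bar>Re s - Re s0\<bar> \<le> 1" using abs_Re_le_cmod[of "s - s0"] by simp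
      have Rs: "r3 \<le> Re s" "0 \<le> Re s" "Re s \<le> Re s0 + 1" using Re1 rs by linarith+
      have R0: "Re s > \<rho>0" using Rs r3 by linarith
      have cl0: "c1 * norm l > 0" using c1 l0 by simp
      have "u s \<noteq> 0" using ul cl0 by auto
      then have "g w \<noteq> 0" unfolding s(1) gA[OF R0] using A_nz[OF R0] by simp
      moreover have "norm (poly P w / (g w)\<^sup>2) \<le> K * exp (Re s0) ^ (N + 2)"
      proof -
        have mm: "\<mu> * Re s \<le> \<mu> * Re s0 + \<mu>" using mult_left_mono[OF Rs(3), of \<mu>] mu_ge by (simp add: distrib_left)
        have "norm (poly P w / (g w)\<^sup>2) = norm (H s) * exp (- Re s) / (norm (u s))\<^sup>2" unfolding s(1) by (rule norm_quotient[OF R0])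
        also have "\<dots> \<le> (2 * \<kappa> * exp (\<mu> * Re s0 + \<mu>)) * 1 / (c1 * norm l)\<^sup>2"
        proof (rule frac_le)
          have "norm (H s) \<le> 2 * \<kappa> * exp (\<mu> * Re s0 + \<mu>)"
            using H4[OF Rs(1)] kappa_pos mm by (auto intro: order_trans mult_left_mono)
          then show "norm (H s) * exp (- Re s) \<le> 2 * \<kappa> * exp (\<mu> * Re s0 + \<mu>) * 1"
            using Rs(2) kappa_pos by (intro mult_mono) auto
          show "(c1 * norm l)\<^sup>2 \<le> (norm (u s))\<^sup>2" using ul cl0 by (intro power_mono) auto
        qed (use kappa_pos cl0 in auto)
        also have "\<dots> = K1 * exp (\<mu> * Re s0)" by (simp add: K1_def exp_add)
        also have "\<dots> \<le> K * exp (Re s0) ^ (N + 2)" using pw K1 by (intro mult_mono) (auto simp: K_def)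
        finally show ?thesis .
      qed
      ultimately show ?thesis ..
    qed
    show "\<exists>r>0. 1 / (K * exp (Re s0) ^ (N + 2)) \<le> r \<and> (\<forall>w. norm (w - (d + ray \<theta> s0)) = r \<longrightarrow>
       g w \<noteq> 0 \<and> norm (poly P w / (g w)\<^sup>2) \<le> K * exp (Re s0) ^ (N + 2))"
      using rpos rlow main by blast
  qed
qed

text \<open>Discs with radius a fixed multiple of the distance from d become subsets of a strip: the
  coordinate moves by at most twice the relative radius. Around the middle line of a sector they
  thus stay in its inner half.\<close>

lemma centre_disc:
  assumes w: "norm (w - (d + ray \<theta> (Complex \<rho> \<tau>))) \<le> pi / (8 * \<mu>) * exp \<rho>"
  obtains s where "w = d + ray \<theta> s" "\<rho> - 1 \<le> Re s" "\<bar>Im s - \<tau>\<bar> \<le> pi / (4 * \<mu>)"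
proof -
  define q where "q = norm (w - (d + ray \<theta> (Complex \<rho> \<tau>))) / exp \<rho>"
  have q: "q \<le> pi / (8 * \<mu>)" using w by (simp add: q_def field_simps)
  have "pi / (8 * \<mu>) \<le> 4 / (8 * 1)" using pi_less_4 mu_ge by (intro frac_le) auto
  then have q2: "q \<le> 1/2" using q by linarith
  have q0: "q \<ge> 0" by (simp add: q_def)
  have "norm (w - (d + ray \<theta> (Complex \<rho> \<tau>))) \<le> exp (Re (Complex \<rho> \<tau>)) / 2" using q2 by (simp add: q_def field_simps)
  then obtain s where s: "w = d + ray \<theta> s" "norm (s - Complex \<rho> \<tau> - (w - (d + ray \<theta> (Complex \<rho> \<tau>))) / ray \<theta> (Complex \<rho> \<tau>)) \<le> 2 * q\<^sup>2"
    unfolding q_def by (rule disc_log[unfolded complex.sel]) simp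
  have nq: "norm ((w - (d + ray \<theta> (Complex \<rho> \<tau>))) / ray \<theta> (Complex \<rho> \<tau>)) = q" by (simp add: q_def norm_divide)
  have "2 * q\<^sup>2 \<le> q" using mult_left_mono[OF q2 q0] by (simp add: power2_eq_square)
  then have n: "norm (s - Complex \<rho> \<tau>) \<le> 2 * q"
    using norm_triangle_ineq2[of "s - Complex \<rho> \<tau>" "(w - (d + ray \<theta> (Complex \<rho> \<tau>))) / ray \<theta> (Complex \<rho> \<tau>)"] s(2) nq by linarith
  have "\<bar>Re s - \<rho>\<bar> \<le> 2 * q" "\<bar>Im s - \<tau>\<bar> \<le> 2 * q"
    using abs_Re_le_cmod[of "s - Complex \<rho> \<tau>"] abs_Im_le_cmod[of "s - Complex \<rho> \<tau>"] n by auto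
  moreover have "2 * q \<le> pi / (4 * \<mu>)" using q by simp
  ultimately show ?thesis using q2 by (intro that[OF s(1)]) linarith+
qed

lemma right_disc:
  assumes R: "w.right_lim R" "R \<noteq> 0" and e: "e > 0"
  shows "\<forall>\<^sub>F \<rho> in at_top. \<forall>w. norm (w - (d + ray \<theta> (Complex \<rho> (pi / (2 * \<mu>))))) \<le> pi / (8 * \<mu>) * exp \<rho> \<longrightarrow>
     g w \<noteq> 0 \<and> norm (poly P w / (g w)\<^sup>2) \<le> e"
proof -
  have m: "\<mu> > 0" using mu_ge by simp
  define \<delta> where "\<delta> = pi / (4 * \<mu>)"
  have d: "0 < \<delta>" "\<delta> \<le> pi / (2 * \<mu>)" using m by (auto simp: \<delta>_def field_simps)
  obtain r2 k k' where r2: "\<rho>0 < r2" "k > 0" "k' > 0"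
    and lo: "\<And>s. r2 \<le> Re s \<Longrightarrow> \<delta> \<le> Im s \<Longrightarrow> Im s \<le> pi / \<mu> - \<delta> \<Longrightarrow> norm (u s) \<ge> k * exp (k' * exp (\<mu> * Re s))"
    by (rule w.right_dominant[OF R d]) (rule that, assumption+)
  obtain r3 where r3: "r3 > \<rho>0" and H4: "\<And>s. r3 \<le> Re s \<Longrightarrow> norm (H s) \<le> 2 * \<kappa> * exp (\<mu> * Re s)"
    using w.norm_H by metis
  define f where "f x = 2 * \<kappa> * exp (\<mu> * x) * exp (- x) / (k * exp (k' * exp (\<mu> * x)))\<^sup>2" for x
  have "(f \<longlongrightarrow> 0) at_top" unfolding f_def[abs_def] using r2 m kappa_pos by real_asymp
  then have "\<forall>\<^sub>F x in at_top. f x < e" using e by (rule order_tendstoD)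
  then obtain R0 where R0: "\<And>x. x \<ge> R0 \<Longrightarrow> f x < e" by (auto simp: eventually_at_top_linorder)
  show ?thesis
  proof (rule eventually_mono[OF eventually_ge_at_top[of "max R0 (max r2 r3) + 1"]], intro allI impI)
    fix \<rho> w assume \<rho>: "max R0 (max r2 r3) + 1 \<le> \<rho>"
      and w: "norm (w - (d + ray \<theta> (Complex \<rho> (pi / (2 * \<mu>))))) \<le> pi / (8 * \<mu>) * exp \<rho>"
    obtain s where s: "w = d + ray \<theta> s" "\<rho> - 1 \<le> Re s" "\<bar>Im s - pi / (2 * \<mu>)\<bar> \<le> pi / (4 * \<mu>)"
      by (rule centre_disc[OF w])
    have Rs: "R0 \<le> Re s" "r2 \<le> Re s" "r3 \<le> Re s" using s(2) \<rho> by auto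
    have R00: "Re s > \<rho>0" using Rs r2 by linarith
    have ee: "pi / (2 * \<mu>) - pi / (4 * \<mu>) = \<delta>" "pi / (2 * \<mu>) + pi / (4 * \<mu>) = pi / \<mu> - \<delta>" using m by (auto simp: \<delta>_def field_simps)
    have "\<delta> \<le> Im s" "Im s \<le> pi / \<mu> - \<delta>" using s(3) ee by linarith+
    then have ul: "k * exp (k' * exp (\<mu> * Re s)) \<le> norm (u s)" using lo Rs by blast
    have kp: "k * exp (k' * exp (\<mu> * Re s)) > 0" using r2 by simp
    then have "u s \<noteq> 0" using ul by auto
    then have "g w \<noteq> 0" unfolding s(1) gA[OF R00] using A_nz[OF R00] by simp
    moreover have "norm (poly P w / (g w)\<^sup>2) \<le> f (Re s)"
      unfolding s(1) norm_quotient[OF R00] f_def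
      using H4[OF Rs(3)] ul kp kappa_pos by (intro frac_le mult_right_mono power_mono) auto
    ultimately show "g w \<noteq> 0 \<and> norm (poly P w / (g w)\<^sup>2) \<le> e" using R0[OF Rs(1)] by simp
  qed
qed

lemma left_disc:
  assumes L: "w.left_lim 0"
  shows "\<forall>\<^sub>F \<rho> in at_top. (\<forall>w. norm (w - (d + ray \<theta> (Complex \<rho> (- (pi / (2 * \<mu>)))))) \<le> pi / (8 * \<mu>) * exp \<rho> \<longrightarrow> g w \<noteq> 0) \<and>
     B < norm (poly P (d + ray \<theta> (Complex \<rho> (- (pi / (2 * \<mu>))))) / (g (d + ray \<theta> (Complex \<rho> (- (pi / (2 * \<mu>))))))\<^sup>2)"
proof -
  have m: "\<mu> > 0" using mu_ge by simp
  define \<delta> where "\<delta> = pi / (4 * \<mu>)"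
  have d: "0 < \<delta>" "\<delta> \<le> pi / (2 * \<mu>)" using m by (auto simp: \<delta>_def field_simps)
  obtain r2 k k' where r2: "\<rho>0 < r2" "k > 0" "k' > 0"
    and nz: "\<And>s. r2 \<le> Re s \<Longrightarrow> - (pi / \<mu>) + \<delta> \<le> Im s \<Longrightarrow> Im s \<le> - \<delta> \<Longrightarrow> u s \<noteq> 0"
    and up: "\<And>s. r2 \<le> Re s \<Longrightarrow> - (pi / \<mu>) + \<delta> \<le> Im s \<Longrightarrow> Im s \<le> - \<delta> \<Longrightarrow> norm (u s) \<le> k * exp (- (k' * exp (\<mu> * Re s)))"
    by (rule w.left_recessive[OF L d]) (rule that, assumption+)
  obtain r3 where r3: "r3 > \<rho>0" and H3: "\<And>s. r3 \<le> Re s \<Longrightarrow> norm (H s) \<ge> \<kappa> / 2 * exp (\<mu> * Re s)"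
    using w.norm_H by metis
  define f where "f x = \<kappa> / 2 * exp (\<mu> * x) * exp (- x) / (k * exp (- (k' * exp (\<mu> * x))))\<^sup>2" for x
  have "filterlim f at_top at_top" unfolding f_def[abs_def] using r2 m kappa_pos by real_asymp
  then have "\<forall>\<^sub>F x in at_top. B < f x" by (simp add: filterlim_at_top_dense)
  then show ?thesis using eventually_ge_at_top[of "max r2 r3 + 1"]
  proof eventually_elim
    case (elim \<rho>)
    have ee: "- (pi / (2 * \<mu>)) - pi / (4 * \<mu>) = - (pi / \<mu>) + \<delta>" "- (pi / (2 * \<mu>)) + pi / (4 * \<mu>) = - \<delta>" using m by (auto simp: \<delta>_def field_simps)
    show ?case
    proof (intro conjI allI impI)
      fix w assume w: "norm (w - (d + ray \<theta> (Complex \<rho> (- (pi / (2 * \<mu>)))))) \<le> pi / (8 * \<mu>) * exp \<rho>"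
      obtain s where s: "w = d + ray \<theta> s" "\<rho> - 1 \<le> Re s" "\<bar>Im s - (- (pi / (2 * \<mu>)))\<bar> \<le> pi / (4 * \<mu>)"
        by (rule centre_disc[OF w])
      have Rs: "r2 \<le> Re s" using s(2) elim by auto
      have R00: "Re s > \<rho>0" using Rs r2 by linarith
      have "- (pi / \<mu>) + \<delta> \<le> Im s" "Im s \<le> - \<delta>" using s(3) ee by linarith+
      then have "u s \<noteq> 0" using nz Rs by blast
      then show "g w \<noteq> 0" unfolding s(1) gA[OF R00] using A_nz[OF R00] by simp
    next
      let ?s = "Complex \<rho> (- (pi / (2 * \<mu>)))"
      have Rs: "r2 \<le> Re ?s" "r3 \<le> Re ?s" using elim by auto
      have R00: "Re ?s > \<rho>0" using Rs r2 by linarith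
      have Is: "- (pi / \<mu>) + \<delta> \<le> Im ?s" "Im ?s \<le> - \<delta>" unfolding complex.sel using ee d(1) unfolding \<delta>_def by linarith+
      have "B < f (Re ?s)" using elim by simp
      also have "\<dots> \<le> norm (H ?s) * exp (- Re ?s) / (norm (u ?s))\<^sup>2"
        unfolding f_def using H3[OF Rs(2)] up[OF Rs(1) Is] nz[OF Rs(1) Is]
        by (intro frac_le mult_right_mono power_mono) auto
      finally show "B < norm (poly P (d + ray \<theta> ?s) / (g (d + ray \<theta> ?s))\<^sup>2)" by (simp only: norm_quotient[OF R00])
    qed
  qed
qed

end

section \<open>The equivalence\<close>

context stokes
begin

lemma ex_stokes_ray:
  obtains u V H Sg \<Phi> A \<rho>0 C where "stokes_ray P Q S p q N a b c d D pz Dj r0 g k (stokes_angle N b k) u V H Sg \<Phi> A \<rho>0 C"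
proof -
  obtain u V H Sg \<Phi> A \<rho>0 C where "wkb u V H Sg \<Phi> \<rho>0 \<mu> C \<kappa>"
    "\<And>s. Re s > \<rho>0 \<Longrightarrow> g (d + ray (stokes_angle N b k) s) = A s * u s"
    "\<And>s. Re s > \<rho>0 \<Longrightarrow> (A s)\<^sup>2 * H s = exp s * poly P (d + ray (stokes_angle N b k) s)"
    "\<And>s. Re s > \<rho>0 \<Longrightarrow> poly P (d + ray (stokes_angle N b k) s) \<noteq> 0"
    "\<And>s. Re s > \<rho>0 \<Longrightarrow> norm (H s - of_real \<kappa> * exp (of_real \<mu> * s)) \<le> \<kappa> * exp (\<mu> * Re s) * norm (\<psi> (ray (stokes_angle N b k) s))"
    by (rule bridge[OF stokes_angle_exp[of k]]) (rule that, assumption+)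
  then show ?thesis by (intro that stokes_ray.intro stokes_ray_axioms.intro stokes_axioms) auto
qed

abbreviation "Inf_sector j \<equiv> infinity_in_stokes_sector N b d j g"

lemma many_zeros_if:
  assumes "Inf_sector (k - 1)" "Inf_sector k"
  shows "infinitely_many_zeros_near_ray N b d D r0 k g"
proof -
  obtain u V H Sg \<Phi> A \<rho>0 C where R: "stokes_ray P Q S p q N a b c d D pz Dj r0 g k (stokes_angle N b k) u V H Sg \<Phi> A \<rho>0 C"
    by (rule ex_stokes_ray)
  interpret r: stokes_ray P Q S p q N a b c d D pz Dj r0 g k "stokes_angle N b k" u V H Sg \<Phi> A \<rho>0 C by (rule R)
  obtain L R where LR: "r.w.left_lim L" "r.w.right_lim R" using r.w.ex_left_lim r.w.ex_right_lim by blast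
  have "L \<noteq> 0" "R \<noteq> 0" using r.left_infinity_iff[OF LR(1)] r.right_infinity_iff[OF LR(2)] assms by auto
  then show ?thesis using r.dominant_many_zeros LR by blast
qed

text \<open>A recessive sector below the ray is already enough. As k ranges over all integers, every
  sector lies below some ray, so the sector above needs no separate treatment.\<close>

lemma few_zeros_if:
  assumes "\<not> Inf_sector (k - 1)"
  shows "\<not> infinitely_many_zeros_near_ray N b d D r0 k g"
proof -
  obtain u V H Sg \<Phi> A \<rho>0 C where R: "stokes_ray P Q S p q N a b c d D pz Dj r0 g k (stokes_angle N b k) u V H Sg \<Phi> A \<rho>0 C"
    by (rule ex_stokes_ray)
  interpret r: stokes_ray P Q S p q N a b c d D pz Dj r0 g k "stokes_angle N b k" u V H Sg \<Phi> A \<rho>0 C by (rule R)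
  obtain L where L: "r.w.left_lim L" using r.w.ex_left_lim by blast
  then have "L = 0" using r.left_infinity_iff[OF L] assms by auto
  then show ?thesis using r.recessive_few_zeros L by blast
qed

lemma infinity_iff_zeros:
  "(\<forall>k. Inf_sector k) \<longleftrightarrow> (\<forall>k. infinitely_many_zeros_near_ray N b d D r0 k g)"
proof
  assume z: "\<forall>k. infinitely_many_zeros_near_ray N b d D r0 k g"
  show "\<forall>k. Inf_sector k"
  proof (rule allI, rule ccontr)
    fix k assume "\<not> Inf_sector k"
    then show False using few_zeros_if[of "k + 1"] z by simp
  qed
qed (blast intro: many_zeros_if)

lemma residues_summable_if:
  assumes "Inf_sector (k - 1)" "Inf_sector k"
  shows "\<exists>\<rho>1. (\<lambda>z. norm (poly P z / (deriv g z)\<^sup>2) / (norm z)\<^sup>2) summable_on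
     {z. g z = 0 \<and> (\<exists>s. z = d + ray (stokes_angle N b k) s \<and> \<rho>1 \<le> Re s \<and> \<bar>Im s\<bar> \<le> pi / (2 * \<mu>))}"
proof -
  obtain u V H Sg \<Phi> A \<rho>0 C where R: "stokes_ray P Q S p q N a b c d D pz Dj r0 g k (stokes_angle N b k) u V H Sg \<Phi> A \<rho>0 C"
    by (rule ex_stokes_ray)
  interpret r: stokes_ray P Q S p q N a b c d D pz Dj r0 g k "stokes_angle N b k" u V H Sg \<Phi> A \<rho>0 C by (rule R)
  obtain L R where LR: "r.w.left_lim L" "r.w.right_lim R" using r.w.ex_left_lim r.w.ex_right_lim by blast
  have "L \<noteq> 0" "R \<noteq> 0" using r.left_infinity_iff[OF LR(1)] r.right_infinity_iff[OF LR(2)] assms by auto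
  then show ?thesis using r.zeros_residue_summable LR by metis
qed

lemma good_circle_if:
  assumes "Inf_sector (k - 1)" "Inf_sector k"
  shows "\<exists>\<rho>1. \<exists>K>0. \<forall>s0. \<rho>1 \<le> Re s0 \<longrightarrow> \<bar>Im s0\<bar> \<le> pi / (2 * \<mu>) \<longrightarrow>
    (\<exists>r>0. 1 / (K * exp (Re s0) ^ (N + 2)) \<le> r \<and> (\<forall>w. norm (w - (d + ray (stokes_angle N b k) s0)) = r \<longrightarrow>
       g w \<noteq> 0 \<and> norm (poly P w / (g w)\<^sup>2) \<le> K * exp (Re s0) ^ (N + 2)))"
proof -
  obtain u V H Sg \<Phi> A \<rho>0 C where R: "stokes_ray P Q S p q N a b c d D pz Dj r0 g k (stokes_angle N b k) u V H Sg \<Phi> A \<rho>0 C"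
    by (rule ex_stokes_ray)
  interpret r: stokes_ray P Q S p q N a b c d D pz Dj r0 g k "stokes_angle N b k" u V H Sg \<Phi> A \<rho>0 C by (rule R)
  obtain L R where LR: "r.w.left_lim L" "r.w.right_lim R" using r.w.ex_left_lim r.w.ex_right_lim by blast
  have LR0: "L \<noteq> 0" "R \<noteq> 0" using r.left_infinity_iff[OF LR(1)] r.right_infinity_iff[OF LR(2)] assms by auto
  show ?thesis by (rule r.good_circle[OF LR(1) LR0(1) LR(2) LR0(2)]) blast
qed

lemma small_disc_if:
  assumes "Inf_sector k" "e > 0"
  shows "\<forall>\<^sub>F \<rho> in at_top. \<forall>w. norm (w - (d + ray (stokes_angle N b k) (Complex \<rho> (pi / (2 * \<mu>))))) \<le> pi / (8 * \<mu>) * exp \<rho> \<longrightarrow>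
     g w \<noteq> 0 \<and> norm (poly P w / (g w)\<^sup>2) \<le> e"
proof -
  obtain u V H Sg \<Phi> A \<rho>0 C where R: "stokes_ray P Q S p q N a b c d D pz Dj r0 g k (stokes_angle N b k) u V H Sg \<Phi> A \<rho>0 C"
    by (rule ex_stokes_ray)
  interpret r: stokes_ray P Q S p q N a b c d D pz Dj r0 g k "stokes_angle N b k" u V H Sg \<Phi> A \<rho>0 C by (rule R)
  obtain R where R: "r.w.right_lim R" using r.w.ex_right_lim by blast
  then have "R \<noteq> 0" using r.right_infinity_iff[OF R] assms by auto
  then show ?thesis using r.right_disc[OF R _ assms(2)] by blast
qed

lemma large_centre_if:
  assumes "\<not> Inf_sector (k - 1)"
  shows "\<forall>\<^sub>F \<rho> in at_top. (\<forall>w. norm (w - (d + ray (stokes_angle N b k) (Complex \<rho> (- (pi / (2 * \<mu>)))))) \<le> pi / (8 * \<mu>) * exp \<rho> \<longrightarrow> g w \<noteq> 0) \<and>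
     B < norm (poly P (d + ray (stokes_angle N b k) (Complex \<rho> (- (pi / (2 * \<mu>))))) / (g (d + ray (stokes_angle N b k) (Complex \<rho> (- (pi / (2 * \<mu>))))))\<^sup>2)"
proof -
  obtain u V H Sg \<Phi> A \<rho>0 C where R: "stokes_ray P Q S p q N a b c d D pz Dj r0 g k (stokes_angle N b k) u V H Sg \<Phi> A \<rho>0 C"
    by (rule ex_stokes_ray)
  interpret r: stokes_ray P Q S p q N a b c d D pz Dj r0 g k "stokes_angle N b k" u V H Sg \<Phi> A \<rho>0 C by (rule R)
  obtain L where L: "r.w.left_lim L" using r.w.ex_left_lim by blast
  then have "L = 0" using r.left_infinity_iff[OF L] assms by auto
  then show ?thesis using r.left_disc L by blast
qed

text \<open>At the middle point \<open>z \<rho>\<close> of a recessive sector P/g^2 is huge, and it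
  is holomorphic on a disc of radius proportional to |z|. By \<open>holomorphic_average\<close> the
  value there equals the outer part of the series, which is bounded independently of \<rho>.\<close>

lemma expansion_imp_infinity:
  assumes E: "has_double_pole_expansion P g"
  shows "Inf_sector j"
proof (rule ccontr)
  assume nj: "\<not> Inf_sector j"
  obtain c t where t: "filterlim (\<lambda>n. cmod (t n)) at_top sequentially"
    "summable (\<lambda>n. if t n = 0 then 0 else cmod (c n) / (cmod (t n))\<^sup>2)"
    and ex: "\<And>z. g z \<noteq> 0 \<Longrightarrow> z \<notin> range t \<Longrightarrow> (\<lambda>n. c n / (z - t n)\<^sup>2) sums (poly P z / (g z)\<^sup>2)"
    using E unfolding has_double_pole_expansion_def by blast
  interpret pole_series c t using t by unfold_locales
  define M where "M = suminf m"
  have M: "M \<ge> 0" unfolding M_def by (intro suminf_nonneg m_summable m_nonneg)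
  have S0: "S0 \<ge> 0" by (simp add: S0_def sum_nonneg)
  define \<alpha> where "\<alpha> = pi / (16 * \<mu>)"
  have al: "\<alpha> > 0" using mu_ge by (simp add: \<alpha>_def)
  have al2: "pi / (8 * \<mu>) = 2 * \<alpha>" by (simp add: \<alpha>_def)
  define B where "B = (1 + 2 / \<alpha>)\<^sup>2 * M + S0 / \<alpha>\<^sup>2"
  define z where "z \<rho> = d + ray (stokes_angle N b (j + 1)) (Complex \<rho> (- (pi / (2 * \<mu>))))" for \<rho>
  have "\<forall>\<^sub>F \<rho> in at_top. (\<forall>w. norm (w - z \<rho>) \<le> 2 * \<alpha> * exp \<rho> \<longrightarrow> g w \<noteq> 0) \<and> B < norm (poly P (z \<rho>) / (g (z \<rho>))\<^sup>2)"
    using large_centre_if[of "j + 1" B] nj unfolding z_def al2 by simp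
  moreover have "\<forall>\<^sub>F \<rho> in at_top. ln (norm d + 1) \<le> \<rho>" by (rule eventually_ge_at_top)
  ultimately obtain \<rho> where nz: "\<And>w. norm (w - z \<rho>) \<le> 2 * \<alpha> * exp \<rho> \<Longrightarrow> g w \<noteq> 0"
    and big: "B < norm (poly P (z \<rho>) / (g (z \<rho>))\<^sup>2)" and \<rho>: "ln (norm d + 1) \<le> \<rho>"
    using eventually_happens'[OF trivial_limit_at_top_linorder eventually_conj] by blast
  have "norm d + 1 > 0" by (simp add: add_nonneg_pos)
  then have ed: "norm d + 1 \<le> exp \<rho>" using \<rho> by (metis exp_le_cancel_iff exp_ln)
  then have e1: "1 \<le> exp \<rho>" using norm_ge_zero[of d] by linarith
  \<comment> \<open>Only countably many radii meet some \<open>t n\<close>, which need not be a zero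
    of g; so a radius between \<alpha> exp \<rho> and 2 \<alpha> exp \<rho> avoids them all.\<close>
  have "countable (range (\<lambda>n. norm (t n - z \<rho>)))" by simp
  moreover have "uncountable {\<alpha> * exp \<rho><..<2 * \<alpha> * exp \<rho>}" using al by (simp add: uncountable_open_interval)
  ultimately have "\<not> {\<alpha> * exp \<rho><..<2 * \<alpha> * exp \<rho>} \<subseteq> range (\<lambda>n. norm (t n - z \<rho>))" using countable_subset by blast
  then obtain r where "r \<in> {\<alpha> * exp \<rho><..<2 * \<alpha> * exp \<rho>}" and av: "r \<notin> range (\<lambda>n. norm (t n - z \<rho>))" by blast
  then have r: "\<alpha> * exp \<rho> < r" "r < 2 * \<alpha> * exp \<rho>" by simp_all
  have rpos: "r > 0" using r(1) al by (smt (verit) exp_gt_zero mult_pos_pos)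
  have f: "(\<lambda>w. poly P w / (g w)\<^sup>2) holomorphic_on cball (z \<rho>) r"
    by (intro holomorphic_intros holomorphic_on_subset[OF entire])
      (use nz r in \<open>auto simp: dist_norm norm_minus_commute\<close>)
  have "poly P (z \<rho>) / (g (z \<rho>))\<^sup>2 = out (z \<rho>) r"
  proof (rule holomorphic_average[OF rpos f])
    fix w assume w: "norm (w - z \<rho>) = r"
    have "w \<notin> range t" using av w by auto
    moreover have "g w \<noteq> 0" using nz[of w] w r by simp
    ultimately show "w \<notin> range t \<and> poly P w / (g w)\<^sup>2 = F w" using ex[of w] sums_F[of w] sums_unique2 by blast
  qed
  moreover have "norm (out (z \<rho>) r) \<le> B"
  proof -
    have "norm (z \<rho>) \<le> norm d + exp \<rho>" unfolding z_def by (rule order_trans[OF norm_triangle_ineq]) simp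
    then have "norm (z \<rho>) / r \<le> (2 * exp \<rho>) / (\<alpha> * exp \<rho>)" using ed r al by (intro frac_le) auto
    then have 1: "norm (z \<rho>) / r \<le> 2 / \<alpha>" by simp
    have "\<alpha> * 1 \<le> \<alpha> * exp \<rho>" using al e1 by (intro mult_left_mono) auto
    then have 2: "\<alpha> \<le> r" using r by linarith
    have "norm (out (z \<rho>) r) \<le> (1 + norm (z \<rho>) / r)\<^sup>2 * M + S0 / r\<^sup>2" unfolding M_def by (rule out_summable(2)[OF rpos])
    also have "\<dots> \<le> B" unfolding B_def
    proof (rule add_mono)
      show "(1 + norm (z \<rho>) / r)\<^sup>2 * M \<le> (1 + 2 / \<alpha>)\<^sup>2 * M"
        using 1 M rpos by (intro mult_right_mono power_mono add_left_mono) auto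
      show "S0 / r\<^sup>2 \<le> S0 / \<alpha>\<^sup>2" using 2 S0 al by (intro divide_left_mono power_mono mult_pos_pos) auto
    qed
    finally show ?thesis .
  qed
  ultimately show False using big by simp
qed

text \<open>The \<open>t n\<close> enumerate the zeros of g, and the \<open>c n\<close> are the
  coefficients forced by \<open>double_pole\<close>. Summability and growth are known ray by ray and
  are combined over the finite index range \<open>ks\<close>.\<close>

lemma infinity_imp_expansion:
  assumes inf: "\<And>k. Inf_sector k"
  shows "has_double_pole_expansion P g"
proof -
  define Z where "Z = {z. g z = 0}"
  define ks where "ks = {- (int N + 4)..int N + 4}"
  have fks: "finite ks" by (simp add: ks_def)
  have finZ: "finite {z \<in> Z. norm z \<le> B}" for B
    using finite_zeros_bounded[of 0 B] by (rule finite_subset[rotated]) (auto simp: Z_def)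
  \<comment> \<open>An enumeration by all natural numbers needs infinitely many zeros; those near
    one ray are enough.\<close>
  obtain C where "infinite {z \<in> stokes_neighbourhood N b d D r0 0 C. g z = 0}"
    using many_zeros_if[OF inf inf, of 0] unfolding infinitely_many_zeros_near_ray_def by blast
  then have "infinite Z" by (rule infinite_super[rotated]) (auto simp: Z_def)
  moreover have "countable Z"
  proof (rule countable_subset)
    show "Z \<subseteq> (\<Union>n::nat. {z \<in> Z. norm z \<le> real n})" using real_arch_simple by auto
    show "countable (\<Union>n::nat. {z \<in> Z. norm z \<le> real n})" using finZ by (intro countable_UN) (auto intro: countable_finite)
  qed
  ultimately have bij: "bij_betw (from_nat_into Z) UNIV Z" by (intro bij_betw_from_nat_into)
  define t where "t = from_nat_into Z"
  have rt: "range t = Z" and inj: "inj t" using bij by (auto simp: t_def bij_betw_def)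
  have gt: "g (t n) = 0" for n using rt Z_def by blast
  define \<phi> where "\<phi> z = norm (poly P z / (deriv g z)\<^sup>2) / (norm z)\<^sup>2" for z
  define c where "c n = poly P (t n) / (deriv g (t n))\<^sup>2" for n
  have t_lim: "filterlim (\<lambda>n. cmod (t n)) at_top sequentially"
    unfolding filterlim_at_top
  proof
    fix B
    have "finite (t -` {z \<in> Z. norm z \<le> B})" by (rule finite_vimageI[OF finZ inj])
    then have "finite {n. \<not> B \<le> norm (t n)}" by (rule finite_subset[rotated]) (use rt in auto)
    then show "\<forall>\<^sub>F n in sequentially. B \<le> norm (t n)"
      by (simp only: cofinite_eq_sequentially[symmetric] eventually_cofinite)
  qed
  define U where "U k \<rho> = {z. g z = 0 \<and> (\<exists>s. z = d + ray (stokes_angle N b k) s \<and> \<rho> \<le> Re s \<and> \<bar>Im s\<bar> \<le> pi / (2 * \<mu>))}" for k \<rho>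
  have "\<forall>k. \<exists>\<rho>1. \<phi> summable_on U k \<rho>1"
    unfolding U_def \<phi>_def by (rule allI, rule residues_summable_if[OF inf inf])
  from choice[OF this] obtain \<rho>1 where \<rho>1: "\<And>k. \<phi> summable_on U k (\<rho>1 k)" by blast
  \<comment> \<open>The sum of the absolute values is a common threshold for all rays in
    \<open>ks\<close>.\<close>
  have large: "\<exists>k\<in>ks. \<exists>s. z = d + ray (stokes_angle N b k) s \<and> \<rho> k \<le> Re s \<and> \<bar>Im s\<bar> \<le> pi / (2 * \<mu>)"
    if z: "norm (z - d) \<ge> exp (\<Sum>k\<in>ks. \<bar>\<rho> k\<bar>)" for z and \<rho> :: "int \<Rightarrow> real"
  proof -
    have "norm (z - d) > 0" using z by (rule less_le_trans[OF exp_gt_zero])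
    then have "z \<noteq> d" by auto
    then obtain k s where s: "k \<in> ks" "z = d + ray (stokes_angle N b k) s" "\<bar>Im s\<bar> \<le> pi / (2 * \<mu>)"
      unfolding ks_def by (rule ray_cover)
    have "exp (\<Sum>k\<in>ks. \<bar>\<rho> k\<bar>) \<le> exp (Re s)" using z unfolding s(2) by simp
    moreover have "\<bar>\<rho> k\<bar> \<le> (\<Sum>k\<in>ks. \<bar>\<rho> k\<bar>)" by (rule member_le_sum[OF s(1)]) (use fks in auto)
    ultimately have "\<rho> k \<le> Re s" by simp
    with s show ?thesis by blast
  qed
  have "\<phi> summable_on (\<Union>k\<in>ks'. U k (\<rho>1 k))" if "finite ks'" for ks'
    using that
  proof induction
    case (insert k ks')
    then show ?case using \<rho>1[of k] by (simp add: summable_on_union)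
  qed simp
  from this[OF fks] have "\<phi> summable_on ({z \<in> cball d (exp (\<Sum>k\<in>ks. \<bar>\<rho>1 k\<bar>)). g z = 0} \<union> (\<Union>k\<in>ks. U k (\<rho>1 k)))"
    by (rule summable_on_union[OF summable_on_finite[OF finite_zeros_bounded]])
  then have "\<phi> summable_on Z"
  proof (rule summable_on_subset_banach)
    show "Z \<subseteq> {z \<in> cball d (exp (\<Sum>k\<in>ks. \<bar>\<rho>1 k\<bar>)). g z = 0} \<union> (\<Union>k\<in>ks. U k (\<rho>1 k))"
    proof
      fix z assume z: "z \<in> Z"
      show "z \<in> {z \<in> cball d (exp (\<Sum>k\<in>ks. \<bar>\<rho>1 k\<bar>)). g z = 0} \<union> (\<Union>k\<in>ks. U k (\<rho>1 k))"
      proof (cases "norm (z - d) \<ge> exp (\<Sum>k\<in>ks. \<bar>\<rho>1 k\<bar>)")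
        case True
        then show ?thesis using large[OF True] z by (auto simp: U_def Z_def)
      next
        case False
        then show ?thesis using z by (simp add: Z_def dist_norm norm_minus_commute)
      qed
    qed
  qed
  then have "(\<lambda>n. \<phi> (t n)) summable_on UNIV"
    using summable_on_reindex_bij_betw[OF bij, of \<phi>] by (simp add: t_def)
  then have "summable (\<lambda>n. \<phi> (t n))" by (subst (asm) summable_on_UNIV_nonneg_real_iff) (auto simp: \<phi>_def)
  moreover have "(\<lambda>n. \<phi> (t n)) = (\<lambda>n. if t n = 0 then 0 else cmod (c n) / (cmod (t n))\<^sup>2)"
    by (auto simp: \<phi>_def c_def)
  ultimately have summ: "summable (\<lambda>n. if t n = 0 then 0 else cmod (c n) / (cmod (t n))\<^sup>2)" by simp
  interpret pole_series c t using t_lim summ by unfold_locales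
  define f where "f w = poly P w / (g w)\<^sup>2" for w
  have fh: "f holomorphic_on - range t" unfolding f_def
    by (intro holomorphic_intros holomorphic_on_subset[OF entire]) (auto simp: rt Z_def)
  have loc: "\<exists>\<epsilon>>0. \<exists>h. h holomorphic_on ball (t i) \<epsilon> \<and> (\<forall>w\<in>ball (t i) \<epsilon> - {t i}. w \<notin> range t \<and> f w = c i / (w - t i)\<^sup>2 + h w)" for i
    using double_pole(2)[OF gt[of i]] unfolding f_def c_def rt Z_def by simp
  obtain E where E: "E holomorphic_on UNIV" and fE: "\<And>w. w \<notin> range t \<Longrightarrow> f w = E w + F w"
    by (rule ex_entire[OF fh inj loc]) (rule that, assumption+)
  define good where "good k \<rho> K \<longleftrightarrow> (\<forall>s0. \<rho> \<le> Re s0 \<longrightarrow> \<bar>Im s0\<bar> \<le> pi / (2 * \<mu>) \<longrightarrow>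
    (\<exists>r>0. 1 / (K * exp (Re s0) ^ (N + 2)) \<le> r \<and> (\<forall>w. norm (w - (d + ray (stokes_angle N b k) s0)) = r \<longrightarrow>
       g w \<noteq> 0 \<and> norm (poly P w / (g w)\<^sup>2) \<le> K * exp (Re s0) ^ (N + 2))))" for k \<rho> K
  have "\<exists>\<rho>. \<exists>K>0. good k \<rho> K" for k
    unfolding good_def by (rule good_circle_if[OF inf inf])
  then obtain \<rho>2 K where K: "\<And>k. K k > 0" and gc: "\<And>k. good k (\<rho>2 k) (K k)" by metis
  define K' where "K' = (\<Sum>k\<in>ks. K k)"
  have K'k: "K k \<le> K'" if "k \<in> ks" for k unfolding K'_def by (rule member_le_sum[OF that]) (use fks K in \<open>auto intro: less_imp_le\<close>)
  have K'0: "K' > 0" using K[of 0] K'k[of 0] by (simp add: ks_def)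
  have E0: "E z = 0" for z
  proof (rule entire_part_zero[OF E fE])
    show "K' * 2 ^ (N + 2) > 0" using K'0 by simp
    fix z :: complex assume z: "exp (\<Sum>k\<in>ks. \<bar>\<rho>2 k\<bar>) + norm d \<le> norm z"
    have "exp (\<Sum>k\<in>ks. \<bar>\<rho>2 k\<bar>) \<le> norm (z - d)" using z norm_triangle_ineq2[of z d] by linarith
    from large[OF this] obtain k s where s: "k \<in> ks" "z = d + ray (stokes_angle N b k) s" "\<rho>2 k \<le> Re s" "\<bar>Im s\<bar> \<le> pi / (2 * \<mu>)" by blast
    obtain r where r: "r > 0" "1 / (K k * exp (Re s) ^ (N + 2)) \<le> r"
      and gr: "\<And>w. norm (w - z) = r \<Longrightarrow> g w \<noteq> 0 \<and> norm (poly P w / (g w)\<^sup>2) \<le> K k * exp (Re s) ^ (N + 2)"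
      using gc[unfolded good_def, rule_format, OF s(3,4)] unfolding s(2)[symmetric] by blast
    have "exp (Re s) = norm (z - d)" unfolding s(2) by simp
    also have "\<dots> \<le> norm z + norm d" by (rule norm_triangle_ineq4)
    also have "\<dots> \<le> 2 * norm z" using z exp_ge_zero[of "\<Sum>k\<in>ks. \<bar>\<rho>2 k\<bar>"] by linarith
    finally have "exp (Re s) ^ (N + 2) \<le> (2 * norm z) ^ (N + 2)" by (rule power_mono) simp
    then have "K k * exp (Re s) ^ (N + 2) \<le> K' * (2 * norm z) ^ (N + 2)" using K'k[OF s(1)] K'0 by (intro mult_mono) auto
    then have le: "K k * exp (Re s) ^ (N + 2) \<le> K' * 2 ^ (N + 2) * norm z ^ (N + 2)" by (simp only: power_mult_distrib mult.assoc)
    have "1 / (K' * 2 ^ (N + 2) * norm z ^ (N + 2)) \<le> 1 / (K k * exp (Re s) ^ (N + 2))"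
      using K[of k] by (intro frac_le le) auto
    then show "\<exists>r>0. 1 / (K' * 2 ^ (N + 2) * norm z ^ (N + 2)) \<le> r \<and>
        (\<forall>w. norm (w - z) = r \<longrightarrow> w \<notin> range t \<and> norm (f w) \<le> K' * 2 ^ (N + 2) * norm z ^ (N + 2))"
      using r gr le unfolding rt Z_def f_def by (intro exI[of _ r]) (auto intro: order_trans)
  next
    \<comment> \<open>The middle line of sector 0, around which P/g^2 is uniformly small on discs
      proportional to the distance. The factor drops from pi/(8 \<mu>) to pi/(16 \<mu>) because
      |\<zeta> x| may be as large as 2 exp x.\<close>
    define \<zeta> where "\<zeta> x = d + ray (stokes_angle N b 0) (Complex x (pi / (2 * \<mu>)))" for x
    have lo: "exp x - norm d \<le> norm (\<zeta> x)" for x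
      using norm_triangle_ineq4[of "\<zeta> x" d] by (simp add: \<zeta>_def)
    have "filterlim (\<lambda>x. exp x - norm d) at_top at_top" by real_asymp
    then have "filterlim (\<lambda>x. norm (\<zeta> x)) at_top at_top"
      by (rule filterlim_at_top_mono) (simp add: lo)
    then show "filterlim (\<lambda>x. d + ray (stokes_angle N b 0) (Complex x (pi / (2 * \<mu>)))) at_infinity at_top"
      unfolding \<zeta>_def by (rule filterlim_norm_at_top_imp_at_infinity)
    show "pi / (16 * \<mu>) > 0" using mu_ge by simp
    fix e :: real assume "e > 0"
    from small_disc_if[OF inf this, of 0]
    have "\<forall>\<^sub>F x in at_top. \<forall>w. norm (w - \<zeta> x) \<le> pi / (8 * \<mu>) * exp x \<longrightarrow> g w \<noteq> 0 \<and> norm (f w) \<le> e"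
      by (simp only: \<zeta>_def f_def)
    moreover have "\<forall>\<^sub>F x in at_top. norm d \<le> exp x" by real_asymp
    ultimately have "\<forall>\<^sub>F x in at_top. \<forall>w. norm (w - \<zeta> x) = pi / (16 * \<mu>) * norm (\<zeta> x) \<longrightarrow> w \<notin> range t \<and> norm (f w) \<le> e"
    proof eventually_elim
      case (elim x)
      show ?case
      proof (intro allI impI)
        fix w assume w: "norm (w - \<zeta> x) = pi / (16 * \<mu>) * norm (\<zeta> x)"
        have "norm (\<zeta> x) \<le> norm d + exp x" unfolding \<zeta>_def by (rule order_trans[OF norm_triangle_ineq]) simp
        then have "pi / (16 * \<mu>) * norm (\<zeta> x) \<le> pi / (16 * \<mu>) * (2 * exp x)"
          using elim(2) mu_ge by (intro mult_left_mono) auto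
        then have "norm (w - \<zeta> x) \<le> pi / (8 * \<mu>) * exp x" using w by simp
        then show "w \<notin> range t \<and> norm (f w) \<le> e" using elim(1) unfolding rt Z_def by blast
      qed
    qed
    then show "\<forall>\<^sub>F x in at_top. \<forall>w. norm (w - (d + ray (stokes_angle N b 0) (Complex x (pi / (2 * \<mu>))))) =
        pi / (16 * \<mu>) * norm (d + ray (stokes_angle N b 0) (Complex x (pi / (2 * \<mu>)))) \<longrightarrow> w \<notin> range t \<and> norm (f w) \<le> e"
      by (simp only: \<zeta>_def)
  qed
  show ?thesis unfolding has_double_pole_expansion_def
  proof (rule exI[of _ c], rule exI[of _ t], intro conjI t_lim summ allI impI)
    fix z assume z: "g z \<noteq> 0 \<and> z \<notin> range t"
    then have "poly P z / (g z)\<^sup>2 = F z" using fE[of z] E0 by (simp add: f_def)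
    then show "(\<lambda>n. c n / (z - t n)\<^sup>2) sums (poly P z / (g z)\<^sup>2)" using sums_F[of z] by simp
  qed
qed

end

theorem theorem2p21:
  fixes P Q S :: "complex poly"
    and p q N :: nat
    and a b c d D :: complex
    and pz Dj :: "nat \<Rightarrow> complex"
    and r0 :: real
    and g :: "complex \<Rightarrow> complex"
  assumes p: "p = degree P" and q: "q = degree Q" and "p \<le> q" and N: "N = q - p"
    and P_monic: "lead_coeff P = 1"
    and a: "a = (if p = 0 then 0 else coeff P (p - 1))"
    and b: "b = lead_coeff Q" "b \<noteq> 0"
    and c: "c = (if q = 0 then 0 else coeff Q (q - 1))"
    and zeros_P: "P = (\<Prod>j=1..p. [:- pz j, 1:])"
    and deg_S: "degree S = N"
    and partial_fractions: "\<And>z. poly P z \<noteq> 0 \<Longrightarrow>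
          poly Q z / poly P z = poly S z + (\<Sum>j=1..p. Dj j / (z - pz j))"
    and d: "d = (if N = 0 then 0 else (a * b - c) / (b * of_nat N))"
    and D: "D = (\<Sum>j=1..p. Dj j) / csqrt b"
    and r0: "r0 > 1"
    and entire: "g holomorphic_on UNIV"
    and nontrivial: "\<exists>z. g z \<noteq> 0"
    and ode: "\<And>z. poly P z \<noteq> 0 \<Longrightarrow>
          deriv (deriv g) z - poly (pderiv P) z / poly P z * deriv g z
            + poly Q z / poly P z * g z = 0"
    and no_common_zeros: "\<And>z. \<not> (poly P z = 0 \<and> g z = 0)"
  shows "(has_double_pole_expansion P g \<longleftrightarrow> (\<forall>k. infinity_in_stokes_sector N b d k g)) \<and>
         ((\<forall>k. infinity_in_stokes_sector N b d k g) \<longleftrightarrow>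
           (\<forall>k. infinitely_many_zeros_near_ray N b d D r0 k g))"
proof -
  interpret stokes P Q S p q N a b c d D pz Dj r0 g
    by (rule stokes.intro[OF p q \<open>p \<le> q\<close> N P_monic a b c deg_S partial_fractions d D r0 entire nontrivial ode no_common_zeros])
  show ?thesis using expansion_imp_infinity infinity_imp_expansion infinity_iff_zeros by blast
qed

end
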